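(* Let $k$ be a positive integer and let $g(n)$ be a multiplicative function supported on squarefree numbers such that $g(p)=\frac kp+O\left(\frac1{p^2}\right)$. Let $u>0$ be fixed and $z=R^{1/u}$. Then, as $R\to\infty$, $$Q_g=\sum_{\substack{d_1,d_2\le R\\ p\mid[d_1,d_2]\Rightarrow p<z}}\lambda_{d_1}\lambda_{d_2}\,g([d_1,d_2])\sim\frac{I_k(1,u)}{(\log R)^k}\prod_p\bigl(1-g(p)\bigr)\left(1-\frac1p\right)^{-k}.$$
   Context: Here $\lambda_d=\mu(d)P\left(\frac{\log(R/d)}{\log R}\right)$ with $P(x)=x^m$ for an integer $m>k$, and $P^{(s)}$ denotes the $s$-th derivative of $P$. For integers $k',m$, the function $f(v;k',m)$ is the solution of the differential-difference equation $v^{k'+m+1}f'(v)=-k'(v-1)^{k'+m}f(v-1)$ with initial condition $f(v;k',m)=1$ for $0<v\le1$. For $s\ge1$ the quantities $I_s(t,v)$ are defined by $$I_s(t,v)=\int_0^1\frac{(1-x)^{s-1}}{(s-1)!}\bigl[f(uxt;-s,m)P^{(s)}(xt)\bigr]^2\,dx\quad(0<v\le1),$$ $$I_s(t,v)=I_s(t,1)-s\int_1^v I_s\bigl[(1-x^{-1})t,\,x-1\bigr](1-x^{-1})^s\,\frac{dx}{x}\quad(v>1),$$ where $u$ is the same parameter as in $z=R^{1/u}$.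
   Formalization: The relation ~ is asserted when g(p)≠1 for every prime p; if some g(p)=1 the product is 0 and ~ 0 fails (e.g. k=1, g(2)=1, g(p)=1/p for odd p), so in general the claim is (log R)^k Q_g → I_k(1,u)∏_p(1-g(p))(1-1/p)^{-k}. *)

theory Defs
  imports
    "HOL-Analysis.Analysis"
    "HOL-Computational_Algebra.Squarefree"
    "HOL-Library.Landau_Symbols"
begin

definition moebius_mu :: "nat \<Rightarrow> real" where
  "moebius_mu n = (if squarefree n then (-1) ^ card (prime_factors n) else 0)"

definition multiplicative :: "(nat \<Rightarrow> real) \<Rightarrow> bool" where
  "multiplicative g \<longleftrightarrow>
     g 1 = 1 \<and> (\<forall>a>0. \<forall>b>0. coprime a b \<longrightarrow> g (a * b) = g a * g b)"

definition P_fun :: "nat \<Rightarrow> real \<Rightarrow> real" where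
  "P_fun m x = x ^ m"

definition sieve_weight :: "nat \<Rightarrow> real \<Rightarrow> nat \<Rightarrow> real" where
  "sieve_weight m R d = moebius_mu d * P_fun m (ln (R / real d) / ln R)"

definition Q_form :: "(nat \<Rightarrow> real) \<Rightarrow> nat \<Rightarrow> real \<Rightarrow> real \<Rightarrow> real" where
  "Q_form g m R z =
     (\<Sum>(d1, d2) \<in> {(d1, d2). 1 \<le> d1 \<and> 1 \<le> d2 \<and> real d1 \<le> R \<and> real d2 \<le> R \<and>
                             (\<forall>p. prime p \<and> p dvd lcm d1 d2 \<longrightarrow> real p < z)}.
        sieve_weight m R d1 * sieve_weight m R d2 * g (lcm d1 d2))"

definition singular_product :: "(nat \<Rightarrow> real) \<Rightarrow> nat \<Rightarrow> real" where
  "singular_product g k =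
     (\<Prod>p. if prime p then (1 - g p) * (1 - 1 / real p) powi (- int k) else 1)"

text \<open>
  The differential-difference equation
  \<open>v\<^bsup>k'+m+1\<^esup> f'(v) = -k' (v-1)\<^bsup>k'+m\<^esup> f(v-1)\<close> refers to \<open>f(v-1)\<close>, so it is imposed for
  \<open>v > 1\<close>; continuity links it with the initial condition on \<open>(0,1]\<close>.
\<close>

definition dde_solution :: "int \<Rightarrow> int \<Rightarrow> (real \<Rightarrow> real) \<Rightarrow> bool" where
  "dde_solution k' m f \<longleftrightarrow>
     (\<forall>v. 0 < v \<and> v \<le> 1 \<longrightarrow> f v = 1) \<and>
     continuous_on {0<..} f \<and>
     (\<forall>v>1. f differentiable (at v) \<and>
        v powi (k' + m + 1) * deriv f v = - of_int k' * (v - 1) powi (k' + m) * f (v - 1))"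

text \<open>The solution lives on \<open>(0,\<infinity>)\<close>; the value \<open>1\<close> outside is a convention that makes it unique
  as a total function.\<close>

definition dde_f :: "real \<Rightarrow> int \<Rightarrow> int \<Rightarrow> real" where
  "dde_f v k' m = (THE f. dde_solution k' m f \<and> (\<forall>w\<le>0. f w = 1)) v"

lemma integral_fundef_cong [fundef_cong]:
  fixes f g :: "real \<Rightarrow> real"
  assumes "S = T" "\<And>x. x \<in> T \<Longrightarrow> f x = g x"
  shows "integral S f = integral T g"
  using assms by (auto intro: integral_cong)

text \<open>The parameter \<open>u\<close> of \<open>z = R\<^bsup>1/u\<^esup>\<close> stays fixed throughout the recursion.\<close>

function I_fun :: "real \<Rightarrow> nat \<Rightarrow> nat \<Rightarrow> real \<Rightarrow> real \<Rightarrow> real" where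
  "I_fun u m s t v =
     (if v \<le> 1 then
        integral {0..1} (\<lambda>x. (1 - x) ^ (s - 1) / fact (s - 1) *
          (dde_f (u * x * t) (- int s) (int m) * (deriv ^^ s) (P_fun m) (x * t))\<^sup>2)
      else
        I_fun u m s t 1 -
        real s * integral {1..v} (\<lambda>x. I_fun u m s ((1 - 1 / x) * t) (x - 1) * (1 - 1 / x) ^ s / x))"
  by pat_completeness auto
termination
  by (relation "Wellfounded.measure (\<lambda>(u, m, s, t, v). nat \<lceil>v\<rceil>)") (auto, linarith+)

declare I_fun.simps [simp del]

text \<open>Well-definedness of \<^const>\<open>dde_f\<close> in the range in which it is used
  (\<open>k' = -k\<close> and \<open>m > k\<close>).\<close>

function dde_aux :: "int \<Rightarrow> int \<Rightarrow> real \<Rightarrow> real" where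
  "dde_aux k' m v =
     (if v \<le> 1 then 1 else
        1 - of_int k' * integral {1..v} (\<lambda>w.
          (w - 1) powi (k' + m) / w powi (k' + m + 1) * dde_aux k' m (w - 1)))"
  by pat_completeness auto
termination
  by (relation "Wellfounded.measure (\<lambda>(k', m, v). nat \<lceil>v\<rceil>)") (auto, linarith)

declare dde_aux.simps [simp del]

context
  fixes k' m :: int
  assumes nonneg: "k' + m \<ge> 0"
begin

definition dde_kern :: "real \<Rightarrow> real" where
  "dde_kern w = (w - 1) powi (k' + m) / w powi (k' + m + 1) * dde_aux k' m (w - 1)"

lemma dde_aux_eq: "dde_aux k' m v = 1 - of_int k' * integral {1..v} dde_kern"
  unfolding dde_kern_def
  by (subst dde_aux.simps) (cases "v < 1"; cases "v = 1"; simp)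

lemma dde_kern_cont:
  assumes "continuous_on {..b} (dde_aux k' m)"
  shows "continuous_on {1..b+1} dde_kern"
proof -
  obtain a where a: "k' + m = int a"
    using nonneg nonneg_int_cases by blast
  have "k' + m + 1 = int (Suc a)"
    using a by simp
  then have *: "dde_kern = (\<lambda>w. (w - 1) ^ a / w ^ Suc a * dde_aux k' m (w - 1))"
    unfolding dde_kern_def a by (simp only: power_int_of_nat)
  show ?thesis
    unfolding *
    by (intro continuous_intros continuous_on_compose2[OF assms]) auto
qed

lemma dde_aux_cont_step:
  assumes "continuous_on {1..b} dde_kern"
  shows "continuous_on {..b} (dde_aux k' m)"
proof -
  have 1: "continuous_on {..1} (dde_aux k' m)"
    by (rule continuous_on_eq[of _ "\<lambda>_. 1"]) (auto simp: dde_aux.simps)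
  have 2: "continuous_on {1..b} (dde_aux k' m)"
    unfolding dde_aux_eq
    by (intro continuous_intros indefinite_integral_continuous_1
        integrable_continuous_interval assms)
  have "continuous_on ({..1} \<union> {1..b}) (dde_aux k' m)"
    by (intro continuous_on_closed_Un 1 2) auto
  then show ?thesis
    by (rule continuous_on_subset) auto
qed

lemma dde_aux_cont_nat: "continuous_on {..real n} (dde_aux k' m)"
proof (induction n)
  case 0
  show ?case
    by (rule continuous_on_eq[of _ "\<lambda>_. 1"]) (auto simp: dde_aux.simps)
next
  case (Suc n)
  then have "continuous_on {1..real n + 1} dde_kern"
    by (rule dde_kern_cont)
  from dde_aux_cont_step[OF this] show ?case
    by (simp add: add.commute)
qed

lemma dde_kern_cont': "continuous_on {1..b} dde_kern"
proof -
  obtain n :: nat where "b \<le> real n"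
    using real_arch_simple by blast
  then show ?thesis
    using continuous_on_subset[OF dde_kern_cont[OF dde_aux_cont_nat[of n]], of "{1..b}"] by auto
qed

lemma dde_aux_deriv:
  assumes "v > 1"
  shows "(dde_aux k' m has_real_derivative - of_int k' * dde_kern v) (at v)"
proof -
  have "((\<lambda>x. integral {1..x} dde_kern) has_real_derivative dde_kern v) (at v within {1..v+1})"
    by (rule integral_has_real_derivative[OF dde_kern_cont']) (use assms in auto)
  then have "((\<lambda>x. integral {1..x} dde_kern) has_real_derivative dde_kern v) (at v)"
    using assms by (simp add: at_within_Icc_at)
  then have "((\<lambda>x. 1 - of_int k' * integral {1..x} dde_kern) has_real_derivative
      - of_int k' * dde_kern v) (at v)"
    by (auto intro!: derivative_eq_intros)
  then show ?thesis
    by (simp add: dde_aux_eq[abs_def])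
qed

lemma dde_aux_solution: "dde_solution k' m (dde_aux k' m)"
  unfolding dde_solution_def
proof (intro conjI allI impI)
  show "continuous_on {0<..} (dde_aux k' m)"
  proof (rule continuous_at_imp_continuous_on, rule ballI)
    fix x :: real
    obtain n :: nat where n: "x < real n"
      using reals_Archimedean2 by blast
    then have "continuous_on {..<real n} (dde_aux k' m)"
      using dde_aux_cont_nat[of n] by (rule_tac continuous_on_subset) auto
    with n show "isCont (dde_aux k' m) x"
      by (simp add: continuous_on_eq_continuous_at)
  qed
next
  fix v :: real
  assume v: "v > 1"
  show "dde_aux k' m differentiable (at v)"
    using dde_aux_deriv[OF v] real_differentiable_def by blast
  show "v powi (k' + m + 1) * deriv (dde_aux k' m) v =
        - of_int k' * (v - 1) powi (k' + m) * dde_aux k' m (v - 1)"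
    using v unfolding DERIV_imp_deriv[OF dde_aux_deriv[OF v]] dde_kern_def by simp
qed (auto simp: dde_aux.simps)

lemma dde_solution_unique_nat:
  assumes f: "dde_solution k' m f" and g: "dde_solution k' m g"
  shows "0 < v \<Longrightarrow> v \<le> real n + 1 \<Longrightarrow> f v = g v"
proof (induction n arbitrary: v)
  case 0
  then show ?case
    using f g by (simp add: dde_solution_def)
next
  case (Suc n)
  show ?case
  proof (cases "v \<le> real n + 1")
    case True
    then show ?thesis
      using Suc by simp
  next
    case False
    define h where "h = (\<lambda>x. f x - g x)"
    have "h v = h (real n + 1)"
    proof (rule DERIV_isconst_end[where f = h])
      show "continuous_on {real n + 1..v} h"
        unfolding h_def
        by (intro continuous_on_diff; rule continuous_on_subset[of "{0<..}"])
           (use f g in \<open>auto simp: dde_solution_def\<close>)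
    next
      fix x
      assume x: "real n + 1 < x" "x < v"
      then have x1: "x > 1"
        by linarith
      have "f (x - 1) = g (x - 1)"
        using x x1 Suc by simp
      then have "x powi (k' + m + 1) * deriv f x = x powi (k' + m + 1) * deriv g x"
        using f g x1 by (simp add: dde_solution_def)
      then have eq: "deriv f x = deriv g x"
        using x1 by simp
      have "(f has_real_derivative deriv f x) (at x)" "(g has_real_derivative deriv g x) (at x)"
        using f g x1 by (auto simp: dde_solution_def DERIV_deriv_iff_real_differentiable)
      from DERIV_diff[OF this] show "(h has_real_derivative 0) (at x)"
        by (simp add: h_def eq)
    qed (use False in auto)
    then show ?thesis
      using Suc.IH[of "real n + 1"] by (simp add: h_def)
  qed
qed

lemma dde_solution_ex1: "\<exists>!f. dde_solution k' m f \<and> (\<forall>w\<le>0. f w = 1)"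
proof (rule ex1I[of _ "dde_aux k' m"])
  show "dde_solution k' m (dde_aux k' m) \<and> (\<forall>w\<le>0. dde_aux k' m w = 1)"
    by (auto simp: dde_aux_solution dde_aux.simps)
next
  fix f
  assume f: "dde_solution k' m f \<and> (\<forall>w\<le>0. f w = 1)"
  show "f = dde_aux k' m"
  proof
    fix v :: real
    obtain n :: nat where "v \<le> real n"
      using real_arch_simple by blast
    then have "v > 0 \<Longrightarrow> f v = dde_aux k' m v"
      using dde_solution_unique_nat[OF conjunct1[OF f] dde_aux_solution, of v n] by simp
    then show "f v = dde_aux k' m v"
      using f by (cases "v > 0") (auto simp: dde_aux.simps)
  qed
qed

lemma dde_f_solution: "dde_solution k' m (\<lambda>v. dde_f v k' m)"
  unfolding dde_f_def using theI'[OF dde_solution_ex1] by simp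

end

end

theory Submission
  imports
    Defs
    "HOL-Number_Theory.Prime_Powers"
    "HOL-Real_Asymp.Real_Asymp"
    "HOL-Probability.Probability"
begin

text \<open>
  Write \<open>L = log z\<close>, so that \<open>log R = u L\<close>.  Perron's formula on the line of real part \<open>1\<close>
  expresses the weight \<open>(u - x)\<^sub>+ ^ m\<close> through \<open>exp ((u - x) a) / a ^ (m + 1)\<close>; hence the quadratic
  form is exactly a double integral over \<open>a\<close> and \<open>b\<close> of a finite Euler product over \<open>p < z\<close> with
  local factor \<open>1 - g(p) (p^(-a/L) + p^(-b/L) - p^(-(a+b)/L))\<close>.

  With \<open>Ein s = \<integral>\<^sub>0\<^sup>1 (1 - exp (- s x)) / x dx\<close> and the constant \<open>\<gamma> = lim (Ein T - log T)\<close>, the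
  theorems of Mertens show that \<open>L ^ k\<close> times this product tends to the singular product times
  \<open>exp (- k \<gamma>) exp (k (Ein a + Ein b - Ein (a + b)))\<close>.  The convergence is dominated because
  \<open>L / \<bar>\<zeta>(1 + a/L)\<bar>\<close> is at most a constant times \<open>\<bar>a\<bar> ^ (1 + \<eta>)\<close>; this follows from the pole of
  \<open>\<zeta>\<close> for small \<open>\<bar>a\<bar> / L\<close> and from the 3-4-1 inequality in the intermediate range.
  The hypothesis \<open>m > k\<close> is what makes the dominating function integrable.

  The limit is identified by Laplace transforms: \<open>exp (k Ein a) / a ^ (m + 1)\<close> and
  \<open>exp (- k Ein s)\<close> are, up to constants, the transforms of \<open>x ^ (m - k) f(x; -k, m)\<close> and of
  \<open>y ^ (k - 1) f(y; k, -1)\<close>, since the delay equations turn into first order equations in the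
  transform variable.  Inverting gives the limit as the integral of \<open>y ^ (k - 1) f(y; k, -1)\<close>
  against the square of the first function at \<open>u - y\<close>, and Fubini's theorem shows that the
  recursion defining \<open>I\<^sub>k\<close> computes the same integral.
\<close>

section \<open>Chebyshev and Mertens estimates\<close>

text \<open>Scaling the Perron variables by \<open>L\<close> keeps both lines of integration fixed
  while z grows, and p^(-a/L) depends on p only through ln p / L in (0,1). With mass ln p / (p L) at
  ln p / L the primes tend weakly to Lebesgue measure: this is Mertens' first theorem, and it
  produces every pointwise limit. The obstacle is uniformity in the height. The mixed term
  p^(-(a+b)/L) is estimated by 1/p only, which costs L^k; together with the normalising L^k this
  puts one L^k beside each of the two factors that behave like 1/|zeta(1 + a/L)|^k. With \<eta> =
  1/(2k) these grow like |a|^(k + 1/2), and against |a|^(-(m+1)) a decay of at least |a|^(-3/2) is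
  left. Logarithms of complex numbers are avoided: Euler products are compared with exponentials of
  real parts of prime sums, and the transforms contain integer powers of a exp(-Ein a). The constant
  \<gamma> is Euler's, but it enters by its defining limit alone: exp(-k \<gamma>) from Mertens'
  third theorem cancels exp(k \<gamma>) from the transforms.\<close>

lemma sum_ln_eq_sum_mangoldt_div:
  "(\<Sum>j=1..n. ln (real j)) = (\<Sum>d=1..n. mangoldt d * real (n div d))"
proof -
  have "(\<Sum>j=1..n. ln (real j)) = (\<Sum>j=1..n. \<Sum>d=1..n. if d dvd j then mangoldt d else 0)"
  proof (intro sum.cong refl)
    fix j assume j: "j \<in> {1..n}"
    have "{d. d dvd j} = {d\<in>{1..n}. d dvd j}"
      using j by (auto dest: dvd_imp_le intro: Suc_leI dvd_pos_nat)
    then show "ln (real j) = (\<Sum>d=1..n. if d dvd j then mangoldt d else 0)"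
      using mangoldt_sum[of j, where ?'a = real] j by (simp flip: sum.inter_filter)
  qed
  also have "\<dots> = (\<Sum>d=1..n. \<Sum>j=1..n. if d dvd j then mangoldt d else 0)"
    by (rule sum.swap)
  also have "\<dots> = (\<Sum>d=1..n. mangoldt d * real (n div d))"
  proof (intro sum.cong refl)
    fix d assume d: "d \<in> {1..n}"
    have "{j\<in>{1..n}. d dvd j} = (\<lambda>i. d * i) ` {1..n div d}"
    proof (intro equalityI subsetI)
      fix j assume "j \<in> {j\<in>{1..n}. d dvd j}"
      then obtain i where "j = d * i" "1 \<le> j" "j \<le> n" by auto
      then show "j \<in> (\<lambda>i. d * i) ` {1..n div d}"
        using d by (intro image_eqI[of _ _ i]) (auto simp: less_eq_div_iff_mult_less_eq mult.commute Suc_le_eq)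
    next
      fix j assume "j \<in> (\<lambda>i. d * i) ` {1..n div d}"
      then show "j \<in> {j\<in>{1..n}. d dvd j}"
        using d by (auto simp: less_eq_div_iff_mult_less_eq mult.commute Suc_le_eq)
    qed
    then have "card {j\<in>{1..n}. d dvd j} = n div d"
      using d by (simp add: card_image inj_on_def)
    then show "(\<Sum>j=1..n. if d dvd j then mangoldt d else 0) = mangoldt d * real (n div d)"
      by (simp flip: sum.inter_filter)
  qed
  finally show ?thesis .
qed

lemma half_geometric_sum_le: "(\<Sum>j<n. (1 / 2 :: real) ^ j) \<le> 2"
  by (subst geometric_sum) (auto simp: field_simps)

section \<open>Chebyshev's upper bound\<close>

definition cheb_psi :: "nat \<Rightarrow> real" where "cheb_psi n = (\<Sum>d=1..n. mangoldt d)"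

lemma ln_fact_eq: "ln (fact n :: real) = (\<Sum>j=1..n. ln (real j))"
  by (induction n) (simp_all add: ln_mult)

text \<open>Chebyshev's device: the integers floor(2n/d) - 2 floor(n/d) are nonnegative and equal 1
  for n < d <= 2n. So the increment is at most the sum of \<open>mangoldt d\<close> weighted by
  them, which is the logarithm of the central binomial coefficient.\<close>

lemma cheb_psi_double: "cheb_psi (2 * n) \<le> cheb_psi n + real n * ln 4"
proof -
  have "cheb_psi (2 * n) - cheb_psi n = (\<Sum>d=n+1..2*n. mangoldt d)"
    unfolding cheb_psi_def using sum.ub_add_nat[of 1 n "\<lambda>d. mangoldt d :: real" n] by (simp add: mult_2)
  also have "\<dots> = (\<Sum>d=n+1..2*n. mangoldt d * (real (2 * n div d) - 2 * real (n div d)))"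
  proof (intro sum.cong refl)
    fix d assume d: "d \<in> {n+1..2*n}"
    then have "2 * n div d = 1" "n div d = 0"
      by (auto intro!: div_nat_eqI)
    then show "mangoldt d = mangoldt d * (real (2 * n div d) - 2 * real (n div d))" by simp
  qed
  also have "\<dots> \<le> (\<Sum>d=1..2*n. mangoldt d * (real (2 * n div d) - 2 * real (n div d)))"
  proof (intro sum_mono2)
    fix d :: nat
    have "2 * (n div d) \<le> 2 * n div d"
      by (cases "d = 0") (simp_all add: less_eq_div_iff_mult_less_eq)
    then show "0 \<le> mangoldt d * (real (2 * n div d) - 2 * real (n div d))"
      by (intro mult_nonneg_nonneg mangoldt_nonneg) linarith
  qed auto
  also have "\<dots> = (\<Sum>d=1..2*n. mangoldt d * real (2*n div d)) - 2 * (\<Sum>d=1..2*n. mangoldt d * real (n div d))"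
    by (simp add: algebra_simps sum_subtractf sum_distrib_left)
  also have "(\<Sum>d=1..2*n. mangoldt d * real (n div d)) = (\<Sum>d=1..n. mangoldt d * real (n div d))"
    by (intro sum.mono_neutral_right) auto
  also have "(\<Sum>d=1..2*n. mangoldt d * real (2*n div d)) - 2 * (\<Sum>d=1..n. mangoldt d * real (n div d))
     = ln (fact (2*n)) - 2 * ln (fact n)"
    by (simp only: sum_ln_eq_sum_mangoldt_div [symmetric] ln_fact_eq)
  also have "\<dots> = ln (real (2 * n choose n))"
    by (subst binomial_fact) (simp_all add: ln_div ln_mult)
  also have "\<dots> \<le> ln (4 ^ n)"
  proof (rule ln_mono)
    have "2 * n choose n \<le> 4 ^ n"
      using binomial_le_pow2[of "2*n" n] by (simp add: power_mult)
    then show "real (2 * n choose n) \<le> 4 ^ n"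
      by (metis of_nat_le_iff of_nat_numeral of_nat_power)
  qed simp
  also have "\<dots> = real n * ln 4" by (simp add: ln_realpow)
  finally show ?thesis by simp
qed

text \<open>Strong induction by halving. For h = n div 2 the bound to reach is at least 8h, while
  the ingredients add up to 4h + (3/2)h + 2h, the last summand for a possible odd term. The constant
  4 provides this slack.\<close>

lemma cheb_psi_le: "cheb_psi n \<le> 4 * real n"
proof (induction n rule: less_induct)
  case (less n)
  consider "n = 0" | "n = 1" | "n \<ge> 2" by linarith
  then show ?case
  proof cases
    case 3
    define h where "h = n div 2"
    have ln4: "ln 4 \<le> (3/2 :: real)"
    proof -
      have "ln (4::real) = 2 * ln 2" using ln_realpow[of 2 2] by simp
      then show ?thesis using ln2_le_25_over_36 by simp
    qed
    have "n = 2 * h \<or> n = 2 * h + 1" unfolding h_def by presburger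
    moreover have "cheb_psi (2 * h) \<le> 4 * real h + real h * ln 4"
      using cheb_psi_double[of h] less[of h] 3 unfolding h_def by simp
    moreover have "real h * ln 4 \<le> real h * (3/2)" using ln4 by (intro mult_left_mono) auto
    moreover have "cheb_psi (2 * h + 1) \<le> cheb_psi (2 * h) + ln (real (2 * h + 1))"
    proof -
      have "mangoldt (Suc (2*h)) \<le> ln (real (2 * h + 1))"
      proof -
        have "mangoldt (Suc (2*h)) \<le> (\<Sum>d | d dvd Suc (2*h). mangoldt d :: real)"
          by (intro member_le_sum) (auto simp: mangoldt_nonneg)
        then show ?thesis using mangoldt_sum[of "Suc (2*h)", where ?'a = real] by simp
      qed
      then show ?thesis by (simp add: cheb_psi_def)
    qed
    moreover have "ln (real (2 * h + 1)) \<le> real (2 * h)" using ln_le_minus_one[of "real (2*h+1)"] by simp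
    ultimately show ?thesis by auto
  qed (simp_all add: cheb_psi_def)
qed

text \<open>The sum of mangoldt(d) floor(n/d) is ln n!, which lies within n of n ln n. Replacing the
  floor by n/d loses nothing in one direction and at most \<open>cheb_psi n\<close> <= 4n in the
  other; division by n gives the constants 1 and 4.\<close>

lemma sum_mangoldt_div_bounds:
  assumes "n \<ge> 1"
  shows "ln (real n) - 1 \<le> (\<Sum>d=1..n. mangoldt d / real d)"
    and "(\<Sum>d=1..n. mangoldt d / real d) \<le> ln (real n) + 4"
proof -
  let ?S = "\<Sum>d=1..n. mangoldt d / real d :: real"
  have fact_le: "ln (fact n :: real) \<le> real n * ln (real n)"
  proof -
    have "ln (fact n :: real) \<le> (\<Sum>j=1..n. ln (real n))"
      unfolding ln_fact_eq by (intro sum_mono) auto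
    then show ?thesis by simp
  qed
  have fact_ge: "real n * ln (real n) - real n \<le> ln (fact n :: real)"
  proof -
    \<comment> \<open>A single term of the exponential series, in place of Stirling's
      formula.\<close>
    have "real n ^ n / fact n \<le> exp (real n)"
    proof -
      have "(\<Sum>i\<in>{n}. real n ^ i /\<^sub>R fact i) \<le> (\<Sum>i. real n ^ i /\<^sub>R fact i)"
        by (intro sum_le_suminf summable_exp_generic) auto
      then show ?thesis by (simp add: exp_def divide_inverse mult.commute)
    qed
    then have "ln (real n ^ n / fact n) \<le> real n"
      using assms ln_mono[of "real n ^ n / fact n" "exp (real n)"] by simp
    then show ?thesis using assms by (simp add: ln_div ln_realpow)
  qed
  have "ln (fact n :: real) = (\<Sum>d=1..n. mangoldt d * real (n div d))"
    by (simp only: ln_fact_eq sum_ln_eq_sum_mangoldt_div)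
  also have "\<dots> \<le> (\<Sum>d=1..n. mangoldt d * (real n / real d))"
    by (intro sum_mono mult_left_mono mangoldt_nonneg) (rule of_nat_div_le_of_nat)
  also have "\<dots> = real n * ?S" by (simp add: sum_distrib_left mult.commute)
  finally have "real n * (ln (real n) - 1) \<le> real n * ?S" using fact_ge by (simp add: algebra_simps)
  then show "ln (real n) - 1 \<le> ?S" using assms by simp
  have "real n * ?S - cheb_psi n = (\<Sum>d=1..n. mangoldt d * (real n / real d - 1))"
    by (simp add: cheb_psi_def sum_distrib_left algebra_simps sum_subtractf)
  also have "\<dots> \<le> (\<Sum>d=1..n. mangoldt d * real (n div d))"
  proof (intro sum_mono mult_left_mono mangoldt_nonneg)
    fix d :: nat
    show "real n / real d - 1 \<le> real (n div d)"
      using floor_divide_of_nat_eq[of n d, where ?'a = real] by linarith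
  qed
  also have "\<dots> = ln (fact n :: real)"
    by (simp only: ln_fact_eq sum_ln_eq_sum_mangoldt_div)
  finally have "real n * ?S \<le> real n * (ln (real n) + 4)"
    using fact_le cheb_psi_le[of n] by (simp add: algebra_simps)
  then show "?S \<le> ln (real n) + 4" using assms by simp
qed

section \<open>Mertens' first theorem\<close>

definition primes_below :: "real \<Rightarrow> nat set" where
  "primes_below z = {p. prime p \<and> real p < z}"

lemma finite_primes_below [simp, intro]: "finite (primes_below z)"
  by (rule finite_subset[of _ "{..nat \<lceil>z\<rceil>}"]) (auto simp: primes_below_def, linarith)

lemma primes_belowD: "p \<in> primes_below z \<Longrightarrow> prime p" "p \<in> primes_below z \<Longrightarrow> real p < z"
  by (auto simp: primes_below_def)

lemma primes_below_mono: "z \<le> z' \<Longrightarrow> primes_below z \<subseteq> primes_below z'"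
  by (auto simp: primes_below_def)

lemma real_prime_ge_2: "prime (p::nat) \<Longrightarrow> real p \<ge> 2"
  using prime_ge_2_nat[of p] by linarith

lemma summable_ln_div_square: "summable (\<lambda>n::nat. ln (real n) / real n ^ 2)"
proof (rule summable_comparison_test_ev)
  show "summable (\<lambda>n::nat. real n powr (-(3/2)))"
    by (subst summable_real_powr_iff) auto
  have "eventually (\<lambda>x::real. \<bar>ln x / x ^ 2\<bar> \<le> x powr (-(3/2))) at_top"
    by real_asymp
  then show "eventually (\<lambda>n::nat. norm (ln (real n) / real n ^ 2) \<le> real n powr (-(3/2))) at_top"
    unfolding real_norm_def by (rule eventually_nat_real)
qed

lemma ln_real_nat_nonneg: "ln (real n) \<ge> 0"
  by (cases "n = 0") auto

text \<open>Only proper prime powers separate the two sums. A prime contributes ln p times p^(-2) +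
  p^(-3) + ..., at most 2 ln p / p^2 because p >= 2, and this is summable.\<close>

lemma mangoldt_sum_vs_prime_sum:
  "\<exists>C. \<forall>n. (\<Sum>d=1..n. mangoldt d / real d) - (\<Sum>p | prime p \<and> p \<le> n. ln (real p) / real p) \<in> {0..C}"
proof (intro exI allI)
  fix n :: nat
  let ?P = "{p. prime p \<and> p \<le> n}" and ?Q = "{d\<in>{1..n}. primepow d \<and> \<not> prime d}"
  have fin: "finite ?P" by (rule finite_subset[of _ "{..n}"]) auto
  have "(\<Sum>d=1..n. mangoldt d / real d) = (\<Sum>d\<in>?P \<union> ?Q. mangoldt d / real d :: real)"
    by (intro sum.mono_neutral_right)
       (auto simp: mangoldt_def prime_gt_0_nat Suc_le_eq)
  also have "\<dots> = (\<Sum>d\<in>?P. mangoldt d / real d) + (\<Sum>d\<in>?Q. mangoldt d / real d)"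
    by (intro sum.union_disjoint) (use fin in auto)
  also have "(\<Sum>d\<in>?P. mangoldt d / real d :: real) = (\<Sum>p\<in>?P. ln (real p) / real p)"
    by (intro sum.cong) auto
  finally have eq: "(\<Sum>d=1..n. mangoldt d / real d) - (\<Sum>p\<in>?P. ln (real p) / real p)
      = (\<Sum>d\<in>?Q. mangoldt d / real d)" by simp
  have "(\<Sum>d\<in>?Q. mangoldt d / real d :: real) \<le> (\<Sum>d\<in>(\<lambda>(p,j). p ^ j) ` (?P \<times> {2..<n+2}). mangoldt d / real d)"
  proof (intro sum_mono2)
    \<comment> \<open>A crude range of exponents suffices, since j < 2^j <= p^j <= n. The end n + 2
      is chosen so that the shift by 2 below produces a geometric sum over j < n.\<close>
    show "?Q \<subseteq> (\<lambda>(p,j). p ^ j) ` (?P \<times> {2..<n+2})"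
    proof
      fix d assume d: "d \<in> ?Q"
      then obtain p j where pj: "prime p" "j > 0" "d = p ^ j" by (auto simp: primepow_def)
      have "j \<noteq> 1" using d pj by auto
      have "p ^ 1 \<le> p ^ j" using pj by (intro power_increasing) (auto simp: prime_gt_0_nat Suc_le_eq)
      moreover have "j < 2 ^ j" by (rule less_exp)
      moreover have "2 ^ j \<le> p ^ j" using pj by (intro power_mono prime_ge_2_nat) auto
      moreover have "p ^ j \<le> n" using d pj by simp
      moreover from calculation have "j < n + 2" by linarith
      ultimately show "d \<in> (\<lambda>(p,j). p ^ j) ` (?P \<times> {2..<n+2})"
        using pj d \<open>j \<noteq> 1\<close> by (intro image_eqI[of _ _ "(p,j)"]) auto
    qed
  qed (use fin in \<open>auto intro!: divide_nonneg_nonneg mangoldt_nonneg\<close>)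
  also have "\<dots> \<le> (\<Sum>(p,j)\<in>?P \<times> {2..<n+2}. mangoldt (p ^ j) / real (p ^ j))"
    using sum_image_le[of "?P \<times> {2..<n+2}" "\<lambda>d. mangoldt d / real d :: real" "\<lambda>(p,j). p ^ j"] fin
    by (simp add: o_def case_prod_unfold mangoldt_nonneg)
  also have "\<dots> = (\<Sum>p\<in>?P. \<Sum>j\<in>{2..<n+2}. ln (real p) / real p ^ j)"
    by (subst sum.cartesian_product [symmetric]) (auto intro!: sum.cong)
  also have "\<dots> \<le> (\<Sum>p\<in>?P. 2 * (ln (real p) / real p ^ 2))"
  proof (intro sum_mono)
    fix p assume "p \<in> ?P"
    then have p: "real p \<ge> 2" by (auto dest: real_prime_ge_2)
    have "(\<Sum>j\<in>{2..<n+2}. ln (real p) / real p ^ j) = (\<Sum>j<n. ln (real p) / real p ^ 2 * (1 / real p) ^ j)"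
      by (rule sum.reindex_bij_witness[of _ "\<lambda>j. j + 2" "\<lambda>j. j - 2"])
         (auto simp: power_divide power2_eq_square dest!: le_Suc_ex)
    also have "\<dots> = ln (real p) / real p ^ 2 * (\<Sum>j<n. (1 / real p) ^ j)"
      by (simp add: sum_distrib_left)
    also have "\<dots> \<le> ln (real p) / real p ^ 2 * 2"
    proof (intro mult_left_mono)
      have "(\<Sum>j<n. (1 / real p) ^ j) \<le> (\<Sum>j<n. (1 / 2) ^ j)"
        using p by (intro sum_mono power_mono) (auto simp: field_simps)
      then show "(\<Sum>j<n. (1 / real p) ^ j) \<le> 2"
        using half_geometric_sum_le[of n] by linarith
    qed (use p in auto)
    finally show "(\<Sum>j\<in>{2..<n+2}. ln (real p) / real p ^ j) \<le> 2 * (ln (real p) / real p ^ 2)"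
      by (simp only: mult.commute)
  qed
  also have "\<dots> \<le> 2 * (\<Sum>n. ln (real n) / real n ^ 2)"
    unfolding sum_distrib_left [symmetric]
    by (intro mult_left_mono sum_le_suminf summable_ln_div_square)
       (use fin in \<open>auto simp: Suc_le_eq intro!: divide_nonneg_nonneg intro: ln_real_nat_nonneg\<close>)
  finally show "(\<Sum>d=1..n. mangoldt d / real d) - (\<Sum>p | prime p \<and> p \<le> n. ln (real p) / real p)
      \<in> {0..2 * (\<Sum>n. ln (real n) / real n ^ 2)}"
    unfolding eq by (auto intro!: sum_nonneg divide_nonneg_nonneg mangoldt_nonneg)
qed

theorem mertens_first:
  obtains C where "C \<ge> 0"
    "\<And>z. z \<ge> 1 \<Longrightarrow> \<bar>(\<Sum>p\<in>primes_below z. ln (real p) / real p) - ln z\<bar> \<le> C"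
proof -
  obtain C where C: "\<And>n. (\<Sum>d=1..n. mangoldt d / real d) -
      (\<Sum>p | prime p \<and> p \<le> n. ln (real p) / real p) \<in> {0..C}"
    using mangoldt_sum_vs_prime_sum by blast
  have "\<bar>(\<Sum>p\<in>primes_below z. ln (real p) / real p) - ln z\<bar> \<le> C + 5" if z: "z \<ge> 1" for z
  proof (cases "z = 1")
    case True
    then have "primes_below z = {}" by (auto simp: primes_below_def dest: real_prime_ge_2)
    then show ?thesis using True C[of 1] by auto
  next
    case False
    \<comment> \<open>The largest integer strictly below z, as \<open>primes_below\<close> is
      strict. Then z <= n + 1 <= 2n, so passing from ln n to ln z costs at most ln 2 < 1.\<close>
    define n where "n = nat (\<lceil>z\<rceil> - 1)"
    have n: "n \<ge> 1" "real n < z" "z \<le> real n + 1"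
      using z False unfolding n_def by linarith+
    have "primes_below z = {p. prime p \<and> p \<le> n}"
      using n unfolding primes_below_def by auto
    moreover have "ln (real n) \<le> ln z" using n by simp
    moreover have "ln z \<le> ln (2 * real n)" using n z by (intro ln_mono) auto
    moreover have "ln (2 * real n) \<le> 1 + ln (real n)"
      using n ln_2_less_1 by (simp add: ln_mult)
    ultimately show ?thesis
      using C[of n] sum_mangoldt_div_bounds[OF n(1)] by auto
  qed
  moreover have "C + 5 \<ge> 0" using C[of 1] by auto
  ultimately show ?thesis using that by blast
qed


section \<open>Weak convergence of the prime masses\<close>

lemma exp_times_mono: "L > 0 \<Longrightarrow> x \<le> y \<Longrightarrow> exp (x * L) \<le> exp (y * L :: real)"
  by (simp add: mult_right_mono)

lemma norm_diff_triangle4: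
  "norm (a - d) \<le> norm (a - b) + norm (b - c) + norm (c - d :: 'a :: real_normed_vector)"
  by norm

text \<open>When each prime carries the mass ln p / (p L) at the point ln p / L, Mertens' first
  theorem gives [0,x) the mass x + O(1/L). So in the limit each cell of a fixed partition receives
  its length, and \<phi> is approximated by a step function on the cells.\<close>

theorem prime_weak_convergence:
  fixes \<phi> :: "real \<Rightarrow> complex"
  assumes cont: "continuous_on {0..T} \<phi>" and T: "T > 0"
  shows "((\<lambda>L. \<Sum>p\<in>primes_below (exp (T * L)). of_real (ln (real p) / (real p * L)) * \<phi> (ln (real p) / L))
           \<longlongrightarrow> integral {0..T} \<phi>) at_top"
proof -
  obtain C where C: "C \<ge> 0"
    "\<And>z. z \<ge> 1 \<Longrightarrow> \<bar>(\<Sum>p\<in>primes_below z. ln (real p) / real p) - ln z\<bar> \<le> C"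
    using mertens_first by blast
  define c where "c = (\<lambda>L p. ln (real p) / (real p * L))"
  have lim: "((\<lambda>L. \<Sum>p\<in>primes_below (exp (x * L)). c L p) \<longlongrightarrow> x) at_top" if x: "x \<ge> 0" for x
  proof (rule Lim_null[THEN iffD2], rule Lim_null_comparison)
    show "eventually (\<lambda>L. norm ((\<Sum>p\<in>primes_below (exp (x * L)). c L p) - x) \<le> C / L) at_top"
      using eventually_gt_at_top[of 0]
    proof eventually_elim
      case (elim L)
      have "\<bar>(\<Sum>p\<in>primes_below (exp (x * L)). ln (real p) / real p) - x * L\<bar> \<le> C"
        using C(2)[of "exp (x * L)"] x elim by simp
      also have "(\<Sum>p\<in>primes_below (exp (x * L)). ln (real p) / real p) - x * L =
          L * ((\<Sum>p\<in>primes_below (exp (x * L)). c L p) - x)"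
        using elim by (simp add: c_def sum_distrib_left algebra_simps)
      finally have "L * \<bar>(\<Sum>p\<in>primes_below (exp (x * L)). c L p) - x\<bar> \<le> C"
        using elim by (simp add: abs_mult)
      then show ?case using elim by (simp add: pos_le_divide_eq mult.commute)
    qed
    show "((\<lambda>L. C / L) \<longlongrightarrow> 0) at_top" by real_asymp
  qed
  show ?thesis
  proof (rule tendstoI)
    fix e0 :: real assume e0: "e0 > 0"
    \<comment> \<open>Three errors occur: e (T + 1) for freezing \<phi> at left endpoints in the
      prime sum, whose total mass is below T + 1; e for the masses of the cells; e T for the Riemann
      sum. Their total e (2T + 2) stays below e0.\<close>
    define e where "e = e0 / (2 * T + 3)"
    have e: "e > 0" "e * (2 * T + 3) = e0" using e0 T by (auto simp: e_def)
    have "uniformly_continuous_on {0..T} \<phi>"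
      using cont by (intro compact_uniformly_continuous) auto
    then obtain d where d: "d > 0"
      "\<And>x y. x \<in> {0..T} \<Longrightarrow> y \<in> {0..T} \<Longrightarrow> dist x y < d \<Longrightarrow> dist (\<phi> x) (\<phi> y) < e"
      using e unfolding uniformly_continuous_on_def by metis
    obtain N :: nat where N: "T / d < real N" using reals_Archimedean2 by blast
    have "T / d > 0" using T d by simp
    then have N0: "N > 0" using N by (cases N) auto
    define x where "x = (\<lambda>i. real i * T / real N)"
    have x0: "x 0 = 0" and xN: "x N = T" using N0 by (auto simp: x_def)
    have xstep: "x (Suc i) - x i = T / real N" for i using N0 by (simp add: x_def field_simps)
    have step_d: "T / real N < d" using N N0 d by (simp add: field_simps)
    have xmono: "x i \<le> x j" if "i \<le> j" for i j using that T by (simp add: x_def divide_right_mono)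
    have xnn: "0 \<le> x i" for i using T by (simp add: x_def)
    have xle: "x i \<le> T" if "i \<le> N" for i using xmono[OF that] xN by simp
    \<comment> \<open>The primes of the i-th cell: ln p / L lies in [x i, x (Suc i)), half open
      because \<open>primes_below\<close> is strict.\<close>
    define B where "B = (\<lambda>L i. primes_below (exp (x (Suc i) * L)) - primes_below (exp (x i * L)))"
    have BD: "x i \<le> ln (real p) / L" "ln (real p) / L < x (Suc i)" "prime p" if "p \<in> B L i" "L > 0" for p i L
    proof -
      have "exp (x i * L) \<le> real p" "real p < exp (x (Suc i) * L)" and pp: "prime p"
        using that by (auto simp: B_def primes_below_def)
      then have "x i * L \<le> ln (real p)" "ln (real p) < x (Suc i) * L"
        using real_prime_ge_2[OF pp] ln_less_cancel_iff[of "real p" "exp (x (Suc i) * L)"]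
        by (auto simp: ln_ge_iff)
      then show "x i \<le> ln (real p) / L" "ln (real p) / L < x (Suc i)" "prime p"
        using that pp by (auto simp: field_simps)
    qed
    have sumB: "(\<Sum>p\<in>primes_below (exp (x n * L)). f p) = (\<Sum>i<n. \<Sum>p\<in>B L i. f p)"
      if "L > 0" for L n and f :: "nat \<Rightarrow> 'b::comm_monoid_add"
    proof (induction n)
      case 0
      have "primes_below (exp (x 0 * L)) = {}" by (auto simp: primes_below_def x0 dest: real_prime_ge_2)
      then show ?case by simp
    next
      case (Suc n)
      have un: "primes_below (exp (x (Suc n) * L)) = primes_below (exp (x n * L)) \<union> B L n"
        using primes_below_mono[OF exp_times_mono[OF that xmono[of n "Suc n"]]] by (auto simp: B_def)
      have "(\<Sum>p\<in>primes_below (exp (x (Suc n) * L)). f p) = (\<Sum>p\<in>primes_below (exp (x n * L)). f p) + (\<Sum>p\<in>B L n. f p)"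
        by (subst un, intro sum.union_disjoint) (auto simp: B_def)
      then show ?case using Suc by simp
    qed
    have intsum: "integral {0..x n} \<phi> = (\<Sum>i<n. integral {x i..x (Suc i)} \<phi>)" if "n \<le> N" for n
      using that
    proof (induction n)
      case 0
      then show ?case by (simp add: x0)
    next
      case (Suc n)
      have "\<phi> integrable_on {0..x (Suc n)}"
        using xle[of "Suc n"] Suc.prems xnn
        by (intro integrable_continuous_interval continuous_on_subset[OF cont]) auto
      then have "integral {0..x (Suc n)} \<phi> = integral {0..x n} \<phi> + integral {x n..x (Suc n)} \<phi>"
        using xnn[of n] xmono[of n "Suc n"]
        by (intro Henstock_Kurzweil_Integration.integral_combine[symmetric]) auto
      then show ?case using Suc by simp
    qed
    have interr: "norm (integral {0..T} \<phi> - (\<Sum>i<N. \<phi> (x i) * of_real (T / real N))) \<le> e * T"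
    proof -
      have "integral {0..T} \<phi> - (\<Sum>i<N. \<phi> (x i) * of_real (T / real N))
          = (\<Sum>i<N. integral {x i..x (Suc i)} \<phi> - \<phi> (x i) * of_real (T / real N))"
        using intsum[of N] by (simp add: xN sum_subtractf)
      also have "norm \<dots> \<le> (\<Sum>i<N. e * (T / real N))"
      proof (rule sum_norm_le)
        fix i assume i: "i \<in> {..<N}"
        have int: "\<phi> integrable_on {x i..x (Suc i)}"
          using xle[of "Suc i"] i xnn[of i]
          by (intro integrable_continuous_interval continuous_on_subset[OF cont]) auto
        have "integral {x i..x (Suc i)} \<phi> - \<phi> (x i) * of_real (T / real N)
            = integral {x i..x (Suc i)} (\<lambda>y. \<phi> y - \<phi> (x i))"
          using int xmono[of i "Suc i"] xstep[of i]
          by (subst Henstock_Kurzweil_Integration.integral_diff)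
             (auto simp: content_real scaleR_conv_of_real mult.commute)
        also have "norm \<dots> \<le> e * (x (Suc i) - x i)"
        proof (rule integral_bound)
          show "x i \<le> x (Suc i)" by (rule xmono) simp
          show "continuous_on {x i..x (Suc i)} (\<lambda>y. \<phi> y - \<phi> (x i))"
            using xle[of "Suc i"] i xnn[of i]
            by (intro continuous_intros continuous_on_subset[OF cont]) auto
          fix y assume y: "y \<in> {x i..x (Suc i)}"
          have "dist (\<phi> y) (\<phi> (x i)) < e"
            using y xle[of "Suc i"] i xnn[of i] xstep[of i] step_d xle[of i]
            by (intro d(2)) (auto simp: dist_real_def)
          then show "norm (\<phi> y - \<phi> (x i)) \<le> e" by (simp add: dist_norm)
        qed
        finally show "norm (integral {x i..x (Suc i)} \<phi> - \<phi> (x i) * of_real (T / real N)) \<le> e * (T / real N)"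
          by (simp add: xstep)
      qed
      also have "\<dots> = e * T" using N0 by simp
      finally show ?thesis .
    qed
    have "((\<lambda>L. \<Sum>i<N. \<phi> (x i) * of_real (\<Sum>p\<in>B L i. c L p)) \<longlongrightarrow> (\<Sum>i<N. \<phi> (x i) * of_real (T / real N))) at_top"
    proof (intro tendsto_intros tendsto_sum)
      fix i assume "i \<in> {..<N}"
      have "((\<lambda>L. (\<Sum>p\<in>primes_below (exp (x (Suc i) * L)). c L p) - (\<Sum>p\<in>primes_below (exp (x i * L)). c L p))
           \<longlongrightarrow> x (Suc i) - x i) at_top"
        by (intro tendsto_diff lim xnn)
      moreover have "eventually (\<lambda>L. (\<Sum>p\<in>primes_below (exp (x (Suc i) * L)). c L p) - (\<Sum>p\<in>primes_below (exp (x i * L)). c L p)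
          = (\<Sum>p\<in>B L i. c L p)) at_top"
        using eventually_gt_at_top[of 0] by eventually_elim (simp add: sumB)
      ultimately show "((\<lambda>L. \<Sum>p\<in>B L i. c L p) \<longlongrightarrow> T / real N) at_top"
        unfolding xstep by (rule Lim_transform_eventually)
    qed
    then have ev1: "eventually (\<lambda>L. dist (\<Sum>i<N. \<phi> (x i) * of_real (\<Sum>p\<in>B L i. c L p)) (\<Sum>i<N. \<phi> (x i) * of_real (T / real N)) < e) at_top"
      using e by (intro tendstoD)
    have ev2: "eventually (\<lambda>L. (\<Sum>p\<in>primes_below (exp (T * L)). c L p) < T + 1) at_top"
      using T by (intro order_tendstoD[OF lim]) auto
    show "eventually (\<lambda>L. dist (\<Sum>p\<in>primes_below (exp (T * L)). of_real (ln (real p) / (real p * L)) * \<phi> (ln (real p) / L))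
        (integral {0..T} \<phi>) < e0) at_top"
      using ev1 ev2 eventually_gt_at_top[of 0]
    proof eventually_elim
      case (elim L)
      have cnn: "c L p \<ge> 0" if "prime p" for p
        using real_prime_ge_2[OF that] elim by (auto simp: c_def intro!: divide_nonneg_nonneg)
      have "(\<Sum>p\<in>primes_below (exp (T * L)). of_real (c L p) * \<phi> (ln (real p) / L))
          - (\<Sum>i<N. \<phi> (x i) * of_real (\<Sum>p\<in>B L i. c L p))
          = (\<Sum>i<N. \<Sum>p\<in>B L i. of_real (c L p) * (\<phi> (ln (real p) / L) - \<phi> (x i)))"
        using sumB[OF \<open>0 < L\<close>, of "\<lambda>p. of_real (c L p) * \<phi> (ln (real p) / L)" N]
        by (simp add: xN sum_subtractf algebra_simps sum_distrib_left)
      also have "norm \<dots> \<le> (\<Sum>i<N. \<Sum>p\<in>B L i. c L p * e)"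
      proof (intro sum_norm_le)
        fix i p assume i: "i \<in> {..<N}" and p: "p \<in> B L i"
        have "dist (\<phi> (ln (real p) / L)) (\<phi> (x i)) < e"
          using BD[OF p \<open>0 < L\<close>] xle[of "Suc i"] i xnn[of i] xstep[of i] step_d xle[of i]
          by (intro d(2)) (auto simp: dist_real_def)
        then show "norm (of_real (c L p) * (\<phi> (ln (real p) / L) - \<phi> (x i))) \<le> c L p * e"
          using cnn[OF BD(3)[OF p \<open>0 < L\<close>]] by (simp add: norm_mult dist_norm mult_left_mono)
      qed
      also have "\<dots> = e * (\<Sum>p\<in>primes_below (exp (T * L)). c L p)"
        using sumB[OF \<open>0 < L\<close>, of "c L" N] by (simp add: xN sum_distrib_left mult.commute)
      also have "\<dots> \<le> e * (T + 1)" using elim e by (intro mult_left_mono) auto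
      finally have 1: "norm ((\<Sum>p\<in>primes_below (exp (T * L)). of_real (c L p) * \<phi> (ln (real p) / L))
          - (\<Sum>i<N. \<phi> (x i) * of_real (\<Sum>p\<in>B L i. c L p))) \<le> e * (T + 1)" .
      have "norm ((\<Sum>p\<in>primes_below (exp (T * L)). of_real (c L p) * \<phi> (ln (real p) / L)) - integral {0..T} \<phi>)
          \<le> e * (T + 1) + e + e * T"
        using 1 interr elim(1)
        unfolding dist_norm norm_minus_commute[of "integral {0..T} \<phi>"] by (rule_tac order_trans[OF norm_diff_triangle4]) (intro add_mono, auto)
      also have "\<dots> < e0" using e T by (simp add: algebra_simps flip: e(2))
      finally show ?case by (simp add: dist_norm c_def)
    qed
  qed
qed

text \<open>Cut the range of ln p / L into unit cells starting at T. Since T >= 1, there 1/p is at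
  most the mass ln p / (p L), and by Mertens' first theorem a cell has mass at most (L + 2C)/L <= 1
  + 2C. On the i-th cell the exponential is at most exp(-T - i), so the cells sum geometrically,
  with exp(-1) <= 1/2.\<close>

lemma prime_tail_bound:
  obtains C where "C \<ge> 0" "\<And>L T S. L \<ge> 1 \<Longrightarrow> T \<ge> 1 \<Longrightarrow> finite S \<Longrightarrow>
     (\<And>p. p \<in> S \<Longrightarrow> prime p \<and> real p \<ge> exp (T * L)) \<Longrightarrow>
     (\<Sum>p\<in>S. exp (- ln (real p) / L) / real p) \<le> C * exp (- T)"
proof -
  obtain C where C: "C \<ge> 0"
    "\<And>z. z \<ge> 1 \<Longrightarrow> \<bar>(\<Sum>p\<in>primes_below z. ln (real p) / real p) - ln z\<bar> \<le> C"
    using mertens_first by blast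
  have "(\<Sum>p\<in>S. exp (- ln (real p) / L) / real p) \<le> (1 + 2 * C) * 2 * exp (- T)"
    if L: "L \<ge> 1" and T: "T \<ge> 1" and fin: "finite S" and S: "\<And>p. p \<in> S \<Longrightarrow> prime p \<and> real p \<ge> exp (T * L)" for L T S
  proof -
    define c where "c = (\<lambda>p::nat. ln (real p) / (real p * L))"
    define j where "j = (\<lambda>p::nat. nat \<lfloor>ln (real p) / L - T\<rfloor>)"
    have y: "T \<le> ln (real p) / L" if "p \<in> S" for p
      using S[OF that] L real_prime_ge_2[of p] by (auto simp: ln_ge_iff field_simps)
    have jb: "T + real (j p) \<le> ln (real p) / L" "ln (real p) / L < T + real (j p) + 1" if "p \<in> S" for p
      using y[OF that] unfolding j_def by linarith+
    obtain J where J: "\<And>p. p \<in> S \<Longrightarrow> j p < J"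
      using finite_imageI[OF fin, of j] finite_nat_set_iff_bounded by (metis imageI)
    have "(\<Sum>p\<in>S. exp (- ln (real p) / L) / real p) = (\<Sum>i<J. \<Sum>p | p \<in> S \<and> j p = i. exp (- ln (real p) / L) / real p)"
      using J by (subst sum.group) (auto simp: fin)
    also have "\<dots> \<le> (\<Sum>i<J. exp (-T) * (1 + 2 * C) * (1/2) ^ i)"
    proof (intro sum_mono)
      fix i assume "i \<in> {..<J}"
      define U where "U = primes_below (exp ((T + real i + 1) * L))"
      define V where "V = primes_below (exp ((T + real i) * L))"
      have VU: "V \<subseteq> U" unfolding U_def V_def using L by (intro primes_below_mono exp_times_mono) auto
      have cnn: "c p \<ge> 0" if "prime p" for p
        using real_prime_ge_2[OF that] L by (auto simp: c_def intro!: divide_nonneg_nonneg)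
      have "(\<Sum>p | p \<in> S \<and> j p = i. exp (- ln (real p) / L) / real p) \<le> (\<Sum>p | p \<in> S \<and> j p = i. exp (- T - real i) * c p)"
      proof (intro sum_mono)
        fix p assume p: "p \<in> {p. p \<in> S \<and> j p = i}"
        have p2: "real p \<ge> 2" using S p real_prime_ge_2 by auto
        have "exp (- ln (real p) / L) \<le> exp (- T - real i)"
          using jb[of p] p by auto
        moreover have "1 / real p \<le> c p"
        proof -
          have "1 \<le> ln (real p) / L" using y[of p] p T by auto
          then have "1 / real p \<le> (ln (real p) / L) / real p" using p2 by (intro divide_right_mono) auto
          then show ?thesis by (simp add: c_def mult.commute)
        qed
        ultimately show "exp (- ln (real p) / L) / real p \<le> exp (- T - real i) * c p"
          using mult_mono[of "exp (- ln (real p) / L)" "exp (- T - real i)" "1 / real p" "c p"] by simp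
      qed
      also have "\<dots> = exp (- T - real i) * (\<Sum>p | p \<in> S \<and> j p = i. c p)" by (simp add: sum_distrib_left)
      also have "(\<Sum>p | p \<in> S \<and> j p = i. c p) \<le> (\<Sum>p\<in>U - V. c p)"
      proof (intro sum_mono2)
        show "{p \<in> S. j p = i} \<subseteq> U - V"
        proof
          fix p assume p: "p \<in> {p \<in> S. j p = i}"
          have p2: "real p \<ge> 2" "prime p" using S p real_prime_ge_2 by auto
          have "(T + real i) * L \<le> ln (real p)" "ln (real p) < (T + real i + 1) * L"
            using jb[of p] p L by (auto simp: field_simps)
          then have "exp ((T + real i) * L) \<le> real p" "real p < exp ((T + real i + 1) * L)"
            using p2 exp_le_cancel_iff[of "(T + real i) * L" "ln (real p)"]
              exp_less_cancel_iff[of "ln (real p)" "(T + real i + 1) * L"] by auto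
          then show "p \<in> U - V" using p2 by (auto simp: U_def V_def primes_below_def)
        qed
      qed (auto simp: U_def cnn dest: primes_belowD)
      also have "\<dots> = (\<Sum>p\<in>U. c p) - (\<Sum>p\<in>V. c p)"
        using VU by (intro sum_diff) (auto simp: U_def)
      also have "\<dots> = ((\<Sum>p\<in>U. ln (real p) / real p) - (\<Sum>p\<in>V. ln (real p) / real p)) / L"
        by (simp add: c_def sum_divide_distrib diff_divide_distrib)
      also have "\<dots> \<le> (L + 2 * C) / L"
        using C(2)[of "exp ((T + real i + 1) * L)"] C(2)[of "exp ((T + real i) * L)"] L T
        by (intro divide_right_mono) (auto simp: U_def V_def algebra_simps abs_le_iff)
      also have "\<dots> \<le> 1 + 2 * C" using L C by (simp add: field_simps) (smt (verit) mult_left_mono mult_cancel_left1)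
      finally have "(\<Sum>p | p \<in> S \<and> j p = i. exp (- ln (real p) / L) / real p) \<le> exp (- T - real i) * (1 + 2 * C)"
        by (simp add: mult_left_mono)
      also have "exp (- T - real i) = exp (-T) * exp (-1) ^ i"
        by (simp add: exp_diff exp_minus flip: exp_of_nat_mult) (simp add: field_simps flip: exp_add exp_of_nat_mult)
      also have "exp (-1) ^ i \<le> (1/2 :: real) ^ i"
        using exp_ge_add_one_self[of 1] by (intro power_mono) (auto simp: exp_minus field_simps)
      finally show "(\<Sum>p | p \<in> S \<and> j p = i. exp (- ln (real p) / L) / real p) \<le> exp (-T) * (1 + 2 * C) * (1/2) ^ i"
        using C by (simp add: mult.commute mult_left_mono mult.left_commute)
    qed
    also have "\<dots> = exp (-T) * (1 + 2 * C) * (\<Sum>i<J. (1/2) ^ i)" by (simp add: sum_distrib_left)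
    also have "\<dots> \<le> exp (-T) * (1 + 2 * C) * 2"
      using C by (intro mult_left_mono half_geometric_sum_le) simp_all
    finally show ?thesis using C by (simp add: algebra_simps)
  qed
  then show ?thesis using that[of "(1 + 2 * C) * 2"] C by auto
qed

section \<open>The zeta function to the right of the line of real part one\<close>

text \<open>The power n^(-s), written through the real logarithm so that no branch has to be
  chosen.\<close>

definition npow :: "nat \<Rightarrow> complex \<Rightarrow> complex" where
  "npow n s = exp (- s * of_real (ln (real n)))"

lemma norm_npow: "n > 0 \<Longrightarrow> norm (npow n s) = real n powr (- Re s)"
  by (simp add: npow_def norm_exp_eq_Re powr_def)

lemma npow_mult: "m > 0 \<Longrightarrow> n > 0 \<Longrightarrow> npow (m * n) s = npow m s * npow n s"
  unfolding npow_def exp_add[symmetric] by (simp add: ln_mult algebra_simps)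

lemma npow_1 [simp]: "npow (Suc 0) s = 1"
  by (simp add: npow_def)

text \<open>Every evaluation below has real part above 1; the edge of this half plane is approached
  by letting L grow in 1 + a/L.\<close>

definition zeta_series :: "complex \<Rightarrow> complex" where "zeta_series s = (\<Sum>n. npow (Suc n) s)"

lemma summable_norm_npow:
  assumes "Re s > 1"
  shows "summable (\<lambda>n. norm (npow (Suc n) s))"
proof -
  have "summable (\<lambda>n. real n powr (- Re s))"
    using assms by (subst summable_real_powr_iff) auto
  then have "summable (\<lambda>n. real (n + 1) powr (- Re s))"
    by (rule summable_ignore_initial_segment)
  then show ?thesis by (simp only: norm_npow zero_less_Suc Suc_eq_plus1[symmetric])
qed

lemma zeta_series_sums: "Re s > 1 \<Longrightarrow> (\<lambda>n. npow (Suc n) s) sums zeta_series s"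
  unfolding zeta_series_def by (rule summable_sums, rule summable_norm_cancel, erule summable_norm_npow)

section \<open>Comparison of the zeta series with an integral\<close>

lemma has_vector_derivative_exp_ln:
  fixes c :: complex
  assumes "x > 0"
  shows "((\<lambda>x. exp (c * of_real (ln x))) has_vector_derivative c / of_real x * exp (c * of_real (ln x))) (at x within A)"
proof -
  have "((\<lambda>x. of_real (ln x) :: complex) has_vector_derivative of_real (inverse x)) (at x within A)"
    using assms by (intro has_vector_derivative_of_real) (auto intro!: derivative_eq_intros simp: divide_inverse)
  then have "((\<lambda>x. c * of_real (ln x)) has_vector_derivative c * of_real (inverse x)) (at x within A)"
    by (rule has_vector_derivative_mult_right)
  from field_vector_diff_chain_within[OF this, of exp "exp (c * of_real (ln x))"]
  show ?thesis
    by (simp add: o_def divide_inverse mult_ac DERIV_exp has_field_derivative_at_within)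
qed

text \<open>The derivative of x^(-s) is -s x^(-s-1), of modulus at most |s|/x^2 when Re s >= 1, and
  the two points are at distance at most 1.\<close>

lemma norm_exp_ln_diff_le:
  assumes "1 \<le> a" "a \<le> x" "x \<le> a + 1" "Re s \<ge> 1"
  shows "norm (exp (- s * of_real (ln x)) - exp (- s * of_real (ln a))) \<le> norm s / a ^ 2"
proof (cases "a = x")
  case False
  then have ax: "a < x" using assms by simp
  have "norm (exp (- s * of_real (ln x)) - exp (- s * of_real (ln a)))
      \<le> norm s / a ^ 2 * x - norm s / a ^ 2 * a"
  proof (rule differentiable_bound_general[OF ax, where f' = "\<lambda>y. (- s) / of_real y * exp (- s * of_real (ln y))" and \<phi>' = "\<lambda>_. norm s / a ^ 2"])
    fix y assume y: "a < y" "y < x"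
    show "((\<lambda>y. exp (- s * of_real (ln y))) has_vector_derivative (- s) / of_real y * exp (- s * of_real (ln y))) (at y)"
      using y assms by (intro has_vector_derivative_exp_ln) auto
    have "exp (- Re s * ln y) \<le> exp (- ln y)" using y assms by (auto simp: mult_le_cancel_right1)
    also have "\<dots> = 1 / y" using y assms by (simp add: exp_minus divide_inverse)
    finally have "norm ((- s) / of_real y * exp (- s * of_real (ln y))) \<le> norm s / y * (1 / y)"
      using y assms mult_left_mono[of "exp (- Re s * ln y)" "1 / y" "norm s / y"]
      by (auto simp: norm_mult norm_divide norm_exp_eq_Re)
    also have "\<dots> = norm s / y ^ 2" by (simp add: power2_eq_square)
    also have "\<dots> \<le> norm s / a ^ 2" using y assms by (intro divide_left_mono power_mono mult_pos_pos) auto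
    finally show "norm ((- s) / of_real y * exp (- s * of_real (ln y))) \<le> norm s / a ^ 2" .
    show "((\<lambda>y. norm s / a ^ 2 * y) has_vector_derivative norm s / a ^ 2) (at y)"
      unfolding has_real_derivative_iff_has_vector_derivative[symmetric]
      by (auto intro!: derivative_eq_intros)
  qed (use assms in \<open>auto intro!: continuous_intros\<close>)
  also have "\<dots> = norm s / a ^ 2 * (x - a)" by (simp only: right_diff_distrib)
  also have "\<dots> \<le> norm s / a ^ 2 * 1" using assms by (intro mult_left_mono) auto
  finally show ?thesis by simp
qed auto

text \<open>The quotient is the integral of x^(-s) from i + 1 to i + 2, so this is the error of the
  rectangle rule on one unit interval.\<close>

lemma npow_integral_approx:
  assumes "Re s > 1"
  shows "norm (npow (Suc i) s - (npow (Suc i) (s - 1) - npow (Suc (Suc i)) (s - 1)) / (s - 1)) \<le> norm s / real (Suc i) ^ 2"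
proof -
  define a where "a = real (Suc i)"
  have a: "a \<ge> 1" "real (Suc (Suc i)) = a + 1" by (auto simp: a_def)
  have s1: "s - 1 \<noteq> 0" using assms by auto
  \<comment> \<open>An antiderivative of x^(-s) - a^(-s). Its increment over [a, a+1] is minus the
    quantity to be estimated, and its derivative is bounded by the preceding lemma.\<close>
  define f where "f = (\<lambda>x. exp ((1 - s) * of_real (ln x)) / (1 - s) - exp (- s * of_real (ln a)) * of_real x)"
  have "norm (f (a + 1) - f a) \<le> norm s / a ^ 2 * (a + 1) - norm s / a ^ 2 * a"
  proof (rule differentiable_bound_general[where f' = "\<lambda>y. exp (- s * of_real (ln y)) - exp (- s * of_real (ln a))" and \<phi>' = "\<lambda>_. norm s / a ^ 2"])
    fix y assume y: "a < y" "y < a + 1"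
    have "exp ((1 - s) * of_real (ln y)) = of_real y * exp (- s * of_real (ln y))"
    proof -
      have "exp ((1 - s) * of_real (ln y)) = exp (of_real (ln y)) * exp (- s * of_real (ln y))"
        unfolding exp_add[symmetric] by (simp add: algebra_simps)
      also have "exp (of_real (ln y)) = complex_of_real y" using y a by (simp only: exp_of_real) simp
      finally show ?thesis .
    qed
    then have "((\<lambda>x. exp ((1 - s) * of_real (ln x)) / (1 - s)) has_vector_derivative
         (of_real y * exp (- s * of_real (ln y))) * (1 - s) / of_real y / (1 - s)) (at y)"
      using has_vector_derivative_divide[OF has_vector_derivative_exp_ln[of y "1 - s" UNIV], of "1 - s"] y a
      by (simp add: mult.commute)
    moreover have "(of_real y * exp (- s * of_real (ln y))) * (1 - s) / of_real y / (1 - s) = exp (- s * of_real (ln y))"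
      using y a s1 by simp
    ultimately have "((\<lambda>x. exp ((1 - s) * of_real (ln x)) / (1 - s)) has_vector_derivative exp (- s * of_real (ln y))) (at y)"
      by simp
    moreover have "((\<lambda>x. exp (- s * of_real (ln a)) * of_real x) has_vector_derivative exp (- s * of_real (ln a)) * 1) (at y)"
      by (intro has_vector_derivative_mult_right has_vector_derivative_of_real[of "\<lambda>x. x" 1, simplified])
    ultimately show "(f has_vector_derivative exp (- s * of_real (ln y)) - exp (- s * of_real (ln a))) (at y)"
      unfolding f_def by (auto intro!: has_vector_derivative_diff)
    show "norm (exp (- s * of_real (ln y)) - exp (- s * of_real (ln a))) \<le> norm s / a ^ 2"
      using y a assms by (intro norm_exp_ln_diff_le) auto
    show "((\<lambda>y. norm s / a ^ 2 * y) has_vector_derivative norm s / a ^ 2) (at y)"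
      unfolding has_real_derivative_iff_has_vector_derivative[symmetric]
      by (auto intro!: derivative_eq_intros)
  qed (use a s1 in \<open>auto intro!: continuous_intros simp: f_def\<close>)
  also have "f (a + 1) - f a = - (npow (Suc i) s - (npow (Suc i) (s - 1) - npow (Suc (Suc i)) (s - 1)) / (s - 1))"
  proof -
    have gen: "x / (1 - s) - c * (y + 1) - (w / (1 - s) - c * y) = - (c - (w - x) / (s - 1))" for x y c w :: complex
    proof -
      have "(w - x) / (s - 1) = (x - w) / (1 - s)" using minus_divide_divide[of "w - x" "s - 1"] by simp
      then show ?thesis by (simp add: algebra_simps diff_divide_distrib)
    qed
    show ?thesis
      unfolding npow_def a(2) a_def[symmetric] f_def of_real_add of_real_1
      by (subst gen) (simp add: algebra_simps)
  qed
  also have "norm s / a ^ 2 * (a + 1) - norm s / a ^ 2 * a = norm s / a ^ 2"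
    by (simp add: distrib_left)
  finally show ?thesis by (simp only: a_def[symmetric] norm_minus_cancel)
qed

text \<open>Euler-Maclaurin summation to lowest order: the tail after M terms is replaced by the
  integral from M + 1, and the errors |s|/n^2 telescope through 1/n^2 <= 2 (1/n - 1/(n+1)). Taking M
  = 0 exhibits the pole at 1; a large M controls heights small compared with M.\<close>

lemma zeta_series_approx:
  assumes "Re s > 1"
  shows "norm (zeta_series s - (\<Sum>i<M. npow (Suc i) s) - npow (Suc M) (s - 1) / (s - 1)) \<le> 2 * norm s / real (Suc M)"
proof -
  define h where "h = (\<lambda>i. npow (Suc i) (s - 1) / (s - 1))"
  have bound: "norm ((\<Sum>i<n. npow (Suc i) s) - (\<Sum>i<M. npow (Suc i) s) - (h M - h n)) \<le> 2 * norm s / real (Suc M)"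
    if "n \<ge> M" for n
  proof -
    have "(\<Sum>i<n. npow (Suc i) s) - (\<Sum>i<M. npow (Suc i) s) - (h M - h n)
        = (\<Sum>i\<in>{M..<n}. npow (Suc i) s - (h i - h (Suc i)))"
      using that
      by (induction n rule: dec_induct) (auto simp: algebra_simps)
    also have "norm \<dots> \<le> (\<Sum>i\<in>{M..<n}. 2 * norm s * (1 / real (Suc i) - 1 / real (Suc (Suc i))))"
    proof (rule sum_norm_le)
      fix i
      have "norm (npow (Suc i) s - (h i - h (Suc i))) \<le> norm s / real (Suc i) ^ 2"
        using npow_integral_approx[OF assms, of i] by (simp add: h_def diff_divide_distrib)
      also have "\<dots> = norm s * (1 / real (Suc i) ^ 2)" by simp
      also have "\<dots> \<le> norm s * (2 * (1 / real (Suc i) - 1 / real (Suc (Suc i))))"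
      proof (rule mult_left_mono)
        have "1 / real (Suc i) - 1 / real (Suc (Suc i)) = 1 / (real (Suc i) * real (Suc (Suc i)))"
          by (simp add: field_simps)
        moreover have "1 / real (Suc i) ^ 2 \<le> 2 / (real (Suc i) * real (Suc (Suc i)))"
          using mult_left_mono[of "real (Suc (Suc i))" "2 * real (Suc i)" "real (Suc i)"]
          by (simp only: divide_le_eq power2_eq_square) (simp add: divide_simps)
        ultimately show "1 / real (Suc i) ^ 2 \<le> 2 * (1 / real (Suc i) - 1 / real (Suc (Suc i)))" by simp
      qed simp
      finally show "norm (npow (Suc i) s - (h i - h (Suc i))) \<le> 2 * norm s * (1 / real (Suc i) - 1 / real (Suc (Suc i)))"
        by (simp add: mult_ac)
    qed
    also have "\<dots> = 2 * norm s * (1 / real (Suc M) - 1 / real (Suc n))"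
      using that by (induction n rule: dec_induct) (auto simp: algebra_simps)
    also have "\<dots> \<le> 2 * norm s * (1 / real (Suc M))" by (intro mult_left_mono) auto
    finally show ?thesis by simp
  qed
  have "h \<longlonglongrightarrow> 0"
  proof (rule tendsto_norm_zero_cancel)
    have "(\<lambda>i. real (Suc i) powr (- Re (s - 1))) \<longlonglongrightarrow> 0"
      using assms by (intro tendsto_neg_powr filterlim_compose[OF filterlim_real_sequentially filterlim_Suc]) auto
    then have "(\<lambda>i. real (Suc i) powr (- Re (s - 1)) / norm (s - 1)) \<longlonglongrightarrow> 0"
      by (rule tendsto_divide_zero)
    then show "(\<lambda>i. norm (h i)) \<longlonglongrightarrow> 0"
      by (simp add: h_def norm_divide norm_npow del: of_nat_Suc)
  qed
  then have "(\<lambda>n. norm ((\<Sum>i<n. npow (Suc i) s) - (\<Sum>i<M. npow (Suc i) s) - (h M - h n)))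
      \<longlonglongrightarrow> norm (zeta_series s - (\<Sum>i<M. npow (Suc i) s) - (h M - 0))"
    using zeta_series_sums[OF assms] unfolding sums_def by (intro tendsto_intros)
  then show ?thesis
    using bound unfolding h_def[symmetric]
    by (intro tendsto_upperbound[where F = sequentially])
       (auto simp: h_def intro!: eventually_sequentiallyI[of M])
qed


section \<open>The Euler product of zeta\<close>

definition coprime_to :: "nat set \<Rightarrow> nat set" where
  "coprime_to A = {n. n > 0 \<and> (\<forall>p\<in>A. \<not> p dvd n)}"

lemma npow_abs_summable:
  assumes "Re s > 1" "A \<subseteq> {0<..}"
  shows "(\<lambda>n. norm (npow n s)) summable_on A" "(\<lambda>n. npow n s) summable_on A"
proof -
  have "(\<lambda>n. norm (norm (npow (Suc n) s))) summable_on UNIV"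
    using summable_norm_npow[OF assms(1)] by (intro norm_summable_imp_summable_on) simp
  then have "(\<lambda>n. norm (npow n s)) summable_on (Suc ` UNIV)"
    by (subst summable_on_reindex) (auto simp: o_def)
  then show *: "(\<lambda>n. norm (npow n s)) summable_on A"
    by (rule summable_on_subset_banach) (use assms in \<open>auto simp: image_iff gr0_conv_Suc\<close>)
  then show "(\<lambda>n. npow n s) summable_on A" by (rule abs_summable_summable)
qed

lemma infsum_npow_all:
  assumes "Re s > 1"
  shows "infsum (\<lambda>n. npow n s) (coprime_to {}) = zeta_series s"
proof -
  have eq: "coprime_to {} = range Suc" by (auto simp: coprime_to_def image_iff gr0_conv_Suc)
  have "infsum (\<lambda>n. npow n s) (range Suc) = infsum (\<lambda>n. npow (Suc n) s) UNIV"
    by (subst infsum_reindex) (auto simp: o_def)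
  also have "\<dots> = zeta_series s"
    using norm_summable_imp_has_sum[OF summable_norm_npow[OF assms] zeta_series_sums[OF assms]] by (rule infsumI)
  finally show ?thesis by (simp add: eq)
qed

text \<open>The sieve of Eratosthenes: multiplication by p maps the integers coprime to A onto the
  multiples of p among them, so the factor 1 - p^(-s) removes exactly these multiples from the
  series.\<close>

lemma euler_product_finite:
  assumes "Re s > 1" "finite A" "\<And>p. p \<in> A \<Longrightarrow> prime p"
  shows "zeta_series s * (\<Prod>p\<in>A. 1 - npow p s) = infsum (\<lambda>n. npow n s) (coprime_to A)"
  using assms(2,3)
proof (induction A rule: finite_induct)
  case empty
  then show ?case using assms by (simp add: infsum_npow_all)
next
  case (insert p A)
  have p: "prime p" and pA: "p \<notin> A" using insert by auto
  have p0: "p > 0" using p prime_gt_0_nat by auto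
  have eq: "{n\<in>coprime_to A. p dvd n} = (\<lambda>n. p * n) ` coprime_to A"
  proof (intro equalityI subsetI)
    fix n assume "n \<in> {n\<in>coprime_to A. p dvd n}"
    then obtain m where "n = p * m" "n \<in> coprime_to A" by auto
    then show "n \<in> (\<lambda>n. p * n) ` coprime_to A"
      by (auto simp: coprime_to_def intro!: image_eqI[of _ _ m])
  next
    fix n assume "n \<in> (\<lambda>n. p * n) ` coprime_to A"
    then obtain m where m: "n = p * m" "m \<in> coprime_to A" by auto
    have "\<not> q dvd p * m" if q: "q \<in> A" for q
    proof
      assume "q dvd p * m"
      then have "q dvd p" using m q insert.prems[of q] prime_dvd_mult_nat[of q p m] by (auto simp: coprime_to_def)
      then show False using p q pA insert.prems[of q] primes_dvd_imp_eq by auto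
    qed
    then show "n \<in> {n\<in>coprime_to A. p dvd n}" using m p0 by (auto simp: coprime_to_def)
  qed
  have eq': "coprime_to (insert p A) = coprime_to A - {n\<in>coprime_to A. p dvd n}"
    by (auto simp: coprime_to_def)
  have "infsum (\<lambda>n. npow n s) (coprime_to (insert p A)) =
      infsum (\<lambda>n. npow n s) (coprime_to A) - infsum (\<lambda>n. npow n s) {n\<in>coprime_to A. p dvd n}"
    unfolding eq' by (intro infsum_Diff npow_abs_summable assms) (auto simp: coprime_to_def)
  also have "infsum (\<lambda>n. npow n s) {n\<in>coprime_to A. p dvd n} = infsum (\<lambda>n. npow (p * n) s) (coprime_to A)"
    unfolding eq using p0 by (subst infsum_reindex) (auto simp: o_def inj_on_def)
  also have "\<dots> = infsum (\<lambda>n. npow p s * npow n s) (coprime_to A)"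
    by (intro infsum_cong npow_mult p0) (auto simp: coprime_to_def)
  also have "\<dots> = npow p s * infsum (\<lambda>n. npow n s) (coprime_to A)"
    by (rule infsum_cmult_right')
  finally have step: "infsum (\<lambda>n. npow n s) (coprime_to (insert p A)) =
      infsum (\<lambda>n. npow n s) (coprime_to A) - npow p s * infsum (\<lambda>n. npow n s) (coprime_to A)" .
  have IH: "zeta_series s * (\<Prod>p\<in>A. 1 - npow p s) = infsum (\<lambda>n. npow n s) (coprime_to A)"
    using insert by simp
  have "zeta_series s * (\<Prod>p\<in>insert p A. 1 - npow p s) =
      zeta_series s * (\<Prod>p\<in>A. 1 - npow p s) - npow p s * (zeta_series s * (\<Prod>p\<in>A. 1 - npow p s))"
    using insert.hyps by (simp add: algebra_simps)
  then show ?case by (simp only: IH step)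
qed

text \<open>After sieving by all primes below N only 1 and integers n >= N survive, because every
  prime factor of a survivor is at least N. What remains beside 1 is bounded by a tail of an
  absolutely convergent series.\<close>

lemma euler_product_tendsto:
  assumes "Re s > 1"
  shows "(\<lambda>N. zeta_series s * (\<Prod>p\<in>primes_below (real N). 1 - npow p s)) \<longlonglongrightarrow> 1"
proof -
  let ?f = "\<lambda>n. norm (npow n s)"
  have tail: "norm (zeta_series s * (\<Prod>p\<in>primes_below (real N). 1 - npow p s) - 1) \<le> infsum ?f {0<..} - sum ?f {0<..<N}"
    if N: "N \<ge> 2" for N
  proof -
    define B where "B = coprime_to (primes_below (real N)) - {1}"
    have sub: "B \<subseteq> {N..}"
    proof
      fix n assume n: "n \<in> B"
      then have "n \<noteq> 1" "n > 0" by (auto simp: B_def coprime_to_def)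
      then obtain p where p: "prime p" "p dvd n" using prime_factor_nat by blast
      then have "p \<ge> N" using n by (auto simp: B_def coprime_to_def primes_below_def)
      then show "n \<in> {N..}" using dvd_imp_le[OF p(2) \<open>n > 0\<close>] by simp
    qed
    have "coprime_to (primes_below (real N)) = insert 1 B"
      by (auto simp: B_def coprime_to_def primes_below_def)
    then have "zeta_series s * (\<Prod>p\<in>primes_below (real N). 1 - npow p s) = infsum (\<lambda>n. npow n s) (insert 1 B)"
      by (subst euler_product_finite[OF assms]) (auto dest: primes_belowD)
    also have "\<dots> = 1 + infsum (\<lambda>n. npow n s) B"
      using sub N by (subst infsum_insert) (auto intro!: npow_abs_summable assms simp: B_def)
    finally have "norm (zeta_series s * (\<Prod>p\<in>primes_below (real N). 1 - npow p s) - 1) = norm (infsum (\<lambda>n. npow n s) B)" by simp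
    also have "\<dots> \<le> infsum ?f B"
      using sub N by (intro norm_infsum_bound npow_abs_summable assms) auto
    also have "\<dots> \<le> infsum ?f {N..}"
      using sub N by (intro infsum_mono_neutral npow_abs_summable assms) auto
    also have "{N..} = {0<..} - {0<..<N}" using N by auto
    also have "infsum ?f ({0<..} - {0<..<N}) = infsum ?f {0<..} - infsum ?f {0<..<N}"
      by (intro infsum_Diff npow_abs_summable assms) auto
    finally show ?thesis by simp
  qed
  have "(\<lambda>N. sum ?f {0<..<N}) \<longlonglongrightarrow> infsum ?f {0<..}"
  proof -
    have "(?f has_sum infsum ?f {0<..}) {0<..}"
      by (intro has_sum_infsum npow_abs_summable assms) auto
    then have "((\<lambda>n. if n = 0 then 0 else ?f n) has_sum infsum ?f {0<..}) UNIV"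
      by (subst (asm) has_sum_cong_neutral[of _ _ "\<lambda>n. if n = 0 then 0 else ?f n"]) auto
    then have "(\<lambda>n. if n = 0 then 0 else ?f n) sums infsum ?f {0<..}"
      by (rule has_sum_imp_sums)
    moreover have "(\<Sum>n<N. if n = 0 then 0 else ?f n) = sum ?f {0<..<N}" for N
      by (intro sum.mono_neutral_cong_right) auto
    ultimately show ?thesis by (simp add: sums_def)
  qed
  then have "(\<lambda>N. infsum ?f {0<..} - sum ?f {0<..<N}) \<longlonglongrightarrow> infsum ?f {0<..} - infsum ?f {0<..}"
    by (intro tendsto_intros)
  then have "(\<lambda>N. infsum ?f {0<..} - sum ?f {0<..<N}) \<longlonglongrightarrow> 0" by simp
  then have "(\<lambda>N. zeta_series s * (\<Prod>p\<in>primes_below (real N). 1 - npow p s) - 1) \<longlonglongrightarrow> 0"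
    by (rule Lim_null_comparison[rotated]) (use tail in \<open>auto intro!: eventually_sequentiallyI[of 2]\<close>)
  then show ?thesis by (simp add: LIM_zero_iff)
qed

text \<open>The square of the modulus is 1 + (2 Re w + |w|^2), and 1 + x <= exp x.\<close>

lemma norm_one_plus_le: "norm (1 + w) \<le> exp (Re w + norm w ^ 2 / 2)" for w :: complex
proof -
  have "norm (1 + w) ^ 2 = 1 + (2 * Re w + norm w ^ 2)"
    unfolding cmod_power2 by (simp add: power2_eq_square algebra_simps)
  also have "\<dots> \<le> exp (2 * Re w + norm w ^ 2)" by (rule exp_ge_add_one_self)
  also have "\<dots> = exp (Re w + norm w ^ 2 / 2) ^ 2"
    unfolding power2_eq_square exp_add[symmetric] by (simp add: field_simps)
  finally show ?thesis by (rule power2_le_imp_le) simp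
qed

text \<open>The lower bound is the upper bound for 1/(1 - q) = 1 + w, where w = q + q^2/(1 - q) and
  |w| <= 2|q|. The constant 4 covers 2|q|^2 in Re w and (2|q|)^2 / 2 from the square.\<close>

lemma norm_one_minus_bounds:
  fixes q :: complex
  assumes "norm q \<le> 1/2"
  shows "norm (1 - q) \<le> exp (- Re q + 4 * norm q ^ 2)"
    and "exp (- Re q - 4 * norm q ^ 2) \<le> norm (1 - q)"
proof -
  have "norm (1 - q) \<le> exp (- Re q + norm q ^ 2 / 2)" using norm_one_plus_le[of "- q"] by simp
  also have "\<dots> \<le> exp (- Re q + 4 * norm q ^ 2)" by simp
  finally show "norm (1 - q) \<le> exp (- Re q + 4 * norm q ^ 2)" .
  have q1: "1 - q \<noteq> 0" using assms by auto
  have n1: "norm (1 - q) \<ge> 1/2" using norm_triangle_ineq2[of 1 q] assms by simp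
  define w where "w = q / (1 - q)"
  have w: "1 + w = 1 / (1 - q)" "w = q + q ^ 2 / (1 - q)" using q1 by (auto simp: w_def field_simps power2_eq_square)
  have "norm w \<le> 2 * norm q"
    using n1 mult_left_mono[OF n1, of "norm q"] by (simp add: w_def norm_divide divide_le_eq) 
  then have "norm w ^ 2 \<le> (2 * norm q) ^ 2" by (intro power_mono) auto
  moreover have "Re w \<le> Re q + 2 * norm q ^ 2"
  proof -
    have "Re (q ^ 2 / (1 - q)) \<le> norm (q ^ 2 / (1 - q))" by (rule complex_Re_le_cmod)
    also have "\<dots> \<le> 2 * norm q ^ 2"
      using n1 mult_left_mono[OF n1, of "norm q ^ 2"] by (simp add: norm_divide norm_power divide_le_eq)
    finally show ?thesis by (simp add: w(2))
  qed
  ultimately have "Re w + norm w ^ 2 / 2 \<le> Re q + 4 * norm q ^ 2" by (simp add: power_mult_distrib)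
  then have "norm (1 + w) \<le> exp (Re q + 4 * norm q ^ 2)" using norm_one_plus_le[of w] by (meson exp_le_cancel_iff order_trans)
  then have "1 / norm (1 - q) \<le> exp (Re q + 4 * norm q ^ 2)" by (simp add: w(1) norm_divide)
  then have "1 \<le> exp (Re q + 4 * norm q ^ 2) * norm (1 - q)" using n1 q1 by (simp add: divide_le_eq)
  moreover have "exp (- Re q - 4 * norm q ^ 2) * exp (Re q + 4 * norm q ^ 2) = 1"
    by (simp flip: exp_add)
  ultimately show "exp (- Re q - 4 * norm q ^ 2) \<le> norm (1 - q)"
    using mult_left_mono[of 1 "exp (Re q + 4 * norm q ^ 2) * norm (1 - q)" "exp (- Re q - 4 * norm q ^ 2)"]
    by (simp add: mult.assoc[symmetric])
qed

lemma sum_inverse_squares_le: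
  assumes "finite A" "\<And>p. p \<in> A \<Longrightarrow> p \<ge> 2"
  shows "(\<Sum>p\<in>A. 1 / real p ^ 2) \<le> 1"
proof -
  obtain n where n: "\<And>p. p \<in> A \<Longrightarrow> p < n" using assms(1) finite_nat_set_iff_bounded by auto
  have "(\<Sum>p\<in>A. 1 / real p ^ 2) \<le> (\<Sum>p\<in>{2..<n+2}. 1 / real p ^ 2)"
    using n assms by (intro sum_mono2) force+
  also have "\<dots> \<le> (\<Sum>p\<in>{2..<n+2}. 1 / real (p - 1) - 1 / real p)"
  proof (intro sum_mono)
    fix p assume "p \<in> {2..<n+2}"
    then have p: "real (p - 1) = real p - 1" "real p \<ge> 2" by auto
    then show "1 / real p ^ 2 \<le> 1 / real (p - 1) - 1 / real p"
      unfolding p(1) by (simp add: field_simps power2_eq_square)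
  qed
  also have "\<dots> = 1 - 1 / real (n + 1)" by (induction n) auto
  also have "\<dots> \<le> 1" by simp
  finally show ?thesis .
qed

text \<open>The second order terms add up to at most 4 times the sum of 1/p^2, hence to at most 4.
  So the factor exp 4 serves for every s and z.\<close>

lemma norm_euler_factor_bounds:
  assumes "Re s > 1"
  defines "PP \<equiv> (\<lambda>z. \<Sum>p\<in>primes_below z. Re (npow p s))"
  shows "norm (\<Prod>p\<in>primes_below z. 1 - npow p s) \<le> exp 4 * exp (- PP z)"
    and "exp (- PP z) \<le> exp 4 * norm (\<Prod>p\<in>primes_below z. 1 - npow p s)"
proof -
  have q: "norm (npow p s) \<le> 1 / real p" "norm (npow p s) \<le> 1 / 2" if "p \<in> primes_below z" for p
  proof -
    have p: "real p \<ge> 2" using that real_prime_ge_2 primes_belowD by blast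
    have "norm (npow p s) = real p powr (- Re s)" using p by (intro norm_npow) auto
    also have "\<dots> \<le> real p powr (- 1)" using p assms by (intro powr_mono) auto
    finally show "norm (npow p s) \<le> 1 / real p" using p by (simp add: powr_minus_divide)
    also have "\<dots> \<le> 1 / 2" using p by (simp add: field_simps)
    finally show "norm (npow p s) \<le> 1 / 2" .
  qed
  have sq: "(\<Sum>p\<in>primes_below z. 4 * norm (npow p s) ^ 2) \<le> 4"
  proof -
    have "(\<Sum>p\<in>primes_below z. norm (npow p s) ^ 2) \<le> (\<Sum>p\<in>primes_below z. 1 / real p ^ 2)"
    proof (intro sum_mono)
      fix p assume "p \<in> primes_below z"
      from power_mono[OF q(1)[OF this], of 2] show "norm (npow p s) ^ 2 \<le> 1 / real p ^ 2"
        by (simp add: power_divide)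
    qed
    also have "\<dots> \<le> 1" by (intro sum_inverse_squares_le) (auto dest: primes_belowD prime_ge_2_nat)
    finally show ?thesis by (simp add: sum_distrib_left[symmetric])
  qed
  have "norm (\<Prod>p\<in>primes_below z. 1 - npow p s) \<le> (\<Prod>p\<in>primes_below z. exp (- Re (npow p s) + 4 * norm (npow p s) ^ 2))"
    unfolding prod_norm[symmetric] by (intro prod_mono conjI norm_one_minus_bounds q) auto
  also have "\<dots> = exp (- PP z + (\<Sum>p\<in>primes_below z. 4 * norm (npow p s) ^ 2))"
    by (simp add: exp_sum[symmetric] PP_def sum_subtractf)
  also have "\<dots> \<le> exp (- PP z + 4)" using sq by simp
  finally show "norm (\<Prod>p\<in>primes_below z. 1 - npow p s) \<le> exp 4 * exp (- PP z)" by (simp only: exp_add mult.commute)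
  have "exp (- PP z) \<le> exp (4 + (- PP z - (\<Sum>p\<in>primes_below z. 4 * norm (npow p s) ^ 2)))" using sq by simp
  also have "\<dots> = exp 4 * (\<Prod>p\<in>primes_below z. exp (- Re (npow p s) - 4 * norm (npow p s) ^ 2))"
    by (simp only: exp_add) (simp add: exp_sum[symmetric] PP_def sum_subtractf sum_negf)
  also have "\<dots> \<le> exp 4 * norm (\<Prod>p\<in>primes_below z. 1 - npow p s)"
    unfolding prod_norm[symmetric] by (intro mult_left_mono prod_mono conjI norm_one_minus_bounds q) auto
  finally show "exp (- PP z) \<le> exp 4 * norm (\<Prod>p\<in>primes_below z. 1 - npow p s)" .
qed

text \<open>Takes the place of log zeta. The factor 2 absorbs the distance of the partial Euler
  product from its limit. Being valid for all large N, the comparison can be made at one common N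
  for several values of s.\<close>

lemma zeta_series_vs_prime_sum:
  assumes "Re s > 1"
  shows "eventually (\<lambda>N. norm (zeta_series s) \<le> 2 * exp 4 * exp (\<Sum>p\<in>primes_below (real N). Re (npow p s)) \<and>
            exp (\<Sum>p\<in>primes_below (real N). Re (npow p s)) \<le> 2 * exp 4 * norm (zeta_series s)) sequentially"
proof -
  have "(\<lambda>N. norm (zeta_series s * (\<Prod>p\<in>primes_below (real N). 1 - npow p s))) \<longlonglongrightarrow> norm (1::complex)"
    by (intro tendsto_norm euler_product_tendsto assms)
  then have lim: "(\<lambda>N. norm (zeta_series s) * norm (\<Prod>p\<in>primes_below (real N). 1 - npow p s)) \<longlonglongrightarrow> 1"
    by (simp add: norm_mult)
  have "eventually (\<lambda>N. norm (zeta_series s) * norm (\<Prod>p\<in>primes_below (real N). 1 - npow p s) < 2) sequentially"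
       "eventually (\<lambda>N. norm (zeta_series s) * norm (\<Prod>p\<in>primes_below (real N). 1 - npow p s) > 1/2) sequentially"
    by (rule order_tendstoD[OF lim], simp)+
  then show ?thesis
  proof eventually_elim
    case (elim N)
    define Pi where "Pi = norm (\<Prod>p\<in>primes_below (real N). 1 - npow p s)"
    define PP where "PP = (\<Sum>p\<in>primes_below (real N). Re (npow p s))"
    have b: "Pi \<le> exp 4 * exp (- PP)" "exp (- PP) \<le> exp 4 * Pi"
      using norm_euler_factor_bounds[OF assms, of "real N"] by (simp_all add: Pi_def PP_def)
    have e: "exp (- PP) * exp PP = 1" by (simp flip: exp_add)
    have "norm (zeta_series s) = norm (zeta_series s) * exp (- PP) * exp PP" using e by (simp add: mult.assoc)
    also have "\<dots> \<le> norm (zeta_series s) * (exp 4 * Pi) * exp PP"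
      by (intro mult_right_mono mult_left_mono b) auto
    also have "\<dots> = (norm (zeta_series s) * Pi) * exp 4 * exp PP" by (simp add: mult_ac)
    also have "\<dots> \<le> 2 * exp 4 * exp PP" using elim unfolding Pi_def[symmetric] by (intro mult_right_mono) auto
    finally have 1: "norm (zeta_series s) \<le> 2 * exp 4 * exp PP" .
    have "exp PP \<le> (2 * (norm (zeta_series s) * Pi)) * exp PP" using elim unfolding Pi_def[symmetric] by simp
    also have "\<dots> \<le> (2 * (norm (zeta_series s) * (exp 4 * exp (- PP)))) * exp PP"
      by (intro mult_right_mono mult_left_mono b) auto
    also have "\<dots> = 2 * exp 4 * norm (zeta_series s) * (exp (- PP) * exp PP)" by (simp add: mult_ac)
    finally have 2: "exp PP \<le> 2 * exp 4 * norm (zeta_series s)" using e by simp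
    show ?case using 1 2 by (simp add: PP_def)
  qed
qed


lemma Re_npow: "n > 0 \<Longrightarrow> Re (npow n s) = real n powr (- Re s) * cos (Im s * ln (real n))"
  by (simp add: npow_def Re_exp powr_def)

text \<open>Rests on 3 + 4 cos x + cos 2x = 2 (1 + cos x)^2 >= 0, weighted by p^(-\<sigma>) and
  summed over primes. The comparison constant 2 exp 4 enters 3 + 4 + 1 = 8 times.\<close>

lemma three_four_one:
  assumes "\<sigma> > 1"
  shows "1 \<le> (2 * exp 4) ^ 8 * (norm (zeta_series (of_real \<sigma>)) ^ 3 * norm (zeta_series (Complex \<sigma> \<tau>)) ^ 4 * norm (zeta_series (Complex \<sigma> (2 * \<tau>))))"
proof -
  let ?P = "\<lambda>N s. \<Sum>p\<in>primes_below (real N). Re (npow p s)"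
  let ?K = "2 * exp 4 :: real"
  have "eventually (\<lambda>N. exp (?P N (of_real \<sigma>)) \<le> ?K * norm (zeta_series (of_real \<sigma>)) \<and>
      exp (?P N (Complex \<sigma> \<tau>)) \<le> ?K * norm (zeta_series (Complex \<sigma> \<tau>)) \<and>
      exp (?P N (Complex \<sigma> (2 * \<tau>))) \<le> ?K * norm (zeta_series (Complex \<sigma> (2 * \<tau>)))) sequentially"
  proof -
    have "Re (of_real \<sigma>) > 1" "Re (Complex \<sigma> \<tau>) > 1" "Re (Complex \<sigma> (2 * \<tau>)) > 1" using assms by auto
    from this[THEN zeta_series_vs_prime_sum] show ?thesis by eventually_elim auto
  qed
  then obtain N where N: "exp (?P N (of_real \<sigma>)) \<le> ?K * norm (zeta_series (of_real \<sigma>))"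
      "exp (?P N (Complex \<sigma> \<tau>)) \<le> ?K * norm (zeta_series (Complex \<sigma> \<tau>))"
      "exp (?P N (Complex \<sigma> (2 * \<tau>))) \<le> ?K * norm (zeta_series (Complex \<sigma> (2 * \<tau>)))"
    by (auto dest!: eventually_happens)
  have "0 \<le> (\<Sum>p\<in>primes_below (real N). 3 * Re (npow p (of_real \<sigma>)) + 4 * Re (npow p (Complex \<sigma> \<tau>)) + Re (npow p (Complex \<sigma> (2 * \<tau>))))"
  proof (rule sum_nonneg)
    fix p assume "p \<in> primes_below (real N)"
    then have p: "p > 0" by (auto dest: primes_belowD prime_gt_0_nat)
    define c where "c = cos (\<tau> * ln (real p))"
    have "3 * Re (npow p (of_real \<sigma>)) + 4 * Re (npow p (Complex \<sigma> \<tau>)) + Re (npow p (Complex \<sigma> (2 * \<tau>)))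
        = real p powr (- \<sigma>) * (3 + 4 * c + cos (2 * (\<tau> * ln (real p))))"
      using p by (simp add: Re_npow c_def algebra_simps)
    also have "3 + 4 * c + cos (2 * (\<tau> * ln (real p))) = 2 * (1 + c) ^ 2"
      by (simp only: cos_double_cos) (simp add: c_def power2_eq_square algebra_simps)
    finally show "0 \<le> 3 * Re (npow p (of_real \<sigma>)) + 4 * Re (npow p (Complex \<sigma> \<tau>)) + Re (npow p (Complex \<sigma> (2 * \<tau>)))"
      by simp
  qed
  also have "\<dots> = 3 * ?P N (of_real \<sigma>) + 4 * ?P N (Complex \<sigma> \<tau>) + ?P N (Complex \<sigma> (2 * \<tau>))"
    by (simp add: sum.distrib sum_distrib_left)
  finally have "1 \<le> exp (3 * ?P N (of_real \<sigma>) + 4 * ?P N (Complex \<sigma> \<tau>) + ?P N (Complex \<sigma> (2 * \<tau>)))" by simp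
  also have "\<dots> = exp (?P N (of_real \<sigma>)) ^ 3 * exp (?P N (Complex \<sigma> \<tau>)) ^ 4 * exp (?P N (Complex \<sigma> (2 * \<tau>)))"
    by (simp only: exp_add exp_of_nat_mult[of 3, simplified] exp_of_nat_mult[of 4, simplified])
  also have "\<dots> \<le> (?K * norm (zeta_series (of_real \<sigma>))) ^ 3 * (?K * norm (zeta_series (Complex \<sigma> \<tau>))) ^ 4 * (?K * norm (zeta_series (Complex \<sigma> (2 * \<tau>))))"
    by (intro mult_mono power_mono N) auto
  also have "\<dots> = ?K ^ 8 * (norm (zeta_series (of_real \<sigma>)) ^ 3 * norm (zeta_series (Complex \<sigma> \<tau>)) ^ 4 * norm (zeta_series (Complex \<sigma> (2 * \<tau>))))"
    by (simp only: power_mult_distrib) (simp add: eval_nat_numeral)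
  finally show ?thesis .
qed

section \<open>Zeta near the pole and prime sums cut at exp L\<close>

lemma zeta_series_near_pole: "Re s > 1 \<Longrightarrow> norm (zeta_series s - 1 / (s - 1)) \<le> 2 * norm s"
  using zeta_series_approx[of s 0] by simp

lemma Re_line [simp]: "Re (1 + Complex 1 t / of_real L) = 1 + 1 / L" "Im (1 + Complex 1 t / of_real L) = t / L"
  by (simp_all add: Re_divide_of_real Im_divide_of_real)

lemma zeta_series_one_plus_le: 
  assumes "L \<ge> 1" shows "norm (zeta_series (of_real (1 + 1 / L))) \<le> 5 * L"
proof -
  have "norm (zeta_series (of_real (1 + 1/L)) - of_real L) \<le> 2 * (1 + 1 / L)"
  proof -
    have e: "1 / (complex_of_real (1 + 1 / L) - 1) = of_real L" by simp
    have n: "norm (complex_of_real (1 + 1 / L)) = 1 + 1 / L" using assms by (simp only: norm_of_real) simp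
    show ?thesis
      using zeta_series_near_pole[of "of_real (1 + 1 / L)"] assms unfolding e n by simp
  qed
  then have "norm (zeta_series (of_real (1 + 1/L))) \<le> L + 2 * (1 + 1 / L)"
    using norm_triangle_sub[of "zeta_series (of_real (1 + 1/L))" "of_real L"] assms by simp
  also have "1 / L \<le> L" using assms by (simp add: field_simps) (smt (verit) mult_le_cancel_left1)
  finally show ?thesis using assms by simp
qed

text \<open>The first bound drops the primes from exp L on, whose effect is bounded by the tail
  estimate with T = 1. The second is a weak form of the 3-4-1 argument built on 1 + cos x >= 0; it
  serves for very large heights. The third is the upper half of Mertens' second theorem, read off
  from zeta(1 + 1/L) <= 5L.\<close>

lemma prime_sum_cutoff:
  obtains C where "C > 0"
    "\<And>L t. L \<ge> 1 \<Longrightarrow> exp (- (\<Sum>p\<in>primes_below (exp L). Re (npow p (1 + Complex 1 t / of_real L)))) *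
        norm (zeta_series (1 + Complex 1 t / of_real L)) \<le> C"
    "\<And>L t. L \<ge> 1 \<Longrightarrow> 1 \<le> C * L * norm (zeta_series (1 + Complex 1 t / of_real L))"
    "\<And>L. L \<ge> 1 \<Longrightarrow> (\<Sum>p\<in>primes_below (exp L). 1 / real p) \<le> ln L + C"
proof -
  obtain C0 where C0: "C0 \<ge> 0" "\<And>L T S. L \<ge> 1 \<Longrightarrow> T \<ge> 1 \<Longrightarrow> finite S \<Longrightarrow>
     (\<And>p. p \<in> S \<Longrightarrow> prime p \<and> real p \<ge> exp (T * L)) \<Longrightarrow>
     (\<Sum>p\<in>S. exp (- ln (real p) / L) / real p) \<le> C0 * exp (- T)"
    using prime_tail_bound by blast
  obtain C1 where C1: "C1 \<ge> 0"
    "\<And>z. z \<ge> 1 \<Longrightarrow> \<bar>(\<Sum>p\<in>primes_below z. ln (real p) / real p) - ln z\<bar> \<le> C1"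
    using mertens_first by blast
  let ?K = "2 * exp 4 :: real"
  have powr_eq: "real p powr (- (1 + 1 / L)) = exp (- ln (real p) / L) / real p" if "prime p" for p L
    using prime_gt_0_nat[OF that] by (simp add: powr_def exp_minus exp_add field_simps flip: exp_add)
  have A: "exp (- (\<Sum>p\<in>primes_below (exp L). Re (npow p (1 + Complex 1 t / of_real L)))) *
        norm (zeta_series (1 + Complex 1 t / of_real L)) \<le> ?K * exp C0" if L: "L \<ge> 1" for L t
  proof -
    define s where "s = 1 + Complex 1 t / of_real L"
    have s1: "Re s > 1" using L by (simp add: s_def)
    have Res: "Re s = 1 + 1 / L" by (simp add: s_def)
    have "eventually (\<lambda>N. norm (zeta_series s) \<le> ?K * exp (\<Sum>p\<in>primes_below (real N). Re (npow p s)) \<and> real N \<ge> exp L) sequentially"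
      using zeta_series_vs_prime_sum[OF s1] filterlim_real_sequentially[unfolded filterlim_at_top, rule_format, of "exp L"]
      by eventually_elim auto
    then obtain N where N: "norm (zeta_series s) \<le> ?K * exp (\<Sum>p\<in>primes_below (real N). Re (npow p s))" "real N \<ge> exp L"
      by (auto dest!: eventually_happens)
    define S where "S = primes_below (real N) - primes_below (exp L)"
    have "(\<Sum>p\<in>primes_below (real N). Re (npow p s)) - (\<Sum>p\<in>primes_below (exp L). Re (npow p s)) = (\<Sum>p\<in>S. Re (npow p s))"
      unfolding S_def using primes_below_mono[OF N(2)] by (intro sum_diff[symmetric]) auto
    also have "\<dots> \<le> (\<Sum>p\<in>S. exp (- ln (real p) / L) / real p)"
    proof (intro sum_mono)
      fix p assume "p \<in> S"
      then have p: "prime p" "p > 0" by (auto simp: S_def dest: primes_belowD prime_gt_0_nat)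
      have "Re (npow p s) \<le> norm (npow p s)" by (rule complex_Re_le_cmod)
      then show "Re (npow p s) \<le> exp (- ln (real p) / L) / real p"
        using p powr_eq[OF p(1), of L] by (simp add: norm_npow Res)
    qed
    also have "\<dots> \<le> C0 * exp (- 1)"
      using L by (intro C0(2)) (auto simp: S_def primes_below_def)
    also have "\<dots> \<le> C0 * 1" using C0(1) by (intro mult_left_mono) auto
    finally have d: "(\<Sum>p\<in>primes_below (real N). Re (npow p s)) - (\<Sum>p\<in>primes_below (exp L). Re (npow p s)) \<le> C0" by simp
    have "exp (- (\<Sum>p\<in>primes_below (exp L). Re (npow p s))) * norm (zeta_series s) \<le>
        exp (- (\<Sum>p\<in>primes_below (exp L). Re (npow p s))) * (?K * exp (\<Sum>p\<in>primes_below (real N). Re (npow p s)))"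
      by (intro mult_left_mono N) auto
    also have "\<dots> = ?K * exp ((\<Sum>p\<in>primes_below (real N). Re (npow p s)) - (\<Sum>p\<in>primes_below (exp L). Re (npow p s)))"
      by (simp add: exp_diff exp_minus field_simps)
    also have "\<dots> \<le> ?K * exp C0" using d by simp
    finally show ?thesis by (simp add: s_def)
  qed
  have B: "1 \<le> ?K * (?K * 5) * L * norm (zeta_series (1 + Complex 1 t / of_real L))" if L: "L \<ge> 1" for L t
  proof -
    define s where "s = 1 + Complex 1 t / of_real L"
    define r :: complex where "r = of_real (1 + 1 / L)"
    have s1: "Re s > 1" "Re r > 1" using L by (simp_all add: s_def r_def)
    have "eventually (\<lambda>N. exp (\<Sum>p\<in>primes_below (real N). Re (npow p s)) \<le> ?K * norm (zeta_series s) \<and>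
        exp (\<Sum>p\<in>primes_below (real N). Re (npow p r)) \<le> ?K * norm (zeta_series r)) sequentially"
      using zeta_series_vs_prime_sum[OF s1(1)] zeta_series_vs_prime_sum[OF s1(2)] by eventually_elim auto
    then obtain N where N: "exp (\<Sum>p\<in>primes_below (real N). Re (npow p s)) \<le> ?K * norm (zeta_series s)"
        "exp (\<Sum>p\<in>primes_below (real N). Re (npow p r)) \<le> ?K * norm (zeta_series r)"
      by (auto dest!: eventually_happens)
    have "0 \<le> (\<Sum>p\<in>primes_below (real N). Re (npow p s) + Re (npow p r))"
    proof (rule sum_nonneg)
      fix p assume "p \<in> primes_below (real N)"
      then have p: "p > 0" by (auto dest: primes_belowD prime_gt_0_nat)
      have "Re (npow p s) + Re (npow p r) = real p powr (- (1 + 1 / L)) * (cos (t / L * ln (real p)) + 1)"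
        using p by (simp add: Re_npow s_def r_def algebra_simps)
      also have "\<dots> \<ge> 0"
        using cos_ge_minus_one[of "t / L * ln (real p)"] by (intro mult_nonneg_nonneg powr_ge_zero) linarith
      finally show "0 \<le> Re (npow p s) + Re (npow p r)" .
    qed
    then have "1 \<le> exp ((\<Sum>p\<in>primes_below (real N). Re (npow p s)) + (\<Sum>p\<in>primes_below (real N). Re (npow p r)))"
      by (simp add: sum.distrib)
    also have "\<dots> \<le> (?K * norm (zeta_series s)) * (?K * norm (zeta_series r))"
      unfolding exp_add by (intro mult_mono N) auto
    also have "\<dots> \<le> (?K * norm (zeta_series s)) * (?K * (5 * L))"
      using zeta_series_one_plus_le[OF L] by (intro mult_left_mono) (auto simp: r_def)
    finally show ?thesis by (simp add: s_def mult_ac)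
  qed
  have D: "(\<Sum>p\<in>primes_below (exp L). 1 / real p) \<le> ln L + (ln (?K * 5) + 1 + C1)" if L: "L \<ge> 1" for L
  proof -
    define r :: complex where "r = of_real (1 + 1 / L)"
    have s1: "Re r > 1" using L by (simp_all add: r_def)
    have "eventually (\<lambda>N. exp (\<Sum>p\<in>primes_below (real N). Re (npow p r)) \<le> ?K * norm (zeta_series r) \<and> real N \<ge> exp L) sequentially"
      using zeta_series_vs_prime_sum[OF s1] filterlim_real_sequentially[unfolded filterlim_at_top, rule_format, of "exp L"]
      by eventually_elim auto
    then obtain N where N: "exp (\<Sum>p\<in>primes_below (real N). Re (npow p r)) \<le> ?K * norm (zeta_series r)" "real N \<ge> exp L"
      by (auto dest!: eventually_happens)
    have "(\<Sum>p\<in>primes_below (exp L). Re (npow p r)) \<le> (\<Sum>p\<in>primes_below (real N). Re (npow p r))"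
      using primes_below_mono[OF N(2)]
      by (intro sum_mono2) (auto simp: r_def Re_npow dest!: primes_belowD(1) prime_gt_0_nat)
    also have "\<dots> = ln (exp \<dots>)" by simp
    also have "\<dots> \<le> ln (?K * (5 * L))"
      using zeta_series_one_plus_le[OF L] by (intro ln_mono order_trans[OF N(1)] mult_left_mono) (auto simp: r_def)
    also have "\<dots> = ln (?K * 5) + ln L" using L by (simp add: ln_mult)
    finally have 1: "(\<Sum>p\<in>primes_below (exp L). Re (npow p r)) \<le> ln (?K * 5) + ln L" .
    have "(\<Sum>p\<in>primes_below (exp L). 1 / real p) \<le> (\<Sum>p\<in>primes_below (exp L). Re (npow p r) + ln (real p) / real p / L)"
    proof (intro sum_mono)
      fix p assume "p \<in> primes_below (exp L)"
      then have p: "prime p" "p > 0" by (auto dest: primes_belowD prime_gt_0_nat)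
      \<comment> \<open>Trades 1/p for p^(-1-1/L) at the cost ln p / (p L), and Mertens' first
        theorem bounds the sum of these costs.\<close>
      have "1 - ln (real p) / L \<le> exp (- ln (real p) / L)" using exp_ge_add_one_self[of "- ln (real p) / L"] by simp
      then have "(1 - ln (real p) / L) / real p \<le> exp (- ln (real p) / L) / real p" by (intro divide_right_mono) auto
      also have "\<dots> = Re (npow p r)" using powr_eq[OF p(1), of L] p by (simp add: Re_npow r_def)
      finally show "1 / real p \<le> Re (npow p r) + ln (real p) / real p / L"
        by (simp add: diff_divide_distrib mult.commute)
    qed
    also have "\<dots> = (\<Sum>p\<in>primes_below (exp L). Re (npow p r)) + (\<Sum>p\<in>primes_below (exp L). ln (real p) / real p) / L"
      by (simp add: sum.distrib sum_divide_distrib)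
    also have "(\<Sum>p\<in>primes_below (exp L). ln (real p) / real p) / L \<le> (L + C1) / L"
      using C1(2)[of "exp L"] L by (intro divide_right_mono) auto
    also have "\<dots> \<le> 1 + C1" using L C1 by (simp add: field_simps mult_le_cancel_left1)
    finally show ?thesis using 1 by simp
  qed
  define C where "C = max (?K * exp C0) (max (?K * (?K * 5)) (ln (?K * 5) + 1 + C1))"
  show ?thesis
  proof (rule that[of C])
    show "C > 0" by (simp add: C_def less_max_iff_disj)
    show "exp (- (\<Sum>p\<in>primes_below (exp L). Re (npow p (1 + Complex 1 t / of_real L)))) *
        norm (zeta_series (1 + Complex 1 t / of_real L)) \<le> C" if "L \<ge> 1" for L t
      using A[OF that, of t] by (simp add: C_def)
    show "1 \<le> C * L * norm (zeta_series (1 + Complex 1 t / of_real L))" if "L \<ge> 1" for L t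
      using that by (intro order_trans[OF B[OF that, of t]] mult_right_mono) (auto simp: C_def)
    show "(\<Sum>p\<in>primes_below (exp L). 1 / real p) \<le> ln L + C" if "L \<ge> 1" for L
      using D[OF that] by (simp add: C_def)
  qed
qed

section \<open>Lower bounds for zeta up to height L\<close>

lemma exp_neg_diff_le: "x \<ge> 0 \<Longrightarrow> y \<ge> 0 \<Longrightarrow> \<bar>exp (- x) - exp (- y)\<bar> \<le> \<bar>x - y :: real\<bar>"
proof (induction x y rule: linorder_wlog)
  case (le x y)
  have "exp (- x) - exp (- y) = exp (- x) * (1 - exp (- (y - x)))" by (simp add: algebra_simps flip: exp_add)
  also have "\<dots> \<le> 1 * (y - x)"
  proof (rule mult_mono)
    show "1 - exp (- (y - x)) \<le> y - x" using exp_ge_add_one_self[of "- (y - x)"] by linarith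
  qed (use le in auto)
  finally show ?case using le by simp
qed (simp add: abs_minus_commute)

lemma npow_Complex_diff_le:
  assumes "n > 0" "x \<ge> 0" "y \<ge> 0"
  shows "norm (npow n (Complex (c + x) \<tau>) - npow n (Complex (c + y) \<tau>)) \<le> real n powr (- c) * (\<bar>x - y\<bar> * ln (real n))"
proof -
  have split: "npow n (Complex (c + w) \<tau>) = npow n (Complex c \<tau>) * of_real (exp (- (w * ln (real n))))" for w
    unfolding npow_def exp_of_real[symmetric] exp_add[symmetric]
    by (intro arg_cong[of _ _ exp]) (simp add: complex_eq_iff algebra_simps)
  have "norm (npow n (Complex (c + x) \<tau>) - npow n (Complex (c + y) \<tau>)) =
      real n powr (- c) * \<bar>exp (- (x * ln (real n))) - exp (- (y * ln (real n)))\<bar>"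
    unfolding split right_diff_distrib[symmetric] norm_mult
    using assms by (simp add: norm_npow norm_of_real flip: of_real_diff)
  also have "\<dots> \<le> real n powr (- c) * \<bar>x * ln (real n) - y * ln (real n)\<bar>"
    using assms by (intro mult_left_mono exp_neg_diff_le) auto
  also have "\<bar>x * ln (real n) - y * ln (real n)\<bar> = \<bar>x - y\<bar> * ln (real n)"
    using assms by (simp flip: left_diff_distrib add: abs_mult)
  finally show ?thesis .
qed

lemma harmonic_le: "(\<Sum>i<M. 1 / real (Suc i)) \<le> 1 + ln (real (Suc M))"
proof (induction M)
  case (Suc M)
  show ?case
  proof (cases "M = 0")
    case False
    have "(\<Sum>i<Suc M. 1 / real (Suc i)) = 1 + (\<Sum>i<M. 1 / real (Suc (Suc i)))"
      by (subst sum.lessThan_Suc_shift) simp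
    also have "(\<Sum>i<M. 1 / real (Suc (Suc i))) \<le> (\<Sum>i<M. ln (real (Suc (Suc i))) - ln (real (Suc i)))"
    proof (rule sum_mono)
      fix i
      have "ln (real (Suc i) / real (Suc (Suc i))) \<le> real (Suc i) / real (Suc (Suc i)) - 1"
        by (intro ln_le_minus_one) auto
      also have "\<dots> = - (1 / real (Suc (Suc i)))" by (simp add: field_simps)
      finally show "1 / real (Suc (Suc i)) \<le> ln (real (Suc (Suc i))) - ln (real (Suc i))"
        by (simp add: ln_div)
    qed
    also have "\<dots> = ln (real (Suc M))" by (subst sum_lessThan_telescope) simp
    also have "\<dots> \<le> ln (real (Suc (Suc M)))" by simp
    finally show ?thesis by simp
  qed auto
qed simp

text \<open>Heights up to 2L occur because the 3-4-1 inequality doubles the height. Keeping about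
  L^3 terms pushes the truncation error 2|s|/(M+1) down to order L^(-2), below every L^(-\<eta>)
  with \<eta> < 1, while the terms kept cost only powers of ln L.\<close>

context
  fixes L :: real and M :: nat
  assumes L: "L \<ge> 16"
  defines "M \<equiv> nat \<lceil>L ^ 3\<rceil>"
begin

lemma M_bounds: "real (Suc M) \<ge> L ^ 3" "real (Suc M) \<le> L ^ 3 + 2"
proof -
  have "L ^ 3 \<ge> 0" using L by simp
  then show "real (Suc M) \<ge> L ^ 3" "real (Suc M) \<le> L ^ 3 + 2" unfolding M_def by linarith+
qed

lemma zeta_series_err_le:
  assumes "0 < \<delta>" "\<delta> \<le> 1" "\<bar>\<tau>\<bar> \<le> 2 * L"
  shows "2 * norm (Complex (1 + \<delta>) \<tau>) / real (Suc M) \<le> 5 * L / L ^ 3"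
proof -
  have "norm (Complex (1 + \<delta>) \<tau>) \<le> (1 + \<delta>) + 2 * L"
    using cmod_le[of "Complex (1 + \<delta>) \<tau>"] assms by simp
  then have "2 * norm (Complex (1 + \<delta>) \<tau>) \<le> 5 * L" using assms L by simp
  then show ?thesis using L M_bounds by (intro frac_le) auto
qed

text \<open>The terms kept are at most a harmonic sum, 1 plus a logarithm, and the polar term is at
  most 1/|s - 1| <= 16 because the height is at least 1/16; this makes up the constant 17.\<close>

lemma zeta_series_upper:
  assumes "0 < \<delta>" "\<delta> \<le> 1" "1/16 \<le> \<bar>\<tau>\<bar>" "\<bar>\<tau>\<bar> \<le> 2 * L"
  shows "norm (zeta_series (Complex (1 + \<delta>) \<tau>)) \<le> 17 + ln (L ^ 3 + 2) + 5 * L / L ^ 3"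
proof -
  let ?s = "Complex (1 + \<delta>) \<tau>"
  have s: "Re ?s > 1" using assms by simp
  have a: "norm (zeta_series ?s - (\<Sum>i<M. npow (Suc i) ?s) - npow (Suc M) (?s - 1) / (?s - 1)) \<le> 5 * L / L ^ 3"
    using zeta_series_approx[OF s, of M] zeta_series_err_le[of \<delta> \<tau>] assms by linarith
  have "norm (\<Sum>i<M. npow (Suc i) ?s) \<le> (\<Sum>i<M. 1 / real (Suc i))"
  proof (rule sum_norm_le)
    fix i
    have "norm (npow (Suc i) ?s) = real (Suc i) powr (- (1 + \<delta>))" by (simp add: norm_npow)
    also have "\<dots> \<le> real (Suc i) powr (- 1)" using assms by (intro powr_mono) auto
    finally show "norm (npow (Suc i) ?s) \<le> 1 / real (Suc i)" by (simp add: powr_minus_divide)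
  qed
  also have "\<dots> \<le> 1 + ln (L ^ 3 + 2)"
    using harmonic_le[of M] ln_mono[OF M_bounds(2)] by simp
  finally have b: "norm (\<Sum>i<M. npow (Suc i) ?s) \<le> 1 + ln (L ^ 3 + 2)" .
  have "norm (npow (Suc M) (?s - 1)) \<le> 1"
    using assms powr_mono[of _ 0 "real (Suc M)"] by (simp add: norm_npow)
  moreover have "\<bar>\<tau>\<bar> \<le> norm (?s - 1)" using abs_Im_le_cmod[of "?s - 1"] by simp
  ultimately have "norm (npow (Suc M) (?s - 1) / (?s - 1)) \<le> 1 / (1/16)"
    unfolding norm_divide using assms by (intro frac_le) auto
  then have c: "norm (npow (Suc M) (?s - 1) / (?s - 1)) \<le> 16" by simp
  show ?thesis using a b c
    norm_triangle_ineq[of "zeta_series ?s - (\<Sum>i<M. npow (Suc i) ?s) - npow (Suc M) (?s - 1) / (?s - 1)" "(\<Sum>i<M. npow (Suc i) ?s) + npow (Suc M) (?s - 1) / (?s - 1)"]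
    norm_triangle_ineq[of "(\<Sum>i<M. npow (Suc i) ?s)" "npow (Suc M) (?s - 1) / (?s - 1)"]
    by (simp add: algebra_simps)
qed

text \<open>Moves the abscissa at fixed height. A kept term 1/n^s changes by at most \<delta>0
  ln(M+1) / n; the polar term changes in its numerator and in its denominator, where 16 and 256
  bound 1/|s - 1| and the product of two such factors; the two truncation errors give 10 L /
  L^3.\<close>

lemma zeta_series_diff:
  assumes "0 < \<delta>" "\<delta> \<le> \<delta>0" "\<delta>0 \<le> 1" "1/16 \<le> \<bar>\<tau>\<bar>" "\<bar>\<tau>\<bar> \<le> 2 * L"
  shows "norm (zeta_series (Complex (1 + \<delta>) \<tau>) - zeta_series (Complex (1 + \<delta>0) \<tau>))
     \<le> \<delta>0 * (ln (L ^ 3 + 2) * (1 + ln (L ^ 3 + 2)) + 16 * ln (L ^ 3 + 2) + 256) + 10 * L / L ^ 3"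
proof -
  let ?s = "Complex (1 + \<delta>) \<tau>" and ?r = "Complex (1 + \<delta>0) \<tau>"
  define l where "l = ln (real (Suc M))"
  have l: "0 \<le> l" "l \<le> ln (L ^ 3 + 2)" using ln_mono[OF M_bounds(2)] by (auto simp: l_def)
  have s: "Re ?s > 1" "Re ?r > 1" using assms by auto
  define A where "A = (\<lambda>s. \<Sum>i<M. npow (Suc i) s)"
  define B where "B = (\<lambda>s. npow (Suc M) (s - 1) / (s - 1))"
  have a1: "norm (zeta_series ?s - A ?s - B ?s) \<le> 5 * L / L ^ 3"
    unfolding A_def B_def using zeta_series_approx[OF s(1), of M] zeta_series_err_le[of \<delta> \<tau>] assms by linarith
  have a2: "norm (zeta_series ?r - A ?r - B ?r) \<le> 5 * L / L ^ 3"
    unfolding A_def B_def using zeta_series_approx[OF s(2), of M] zeta_series_err_le[of \<delta>0 \<tau>] assms by linarith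
  have "norm (A ?s - A ?r) \<le> (\<Sum>i<M. 1 / real (Suc i) * (\<delta>0 * l))"
    unfolding A_def sum_subtractf[symmetric]
  proof (rule sum_norm_le)
    fix i assume i: "i \<in> {..<M}"
    have "norm (npow (Suc i) ?s - npow (Suc i) ?r) \<le> real (Suc i) powr (- 1) * (\<bar>\<delta> - \<delta>0\<bar> * ln (real (Suc i)))"
      using assms by (intro npow_Complex_diff_le) auto
    also have "\<dots> \<le> real (Suc i) powr (- 1) * (\<delta>0 * l)"
      using assms i l by (intro mult_left_mono mult_mono) (auto simp: l_def)
    finally show "norm (npow (Suc i) ?s - npow (Suc i) ?r) \<le> 1 / real (Suc i) * (\<delta>0 * l)"
      by (simp add: powr_minus_divide)
  qed
  also have "\<dots> = (\<Sum>i<M. 1 / real (Suc i)) * (\<delta>0 * l)" by (simp add: sum_distrib_right)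
  also have "\<dots> \<le> (1 + l) * (\<delta>0 * l)"
    using harmonic_le[of M] l assms by (intro mult_right_mono) (auto simp: l_def)
  also have "\<dots> \<le> (1 + ln (L ^ 3 + 2)) * (\<delta>0 * ln (L ^ 3 + 2))"
    using l assms by (intro mult_mono) auto
  finally have b: "norm (A ?s - A ?r) \<le> \<delta>0 * (ln (L ^ 3 + 2) * (1 + ln (L ^ 3 + 2)))" by (simp add: mult_ac)
  have sr: "?s - 1 = Complex (0 + \<delta>) \<tau>" "?r - 1 = Complex (0 + \<delta>0) \<tau>" by (auto simp: complex_eq_iff)
  have nz: "?s - 1 \<noteq> 0" "?r - 1 \<noteq> 0" using assms by (auto simp: complex_eq_iff)
  have ns: "norm (?s - 1) \<ge> 1/16" "norm (?r - 1) \<ge> 1/16"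
    using abs_Im_le_cmod[of "?s - 1"] abs_Im_le_cmod[of "?r - 1"] assms by auto
  have d1: "norm (npow (Suc M) (?s - 1) - npow (Suc M) (?r - 1)) \<le> \<delta>0 * ln (L ^ 3 + 2)"
  proof -
    have "norm (npow (Suc M) (?s - 1) - npow (Suc M) (?r - 1)) \<le> real (Suc M) powr (- 0) * (\<bar>\<delta> - \<delta>0\<bar> * ln (real (Suc M)))"
      unfolding sr using assms by (intro npow_Complex_diff_le) auto
    also have "\<dots> = \<bar>\<delta> - \<delta>0\<bar> * l" by (simp add: l_def)
    also have "\<dots> \<le> \<delta>0 * ln (L ^ 3 + 2)" using assms l by (intro mult_mono) auto
    finally show ?thesis .
  qed
  have d2: "norm (npow (Suc M) (?r - 1)) \<le> 1"
    using assms powr_mono[of _ 0 "real (Suc M)"] by (simp add: norm_npow)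
  have "B ?s - B ?r = (npow (Suc M) (?s - 1) - npow (Suc M) (?r - 1)) / (?s - 1) + npow (Suc M) (?r - 1) * ((?r - ?s) / ((?s - 1) * (?r - 1)))"
  proof -
    have "x / c - y / d = (x - y) / c + y * ((d - c) / (c * d))" if "c \<noteq> 0" "d \<noteq> 0" for x y c d :: complex
      using that by (simp add: field_simps)
    from this[OF nz, of "npow (Suc M) (?s - 1)" "npow (Suc M) (?r - 1)"] show ?thesis
      unfolding B_def by simp
  qed
  also have "norm \<dots> \<le> \<delta>0 * ln (L ^ 3 + 2) / (1/16) + 1 * (\<delta>0 / (1/16 * (1/16)))"
  proof (intro norm_triangle_le add_mono)
    show "norm ((npow (Suc M) (?s - 1) - npow (Suc M) (?r - 1)) / (?s - 1)) \<le> \<delta>0 * ln (L ^ 3 + 2) / (1/16)"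
      unfolding norm_divide using d1 ns by (intro frac_le) (auto intro: order_trans[OF norm_ge_zero])
    have "?r - ?s = of_real (\<delta>0 - \<delta>)" by (simp add: complex_eq_iff)
    then have "norm (?r - ?s) \<le> \<delta>0" using assms by (simp add: norm_of_real del: of_real_diff)
    then have "norm ((?r - ?s) / ((?s - 1) * (?r - 1))) \<le> \<delta>0 / (1/16 * (1/16))"
      unfolding norm_divide norm_mult using ns assms by (intro frac_le mult_mono) auto
    then show "norm (npow (Suc M) (?r - 1) * ((?r - ?s) / ((?s - 1) * (?r - 1)))) \<le> 1 * (\<delta>0 / (1/16 * (1/16)))"
      unfolding norm_mult using d2 by (intro mult_mono) auto
  qed
  finally have c: "norm (B ?s - B ?r) \<le> 16 * (\<delta>0 * ln (L ^ 3 + 2)) + 256 * \<delta>0" by simp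
  have "zeta_series ?s - zeta_series ?r = (zeta_series ?s - A ?s - B ?s) - (zeta_series ?r - A ?r - B ?r) + (A ?s - A ?r) + (B ?s - B ?r)" by simp
  also have "norm \<dots> \<le> norm (zeta_series ?s - A ?s - B ?s) + norm (zeta_series ?r - A ?r - B ?r) + norm (A ?s - A ?r) + norm (B ?s - B ?r)"
    by norm
  finally have "norm (zeta_series ?s - zeta_series ?r) \<le> norm (zeta_series ?s - A ?s - B ?s) + norm (zeta_series ?r - A ?r - B ?r) + norm (A ?s - A ?r) + norm (B ?s - B ?r)" .
  moreover have "10 * L / L ^ 3 = 5 * L / L ^ 3 + 5 * L / L ^ 3" by simp
  moreover have "\<delta>0 * (X + 16 * Y + 256) = \<delta>0 * X + 16 * (\<delta>0 * Y) + 256 * \<delta>0" for X Y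
    by (simp add: algebra_simps)
  ultimately show ?thesis using a1 a2 b c by simp
qed

end

text \<open>A quantitative form of the classical proof of nonvanishing. Moving right by \<delta>0 =
  L^(-\<eta>) sets the cubed pole, L^(3\<eta>), against the fourth power of a supposedly small
  value, L^(-4\<eta>) up to powers of ln L. The net factor L^(-\<eta>) beats all logarithms and
  contradicts the 3-4-1 inequality.\<close>

lemma zeta_series_lower_mid:
  assumes "0 < \<eta>" "\<eta> < 1"
  shows "eventually (\<lambda>L. \<forall>\<tau>. 1/16 \<le> \<bar>\<tau>\<bar> \<and> \<bar>\<tau>\<bar> \<le> L \<longrightarrow> norm (zeta_series (Complex (1 + 1 / L) \<tau>)) \<ge> L powr (- \<eta>)) at_top"
proof -
  let ?U = "\<lambda>L::real. 17 + ln (L ^ 3 + 2) + 5 * L / L ^ 3"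
  let ?D = "\<lambda>L::real. L powr (-\<eta>) * (ln (L ^ 3 + 2) * (1 + ln (L ^ 3 + 2)) + 16 * ln (L ^ 3 + 2) + 256) + 10 * L / L ^ 3"
  \<comment> \<open>The factor 125 = 5^3 comes from the cube of zeta(1 + \<delta>0) <= 5/\<delta>0,
    the other one from \<open>three_four_one\<close>.\<close>
  let ?K = "(2 * exp 4) ^ 8 * 125 :: real"
  have "eventually (\<lambda>L. (L powr (- \<eta>)) ^ 3 > ?K * ?U L * (?D L + L powr (- \<eta>)) ^ 4) at_top"
    using assms by real_asymp
  moreover have "eventually (\<lambda>L. 1 / L \<le> L powr (- \<eta>)) at_top" using assms by real_asymp
  ultimately show ?thesis using eventually_ge_at_top[of 16]
  proof eventually_elim
    case (elim L)
    show ?case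
    proof (intro allI impI)
      fix \<tau> assume \<tau>: "1/16 \<le> \<bar>\<tau>\<bar> \<and> \<bar>\<tau>\<bar> \<le> L"
      define \<delta>0 where "\<delta>0 = L powr (- \<eta>)"
      have \<delta>0: "0 < \<delta>0" "\<delta>0 \<le> 1" "1 / L \<le> \<delta>0"
        using elim assms powr_mono[of "- \<eta>" 0 L] by (auto simp: \<delta>0_def)
      let ?s = "Complex (1 + 1 / L) \<tau>" and ?r = "Complex (1 + \<delta>0) \<tau>" and ?q = "Complex (1 + \<delta>0) (2 * \<tau>)"
      have d: "norm (zeta_series ?s - zeta_series ?r) \<le> ?D L"
        using zeta_series_diff[of L "1/L" \<delta>0 \<tau>] \<tau> \<delta>0 elim by (simp add: \<delta>0_def)
      have up: "norm (zeta_series ?q) \<le> ?U L"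
        using zeta_series_upper[of L \<delta>0 "2 * \<tau>"] \<tau> \<delta>0 elim by auto
      have pole: "norm (zeta_series (of_real (1 + \<delta>0))) \<le> 5 * (1 / \<delta>0)"
        using zeta_series_one_plus_le[of "1 / \<delta>0"] \<delta>0 by (simp add: field_simps)
      have Upos: "?U L \<ge> 0" using elim by (intro add_nonneg_nonneg) (auto intro!: ln_ge_zero add_increasing)
      show "norm (zeta_series ?s) \<ge> L powr (- \<eta>)"
      proof (rule ccontr)
        assume "\<not> norm (zeta_series ?s) \<ge> L powr (- \<eta>)"
        then have "norm (zeta_series ?r) \<le> ?D L + L powr (- \<eta>)"
          using d norm_triangle_ineq2[of "zeta_series ?r" "zeta_series ?s"] by (simp add: norm_minus_commute)
        then have r4: "norm (zeta_series ?r) ^ 4 \<le> (?D L + L powr (- \<eta>)) ^ 4" by (intro power_mono) auto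
        have "1 \<le> (2 * exp 4) ^ 8 * (norm (zeta_series (of_real (1 + \<delta>0))) ^ 3 * norm (zeta_series ?r) ^ 4 * norm (zeta_series ?q))"
          using \<delta>0 by (intro three_four_one) auto
        also have "\<dots> \<le> (2 * exp 4) ^ 8 * ((5 * (1 / \<delta>0)) ^ 3 * (?D L + L powr (- \<eta>)) ^ 4 * ?U L)"
          using power_mono[OF pole, of 3] r4 up \<delta>0(1)
          by (intro mult_left_mono mult_mono mult_nonneg_nonneg) auto
        also have "\<dots> = ?K * ?U L * (?D L + L powr (- \<eta>)) ^ 4 / \<delta>0 ^ 3"
          by (simp add: power_divide field_simps)
        also have "\<dots> < \<delta>0 ^ 3 / \<delta>0 ^ 3"
          using elim(1) \<delta>0 by (intro divide_strict_right_mono) (auto simp: \<delta>0_def)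
        finally show False using \<delta>0 by simp
      qed
    qed
  qed
qed

text \<open>Three ranges of |a| with a = 1 + it. Up to L/8 the pole, of size L/|a|, dominates.
  Between L/8 and L^2 the intermediate bound L^(-\<eta>) applies and (8|a|)^(1+\<eta>) >=
  L^(1+\<eta>) makes up for it. Beyond L^2 the crude bound 1 <= C1 L |zeta| suffices.\<close>

lemma zeta_series_lower:
  assumes "0 < \<eta>" "\<eta> < 1"
  obtains C L0 where "C > 0" "L0 \<ge> 1"
    "\<And>L t. L \<ge> L0 \<Longrightarrow> L \<le> C * norm (Complex 1 t) powr (1 + \<eta>) * norm (zeta_series (1 + Complex 1 t / of_real L))"
proof -
  obtain C1 where C1: "C1 > 0" "\<And>L t. L \<ge> 1 \<Longrightarrow> 1 \<le> C1 * L * norm (zeta_series (1 + Complex 1 t / of_real L))"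
    using prime_sum_cutoff by metis
  obtain L1 where L1: "\<And>L \<tau>. L \<ge> L1 \<Longrightarrow> 1/16 \<le> \<bar>\<tau>\<bar> \<Longrightarrow> \<bar>\<tau>\<bar> \<le> L \<Longrightarrow> norm (zeta_series (Complex (1 + 1 / L) \<tau>)) \<ge> L powr (- \<eta>)"
    using zeta_series_lower_mid[OF assms] unfolding eventually_at_top_linorder by blast
  define C where "C = max 2 (max (8 powr (1 + \<eta>)) C1)"
  have C: "C \<ge> 2" "C \<ge> 8 powr (1 + \<eta>)" "C \<ge> C1" by (auto simp: C_def)
  have "L \<le> C * norm (Complex 1 t) powr (1 + \<eta>) * norm (zeta_series (1 + Complex 1 t / of_real L))"
    if L: "L \<ge> max 16 L1" for L t
  proof -
    define a where "a = norm (Complex 1 t)"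
    define s where "s = 1 + Complex 1 t / of_real L"
    have a1: "a \<ge> 1" using abs_Re_le_cmod[of "Complex 1 t"] by (simp add: a_def)
    have ap: "a \<le> a powr (1 + \<eta>)" using powr_mono[of 1 "1 + \<eta>" a] a1 assms by simp
    have s: "Re s > 1" "norm (s - 1) = a / L" "s - 1 \<noteq> 0"
      using L a1 by (auto simp: s_def a_def norm_divide complex_eq_iff)
    consider "a \<le> L / 8" | "L / 8 \<le> a" "a \<le> L ^ 2" | "L ^ 2 \<le> a" by linarith
    then have "L \<le> C * a powr (1 + \<eta>) * norm (zeta_series s)"
    proof cases
      case 1
      have "norm (zeta_series s - 1 / (s - 1)) \<le> 2 * norm s" by (rule zeta_series_near_pole[OF s(1)])
      moreover have "norm s \<le> 1 + 1/8"
      proof -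
        have "a / L \<le> 1/8" using 1 L by (simp add: field_simps)
        moreover have "norm s \<le> 1 + a / L" using norm_triangle_ineq[of 1 "s - 1"] s(2) by simp
        ultimately show ?thesis by linarith
      qed
      moreover have "norm (1 / (s - 1)) = L / a" using s L by (simp add: norm_divide)
      moreover have "L / a \<ge> 8" using 1 a1 by (simp add: field_simps)
      ultimately have "norm (zeta_series s) \<ge> L / a / 2"
        using norm_triangle_ineq2[of "1 / (s - 1)" "1 / (s - 1) - zeta_series s"] by (simp add: norm_minus_commute)
      then have "2 * a * norm (zeta_series s) \<ge> L" using a1 by (simp add: field_simps)
      also have "2 * a * norm (zeta_series s) \<le> C * a powr (1 + \<eta>) * norm (zeta_series s)"
        using C ap a1 by (intro mult_right_mono mult_mono) auto
      finally show ?thesis .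
    next
      case 2
      \<comment> \<open>The thresholds 8 and 16 fit together here: a height below 1/16 would give a
        < 1 + L/16 <= L/8 once L >= 16.\<close>
      have "1/16 \<le> \<bar>t / L\<bar>"
      proof (rule ccontr)
        assume "\<not> 1/16 \<le> \<bar>t / L\<bar>"
        then have "\<bar>t\<bar> < L / 16" using L by (simp add: abs_divide field_simps)
        then have "a < 1 + L / 16" using cmod_le[of "Complex 1 t"] by (simp add: a_def)
        then show False using 2 L by simp
      qed
      moreover have "\<bar>t / L\<bar> \<le> L"
      proof -
        have "\<bar>t\<bar> \<le> a" using abs_Im_le_cmod[of "Complex 1 t"] by (simp add: a_def)
        then show ?thesis using 2 L by (simp add: abs_divide field_simps power2_eq_square)
      qed
      ultimately have "norm (zeta_series (Complex (1 + 1 / L) (t / L))) \<ge> L powr (- \<eta>)" using L by (intro L1) auto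
      moreover have "s = Complex (1 + 1 / L) (t / L)" by (simp add: complex_eq_iff s_def)
      ultimately have z: "norm (zeta_series s) \<ge> L powr (- \<eta>)" by simp
      have "L = L powr (1 + \<eta>) * L powr (- \<eta>)" using L by (simp flip: powr_add)
      also have "\<dots> \<le> (8 * a) powr (1 + \<eta>) * norm (zeta_series s)"
        using 2 L assms z by (intro mult_mono powr_mono2) auto
      also have "\<dots> = 8 powr (1 + \<eta>) * a powr (1 + \<eta>) * norm (zeta_series s)" using a1 by (simp add: powr_mult)
      also have "\<dots> \<le> C * a powr (1 + \<eta>) * norm (zeta_series s)" using C by (intro mult_right_mono) auto
      finally show ?thesis .
    next
      case 3
      have "L * 1 \<le> L * (C1 * L * norm (zeta_series s))" using C1(2)[of L t] L by (intro mult_left_mono) (auto simp: s_def)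
      also have "\<dots> = C1 * L ^ 2 * norm (zeta_series s)" by (simp add: power2_eq_square)
      also have "\<dots> \<le> C * a powr (1 + \<eta>) * norm (zeta_series s)"
        using C C1 3 ap L by (intro mult_right_mono mult_mono) auto
      finally show ?thesis by simp
    qed
    then show ?thesis by (simp add: a_def s_def)
  qed
  then show ?thesis using C by (intro that[of C "max 16 L1"]) auto
qed

section \<open>Laplace transforms of the delay functions\<close>

text \<open>The value at 0 is the continuous extension, so the integrand of \<open>Ein\<close>, the
  entire exponential integral, is continuous.\<close>

definition ein_ker :: "complex \<Rightarrow> real \<Rightarrow> complex" where
  "ein_ker s x = (if x = 0 then s else (1 - exp (- s * of_real x)) / of_real x)"

definition Ein :: "complex \<Rightarrow> complex" where "Ein s = integral {0..1} (ein_ker s)"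

lemma continuous_ein_ker: "continuous_on A (ein_ker s)"
proof (rule continuous_at_imp_continuous_on, rule ballI)
  fix x :: real
  show "isCont (ein_ker s) x"
  proof (cases "x = 0")
    case True
    have "((\<lambda>z. 1 - exp (- s * z)) has_field_derivative s) (at 0)"
      by (auto intro!: derivative_eq_intros)
    then have lim: "((\<lambda>h. (1 - exp (- s * h)) / h) \<longlongrightarrow> s) (at 0)" by (simp add: DERIV_def)
    have "filterlim complex_of_real (at 0) (at 0)"
      by (intro filterlim_atI tendsto_eq_intros) (auto simp: eventually_at_filter)
    then have "((\<lambda>x. (1 - exp (- s * of_real x)) / complex_of_real x) \<longlongrightarrow> s) (at 0)"
      using lim by (rule filterlim_compose[rotated])
    then have "(ein_ker s \<longlongrightarrow> s) (at 0)"
      by (rule Lim_transform_eventually) (auto simp: ein_ker_def eventually_at_filter)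
    then show ?thesis using True by (simp add: isCont_def ein_ker_def)
  next
    case False
    have "isCont (\<lambda>x. (1 - exp (- s * of_real x)) / complex_of_real x) x"
      using False by (intro continuous_intros) auto
    moreover have "eventually (\<lambda>y. ein_ker s y = (1 - exp (- s * of_real y)) / complex_of_real y) (nhds x)"
      using t1_space_nhds[OF False] by eventually_elim (auto simp: ein_ker_def)
    ultimately show ?thesis by (subst isCont_cong)
  qed
qed

lemma Ein_has_field_derivative:
  assumes "s \<noteq> 0"
  shows "(Ein has_field_derivative (1 - exp (- s)) / s) (at s)"
proof -
  have "((\<lambda>s. integral (cbox 0 1) (ein_ker s)) has_field_derivative integral (cbox 0 1) (\<lambda>x. exp (- s * of_real x))) (at s within UNIV)"
  proof (rule leibniz_rule_field_derivative)
    fix s :: complex and x :: real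
    show "((\<lambda>s. ein_ker s x) has_field_derivative exp (- s * of_real x)) (at s within UNIV)"
      by (cases "x = 0") (auto simp: ein_ker_def intro!: derivative_eq_intros)
    show "ein_ker s integrable_on cbox 0 1"
      by (intro integrable_continuous continuous_ein_ker)
  qed (auto simp: case_prod_unfold intro!: continuous_intros)
  moreover have "((\<lambda>x. exp (- s * of_real x)) has_integral (- exp (- s * of_real 1) / s - (- exp (- s * of_real 0) / s))) {0..1}"
  proof (rule fundamental_theorem_of_calculus)
    fix x :: real
    have "((\<lambda>z. - exp (- s * z) / s) has_field_derivative exp (- s * of_real x)) (at (of_real x))"
      using assms by (auto intro!: derivative_eq_intros)
    then show "((\<lambda>x. - exp (- s * of_real x) / s) has_vector_derivative exp (- s * of_real x)) (at x within {0..1})"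
      using has_vector_derivative_real_field has_vector_derivative_at_within by blast
  qed simp
  then have "integral {0..1} (\<lambda>x. exp (- s * of_real x)) = (1 - exp (- s)) / s"
    by (simp add: integral_unique diff_divide_distrib)
  ultimately show ?thesis by (simp add: Ein_def[abs_def])
qed

definition ein_real :: "real \<Rightarrow> real" where
  "ein_real T = integral {0..1} (\<lambda>x. if x = 0 then T else (1 - exp (- T * x)) / x)"

lemma Ein_of_real: "Ein (of_real T) = of_real (ein_real T)"
proof -
  have ker: "ein_ker (of_real T) x = of_real (if x = 0 then T else (1 - exp (- T * x)) / x)" for x
    by (simp add: ein_ker_def exp_of_real flip: of_real_mult of_real_minus)
  have "(\<lambda>x. Re (ein_ker (of_real T) x)) integrable_on {0..1}"
    by (intro integrable_continuous_interval continuous_intros continuous_ein_ker)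
  then have "(\<lambda>x. if x = 0 then T else (1 - exp (- T * x)) / x) integrable_on {0..1}"
    unfolding ker Re_complex_of_real .
  then have "integral {0..1} (complex_of_real \<circ> (\<lambda>x. if x = 0 then T else (1 - exp (- T * x)) / x)) = of_real (ein_real T)"
    unfolding ein_real_def by (intro integral_linear bounded_linear_of_real)
  moreover have "ein_ker (of_real T) = complex_of_real \<circ> (\<lambda>x. if x = 0 then T else (1 - exp (- T * x)) / x)"
    by (rule ext) (simp only: ker o_def)
  ultimately show ?thesis by (simp only: Ein_def)
qed

lemma ein_real_has_derivative:
  assumes "T > 0" shows "(ein_real has_real_derivative (1 - exp (- T)) / T) (at T)"
proof -
  have "((\<lambda>T. Ein (of_real T)) has_vector_derivative (1 - exp (- of_real T)) / of_real T) (at T)"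
    using Ein_has_field_derivative[of "of_real T"] assms by (intro has_vector_derivative_real_field) auto
  from bounded_linear.has_vector_derivative[OF bounded_linear_Re this]
  have "(ein_real has_vector_derivative Re ((1 - exp (- of_real T)) / of_real T)) (at T)"
    unfolding Ein_of_real by simp
  also have "(1 - exp (- of_real T)) / of_real T = complex_of_real ((1 - exp (- T)) / T)"
    by (simp add: exp_of_real flip: of_real_minus)
  finally show ?thesis by (simp add: has_real_derivative_iff_has_vector_derivative)
qed

text \<open>The derivative is -exp(-T)/T, so the function decreases; after subtraction of exp(-T) it
  increases on T >= 1. Hence it is decreasing and bounded below.\<close>

lemma ein_real_minus_ln_converges: "\<exists>c. ((\<lambda>T. ein_real T - ln T) \<longlongrightarrow> c) at_top"
proof -
  define h where "h = (\<lambda>T. ein_real T - ln T)"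
  have d: "(h has_real_derivative - exp (- T) / T) (at T)" if "T > 0" for T
    unfolding h_def using that by (auto intro!: derivative_eq_intros ein_real_has_derivative simp: field_simps)
  have dec: "h y \<le> h x" if "1 \<le> x" "x \<le> y" for x y
  proof (rule DERIV_nonpos_imp_nonincreasing[of x y h])
    fix w assume w: "x \<le> w" "w \<le> y"
    have "- exp (- w) / w \<le> 0" using w that by simp
    then show "\<exists>z. (h has_real_derivative z) (at w) \<and> z \<le> 0" using d[of w] w that by force
  qed (use that in auto)
  have inc: "h x - exp (- x) \<le> h y - exp (- y)" if "1 \<le> x" "x \<le> y" for x y
  proof (rule DERIV_nonneg_imp_nondecreasing[of x y "\<lambda>x. h x - exp (- x)"])
    fix w assume w: "x \<le> w" "w \<le> y"
    have "((\<lambda>x. h x - exp (- x)) has_real_derivative (- exp (- w) / w + exp (- w))) (at w)"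
      using w that by (auto intro!: derivative_eq_intros d)
    moreover have "- exp (- w) / w + exp (- w) \<ge> 0" using w that by (simp add: field_simps)
    ultimately show "\<exists>z. ((\<lambda>x. h x - exp (- x)) has_real_derivative z) (at w) \<and> 0 \<le> z" by blast
  qed (use that in auto)
  have low: "h 1 - exp (- 1) \<le> h T" if "T \<ge> 1" for T
    using inc[of 1 T] that exp_gt_zero[of "- T"] by linarith
  have "Inf (h ` {1..}) \<le> h T" if "T \<ge> 1" for T
    using that low by (intro cInf_lower bdd_belowI[of _ "h 1 - exp (-1)"]) auto
  have "(h \<longlongrightarrow> Inf (h ` {1..})) at_top"
  proof (rule decreasing_tendsto)
    show "eventually (\<lambda>T. Inf (h ` {1..}) \<le> h T) at_top"
      using eventually_ge_at_top[of 1] by eventually_elim fact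
    fix x assume "Inf (h ` {1..}) < x"
    then obtain T where T: "T \<ge> 1" "h T < x"
      using cInf_lessD[of "h ` {1..}" x] by auto
    show "eventually (\<lambda>T. h T < x) at_top"
      using eventually_ge_at_top[of T] by eventually_elim (use T dec in fastforce)
  qed
  then show ?thesis unfolding h_def by blast
qed

text \<open>Euler's constant, known here only through the limit.\<close>

definition ein_const :: real where "ein_const = (SOME c. ((\<lambda>T. ein_real T - ln T) \<longlongrightarrow> c) at_top)"

lemma ein_const: "((\<lambda>T. ein_real T - ln T) \<longlongrightarrow> ein_const) at_top"
  unfolding ein_const_def by (rule someI_ex[OF ein_real_minus_ln_converges])

text \<open>The originals to be transformed: support on the positive half line turns an integral
  over the whole line into a Laplace transform, and polynomial growth makes it converge for every
  \<open>Re a > 0\<close>.\<close>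

definition poly_bounded :: "(real \<Rightarrow> real) \<Rightarrow> bool" where
  "poly_bounded \<psi> \<longleftrightarrow> \<psi> \<in> borel_measurable borel \<and> (\<forall>x\<le>0. \<psi> x = 0) \<and>
     (\<exists>C q. C \<ge> 0 \<and> (\<forall>x>0. \<bar>\<psi> x\<bar> \<le> C * (1 + x) ^ q))"

text \<open>One term of the exponential series, (\<epsilon> (1 + x))^q / q! <= exp(\<epsilon> (1 +
  x)), turns polynomial growth into an exponential rate as small as desired.\<close>

lemma poly_bounded_exp_bound:
  assumes "poly_bounded \<psi>" "\<epsilon> > 0"
  obtains C where "C \<ge> 0" "\<And>x. \<bar>\<psi> x\<bar> \<le> C * exp (\<epsilon> * x) * indicator {0..} x"
proof -
  obtain C q where C: "C \<ge> 0" "\<And>x. x > 0 \<Longrightarrow> \<bar>\<psi> x\<bar> \<le> C * (1 + x) ^ q" and z: "\<And>x. x \<le> 0 \<Longrightarrow> \<psi> x = 0"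
    using assms by (auto simp: poly_bounded_def)
  define K where "K = C * (fact q / \<epsilon> ^ q * exp \<epsilon>)"
  have "\<bar>\<psi> x\<bar> \<le> K * exp (\<epsilon> * x) * indicator {0..} x" for x
  proof (cases "x > 0")
    case True
    have "(\<epsilon> * (1 + x)) ^ q / fact q \<le> exp (\<epsilon> * (1 + x))"
    proof -
      have "(\<Sum>i\<in>{q}. (\<epsilon> * (1 + x)) ^ i /\<^sub>R fact i) \<le> (\<Sum>i. (\<epsilon> * (1 + x)) ^ i /\<^sub>R fact i)"
        using True assms by (intro sum_le_suminf summable_exp_generic) auto
      then show ?thesis by (simp add: exp_def divide_inverse mult.commute)
    qed
    moreover have "exp (\<epsilon> * (1 + x)) = exp \<epsilon> * exp (\<epsilon> * x)" by (simp add: distrib_left exp_add)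
    ultimately have "\<epsilon> ^ q * (1 + x) ^ q / fact q \<le> exp \<epsilon> * exp (\<epsilon> * x)" by (simp only: power_mult_distrib)
    then have "(1 + x) ^ q \<le> fact q / \<epsilon> ^ q * exp \<epsilon> * exp (\<epsilon> * x)"
      using assms by (simp add: divide_le_eq le_divide_eq mult_ac)
    then have "C * (1 + x) ^ q \<le> K * exp (\<epsilon> * x)"
      using mult_left_mono[OF _ C(1)] by (simp only: K_def mult.assoc)
    then show ?thesis using C(2)[OF True] True by simp
  next
    case False
    then show ?thesis using z[of x] C assms by (auto simp: K_def)
  qed
  then show ?thesis using that[of K] C assms by (auto simp: K_def)
qed

lemma integrable_exp_neg: "c > 0 \<Longrightarrow> integrable lborel (\<lambda>x. exp (- c * x) * indicator {0..} (x::real) :: real)"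
proof -
  assume c: "c > 0"
  have "integrable lborel (\<lambda>x. x ^ 0 * exp (- x) * indicator {0..} (x::real) :: real)"
    unfolding integrable_iff_bounded
    using nn_intergal_power_times_exp_Ici[of 0]
    by (auto simp: ennreal_mult'' abs_mult ennreal_indicator mult_ac)
  from lborel_integrable_real_affine[OF this, of c 0]
  show ?thesis using c by (simp add: indicator_def zero_le_mult_iff)
qed

definition laplace :: "(real \<Rightarrow> real) \<Rightarrow> complex \<Rightarrow> complex" where
  "laplace \<psi> a = (LINT x|lborel. exp (- a * of_real x) * of_real (\<psi> x))"

lemma laplace_integrable:
  assumes "poly_bounded \<psi>" "Re a > 0"
  shows "integrable lborel (\<lambda>x. exp (- a * of_real x) * complex_of_real (\<psi> x))"
proof -
  have [measurable]: "\<psi> \<in> borel_measurable borel" using assms by (simp add: poly_bounded_def)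
  obtain C where C: "C \<ge> 0" "\<And>x. \<bar>\<psi> x\<bar> \<le> C * exp (Re a / 2 * x) * indicator {0..} x"
    using poly_bounded_exp_bound[OF assms(1), of "Re a / 2"] assms(2) by auto
  have "integrable lborel (\<lambda>x. C * (exp (- (Re a / 2) * x) * indicator {0..} (x::real)))"
    using assms by (intro integrable_mult_right integrable_exp_neg) auto
  then show ?thesis
  proof (rule Bochner_Integration.integrable_bound)
    show "AE x in lborel. norm (exp (- a * of_real x) * complex_of_real (\<psi> x)) \<le> norm (C * (exp (- (Re a / 2) * x) * indicator {0..} x))"
    proof (rule AE_I2)
      fix x
      have "norm (exp (- a * of_real x) * complex_of_real (\<psi> x)) = exp (- Re a * x) * \<bar>\<psi> x\<bar>"
        by (simp add: norm_mult norm_exp_eq_Re)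
      also have "\<dots> \<le> exp (- Re a * x) * (C * exp (Re a / 2 * x) * indicator {0..} x)"
        by (intro mult_left_mono C) auto
      also have "\<dots> = C * (exp (- (Re a / 2) * x) * indicator {0..} x)"
      proof -
        have "exp (- Re a * x) * exp (Re a / 2 * x) = exp (- (Re a / 2) * x)"
          unfolding exp_add[symmetric] by (simp add: algebra_simps)
        then show ?thesis by (metis mult.assoc mult.left_commute)
      qed
      finally show "norm (exp (- a * of_real x) * complex_of_real (\<psi> x)) \<le> norm (C * (exp (- (Re a / 2) * x) * indicator {0..} x))"
        by simp
    qed
  qed measurable
qed

lemma poly_bounded_times_x:
  assumes "poly_bounded \<psi>" shows "poly_bounded (\<lambda>x. x * \<psi> x)"
proof -
  have [measurable]: "\<psi> \<in> borel_measurable borel" using assms by (simp add: poly_bounded_def)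
  obtain C q where C: "C \<ge> 0" "\<And>x. x > 0 \<Longrightarrow> \<bar>\<psi> x\<bar> \<le> C * (1 + x) ^ q"
    using assms by (auto simp: poly_bounded_def)
  have "\<bar>x * \<psi> x\<bar> \<le> C * (1 + x) ^ Suc q" if "x > 0" for x
  proof -
    have "\<bar>x * \<psi> x\<bar> = x * \<bar>\<psi> x\<bar>" using that by (simp add: abs_mult)
    also have "\<dots> \<le> (1 + x) * (C * (1 + x) ^ q)" using C that by (intro mult_mono) auto
    finally show ?thesis by (simp add: mult_ac)
  qed
  then show ?thesis using assms C(1) unfolding poly_bounded_def
    by (intro conjI exI[of _ C] exI[of _ "Suc q"]) auto
qed

text \<open>Dominated convergence of difference quotients along a null sequence: for |h| < Re a / 2
  the quotient (exp(-h x) - 1)/h is at most x exp(x Re a / 2), which leaves the integrable majorant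
  x |\<psi> x| exp(-x Re a / 2).\<close>

lemma laplace_has_field_derivative:
  assumes pb: "poly_bounded \<psi>" and a: "Re a > 0"
  shows "(laplace \<psi> has_field_derivative - laplace (\<lambda>x. x * \<psi> x) a) (at a)"
proof -
  have [measurable]: "\<psi> \<in> borel_measurable borel" using pb by (simp add: poly_bounded_def)
  define \<sigma> where "\<sigma> = Re a / 2"
  have \<sigma>: "\<sigma> > 0" using a by (simp add: \<sigma>_def)
  have "((\<lambda>h. (laplace \<psi> (a + h) - laplace \<psi> a) / h) \<longlongrightarrow> - laplace (\<lambda>x. x * \<psi> x) a) (at 0)"
  proof (subst tendsto_at_iff_sequentially, intro allI impI)
    fix h :: "nat \<Rightarrow> complex"
    assume h: "\<forall>i. h i \<in> UNIV - {0}" and lim: "h \<longlonglongrightarrow> 0"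
    have ev: "eventually (\<lambda>i. norm (h i) < \<sigma>) sequentially"
      using order_tendstoD(2)[OF tendsto_norm_zero[OF lim]] \<sigma> by auto
    then obtain N where N: "\<And>i. i \<ge> N \<Longrightarrow> norm (h i) < \<sigma>" by (auto simp: eventually_sequentially)
    define g where "g = (\<lambda>i. h (i + N))"
    have g: "g i \<noteq> 0" "norm (g i) < \<sigma>" for i using h N[of "i + N"] by (auto simp: g_def)
    have glim: "g \<longlonglongrightarrow> 0" unfolding g_def using lim by (rule LIMSEQ_ignore_initial_segment)
    define s where "s = (\<lambda>i x. exp (- a * of_real x) * complex_of_real (\<psi> x) * ((exp (- g i * of_real x) - 1) / g i))"
    have int: "(laplace \<psi> (a + g i) - laplace \<psi> a) / g i = (LINT x|lborel. s i x)" for i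
    proof -
      have "\<bar>Re (g i)\<bar> \<le> norm (g i)" by (rule abs_Re_le_cmod)
      then have "Re (a + g i) > 0" using g(2)[of i] a by (simp add: \<sigma>_def)
      then have "laplace \<psi> (a + g i) - laplace \<psi> a = (LINT x|lborel. exp (- (a + g i) * of_real x) * complex_of_real (\<psi> x) - exp (- a * of_real x) * complex_of_real (\<psi> x))"
        unfolding laplace_def by (intro Bochner_Integration.integral_diff[symmetric] laplace_integrable pb a)
      then have "(laplace \<psi> (a + g i) - laplace \<psi> a) / g i = (LINT x|lborel. (exp (- (a + g i) * of_real x) * complex_of_real (\<psi> x) - exp (- a * of_real x) * complex_of_real (\<psi> x)) / g i)"
        by simp
      also have "\<dots> = (LINT x|lborel. s i x)"
      proof (intro Bochner_Integration.integral_cong refl)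
        fix x :: real
        have "exp (- (a + g i) * of_real x) = exp (- a * of_real x) * exp (- g i * of_real x)"
          unfolding exp_add[symmetric] by (simp add: algebra_simps)
        then show "(exp (- (a + g i) * of_real x) * complex_of_real (\<psi> x) - exp (- a * of_real x) * complex_of_real (\<psi> x)) / g i = s i x"
          by (simp add: s_def algebra_simps diff_divide_distrib)
      qed
      finally show ?thesis .
    qed
    have "(\<lambda>i. LINT x|lborel. s i x) \<longlonglongrightarrow> (LINT x|lborel. exp (- a * of_real x) * complex_of_real (\<psi> x) * (- of_real x))"
    proof (rule integral_dominated_convergence[where w = "\<lambda>x. norm (exp (- of_real \<sigma> * of_real x) * complex_of_real (x * \<psi> x))"])
      show "integrable lborel (\<lambda>x. norm (exp (- of_real \<sigma> * of_real x) * complex_of_real (x * \<psi> x)))"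
        using \<sigma> by (intro integrable_norm laplace_integrable poly_bounded_times_x pb) auto
      show "AE x in lborel. (\<lambda>i. s i x) \<longlonglongrightarrow> exp (- a * of_real x) * complex_of_real (\<psi> x) * (- of_real x)"
      proof (rule AE_I2)
        fix x :: real
        have "((\<lambda>z. exp (- z * of_real x)) has_field_derivative - of_real x) (at (0::complex))"
          by (auto intro!: derivative_eq_intros)
        then have "((\<lambda>h. (exp (- h * complex_of_real x) - 1) / h) \<longlongrightarrow> - of_real x) (at 0)"
          by (simp add: DERIV_def)
        moreover have "filterlim g (at 0) sequentially"
          using glim g by (intro filterlim_atI) auto
        ultimately have "(\<lambda>i. (exp (- g i * complex_of_real x) - 1) / g i) \<longlonglongrightarrow> - of_real x"
          by (rule filterlim_compose)
        then show "(\<lambda>i. s i x) \<longlonglongrightarrow> exp (- a * of_real x) * complex_of_real (\<psi> x) * (- of_real x)"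
          unfolding s_def by (intro tendsto_mult tendsto_const)
      qed
      show "AE x in lborel. norm (s i x) \<le> norm (exp (- of_real \<sigma> * of_real x) * complex_of_real (x * \<psi> x))" for i
      proof (rule AE_I2)
        fix x :: real
        show "norm (s i x) \<le> norm (exp (- of_real \<sigma> * of_real x) * complex_of_real (x * \<psi> x))"
        proof (cases "x > 0")
          case False
          then show ?thesis using pb by (simp add: poly_bounded_def s_def)
        next
          case True
          have "norm (exp (- g i * of_real x) - 1) \<le> exp (norm (- g i * of_real x)) * norm (- g i * of_real x)"
            using Taylor_exp_field[of "- g i * complex_of_real x" 0] by simp
          also have "\<dots> = exp (norm (g i) * x) * x * norm (g i)" using True by (simp add: norm_mult)
          also have "\<dots> \<le> exp (\<sigma> * x) * x * norm (g i)" using True g(2)[of i] by (intro mult_right_mono) auto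
          finally have "norm ((exp (- g i * of_real x) - 1) / g i) \<le> exp (\<sigma> * x) * x"
            using g(1)[of i] by (simp add: norm_divide divide_le_eq)
          then have "norm (s i x) \<le> exp (- (Re a * x)) * \<bar>\<psi> x\<bar> * (exp (\<sigma> * x) * x)"
            unfolding s_def norm_mult by (intro mult_mono) (auto simp: norm_exp_eq_Re)
          also have "\<dots> = (exp (- (Re a * x)) * exp (\<sigma> * x)) * (x * \<bar>\<psi> x\<bar>)" by (simp only: mult_ac)
          also have "exp (- (Re a * x)) * exp (\<sigma> * x) = exp (- (\<sigma> * x))"
            unfolding exp_add[symmetric] by (simp add: \<sigma>_def field_simps)
          finally show ?thesis using True by (simp add: norm_mult norm_exp_eq_Re abs_mult)
        qed
      qed
    qed (auto simp: s_def)
    also have "(LINT x|lborel. exp (- a * of_real x) * complex_of_real (\<psi> x) * (- of_real x)) = - laplace (\<lambda>x. x * \<psi> x) a"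
      unfolding laplace_def by (subst Bochner_Integration.integral_minus[symmetric]) (simp add: mult_ac)
    finally have "(\<lambda>i. (laplace \<psi> (a + g i) - laplace \<psi> a) / g i) \<longlonglongrightarrow> - laplace (\<lambda>x. x * \<psi> x) a"
      by (simp add: int)
    then show "((\<lambda>h. (laplace \<psi> (a + h) - laplace \<psi> a) / h) \<circ> h) \<longlonglongrightarrow> - laplace (\<lambda>x. x * \<psi> x) a"
      unfolding g_def o_def by (rule LIMSEQ_offset)
  qed
  then show ?thesis by (simp add: DERIV_def)
qed


text \<open>One parametrisation for all delay functions: the parameters -\<kappa> and n + \<kappa>
  add up to n, so v^(n+1) F'(v) = \<kappa> (v-1)^n F(v-1). Here \<kappa> = k, n = m - k gives f(.;
  -k, m), while \<kappa> = -k, n = k - 1 gives f(.; k, -1), and \<kappa> = 0 gives the constant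
  1.\<close>

context
  fixes \<kappa> :: int and n :: nat and F :: "real \<Rightarrow> real"
  defines "F \<equiv> dde_aux (- \<kappa>) (int n + \<kappa>)"
begin

lemma delay_nonneg: "- \<kappa> + (int n + \<kappa>) \<ge> 0" by simp

lemma delay_aux_le1: "v \<le> 1 \<Longrightarrow> F v = 1"
  by (simp add: F_def dde_aux.simps)

lemma delay_aux_deriv:
  assumes "v > 1"
  shows "(F has_real_derivative of_int \<kappa> * (v - 1) ^ n / v ^ (n + 1) * F (v - 1)) (at v)"
proof -
  have e: "int n + 1 = int (Suc n)" by simp
  have "dde_kern (- \<kappa>) (int n + \<kappa>) v = (v - 1) ^ n / v ^ (n + 1) * F (v - 1)"
    unfolding dde_kern_def[OF delay_nonneg] F_def
    by (simp only: add.assoc[symmetric] add.commute[of _ \<kappa>] add.right_inverse add_0 e power_int_of_nat Suc_eq_plus1)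
  then show ?thesis using dde_aux_deriv[OF delay_nonneg assms] by (simp add: F_def mult_ac)
qed

lemma delay_aux_cont: "continuous_on A F"
proof -
  have "continuous_on {..real N} F" for N unfolding F_def by (rule dde_aux_cont_nat[OF delay_nonneg])
  then have "isCont F x" for x
  proof -
    obtain N :: nat where N: "x < real N" using reals_Archimedean2 by blast
    have "continuous_on {..<real N} F"
      by (rule continuous_on_subset[OF \<open>continuous_on {..real N} F\<close>]) auto
    then show ?thesis using N by (simp add: continuous_on_eq_continuous_at)
  qed
  then show ?thesis by (simp add: continuous_at_imp_continuous_on)
qed

text \<open>If |F| is at most the power w^K one unit to the left, with K = |\<kappa>|, the delay
  equation gives |F'(w)| <= K w^(K-1), the derivative of w^K. So the bound advances by unit
  intervals.\<close>

lemma delay_aux_bound: "\<bar>F v\<bar> \<le> max 1 v ^ nat \<bar>\<kappa>\<bar>"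
proof -
  define K where "K = nat \<bar>\<kappa>\<bar>"
  have "\<bar>F v\<bar> \<le> max 1 v ^ K" if "v \<le> real N + 1" for N v
    using that
  proof (induction N arbitrary: v)
    case 0
    then show ?case by (simp add: delay_aux_le1)
  next
    case (Suc N)
    show ?case
    proof (cases "v \<le> 1")
      case True
      then show ?thesis by (simp add: delay_aux_le1)
    next
      case False
      have "norm (F v - F 1) \<le> v ^ K - 1 ^ K"
      proof (rule differentiable_bound_general[where \<phi> = "\<lambda>v. v ^ K" and \<phi>' = "\<lambda>w. real K * w ^ (K - 1)"])
        fix w assume w: "1 < w" "w < v"
        show "(F has_vector_derivative of_int \<kappa> * (w - 1) ^ n / w ^ (n + 1) * F (w - 1)) (at w)"
          using delay_aux_deriv[of w] w by (simp add: has_real_derivative_iff_has_vector_derivative)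
        show "((\<lambda>v. v ^ K) has_vector_derivative real K * w ^ (K - 1)) (at w)"
          unfolding has_real_derivative_iff_has_vector_derivative[symmetric]
          by (auto intro!: derivative_eq_intros)
        show "norm (of_int \<kappa> * (w - 1) ^ n / w ^ (n + 1) * F (w - 1)) \<le> real K * w ^ (K - 1)"
        proof (cases "\<kappa> = 0")
          case False
          then have K: "K \<ge> 1" by (auto simp: K_def)
          have "\<bar>F (w - 1)\<bar> \<le> max 1 (w - 1) ^ K" using w Suc.prems by (intro Suc.IH) auto
          also have "\<dots> \<le> w ^ K" using w by (intro power_mono) auto
          finally have 1: "\<bar>F (w - 1)\<bar> \<le> w ^ K" .
          have 2: "(w - 1) ^ n / w ^ (n + 1) \<le> 1 / w"
          proof -
            have "(w - 1) ^ n / w ^ (n + 1) \<le> w ^ n / w ^ (n + 1)"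
              using w by (intro divide_right_mono power_mono) auto
            then show ?thesis using w by simp
          qed
          have "norm (of_int \<kappa> * (w - 1) ^ n / w ^ (n + 1) * F (w - 1)) = real K * ((w - 1) ^ n / w ^ (n + 1)) * \<bar>F (w - 1)\<bar>"
            using w by (simp add: abs_mult abs_divide K_def)
          also have "\<dots> \<le> real K * (1 / w) * w ^ K" using w
            by (intro mult_mono 1 mult_left_mono 2) auto
          also have "\<dots> = real K * w ^ (K - 1)" using K w by (cases K) auto
          finally show ?thesis .
        qed (use w in simp)
      qed (use False in \<open>auto intro!: delay_aux_cont continuous_intros\<close>)
      then have "\<bar>F v\<bar> \<le> v ^ K" using delay_aux_le1[of 1] by auto
      then show ?thesis using False by (simp add: max_def)
    qed
  qed
  moreover obtain N :: nat where "v \<le> real N" using real_arch_simple by blast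
  ultimately show ?thesis unfolding K_def by (meson add_increasing2 zero_le_one)
qed

text \<open>The factor x^n turns the delay equation into one with constant coefficients; see
  \<open>delay_fun_times_x_deriv\<close>.\<close>

definition delay_fun :: "real \<Rightarrow> real" where "delay_fun x = (if x \<le> 0 then 0 else x ^ n * F x)"

lemma delay_fun_bound: "x > 0 \<Longrightarrow> \<bar>delay_fun x\<bar> \<le> (1 + x) ^ (n + nat \<bar>\<kappa>\<bar>)"
proof -
  assume x: "x > 0"
  have "\<bar>delay_fun x\<bar> = x ^ n * \<bar>F x\<bar>" using x by (simp add: delay_fun_def abs_mult)
  also have "\<dots> \<le> (1 + x) ^ n * (1 + x) ^ nat \<bar>\<kappa>\<bar>"
    using x by (intro mult_mono power_mono order_trans[OF delay_aux_bound]) auto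
  finally show ?thesis by (simp add: power_add)
qed

lemma delay_fun_measurable [measurable]: "delay_fun \<in> borel_measurable borel"
proof -
  have [measurable]: "F \<in> borel_measurable borel"
    by (rule borel_measurable_continuous_onI[OF delay_aux_cont])
  show ?thesis unfolding delay_fun_def[abs_def] by measurable
qed

lemma delay_fun_poly_bounded: "poly_bounded delay_fun"
  unfolding poly_bounded_def using delay_fun_bound
  by (intro conjI exI[of _ "1::real"] exI[of _ "n + nat \<bar>\<kappa>\<bar>"]) (auto simp: delay_fun_def)

lemma delay_fun_shift_poly_bounded: "poly_bounded (\<lambda>x. delay_fun (x - 1))"
  unfolding poly_bounded_def
proof (intro conjI exI[of _ "1::real"] exI[of _ "n + nat \<bar>\<kappa>\<bar>"] allI impI)
  show "(\<lambda>x. delay_fun (x - 1)) \<in> borel_measurable borel" by measurable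
next
  fix x :: real assume "x > 0"
  show "\<bar>delay_fun (x - 1)\<bar> \<le> 1 * (1 + x) ^ (n + nat \<bar>\<kappa>\<bar>)"
  proof (cases "x > 1")
    case True
    then have "\<bar>delay_fun (x - 1)\<bar> \<le> (1 + (x - 1)) ^ (n + nat \<bar>\<kappa>\<bar>)" by (intro delay_fun_bound) auto
    also have "\<dots> \<le> (1 + x) ^ (n + nat \<bar>\<kappa>\<bar>)" using True by (intro power_mono) auto
    finally show ?thesis by simp
  qed (use \<open>x > 0\<close> in \<open>simp add: delay_fun_def\<close>)
qed (auto simp: delay_fun_def)

text \<open>For D = \<open>delay_fun\<close> this reads (x D)' = (n+1) D + \<kappa> D(x-1), all
  powers having cancelled. At 1 the two branches of F meet, and for n = 0 the derivative may jump
  there.\<close>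

lemma delay_fun_times_x_deriv:
  assumes "x > 0" "x \<noteq> 1"
  shows "((\<lambda>x. x ^ (n + 1) * F x) has_real_derivative (real n + 1) * delay_fun x + of_int \<kappa> * delay_fun (x - 1)) (at x)"
proof (cases "x < 1")
  case True
  have "((\<lambda>x. x ^ (n + 1)) has_real_derivative (real n + 1) * x ^ n) (at x)"
    by (rule derivative_eq_intros refl | simp)+
  then have "((\<lambda>x. x ^ (n + 1) * F x) has_real_derivative (real n + 1) * x ^ n) (at x)"
    by (rule has_field_derivative_transform_within_open[of _ _ _ "{..<1}"]) (use True in \<open>auto simp: delay_aux_le1\<close>)
  then show ?thesis using assms True by (simp add: delay_fun_def delay_aux_le1)
next
  case False
  then have x: "x > 1" using assms by simp
  have "((\<lambda>x. x ^ (n + 1) * F x) has_real_derivative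
      (real n + 1) * x ^ n * F x + x ^ (n + 1) * (of_int \<kappa> * (x - 1) ^ n / x ^ (n + 1) * F (x - 1))) (at x)"
    by (rule derivative_eq_intros delay_aux_deriv x refl | simp)+
  then show ?thesis using x by (simp add: delay_fun_def mult_ac)
qed

text \<open>The transform of (x D)' = (n+1) D + \<kappa> D(x-1), where the shift becomes the factor
  exp(-a). Since the transform of x D is minus the derivative of that of D, this is a first order
  linear equation in a.\<close>

lemma laplace_dphi_by_parts:
  assumes a: "Re a > 0"
  shows "a * laplace (\<lambda>x. x * delay_fun x) a = (of_nat n + 1) * laplace delay_fun a + of_int \<kappa> * (exp (- a) * laplace delay_fun a)"
proof -
  define Y where "Y = (\<lambda>x. x ^ (n + 1) * F x)"
  define D where "D = (\<lambda>x. (real n + 1) * delay_fun x + of_int \<kappa> * delay_fun (x - 1))"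
  define f where "f = (\<lambda>x. exp (- a * of_real x) * complex_of_real (D x) - a * (exp (- a * of_real x) * complex_of_real (x * delay_fun x)))"
  note pb = delay_fun_poly_bounded delay_fun_shift_poly_bounded poly_bounded_times_x[OF delay_fun_poly_bounded]
  have Deq: "(\<lambda>x. exp (- a * of_real x) * complex_of_real (D x)) =
      (\<lambda>x. (of_nat n + 1) * (exp (- a * of_real x) * complex_of_real (delay_fun x)) + of_int \<kappa> * (exp (- a * of_real x) * complex_of_real (delay_fun (x - 1))))"
    by (rule ext) (simp add: D_def algebra_simps)
  have intD: "integrable lborel (\<lambda>x. exp (- a * of_real x) * complex_of_real (D x))"
    unfolding Deq by (intro Bochner_Integration.integrable_add integrable_mult_right laplace_integrable pb a)
  have intf: "integrable lborel f"
    unfolding f_def by (intro Bochner_Integration.integrable_diff integrable_mult_right intD laplace_integrable pb a)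
  have LD: "(LINT x|lborel. exp (- a * of_real x) * complex_of_real (D x)) = (of_nat n + 1) * laplace delay_fun a + of_int \<kappa> * laplace (\<lambda>x. delay_fun (x - 1)) a"
    unfolding Deq laplace_def
    by (subst Bochner_Integration.integral_add[OF integrable_mult_right integrable_mult_right, OF laplace_integrable[OF pb(1) a] laplace_integrable[OF pb(2) a]]) simp
  have shift: "laplace (\<lambda>x. delay_fun (x - 1)) a = exp (- a) * laplace delay_fun a"
  proof -
    have "laplace (\<lambda>x. delay_fun (x - 1)) a = (LINT x|lborel. exp (- a * of_real (1 + 1 * x)) * complex_of_real (delay_fun ((1 + 1 * x) - 1)))"
      unfolding laplace_def by (subst lborel_integral_real_affine[where c = 1 and t = 1]) auto
    also have "\<dots> = (LINT x|lborel. exp (- a) * (exp (- a * of_real x) * complex_of_real (delay_fun x)))"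
    proof (intro Bochner_Integration.integral_cong refl)
      fix x :: real
      have "exp (- a * of_real (1 + 1 * x)) = exp (- a) * exp (- a * of_real x)"
        unfolding exp_add[symmetric] by (simp add: algebra_simps)
      then show "exp (- a * of_real (1 + 1 * x)) * complex_of_real (delay_fun ((1 + 1 * x) - 1)) = exp (- a) * (exp (- a * of_real x) * complex_of_real (delay_fun x))"
        by simp
    qed
    finally show ?thesis by (simp add: laplace_def)
  qed
  \<comment> \<open>On [0,N] the fundamental theorem of calculus with exceptional point 1 leaves
    only the boundary term at N, as Y vanishes at 0.\<close>
  have trunc: "(LINT x|lborel. indicator {0..real N} x *\<^sub>R f x) = exp (- a * of_real (real N)) * complex_of_real (real N * delay_fun (real N))" for N
  proof -
    have "(f has_integral exp (- a * of_real (real N)) * complex_of_real (Y (real N)) - exp (- a * of_real 0) * complex_of_real (Y 0)) {0..real N}"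
    proof (rule fundamental_theorem_of_calculus_interior_strong[of "{1}"])
      fix x assume x: "x \<in> {0<..<real N} - {1}"
      have "(Y has_real_derivative D x) (at x)" unfolding Y_def D_def using x by (intro delay_fun_times_x_deriv) auto
      then have "((\<lambda>x. complex_of_real (Y x)) has_vector_derivative of_real (D x)) (at x)"
        by (intro has_vector_derivative_of_real)
      moreover have "((\<lambda>x. exp (- a * of_real x)) has_vector_derivative - a * exp (- a * of_real x)) (at x)"
      proof -
        have "((\<lambda>z. exp (- a * z)) has_field_derivative - a * exp (- a * of_real x)) (at (of_real x))"
          by (auto intro!: derivative_eq_intros)
        then show ?thesis using has_vector_derivative_real_field by blast
      qed
      ultimately have "((\<lambda>x. exp (- a * of_real x) * complex_of_real (Y x)) has_vector_derivative
          exp (- a * of_real x) * of_real (D x) + (- a * exp (- a * of_real x)) * complex_of_real (Y x)) (at x)"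
        by (intro has_vector_derivative_mult)
      moreover have "Y x = x * delay_fun x" using x by (simp add: Y_def delay_fun_def)
      ultimately show "((\<lambda>x. exp (- a * of_real x) * complex_of_real (Y x)) has_vector_derivative f x) (at x)"
        by (simp add: f_def mult_ac)
    qed (auto simp: Y_def intro!: continuous_intros delay_aux_cont)
    moreover have "Y 0 = 0" "Y (real N) = real N * delay_fun (real N)" by (auto simp: Y_def delay_fun_def)
    ultimately have "integral {0..real N} f = exp (- a * of_real (real N)) * complex_of_real (real N * delay_fun (real N))"
      by (simp add: integral_unique)
    moreover have "set_integrable lborel {0..real N} f"
      unfolding set_integrable_def using integrable_mult_indicator[OF _ intf, of "{0..real N}"] by simp
    ultimately show ?thesis
      using set_borel_integral_eq_integral(2)[of "{0..real N}" f] by (simp add: set_lebesgue_integral_def)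
  qed
  have f0: "f x = 0" if "x < 0" for x using that by (simp add: f_def D_def delay_fun_def)
  have lim1: "(\<lambda>N. LINT x|lborel. indicator {0..real N} x *\<^sub>R f x) \<longlonglongrightarrow> (LINT x|lborel. f x)"
  proof (rule integral_dominated_convergence[where w = "\<lambda>x. norm (f x)"])
    show "f \<in> borel_measurable lborel" using intf by auto
    then show "(\<lambda>x. indicator {0..real N} x *\<^sub>R f x) \<in> borel_measurable lborel" for N by measurable
    show "AE x in lborel. (\<lambda>N. indicator {0..real N} x *\<^sub>R f x) \<longlonglongrightarrow> f x"
    proof (rule AE_I2)
      fix x
      obtain N0 :: nat where N0: "x \<le> real N0" using real_arch_simple by blast
      have "eventually (\<lambda>N. indicator {0..real N} x *\<^sub>R f x = f x) sequentially"
        using N0 f0[of x] by (intro eventually_sequentiallyI[of N0]) (auto simp: indicator_def)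
      then show "(\<lambda>N. indicator {0..real N} x *\<^sub>R f x) \<longlonglongrightarrow> f x" by (rule tendsto_eventually)
    qed
  qed (use intf in \<open>auto simp: indicator_def\<close>)
  have lim2: "(\<lambda>N. exp (- a * of_real (real N)) * complex_of_real (real N * delay_fun (real N))) \<longlonglongrightarrow> 0"
  proof -
    obtain C where C: "C \<ge> 0" "\<And>x. \<bar>x * delay_fun x\<bar> \<le> C * exp (Re a / 2 * x) * indicator {0..} x"
      using poly_bounded_exp_bound[OF pb(3), of "Re a / 2"] a by auto
    have "(\<lambda>N. C * exp (- (Re a / 2) * real N)) \<longlonglongrightarrow> 0"
    proof -
      have "filterlim (\<lambda>N. Re a / 2 * real N) at_top sequentially"
        using a by (intro filterlim_tendsto_pos_mult_at_top[OF tendsto_const] filterlim_real_sequentially) auto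
      then have "(\<lambda>N. exp (- (Re a / 2 * real N))) \<longlonglongrightarrow> 0"
        by (intro filterlim_compose[OF exp_at_bot] filterlim_compose[OF filterlim_uminus_at_bot_at_top])
      then show ?thesis by (auto intro: tendsto_mult_right_zero)
    qed
    then show ?thesis
    proof (rule Lim_null_comparison[rotated], intro always_eventually allI)
      fix N :: nat
      have "norm (exp (- a * of_real (real N)) * complex_of_real (real N * delay_fun (real N))) = exp (- Re a * real N) * \<bar>real N * delay_fun (real N)\<bar>"
        by (simp only: norm_mult norm_of_real norm_exp_eq_Re) simp
      also have "\<dots> \<le> exp (- Re a * real N) * (C * exp (Re a / 2 * real N))"
        using C(2)[of "real N"] by (intro mult_left_mono) auto
      also have "\<dots> = C * (exp (- Re a * real N) * exp (Re a / 2 * real N))" by (simp only: mult_ac)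
      also have "exp (- Re a * real N) * exp (Re a / 2 * real N) = exp (- (Re a / 2) * real N)"
        unfolding exp_add[symmetric] by (simp add: field_simps)
      finally show "norm (exp (- a * of_real (real N)) * complex_of_real (real N * delay_fun (real N))) \<le> C * exp (- (Re a / 2) * real N)" .
    qed
  qed
  have "(LINT x|lborel. f x) = 0" using LIMSEQ_unique[OF lim1] lim2 by (simp add: trunc)
  moreover have "(LINT x|lborel. f x) = (LINT x|lborel. exp (- a * of_real x) * complex_of_real (D x)) - a * laplace (\<lambda>x. x * delay_fun x) a"
    unfolding f_def laplace_def
    by (subst Bochner_Integration.integral_diff[OF intD integrable_mult_right, OF laplace_integrable[OF pb(3) a]]) simp
  ultimately show ?thesis unfolding LD shift by simp
qed

text \<open>Substituting y = T x gives the integrand exp(-y) y^n F(y/T), and F(y/T) = 1 once T >= y;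
  the limit is the Gamma integral n!. It fixes the constant of integration in
  \<open>laplace_dphi\<close>.\<close>

lemma laplace_dphi_limit: "((\<lambda>T. of_real T ^ (n + 1) * laplace delay_fun (of_real T)) \<longlongrightarrow> fact n) at_top"
proof -
  have Fm [measurable]: "F \<in> borel_measurable borel"
    by (rule borel_measurable_continuous_onI[OF delay_aux_cont])
  define s where "s = (\<lambda>T y. complex_of_real (exp (- y) * y ^ n * F (y / T) * indicator {0<..} y))"
  have bi: "has_bochner_integral lborel (\<lambda>x. x ^ q * exp (- x) * indicator {0..} (x::real) :: real) (fact q)" for q
  proof (rule has_bochner_integral_nn_integral)
    show "AE x in lborel. 0 \<le> x ^ q * exp (- x) * indicator {0..} (x::real)"
      by (rule AE_I2) (auto simp: indicator_def)
  qed (use nn_intergal_power_times_exp_Ici[of q] in \<open>auto simp: ennreal_mult'' ennreal_indicator\<close>)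
  have "((\<lambda>T. LINT y|lborel. s T y) \<longlongrightarrow> (LINT y|lborel. complex_of_real (y ^ n * exp (- y) * indicator {0..} y))) at_top"
  proof (rule integral_dominated_convergence_at_top[where w = "\<lambda>y. (y ^ n * exp (- y) * indicator {0..} y) + (y ^ (n + nat \<bar>\<kappa>\<bar>) * exp (- y) * indicator {0..} y)"])
    show "AE y in lborel. ((\<lambda>T. s T y) \<longlongrightarrow> complex_of_real (y ^ n * exp (- y) * indicator {0..} y)) at_top"
    proof -
      have "((\<lambda>T. s T y) \<longlongrightarrow> complex_of_real (y ^ n * exp (- y) * indicator {0..} y)) at_top" if "y \<noteq> 0" for y
      proof -
        have "eventually (\<lambda>T. s T y = complex_of_real (y ^ n * exp (- y) * indicator {0..} y)) at_top"
          using eventually_ge_at_top[of "max 1 y"]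
        proof eventually_elim
          case (elim T)
          have "y / T \<le> 1" using elim by (simp add: divide_le_eq)
          then show ?case using that by (auto simp: s_def delay_aux_le1 indicator_def)
        qed
        then show ?thesis by (rule tendsto_eventually)
      qed
      then show ?thesis using AE_lborel_singleton[of "0::real"] by auto
    qed
    show "integrable lborel (\<lambda>y. (y ^ n * exp (- y) * indicator {0..} y) + (y ^ (n + nat \<bar>\<kappa>\<bar>) * exp (- y) * indicator {0..} (y::real)) :: real)"
      using bi by (intro Bochner_Integration.integrable_add) (auto simp: has_bochner_integral_iff)
    show "\<forall>\<^sub>F T in at_top. AE y in lborel. norm (s T y) \<le> (y ^ n * exp (- y) * indicator {0..} y) + (y ^ (n + nat \<bar>\<kappa>\<bar>) * exp (- y) * indicator {0..} y)"
      using eventually_ge_at_top[of 1]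
    proof eventually_elim
      case (elim T)
      show ?case
      proof (rule AE_I2)
        fix y :: real
        show "norm (s T y) \<le> (y ^ n * exp (- y) * indicator {0..} y) + (y ^ (n + nat \<bar>\<kappa>\<bar>) * exp (- y) * indicator {0..} y)"
        proof (cases "y > 0")
          case True
          have "\<bar>F (y / T)\<bar> \<le> max 1 (y / T) ^ nat \<bar>\<kappa>\<bar>" by (rule delay_aux_bound)
          also have "\<dots> \<le> max 1 y ^ nat \<bar>\<kappa>\<bar>"
            using True elim by (intro power_mono max.mono) (auto simp: divide_le_eq mult_le_cancel_left1)
          also have "\<dots> \<le> 1 + y ^ nat \<bar>\<kappa>\<bar>" using True by (auto simp: max_def)
          finally have "(exp (- y) * y ^ n) * \<bar>F (y / T)\<bar> \<le> (exp (- y) * y ^ n) * (1 + y ^ nat \<bar>\<kappa>\<bar>)"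
            using True by (intro mult_left_mono) auto
          then show ?thesis using True by (simp add: s_def abs_mult norm_mult norm_power algebra_simps power_add)
        qed (auto simp: s_def indicator_def)
      qed
    qed
  qed (auto simp: s_def)
  moreover have "(LINT y|lborel. complex_of_real (y ^ n * exp (- y) * indicator {0..} y)) = fact n"
    using bi[of n] by (simp only: integral_complex_of_real has_bochner_integral_integral_eq) simp
  moreover have "eventually (\<lambda>T. (LINT y|lborel. s T y) = of_real T ^ (n + 1) * laplace delay_fun (of_real T)) at_top"
    using eventually_gt_at_top[of 0]
  proof eventually_elim
    case (elim T)
    have "(LINT y|lborel. s T y) = \<bar>T\<bar> *\<^sub>R (LINT x|lborel. s T (0 + T * x))"
      using elim by (intro lborel_integral_real_affine) auto
    also have "\<dots> = of_real T * (LINT x|lborel. of_real T ^ n * (exp (- of_real T * of_real x) * complex_of_real (delay_fun x)))"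
    proof -
      have "s T (0 + T * x) = of_real T ^ n * (exp (- of_real T * of_real x) * complex_of_real (delay_fun x))" for x
      proof -
        have e: "exp (- complex_of_real T * of_real x) = of_real (exp (- (T * x)))"
          by (simp add: exp_of_real flip: of_real_mult of_real_minus)
        show ?thesis
          using elim unfolding e by (auto simp: s_def delay_fun_def indicator_def zero_less_mult_iff power_mult_distrib)
      qed
      then show ?thesis using elim by (simp add: scaleR_conv_of_real)
    qed
    finally show ?case by (simp add: laplace_def)
  qed
  ultimately show ?thesis by (auto intro: Lim_transform_eventually)
qed

text \<open>For E(a) = a exp(-Ein a) one has E'/E = exp(-a)/a, so E^\<kappa> is an integrating
  factor: a^(n+1) times the transform times E^\<kappa> is constant on the half plane. Along the
  positive reals E tends to exp(-\<open>ein_const\<close>), which determines the constant.\<close>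

theorem laplace_dphi:
  assumes a: "Re a > 0"
  shows "laplace delay_fun a = fact n * exp (- of_int \<kappa> * of_real ein_const) * (a * exp (- Ein a)) powi (- \<kappa>) / a ^ (n + 1)"
proof -
  define E where "E = (\<lambda>a. a * exp (- Ein a))"
  define R where "R = (\<lambda>a. a ^ (n + 1) * laplace delay_fun a * E a powi \<kappa>)"
  have E0: "E a \<noteq> 0" if "Re a > 0" for a using that by (auto simp: E_def)
  have dE: "(E has_field_derivative E a * exp (- a) / a) (at a)" if "Re a > 0" for a
  proof -
    have a0: "a \<noteq> 0" using that by auto
    have "(E has_field_derivative 1 * exp (- Ein a) + (exp (- Ein a) * (- ((1 - exp (- a)) / a))) * a) (at a)"
      unfolding E_def using a0 by (auto intro!: derivative_eq_intros Ein_has_field_derivative)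
    then show ?thesis using a0 by (simp add: E_def field_simps)
  qed
  have "(R has_field_derivative 0) (at a within {a. Re a > 0})" if a: "a \<in> {a. Re a > 0}" for a
  proof -
    have ra: "Re a > 0" and a0: "a \<noteq> 0" using a by auto
    define l where "l = laplace delay_fun a"
    define P where "P = E a powi \<kappa>"
    have "((\<lambda>a. E a powi \<kappa>) has_field_derivative of_int \<kappa> * E a powi (\<kappa> - 1) * (E a * exp (- a) / a)) (at a)"
      using DERIV_power_int[OF dE[OF ra], of \<kappa>] E0[OF ra] by simp
    also have "of_int \<kappa> * E a powi (\<kappa> - 1) * (E a * exp (- a) / a) = of_int \<kappa> * P * exp (- a) / a"
      using E0[OF ra] by (simp add: P_def power_int_diff)
    finally have dP: "((\<lambda>a. E a powi \<kappa>) has_field_derivative of_int \<kappa> * P * exp (- a) / a) (at a)" .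
    have "(R has_field_derivative ((of_nat (n + 1) * a ^ n) * l + (- laplace (\<lambda>x. x * delay_fun x) a) * a ^ (n + 1)) * P +
        of_int \<kappa> * P * exp (- a) / a * (a ^ (n + 1) * l)) (at a)"
      unfolding R_def l_def P_def
      by (intro DERIV_mult dP[unfolded P_def] laplace_has_field_derivative delay_fun_poly_bounded ra)
         (rule derivative_eq_intros refl | simp)+
    also have "((of_nat (n + 1) * a ^ n) * l + (- laplace (\<lambda>x. x * delay_fun x) a) * a ^ (n + 1)) * P +
        of_int \<kappa> * P * exp (- a) / a * (a ^ (n + 1) * l) =
        a ^ n * P * ((of_nat n + 1) * l + of_int \<kappa> * (exp (- a) * l) - a * laplace (\<lambda>x. x * delay_fun x) a)"
      using a0 by (simp add: algebra_simps)
    also have "\<dots> = 0" using laplace_dphi_by_parts[OF ra] by (simp add: l_def)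
    finally show ?thesis by (rule has_field_derivative_at_within)
  qed
  then obtain c where c: "\<And>a. Re a > 0 \<Longrightarrow> R a = c"
    using has_field_derivative_zero_constant[OF convex_halfspace_Re_gt, of 0 R] by auto
  have "((\<lambda>T. of_real T ^ (n + 1) * laplace delay_fun (of_real T) * (of_real (exp (- (ein_real T - ln T))) :: complex) powi \<kappa>)
      \<longlongrightarrow> fact n * (of_real (exp (- ein_const)) :: complex) powi \<kappa>) at_top"
    by (intro tendsto_mult laplace_dphi_limit tendsto_power_int tendsto_of_real tendsto_exp tendsto_minus ein_const) auto
  moreover have "eventually (\<lambda>T. of_real T ^ (n + 1) * laplace delay_fun (of_real T) * (of_real (exp (- (ein_real T - ln T))) :: complex) powi \<kappa> = c) at_top"
    using eventually_gt_at_top[of 0]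
  proof eventually_elim
    case (elim T)
    have "E (of_real T) = of_real (exp (- (ein_real T - ln T)))"
      using elim by (simp add: E_def Ein_of_real exp_diff exp_minus exp_of_real field_simps flip: of_real_minus)
    then show ?case using c[of "of_real T"] elim by (simp add: R_def)
  qed
  ultimately have "((\<lambda>T::real. c) \<longlongrightarrow> fact n * (of_real (exp (- ein_const)) :: complex) powi \<kappa>) at_top"
    by (rule Lim_transform_eventually)
  then have "c = fact n * (of_real (exp (- ein_const)) :: complex) powi \<kappa>"
    by (simp add: tendsto_const_iff)
  moreover have "(of_real (exp (- ein_const)) :: complex) powi \<kappa> = exp (- of_int \<kappa> * of_real ein_const)"
    by (simp add: exp_of_real[symmetric] exp_power_int mult.commute)
  moreover have "a \<noteq> 0" using a by auto
  moreover have Ea: "a * exp (- Ein a) = E a" by (simp add: E_def)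
  ultimately show ?thesis
    using c[OF a] E0[OF a] unfolding R_def Ea
    by (simp add: power_int_minus field_simps)
qed

end

section \<open>Fourier and Laplace inversion\<close>

lemma (in pair_sigma_finite) integrable_pair_mult:
  fixes f g :: "_ \<Rightarrow> 'c :: {real_normed_field, banach, second_countable_topology}"
  assumes f: "integrable M1 f" and g: "integrable M2 g"
  shows "integrable (M1 \<Otimes>\<^sub>M M2) (\<lambda>(x, y). f x * g y)"
    and "integral\<^sup>L (M1 \<Otimes>\<^sub>M M2) (\<lambda>(x, y). f x * g y) = integral\<^sup>L M1 f * integral\<^sup>L M2 g"
proof -
  have [measurable]: "f \<in> borel_measurable M1" "g \<in> borel_measurable M2" using f g by auto
  show int: "integrable (M1 \<Otimes>\<^sub>M M2) (\<lambda>(x, y). f x * g y)"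
  proof (rule Fubini_integrable)
    show "integrable M1 (\<lambda>x. LINT y|M2. norm (case (x, y) of (x, y) \<Rightarrow> f x * g y))"
      using f by (simp add: norm_mult)
    show "AE x in M1. integrable M2 (\<lambda>y. case (x, y) of (x, y) \<Rightarrow> f x * g y)"
      using g by simp
  qed measurable
  show "integral\<^sup>L (M1 \<Otimes>\<^sub>M M2) (\<lambda>(x, y). f x * g y) = integral\<^sup>L M1 f * integral\<^sup>L M2 g"
    using integral_fst'[OF int] by simp
qed

lemma gaussian_integrable: "\<epsilon> > 0 \<Longrightarrow> integrable lborel (\<lambda>t. exp (- ((\<epsilon> * t) ^ 2) / 2) :: real)"
proof -
  assume e: "\<epsilon> > 0"
  have "integrable lborel (\<lambda>t. sqrt (2 * pi) * std_normal_density t)"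
    by (intro integrable_mult_right integrable_normal_density) auto
  then have "integrable lborel (\<lambda>t. exp (- (t ^ 2) / 2) :: real)"
    by (simp add: std_normal_density_def)
  from lborel_integrable_real_affine[OF this, of \<epsilon> 0] e show ?thesis by simp
qed

text \<open>The characteristic function of the standard normal distribution, rescaled.\<close>

lemma gaussian_fourier:
  assumes e: "\<epsilon> > 0"
  shows "(LINT t|lborel. exp (\<i> * of_real (v * t)) * complex_of_real (exp (- ((\<epsilon> * t) ^ 2) / 2)))
     = of_real (sqrt (2 * pi) / \<epsilon> * exp (- ((v / \<epsilon>) ^ 2) / 2))"
proof -
  have base: "(LINT t|lborel. exp (\<i> * of_real (w * t)) * complex_of_real (exp (- (t ^ 2) / 2))) = of_real (sqrt (2 * pi) * exp (- (w ^ 2) / 2))" for w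
  proof -
    have "of_real (exp (- (w ^ 2) / 2)) = char std_normal_distribution w"
      by (simp add: char_std_normal_distribution)
    also have "\<dots> = (LINT t|lborel. std_normal_density t *\<^sub>R exp (\<i> * of_real (w * t)))"
      unfolding char_def by (subst integral_density) (auto simp: mult_ac)
    also have "\<dots> = (LINT t|lborel. of_real (1 / sqrt (2 * pi)) * (exp (\<i> * of_real (w * t)) * complex_of_real (exp (- (t ^ 2) / 2))))"
      by (intro Bochner_Integration.integral_cong) (auto simp: std_normal_density_def scaleR_conv_of_real mult_ac)
    also have "\<dots> = of_real (1 / sqrt (2 * pi)) * (LINT t|lborel. exp (\<i> * of_real (w * t)) * complex_of_real (exp (- (t ^ 2) / 2)))"
      by simp
    finally show ?thesis by (simp add: field_simps)
  qed
  have "(LINT t|lborel. exp (\<i> * of_real (v / \<epsilon> * t)) * complex_of_real (exp (- (t ^ 2) / 2))) =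
     \<bar>\<epsilon>\<bar> *\<^sub>R (LINT t|lborel. exp (\<i> * of_real (v / \<epsilon> * (0 + \<epsilon> * t))) * complex_of_real (exp (- ((0 + \<epsilon> * t) ^ 2) / 2)))"
    using e by (intro lborel_integral_real_affine) auto
  then show ?thesis using e unfolding base by (simp add: scaleR_conv_of_real field_simps)
qed

text \<open>Gaussian damping makes Fubini's theorem applicable, and the inner integral over t is
  then a narrow Gaussian around x. As the damping is removed, one side converges because
  \<open>gh\<close> is integrable, the other because g is continuous and bounded.\<close>

theorem fourier_inversion:
  fixes g :: "real \<Rightarrow> complex"
  assumes g: "integrable lborel g" and cont: "continuous_on UNIV g" and B: "\<And>x. norm (g x) \<le> B"
  defines "gh \<equiv> (\<lambda>t. LINT y|lborel. exp (- \<i> * of_real (t * y)) * g y)"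
  assumes gh: "integrable lborel gh"
  shows "(LINT t|lborel. exp (\<i> * of_real (t * x)) * gh t) = 2 * of_real pi * g x"
proof -
  have [measurable]: "g \<in> borel_measurable borel" using cont by (rule borel_measurable_continuous_onI)
  have [measurable]: "gh \<in> borel_measurable lborel" using gh by auto
  define e where "e = (\<lambda>n. inverse (real (Suc n)))"
  have e: "e n > 0" "e \<longlonglongrightarrow> 0" for n unfolding e_def using LIMSEQ_inverse_real_of_nat by auto
  define A where "A = (\<lambda>n. LINT t|lborel. exp (\<i> * of_real (t * x)) * gh t * complex_of_real (exp (- ((e n * t) ^ 2) / 2)))"
  have l1: "A \<longlonglongrightarrow> (LINT t|lborel. exp (\<i> * of_real (t * x)) * gh t)"
    unfolding A_def
  proof (rule integral_dominated_convergence[where w = "\<lambda>t. norm (gh t)"])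
    show "AE t in lborel. (\<lambda>n. exp (\<i> * of_real (t * x)) * gh t * complex_of_real (exp (- ((e n * t) ^ 2) / 2))) \<longlonglongrightarrow> exp (\<i> * of_real (t * x)) * gh t"
    proof (rule AE_I2)
      fix t
      have "(\<lambda>n. exp (\<i> * of_real (t * x)) * gh t * complex_of_real (exp (- ((e n * t) ^ 2) / 2))) \<longlonglongrightarrow> exp (\<i> * of_real (t * x)) * gh t * complex_of_real (exp (- ((0 * t) ^ 2) / 2))"
        by (intro tendsto_intros e(2)) auto
      then show "(\<lambda>n. exp (\<i> * of_real (t * x)) * gh t * complex_of_real (exp (- ((e n * t) ^ 2) / 2))) \<longlonglongrightarrow> exp (\<i> * of_real (t * x)) * gh t"
        by simp
    qed
    show "AE t in lborel. norm (exp (\<i> * of_real (t * x)) * gh t * complex_of_real (exp (- ((e n * t) ^ 2) / 2))) \<le> norm (gh t)" for n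
      by (rule AE_I2) (simp add: norm_mult mult_left_le)
  qed (use gh in auto)
  have l2: "A n = of_real (sqrt (2 * pi)) * (LINT s|lborel. g (x + e n * s) * complex_of_real (exp (- (s ^ 2) / 2)))" for n
  proof -
    define f where "f = (\<lambda>(t, y). exp (\<i> * of_real (t * x)) * (exp (- \<i> * of_real (t * y)) * g y) * complex_of_real (exp (- ((e n * t) ^ 2) / 2)))"
    have fm [measurable]: "f \<in> borel_measurable (lborel \<Otimes>\<^sub>M lborel)" unfolding f_def by measurable
    have fint: "integrable (lborel \<Otimes>\<^sub>M lborel) f"
    proof (rule Bochner_Integration.integrable_bound)
      show "integrable (lborel \<Otimes>\<^sub>M lborel) (\<lambda>(t, y). exp (- ((e n * t) ^ 2) / 2) * norm (g y))"
        using e(1)[of n] g by (intro lborel_pair.integrable_pair_mult(1) gaussian_integrable integrable_norm)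
      show "AE p in lborel \<Otimes>\<^sub>M lborel. norm (f p) \<le> norm (case p of (t, y) \<Rightarrow> exp (- ((e n * t) ^ 2) / 2) * norm (g y))"
        by (rule AE_I2) (auto simp: f_def norm_mult split: prod.splits)
    qed measurable
    have "A n = (LINT t|lborel. LINT y|lborel. f (t, y))"
      unfolding A_def gh_def f_def
      by (intro Bochner_Integration.integral_cong refl)
         (simp only: prod.case integral_mult_right_zero integral_mult_left_zero)
    also have "\<dots> = (LINT y|lborel. LINT t|lborel. f (t, y))"
      using lborel_pair.Fubini_integral[of "\<lambda>t y. f (t, y)"] fint by simp
    also have "\<dots> = (LINT y|lborel. g y * of_real (sqrt (2 * pi) / e n * exp (- (((x - y) / e n) ^ 2) / 2)))"
    proof (intro Bochner_Integration.integral_cong refl)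
      fix y
      have "(LINT t|lborel. f (t, y)) = (LINT t|lborel. g y * (exp (\<i> * of_real ((x - y) * t)) * complex_of_real (exp (- ((e n * t) ^ 2) / 2))))"
      proof (intro Bochner_Integration.integral_cong refl)
        fix t
        have "exp (\<i> * of_real ((x - y) * t)) = exp (\<i> * of_real (t * x)) * exp (- \<i> * of_real (t * y))"
          unfolding exp_add[symmetric] by (simp add: algebra_simps)
        then show "f (t, y) = g y * (exp (\<i> * of_real ((x - y) * t)) * complex_of_real (exp (- ((e n * t) ^ 2) / 2)))"
          by (simp add: f_def mult_ac)
      qed
      also have "\<dots> = g y * (LINT t|lborel. exp (\<i> * of_real ((x - y) * t)) * complex_of_real (exp (- ((e n * t) ^ 2) / 2)))"
        by (rule integral_mult_right_zero)
      finally show "(LINT t|lborel. f (t, y)) = g y * of_real (sqrt (2 * pi) / e n * exp (- (((x - y) / e n) ^ 2) / 2))"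
        by (simp only: gaussian_fourier[OF e(1)])
    qed
    also have "\<dots> = \<bar>e n\<bar> *\<^sub>R (LINT s|lborel. g (x + e n * s) * of_real (sqrt (2 * pi) / e n * exp (- (((x - (x + e n * s)) / e n) ^ 2) / 2)))"
      using e(1)[of n] by (intro lborel_integral_real_affine) auto
    also have "\<dots> = of_real (e n) * (LINT s|lborel. of_real (sqrt (2 * pi) / e n) * (g (x + e n * s) * complex_of_real (exp (- (s ^ 2) / 2))))"
      using e(1)[of n] by (simp add: scaleR_conv_of_real mult_ac)
    also have "\<dots> = of_real (sqrt (2 * pi)) * (LINT s|lborel. g (x + e n * s) * complex_of_real (exp (- (s ^ 2) / 2)))"
      using e(1)[of n] by simp
    finally show ?thesis .
  qed
  have l3: "(\<lambda>n. of_real (sqrt (2 * pi)) * (LINT s|lborel. g (x + e n * s) * complex_of_real (exp (- (s ^ 2) / 2))))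
      \<longlonglongrightarrow> of_real (sqrt (2 * pi)) * (LINT s|lborel. g x * complex_of_real (exp (- (s ^ 2) / 2)))"
  proof (intro tendsto_mult tendsto_const, rule integral_dominated_convergence[where w = "\<lambda>s. B * exp (- (s ^ 2) / 2)"])
    show "AE s in lborel. (\<lambda>n. g (x + e n * s) * complex_of_real (exp (- (s ^ 2) / 2))) \<longlonglongrightarrow> g x * complex_of_real (exp (- (s ^ 2) / 2))"
    proof (rule AE_I2)
      fix s
      have "(\<lambda>n. x + e n * s) \<longlonglongrightarrow> x + 0 * s" by (intro tendsto_intros e(2))
      then have "(\<lambda>n. x + e n * s) \<longlonglongrightarrow> x" by simp
      moreover have "isCont g x" using cont by (simp add: continuous_on_eq_continuous_at)
      ultimately have "(\<lambda>n. g (x + e n * s)) \<longlonglongrightarrow> g x" by (rule isCont_tendsto_compose[rotated])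
      then show "(\<lambda>n. g (x + e n * s) * complex_of_real (exp (- (s ^ 2) / 2))) \<longlonglongrightarrow> g x * complex_of_real (exp (- (s ^ 2) / 2))"
        by (intro tendsto_intros)
    qed
    show "integrable lborel (\<lambda>s. B * exp (- (s ^ 2) / 2))"
      using gaussian_integrable[of 1] by (intro integrable_mult_right) simp
  qed (use B in \<open>auto simp: norm_mult intro!: mult_right_mono\<close>)
  have l4: "of_real (sqrt (2 * pi)) * (LINT s|lborel. g x * complex_of_real (exp (- (s ^ 2) / 2))) = 2 * of_real pi * g x"
  proof -
    have "(LINT s|lborel. complex_of_real (exp (- (s ^ 2) / 2))) = of_real (sqrt (2 * pi))"
      using gaussian_fourier[of 1 0] by simp
    then have "of_real (sqrt (2 * pi)) * (LINT s|lborel. g x * complex_of_real (exp (- (s ^ 2) / 2))) = g x * complex_of_real (sqrt (2 * pi) * sqrt (2 * pi))"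
      by (simp only: integral_mult_right_zero of_real_mult mult_ac)
    also have "sqrt (2 * pi) * sqrt (2 * pi) = 2 * pi" by simp
    finally show ?thesis by simp
  qed
  have "A \<longlonglongrightarrow> 2 * of_real pi * g x" using l3 unfolding l4 by (simp only: l2[symmetric])
  then show ?thesis by (rule LIMSEQ_unique[OF l1])
qed

text \<open>Fourier inversion for exp(-y) \<psi>(y), whose Fourier transform is the Laplace
  transform on the line of real part 1; the factor exp(x) is restored at the end.\<close>

theorem laplace_inversion:
  assumes pb: "poly_bounded \<psi>" and cont: "continuous_on UNIV \<psi>"
    and int: "integrable lborel (\<lambda>t. laplace \<psi> (Complex 1 t))"
  shows "(LINT t|lborel. exp (Complex 1 t * of_real x) * laplace \<psi> (Complex 1 t)) = 2 * of_real pi * of_real (\<psi> x)"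
proof -
  define g where "g = (\<lambda>y. complex_of_real (exp (- y) * \<psi> y))"
  have geq: "exp (- 1 * of_real y) * complex_of_real (\<psi> y) = g y" for y
    by (simp add: g_def exp_of_real flip: of_real_minus)
  have gi: "integrable lborel g" using laplace_integrable[OF pb, of 1] unfolding geq by simp
  obtain C where C: "C \<ge> 0" "\<And>x. \<bar>\<psi> x\<bar> \<le> C * exp (1 * x) * indicator {0..} x"
    using poly_bounded_exp_bound[OF pb, of 1] by auto
  have bd: "norm (g y) \<le> C" for y
  proof -
    have "norm (g y) = exp (- y) * \<bar>\<psi> y\<bar>" by (simp add: g_def abs_mult del: of_real_mult)
    also have "\<dots> \<le> exp (- y) * (C * exp y)"
      using C(2)[of y] C(1) by (intro mult_left_mono) (auto simp: indicator_def split: if_splits intro: order_trans)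
    also have "\<dots> = C" by (simp add: exp_minus)
    finally show ?thesis .
  qed
  have gh: "(LINT y|lborel. exp (- \<i> * of_real (t * y)) * g y) = laplace \<psi> (Complex 1 t)" for t
    unfolding laplace_def
  proof (intro Bochner_Integration.integral_cong refl)
    fix y
    have "exp (- Complex 1 t * of_real y) = exp (- \<i> * of_real (t * y)) * exp (- 1 * of_real y)"
      unfolding exp_add[symmetric] by (intro arg_cong[of _ _ exp]) (simp add: complex_eq_iff)
    then show "exp (- \<i> * of_real (t * y)) * g y = exp (- Complex 1 t * of_real y) * complex_of_real (\<psi> y)"
      by (simp only: geq[symmetric] mult.assoc)
  qed
  have "(LINT t|lborel. exp (\<i> * of_real (t * x)) * laplace \<psi> (Complex 1 t)) = 2 * of_real pi * g x"
  proof -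
    have "continuous_on UNIV g" unfolding g_def using cont by (intro continuous_intros)
    from fourier_inversion[OF gi this bd, of x] int show ?thesis by (simp only: gh)
  qed
  then have "of_real (exp x) * (LINT t|lborel. exp (\<i> * of_real (t * x)) * laplace \<psi> (Complex 1 t)) = 2 * of_real pi * (of_real (exp x * exp (- x)) * of_real (\<psi> x))"
    by (simp add: g_def mult_ac)
  also have "exp x * exp (- x) = 1" by (simp add: exp_minus)
  finally have *: "of_real (exp x) * (LINT t|lborel. exp (\<i> * of_real (t * x)) * laplace \<psi> (Complex 1 t)) = 2 * of_real pi * of_real (\<psi> x)" by simp
  have "exp (Complex 1 t * of_real x) = of_real (exp x) * exp (\<i> * of_real (t * x))" for t
    unfolding exp_of_real[symmetric] exp_add[symmetric] by (intro arg_cong[of _ _ exp]) (simp add: complex_eq_iff)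
  then have "(LINT t|lborel. exp (Complex 1 t * of_real x) * laplace \<psi> (Complex 1 t)) = (LINT t|lborel. of_real (exp x) * (exp (\<i> * of_real (t * x)) * laplace \<psi> (Complex 1 t)))"
    by (simp only: mult.assoc)
  then show ?thesis using * by simp
qed

text \<open>The zero of x^n at the origin joins the branch x^n F to 0. With n = m - k this is one of
  the places where m > k enters.\<close>

lemma delay_fun_continuous:
  assumes "n \<ge> 1" shows "continuous_on UNIV (delay_fun \<kappa> n)"
proof -
  have "delay_fun \<kappa> n = (\<lambda>x. max 0 x ^ n * dde_aux (- \<kappa>) (int n + \<kappa>) x)"
    using assms by (intro ext) (auto simp: delay_fun_def max_def)
  then show ?thesis by (auto intro!: continuous_intros delay_aux_cont)
qed

lemma integrable_norm_powr:
  assumes "c > 1" shows "integrable lborel (\<lambda>t. norm (Complex 1 t) powr (- c))"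
proof -
  have int: "integrable lborel (\<lambda>t. t powr (- c) * indicator {1..} t :: real)"
  proof -
    have "((\<lambda>x. x powr (- c)) has_integral -(1 powr (- c + 1)) / (- c + 1)) {1..}"
      using assms by (intro has_integral_powr_to_inf) auto
    then have "(\<lambda>x. x powr (- c)) absolutely_integrable_on {1..}"
      by (intro nonnegative_absolutely_integrable_1) (auto simp: integrable_on_def)
    then have "integrable lebesgue (\<lambda>t. t powr (- c) * indicator {1..} t :: real)"
      by (simp add: set_integrable_def mult.commute)
    then show ?thesis by (subst (asm) integrable_completion) auto
  qed
  have int2: "integrable lborel (\<lambda>t. (- t) powr (- c) * indicator {1..} (- t) :: real)"
    using lborel_integrable_real_affine[OF int, of "-1" 0] by simp
  have int3: "integrable lborel (\<lambda>t. indicator {-1..1} (t::real) :: real)"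
    by (intro integrable_real_indicator) (auto simp: emeasure_lborel_Icc)
  have "integrable lborel (\<lambda>t. indicator {-1..1} t + (t powr (- c) * indicator {1..} t + (- t) powr (- c) * indicator {1..} (- t)) :: real)"
    by (intro Bochner_Integration.integrable_add int int2 int3)
  then show ?thesis
  proof (rule Bochner_Integration.integrable_bound)
    show "(\<lambda>t. norm (Complex 1 t) powr (- c)) \<in> borel_measurable lborel"
      unfolding complex_norm by measurable
    show "AE t in lborel. norm (norm (Complex 1 t) powr (- c)) \<le> norm (indicator {-1..1} t + (t powr (- c) * indicator {1..} t + (- t) powr (- c) * indicator {1..} (- t)) :: real)"
    proof (rule AE_I2)
      fix t :: real
      have "1 \<le> norm (Complex 1 t)" "\<bar>t\<bar> \<le> norm (Complex 1 t)"
        using abs_Re_le_cmod[of "Complex 1 t"] abs_Im_le_cmod[of "Complex 1 t"] by auto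
      then have "norm (Complex 1 t) powr (- c) \<le> 1 powr (- c)"
        and "\<bar>t\<bar> > 0 \<Longrightarrow> norm (Complex 1 t) powr (- c) \<le> \<bar>t\<bar> powr (- c)"
        using assms by (intro powr_mono2'; simp)+
      then show "norm (norm (Complex 1 t) powr (- c)) \<le> norm (indicator {-1..1} t + (t powr (- c) * indicator {1..} t + (- t) powr (- c) * indicator {1..} (- t)) :: real)"
        by (auto simp: indicator_def abs_if split: if_splits)
    qed
  qed
qed

section \<open>The functional I as a single integral\<close>

lemma dde_f_eq_dde_aux:
  assumes "k' + m \<ge> 0" shows "dde_f v k' m = dde_aux k' m v"
proof -
  have "(THE f. dde_solution k' m f \<and> (\<forall>w\<le>0. f w = 1)) = dde_aux k' m"
    by (rule the1_equality[OF dde_solution_ex1[OF assms]])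
       (auto simp: dde_aux_solution[OF assms] dde_aux.simps)
  then show ?thesis by (simp add: dde_f_def)
qed

lemma higher_deriv_P_fun:
  "j \<le> m \<Longrightarrow> (deriv ^^ j) (P_fun m) = (\<lambda>x. fact m / fact (m - j) * x ^ (m - j))"
proof (induction j)
  case 0
  then show ?case by (simp add: P_fun_def[abs_def])
next
  case (Suc j)
  have "deriv (\<lambda>x. fact m / fact (m - j) * x ^ (m - j)) x = fact m / fact (m - Suc j) * x ^ (m - Suc j)" for x :: real
  proof (rule DERIV_imp_deriv)
    have e: "m - j = Suc (m - Suc j)" using Suc.prems by simp
    have f: "fact (m - j) = real (m - j) * fact (m - Suc j)" unfolding e by (simp add: fact_Suc)
    have "((\<lambda>x. fact m / fact (m - j) * x ^ (m - j)) has_real_derivative fact m / fact (m - j) * (real (m - j) * x ^ (m - Suc j))) (at x)"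
      by (rule derivative_eq_intros refl | simp)+
    also have "fact m / fact (m - j) * (real (m - j) * x ^ (m - Suc j)) = fact m / fact (m - Suc j) * x ^ (m - Suc j)"
      using Suc.prems unfolding f by simp
    finally show "((\<lambda>x. fact m / fact (m - j) * x ^ (m - j)) has_real_derivative fact m / fact (m - Suc j) * x ^ (m - Suc j)) (at x)" .
  qed
  then have "deriv (\<lambda>x::real. fact m / fact (m - j) * x ^ (m - j)) = (\<lambda>x. fact m / fact (m - Suc j) * x ^ (m - Suc j))"
    by (rule ext)
  then show ?case using Suc by simp
qed

text \<open>Here \<rho> = f(.; k, -1), which for k = 1 is Dickman's function. It is the weight that
  arises when the recursion for I_k is unrolled.\<close>

context
  fixes k :: nat and \<rho> W :: "real \<Rightarrow> real"
  assumes k: "k \<ge> 1"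
  defines "\<rho> \<equiv> dde_aux (int k) (- 1)"
  defines "W \<equiv> delay_fun (- int k) (k - 1)"
begin

lemma rho_eq: "\<rho> = dde_aux (- (- int k)) (int (k - 1) + (- int k))"
  using k by (simp add: \<rho>_def of_nat_diff)

lemmas rho_cont = delay_aux_cont[of _ "- int k" "k - 1", folded rho_eq]
lemmas rho_le1 = delay_aux_le1[of _ "- int k" "k - 1", folded rho_eq]

lemma W_eq: "W x = (if x \<le> 0 then 0 else x ^ (k - 1) * \<rho> x)"
  unfolding W_def delay_fun_def rho_eq ..

lemma rho_deriv: "v > 1 \<Longrightarrow> (\<rho> has_real_derivative - real k * (v - 1) ^ (k - 1) / v ^ k * \<rho> (v - 1)) (at v)"
  using delay_aux_deriv[of v "- int k" "k - 1", folded rho_eq] k by simp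

lemma W_measurable: "W \<in> borel_measurable borel"
  unfolding W_def by (rule delay_fun_measurable)

text \<open>The delay equation in integrated form: as a function of w, -y^(k-1) \<rho>(w y) / k is
  an antiderivative of the integrand. While w y < 1 both sides of the equation vanish, \<rho> being
  constant and W cut off. This will be the inner integral in Fubini's theorem.\<close>

lemma rho_integral_identity:
  assumes y: "0 < y" "y \<le> 1" and v: "v \<ge> 1"
  shows "((\<lambda>w. W (w * y - 1) / w ^ k) has_integral y ^ (k - 1) * (1 - \<rho> (v * y)) / real k) {1..v}"
proof -
  define H where "H = (\<lambda>w. - (y ^ (k - 1)) * \<rho> (w * y) / real k)"
  have "((\<lambda>w. W (w * y - 1) / w ^ k) has_integral H v - H 1) {1..v}"
  proof (rule fundamental_theorem_of_calculus_interior_strong[of "{1 / y}"])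
    fix w assume w: "w \<in> {1<..<v} - {1 / y}"
    show "(H has_vector_derivative W (w * y - 1) / w ^ k) (at w)"
      unfolding has_real_derivative_iff_has_vector_derivative[symmetric]
    proof (cases "w * y < 1")
      case True
      have "((\<lambda>w. - (y ^ (k - 1)) * 1 / real k) has_real_derivative 0) (at w)" by simp
      then have "(H has_real_derivative 0) (at w)"
      proof (rule has_field_derivative_transform_within_open[of _ _ _ "{..<1/y}"])
        show "w \<in> {..<1/y}" using True y by (simp add: field_simps)
        show "- (y ^ (k - 1)) * 1 / real k = H w" if "w \<in> {..<1/y}" for w
        proof -
          have "w * y \<le> 1" using that y by (simp add: field_simps)
          then show ?thesis by (simp add: H_def rho_le1)
        qed
      qed simp
      then show "(H has_real_derivative W (w * y - 1) / w ^ k) (at w)" using True by (simp add: W_eq)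
    next
      case False
      then have wy: "w * y > 1" using w y by (auto simp: field_simps)
      have "((\<lambda>w. w * y) has_real_derivative y) (at w)" by (auto intro!: derivative_eq_intros)
      from DERIV_chain2[OF rho_deriv[OF wy] this]
      have "((\<lambda>w. \<rho> (w * y)) has_real_derivative - real k * (w * y - 1) ^ (k - 1) / (w * y) ^ k * \<rho> (w * y - 1) * y) (at w)" .
      then have "(H has_real_derivative (- (y ^ (k - 1)) * (- real k * (w * y - 1) ^ (k - 1) / (w * y) ^ k * \<rho> (w * y - 1) * y)) / real k) (at w)"
        unfolding H_def by (intro DERIV_cdivide DERIV_cmult)
      also have "(- (y ^ (k - 1)) * (- real k * (w * y - 1) ^ (k - 1) / (w * y) ^ k * \<rho> (w * y - 1) * y)) / real k
          = (y * y ^ (k - 1)) * ((w * y - 1) ^ (k - 1) / (w * y) ^ k * \<rho> (w * y - 1))"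
        using k by simp
      also have "y * y ^ (k - 1) = y ^ k" using k by (cases k) auto
      also have "y ^ k * ((w * y - 1) ^ (k - 1) / (w * y) ^ k * \<rho> (w * y - 1)) = W (w * y - 1) / w ^ k"
        using y wy w by (simp add: W_eq power_mult_distrib)
      finally show "(H has_real_derivative W (w * y - 1) / w ^ k) (at w)" .
    qed
  next
    show "continuous_on {1..v} H" unfolding H_def
      by (intro continuous_intros continuous_on_compose2[OF rho_cont[of UNIV]]) (use k in auto)
  qed (use v in auto)
  moreover have "H v - H 1 = y ^ (k - 1) * (1 - \<rho> (v * y)) / real k"
    using y by (simp add: H_def rho_le1 algebra_simps diff_divide_distrib)
  ultimately show ?thesis by simp
qed

text \<open>By a conserved quantity: x^k \<rho>(x) minus k times the integral of V over [x-1, x] is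
  0 for x >= 1, where V(s) = s^(k-1) \<rho>(s). At a first zero y0 the integral of V over
  [y0 - 1, y0] would vanish although V is positive in the interior.\<close>

lemma rho_pos: "\<rho> y > 0"
proof (rule ccontr)
  assume "\<not> \<rho> y > 0"
  then have y: "\<rho> y \<le> 0" by simp
  then have y1: "y > 1" using rho_le1[of y] by (cases "y \<le> 1") auto
  define S where "S = {1..y} \<inter> \<rho> -` {0}"
  have "compact S" unfolding S_def
    using continuous_closed_preimage[OF rho_cont[of "{1..y}"], of "{0}"]
    by (simp add: compact_eq_bounded_closed bounded_subset[of "{1..y}"])
  moreover have "S \<noteq> {}"
    using IVT2'[of \<rho> y 0 1] y y1 rho_le1[of 1] rho_cont by (auto simp: S_def)
  ultimately obtain y0 where y0: "y0 \<in> S" "\<And>x. x \<in> S \<Longrightarrow> y0 \<le> x"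
    using compact_attains_inf[of S] by blast
  have y0': "1 < y0" "y0 \<le> y" "\<rho> y0 = 0"
    using y0(1) rho_le1[of 1] by (auto simp: S_def order.strict_iff_order)
  have pos: "\<rho> x > 0" if "x < y0" for x
  proof (rule ccontr)
    assume n: "\<not> \<rho> x > 0"
    then have x1: "x > 1" using rho_le1[of x] by (cases "x \<le> 1") auto
    then obtain z where "1 \<le> z" "z \<le> x" "\<rho> z = 0"
      using IVT2'[of \<rho> x 0 1] n rho_le1[of 1] rho_cont by auto
    then show False using y0(2)[of z] that y0' by (auto simp: S_def)
  qed
  define V where "V = (\<lambda>x. x ^ (k - 1) * \<rho> x)"
  have Vc: "continuous_on A V" for A unfolding V_def by (intro continuous_intros rho_cont)
  have Vi: "V integrable_on {a..b}" for a b by (intro integrable_continuous_interval Vc)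
  \<comment> \<open>The integral over [x-1, x] is written as a difference of two integrals from 0,
    so that each is differentiated by the fundamental theorem of calculus.\<close>
  define Z where "Z = (\<lambda>x. x ^ k * \<rho> x - real k * (integral {0..x} V - integral {0..x - 1} V))"
  have "Z y0 = Z 1"
  proof (rule DERIV_isconst_end[where f = Z])
    show "continuous_on {1..y0} Z"
    proof -
      have c: "continuous_on {0..y0} (\<lambda>x. integral {0..x} V)" by (intro indefinite_integral_continuous_1 Vi)
      show ?thesis unfolding Z_def
        by (intro continuous_intros rho_cont continuous_on_compose2[OF c] continuous_on_subset[OF c]) auto
    qed
    fix x assume x: "1 < x" "x < y0"
    have d: "((\<lambda>x. integral {0..x} V) has_real_derivative V z) (at z)" if "z > 0" for z
    proof -
      have "((\<lambda>x. integral {0..x} V) has_real_derivative V z) (at z within {0..z + 1})"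
        using that by (intro integral_has_real_derivative Vc) auto
      then show ?thesis using that by (simp add: at_within_Icc_at)
    qed
    have "((\<lambda>x. integral {0..x - 1} V) has_real_derivative V (x - 1) * 1) (at x)"
      using x by (intro DERIV_chain2[of "\<lambda>x. integral {0..x} V" _ "\<lambda>x. x - 1"] d) (auto intro!: derivative_eq_intros)
    then have "(Z has_real_derivative ((real k * x ^ (k - 1)) * \<rho> x + (- real k * (x - 1) ^ (k - 1) / x ^ k * \<rho> (x - 1)) * x ^ k)
        - real k * (V x - V (x - 1) * 1)) (at x)"
      unfolding Z_def using x
      by (intro DERIV_diff DERIV_mult DERIV_cmult d rho_deriv DERIV_pow[of k, simplified]) auto
    also have "((real k * x ^ (k - 1)) * \<rho> x + (- real k * (x - 1) ^ (k - 1) / x ^ k * \<rho> (x - 1)) * x ^ k)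
        - real k * (V x - V (x - 1) * 1) = 0"
      using x by (simp add: V_def algebra_simps)
    finally show "(Z has_real_derivative 0) (at x)" .
  qed (use y0' in auto)
  also have "Z 1 = 0"
  proof -
    have "integral {0..1} V = integral {0..1} (\<lambda>x. x ^ (k - 1))"
      by (intro integral_cong) (auto simp: V_def rho_le1)
    moreover have "((\<lambda>x. x ^ (k - 1)) has_integral 1 ^ k / real k - 0 ^ k / real k) {0..1}"
    proof (rule fundamental_theorem_of_calculus)
      fix x :: real
      have "((\<lambda>x. x ^ k / real k) has_real_derivative real k * x ^ (k - 1) / real k) (at x within {0..1})"
        using DERIV_pow[of k x "{0..1}"] by (intro DERIV_cdivide) simp
      then show "((\<lambda>x. x ^ k / real k) has_vector_derivative x ^ (k - 1)) (at x within {0..1})"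
        using k by (simp add: has_real_derivative_iff_has_vector_derivative)
    qed simp
    ultimately have "integral {0..1} V = 1 / real k" using k by (simp add: integral_unique)
    then show ?thesis using k by (simp add: Z_def rho_le1)
  qed
  finally have "integral {0..y0} V - integral {0..y0 - 1} V = 0" using y0' k by (simp add: Z_def)
  moreover have "integral {0..y0 - 1} V + integral {y0 - 1..y0} V = integral {0..y0} V"
    using y0' by (intro Henstock_Kurzweil_Integration.integral_combine Vi) auto
  ultimately have "integral {y0 - 1..y0} V = 0" by simp
  moreover have "V x \<ge> 0" if "x \<in> {y0 - 1..y0}" for x
    using that y0' pos[of x] by (cases "x = y0") (auto simp: V_def)
  ultimately have "\<forall>x\<in>{y0 - 1..y0}. V x = 0"
    using integral_eq_0_iff[of "y0 - 1" y0 V] Vc y0' by auto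
  then have "V (y0 - 1/2) = 0" using y0' by auto
  moreover have "V (y0 - 1/2) > 0" using y0' pos[of "y0 - 1/2"] by (auto simp: V_def intro!: mult_pos_pos)
  ultimately show False by simp
qed

lemma W_nonneg: "W x \<ge> 0"
  using rho_pos[of x] by (simp add: W_eq)

context
  fixes \<Phi> :: "real \<Rightarrow> real"
  assumes \<Phi>: "continuous_on UNIV \<Phi>"
begin

text \<open>The closed form to which the recursion for I_k unrolls. For 0 <= v <= 1 the factor
  \<rho> is 1 on the whole range, which is the initial formula for I_k.\<close>

definition delay_integral :: "real \<Rightarrow> real \<Rightarrow> real" where
  "delay_integral t v = integral {0..1} (\<lambda>x. (1 - x) ^ (k - 1) / fact (k - 1) * \<rho> (v * (1 - x)) * \<Phi> (x * t))"

lemma Phi_measurable: "\<Phi> \<in> borel_measurable borel"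
  using \<Phi> by (rule borel_measurable_continuous_onI)

lemma delay_integral_integrand_cont: "continuous_on A (\<lambda>x. (1 - x) ^ (k - 1) / fact (k - 1) * \<rho> (v * (1 - x)) * \<Phi> (x * t))"
  by (intro continuous_intros continuous_on_compose2[OF rho_cont[of UNIV]] continuous_on_compose2[OF \<Phi>]) auto

lemma delay_integral_lint: "integrable lborel (\<lambda>x. indicator {0..1} x *\<^sub>R ((1 - x) ^ (k - 1) / fact (k - 1) * \<rho> (v * (1 - x)) * \<Phi> (x * t)))"
    "delay_integral t v = (LINT x|lborel. indicator {0..1} x *\<^sub>R ((1 - x) ^ (k - 1) / fact (k - 1) * \<rho> (v * (1 - x)) * \<Phi> (x * t)))"
proof -
  have *: "set_integrable lborel {0..1} (\<lambda>x. (1 - x) ^ (k - 1) / fact (k - 1) * \<rho> (v * (1 - x)) * \<Phi> (x * t))"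
    by (rule borel_integrable_atLeastAtMost'[OF delay_integral_integrand_cont])
  then show "integrable lborel (\<lambda>x. indicator {0..1} x *\<^sub>R ((1 - x) ^ (k - 1) / fact (k - 1) * \<rho> (v * (1 - x)) * \<Phi> (x * t)))"
    by (simp add: set_integrable_def)
  show "delay_integral t v = (LINT x|lborel. indicator {0..1} x *\<^sub>R ((1 - x) ^ (k - 1) / fact (k - 1) * \<rho> (v * (1 - x)) * \<Phi> (x * t)))"
    unfolding delay_integral_def using set_borel_integral_eq_integral(2)[OF *] by (simp add: set_lebesgue_integral_def)
qed

text \<open>Substituting x -> (1 - 1/w) x turns w (1 - x) - 1 into (w - 1)(1 - x). The cutoff of W
  encodes the shrunken range x <= 1 - 1/w, so the range of x no longer depends on w and Fubini's
  theorem can be used.\<close>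

lemma delay_integral_scaled:
  assumes w: "w \<ge> 1"
  shows "delay_integral ((1 - 1 / w) * t) (w - 1) * (1 - 1 / w) ^ k / w =
    (LINT x|lborel. indicator {0..1} x * (W (w * (1 - x) - 1) / w ^ k * (\<Phi> (x * t) / fact (k - 1))))"
proof (cases "w = 1")
  case True
  have "indicator {0..1} x * (W (w * (1 - x) - 1) / w ^ k * (\<Phi> (x * t) / fact (k - 1))) = (0::real)" for x :: real
    using True by (auto simp: W_eq indicator_def)
  then show ?thesis using True k by (simp only: integral_zero) simp
next
  case False
  define c where "c = 1 - 1 / w"
  have c: "c > 0" "c < 1" "w * c = w - 1" using w False by (auto simp: c_def field_simps)
  have "(LINT x|lborel. indicator {0..1} x * (W (w * (1 - x) - 1) / w ^ k * (\<Phi> (x * t) / fact (k - 1))))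
     = \<bar>c\<bar> *\<^sub>R (LINT x|lborel. indicator {0..1} (0 + c * x) * (W (w * (1 - (0 + c * x)) - 1) / w ^ k * (\<Phi> ((0 + c * x) * t) / fact (k - 1))))"
    using c by (intro lborel_integral_real_affine) auto
  also have "(LINT x|lborel. indicator {0..1} (0 + c * x) * (W (w * (1 - (0 + c * x)) - 1) / w ^ k * (\<Phi> ((0 + c * x) * t) / fact (k - 1))))
     = (LINT x|lborel. (w - 1) ^ (k - 1) / w ^ k * (indicator {0..1} x *\<^sub>R ((1 - x) ^ (k - 1) / fact (k - 1) * \<rho> ((w - 1) * (1 - x)) * \<Phi> (x * (c * t)))))"
  proof (rule integral_cong_AE)
    show "AE x in lborel. indicator {0..1} (0 + c * x) * (W (w * (1 - (0 + c * x)) - 1) / w ^ k * (\<Phi> ((0 + c * x) * t) / fact (k - 1))) =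
      (w - 1) ^ (k - 1) / w ^ k * (indicator {0..1} x *\<^sub>R ((1 - x) ^ (k - 1) / fact (k - 1) * \<rho> ((w - 1) * (1 - x)) * \<Phi> (x * (c * t))))"
      \<comment> \<open>The point x = 1 is left out: for k = 1 the left side has W(0) = 0 there,
        while the power (1 - x)^(k-1) on the right is 1.\<close>
      using AE_lborel_singleton[of "1::real"]
    proof eventually_elim
      case (elim x)
      have "w * (1 - (0 + c * x)) - 1 = w - 1 - (w * c) * x" by (simp add: algebra_simps)
      also have "\<dots> = (w - 1) * (1 - x)" unfolding c(3) by (simp add: algebra_simps)
      finally have e: "w * (1 - (0 + c * x)) - 1 = (w - 1) * (1 - x)" .
      consider "x < 0" | "0 \<le> x" "x < 1" | "x > 1" using elim by linarith
      then show ?case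
      proof cases
        case 1
        then have "c * x < 0" using c by (simp add: mult_pos_neg)
        then show ?thesis using 1 by simp
      next
        case 2
        then have "0 \<le> c * x" "c * x \<le> 1" using c mult_mono[of c 1 x 1] by auto
        moreover have "(w - 1) * (1 - x) > 0" using 2 w False by auto
        ultimately show ?thesis using 2 unfolding e W_eq by (simp add: power_mult_distrib mult_ac)
      next
        case 3
        then have "(w - 1) * (1 - x) \<le> 0" using w by (intro mult_nonneg_nonpos) auto
        then show ?thesis using 3 unfolding e W_eq by simp
      qed
    qed
    note W_measurable [measurable] Phi_measurable [measurable]
    have [measurable]: "\<rho> \<in> borel_measurable borel" by (rule borel_measurable_continuous_onI[OF rho_cont])
    show "(\<lambda>x. indicator {0..1} (0 + c * x) * (W (w * (1 - (0 + c * x)) - 1) / w ^ k * (\<Phi> ((0 + c * x) * t) / fact (k - 1)))) \<in> borel_measurable lborel"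
      by measurable
    show "(\<lambda>x. (w - 1) ^ (k - 1) / w ^ k * (indicator {0..1} x *\<^sub>R ((1 - x) ^ (k - 1) / fact (k - 1) * \<rho> ((w - 1) * (1 - x)) * \<Phi> (x * (c * t))))) \<in> borel_measurable lborel"
      by measurable
  qed
  also have "\<dots> = (w - 1) ^ (k - 1) / w ^ k * delay_integral (c * t) (w - 1)"
    unfolding delay_integral_lint(2) by (rule integral_mult_right_zero)
  also have "\<bar>c\<bar> *\<^sub>R ((w - 1) ^ (k - 1) / w ^ k * delay_integral (c * t) (w - 1)) = delay_integral (c * t) (w - 1) * c ^ k / w"
  proof -
    have "w ^ k = w * w ^ (k - 1)" "c ^ k = c * c ^ (k - 1)" using k by (cases k; simp)+
    moreover have "(w - 1) ^ (k - 1) = w ^ (k - 1) * c ^ (k - 1)" unfolding c(3)[symmetric] by (simp add: power_mult_distrib)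
    ultimately show ?thesis using c w by simp
  qed
  finally show ?thesis by (simp add: c_def)
qed

text \<open>Fubini's theorem on {1..v} times {0..1}. Integrated over w first, the correction term
  becomes, by \<open>rho_integral_identity\<close> with y = 1 - x, the difference between the
  weights \<rho>(1 - x) = 1 and \<rho>(v (1 - x)).\<close>

lemma delay_integral_recursion:
  assumes v: "v \<ge> 1"
  shows "delay_integral t v = delay_integral t 1 - real k * integral {1..v} (\<lambda>w. delay_integral ((1 - 1 / w) * t) (w - 1) * (1 - 1 / w) ^ k / w)"
proof -
  note W_measurable [measurable] Phi_measurable [measurable]
  define S where "S = (\<lambda>w x. indicator {1..v} w * (indicator {0..1} x * (W (w * (1 - x) - 1) / w ^ k * (\<Phi> (x * t) / fact (k - 1)))))"
  have meas: "case_prod S \<in> borel_measurable (lborel \<Otimes>\<^sub>M lborel)" unfolding S_def case_prod_unfold by measurable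
  obtain B where B: "\<And>x. x \<in> {0..1} \<Longrightarrow> \<bar>\<Phi> (x * t)\<bar> \<le> B"
  proof -
    have "continuous_on {0..1} (\<lambda>x. \<Phi> (x * t))"
      by (intro continuous_on_compose2[OF \<Phi>] continuous_intros) auto
    then have "bounded ((\<lambda>x. \<Phi> (x * t)) ` {0..1})" by (intro compact_imp_bounded compact_continuous_image) auto
    then obtain B where "\<forall>x\<in>{0..1}. \<bar>\<Phi> (x * t)\<bar> \<le> B" by (auto simp: bounded_iff)
    then show ?thesis by (intro that) blast
  qed
  define K where "K = (1 + v) ^ (k - 1 + nat \<bar>- int k\<bar>)"
  have B0: "B \<ge> 0" using B[of 0] by force
  have K0: "K \<ge> 0" using v by (simp add: K_def)
  have intS: "integrable (lborel \<Otimes>\<^sub>M lborel) (case_prod S)"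
  proof (rule Bochner_Integration.integrable_bound)
    have fin: "emeasure (lborel \<Otimes>\<^sub>M lborel) ({1..v} \<times> {0..1::real}) < \<infinity>"
      using v by (subst lborel.emeasure_pair_measure_Times) (auto simp: ennreal_mult_less_top)
    show "integrable (lborel \<Otimes>\<^sub>M lborel) (\<lambda>p. K * B * indicator ({1..v} \<times> {0..1::real}) p)"
      using fin by (intro integrable_mult_right integrable_real_indicator) (auto intro!: pair_measureI)
    show "AE p in lborel \<Otimes>\<^sub>M lborel. norm (case_prod S p) \<le> norm (K * B * indicator ({1..v} \<times> {0..1}) p)"
    proof (rule AE_I2, clarify)
      fix w x :: real
      show "norm (S w x) \<le> norm (K * B * indicator ({1..v} \<times> {0..1}) (w, x))"
      proof (cases "w \<in> {1..v} \<and> x \<in> {0..1}")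
        case True
        have "w * (1 - x) \<le> v * 1" using True v by (intro mult_mono) auto
        have "\<bar>W (w * (1 - x) - 1)\<bar> \<le> K"
        proof (cases "w * (1 - x) - 1 > 0")
          case pos: True
          have "\<bar>W (w * (1 - x) - 1)\<bar> \<le> (1 + (w * (1 - x) - 1)) ^ (k - 1 + nat \<bar>- int k\<bar>)"
            unfolding W_def using pos by (rule delay_fun_bound)
          also have "\<dots> \<le> K" unfolding K_def using pos \<open>w * (1 - x) \<le> v * 1\<close> by (intro power_mono) auto
          finally show ?thesis .
        qed (use K0 in \<open>simp add: W_eq\<close>)
        moreover have "\<bar>\<Phi> (x * t)\<bar> / fact (k - 1) \<le> B"
        proof -
          have "\<bar>\<Phi> (x * t)\<bar> \<le> B" using True B by auto
          also have "B \<le> B * fact (k - 1)" using B0 fact_ge_1[of "k - 1"] by (simp add: mult_le_cancel_left1)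
          finally show ?thesis by (simp add: divide_le_eq)
        qed
        moreover have "\<bar>W (w * (1 - x) - 1)\<bar> / w ^ k \<le> \<bar>W (w * (1 - x) - 1)\<bar> / 1"
          using True by (intro divide_left_mono one_le_power) auto
        ultimately have "(\<bar>W (w * (1 - x) - 1)\<bar> / w ^ k) * (\<bar>\<Phi> (x * t)\<bar> / fact (k - 1)) \<le> K * B"
          using K0 by (intro mult_mono) auto
        then show ?thesis using True B0 K0 by (auto simp: S_def abs_mult abs_divide)
      qed (auto simp: S_def indicator_def)
    qed
  qed (use meas in auto)
  define M where "M = (\<lambda>w. delay_integral ((1 - 1 / w) * t) (w - 1) * (1 - 1 / w) ^ k / w)"
  have innerM: "(LINT x|lborel. S w x) = indicator {1..v} w *\<^sub>R M w" for w
    using delay_integral_scaled[of w t] by (cases "w \<in> {1..v}") (auto simp: S_def M_def)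
  have "set_integrable lborel {1..v} M"
    unfolding set_integrable_def using lborel_pair.integrable_fst'[OF intS] by (simp add: innerM)
  from set_borel_integral_eq_integral(2)[OF this]
  have "integral {1..v} M = (LINT w|lborel. LINT x|lborel. S w x)"
    by (simp add: set_lebesgue_integral_def innerM)
  also have "\<dots> = (LINT x|lborel. LINT w|lborel. S w x)"
    by (rule lborel_pair.Fubini_integral[OF intS, symmetric])
  also have "\<dots> = (LINT x|lborel. indicator {0..1} x *\<^sub>R ((1 - x) ^ (k - 1) / fact (k - 1) * \<rho> (1 * (1 - x)) * \<Phi> (x * t)) / real k
      - indicator {0..1} x *\<^sub>R ((1 - x) ^ (k - 1) / fact (k - 1) * \<rho> (v * (1 - x)) * \<Phi> (x * t)) / real k)"
  proof (rule integral_cong_AE)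
    show "AE x in lborel. (LINT w|lborel. S w x) = indicator {0..1} x *\<^sub>R ((1 - x) ^ (k - 1) / fact (k - 1) * \<rho> (1 * (1 - x)) * \<Phi> (x * t)) / real k
      - indicator {0..1} x *\<^sub>R ((1 - x) ^ (k - 1) / fact (k - 1) * \<rho> (v * (1 - x)) * \<Phi> (x * t)) / real k"
      \<comment> \<open>The identity is applied at y = 1 - x, which has to be positive.\<close>
      using AE_lborel_singleton[of "1::real"]
    proof eventually_elim
      case (elim x)
      show ?case
      proof (cases "x \<in> {0..1}")
        case True
        then have y: "0 < 1 - x" "1 - x \<le> 1" using elim by auto
        let ?h = "\<lambda>w. W (w * (1 - x) - 1) / w ^ k"
        note hi = rho_integral_identity[OF y v]
        have "set_integrable lborel {1..v} ?h"
        proof -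
          have "?h absolutely_integrable_on {1..v}"
          proof (rule nonnegative_absolutely_integrable_1)
            show "?h integrable_on {1..v}" using hi by (auto simp: integrable_on_def)
            show "0 \<le> ?h w" if "w \<in> {1..v}" for w
              using that W_nonneg by (intro divide_nonneg_nonneg) auto
          qed
          then show ?thesis unfolding set_integrable_def by (subst (asm) integrable_completion) auto
        qed
        from set_borel_integral_eq_integral(2)[OF this] hi
        have "(LINT w|lborel. indicator {1..v} w * ?h w) = (1 - x) ^ (k - 1) * (1 - \<rho> (v * (1 - x))) / real k"
          by (simp add: set_lebesgue_integral_def integral_unique)
        moreover have "(LINT w|lborel. S w x) = (LINT w|lborel. (indicator {1..v} w * ?h w) * (\<Phi> (x * t) / fact (k - 1)))"
          using True by (intro Bochner_Integration.integral_cong) (auto simp: S_def)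
        ultimately have "(LINT w|lborel. S w x) = (1 - x) ^ (k - 1) * (1 - \<rho> (v * (1 - x))) / real k * (\<Phi> (x * t) / fact (k - 1))"
          by (simp only: integral_mult_left_zero)
        moreover have "\<rho> (1 * (1 - x)) = 1" using y by (intro rho_le1) simp
        moreover have "q * (1 - r) / real k * (z / f) = q / f * 1 * z / real k - q / f * r * z / real k" for q r z f :: real
          by (simp add: algebra_simps diff_divide_distrib)
        ultimately show ?thesis using True by simp
      qed (simp add: S_def)
    qed
    have [measurable]: "\<rho> \<in> borel_measurable borel" by (rule borel_measurable_continuous_onI[OF rho_cont])
    show "(\<lambda>x. LINT w|lborel. S w x) \<in> borel_measurable lborel"
      using borel_measurable_integrable[OF lborel_pair.integrable_snd[OF intS]] by simp
    show "(\<lambda>x. indicator {0..1} x *\<^sub>R ((1 - x) ^ (k - 1) / fact (k - 1) * \<rho> (1 * (1 - x)) * \<Phi> (x * t)) / real k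
      - indicator {0..1} x *\<^sub>R ((1 - x) ^ (k - 1) / fact (k - 1) * \<rho> (v * (1 - x)) * \<Phi> (x * t)) / real k) \<in> borel_measurable lborel"
      by measurable
  qed
  also have "\<dots> = delay_integral t 1 / real k - delay_integral t v / real k"
    unfolding delay_integral_lint(2)
    by (subst Bochner_Integration.integral_diff[OF integrable_divide integrable_divide, OF delay_integral_lint(1)[of 1 t] delay_integral_lint(1)[of v t]])
       (simp only: integral_divide_zero)
  finally have "delay_integral t v = delay_integral t 1 - real k * integral {1..v} M" using k by (simp add: field_simps)
  then show ?thesis by (simp only: M_def)
qed

end

text \<open>The closed form obeys the same recursion and agrees for v <= 1. Inside the recursion v
  is replaced by x - 1 <= v - 1, so induction over unit intervals of v identifies the two.\<close>

theorem I_fun_eq: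
  fixes u :: real and m :: nat
  assumes m: "m > k" and v: "v > 0"
  defines "\<Phi> \<equiv> (\<lambda>x. (dde_aux (- int k) (int m) (u * x) * (fact m / fact (m - k) * x ^ (m - k)))\<^sup>2)"
  shows "I_fun u m k t v = integral {0..1} (\<lambda>x. (1 - x) ^ (k - 1) / fact (k - 1) * \<rho> (v * (1 - x)) * \<Phi> (x * t))"
proof -
  have eqF: "dde_aux (- int k) (int m) = dde_aux (- int k) (int (m - k) + int k)" using m by (simp add: of_nat_diff)
  have c: "continuous_on UNIV \<Phi>" unfolding \<Phi>_def eqF
    by (intro continuous_intros continuous_on_compose2[OF delay_aux_cont[of UNIV "int k" "m - k"]]) auto
  have P: "(dde_f (u * x * t) (- int k) (int m) * (deriv ^^ k) (P_fun m) (x * t))\<^sup>2 = \<Phi> (x * t)" for x t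
    using m by (simp add: \<Phi>_def dde_f_eq_dde_aux higher_deriv_P_fun mult.assoc)
  have base: "I_fun u m k t v = delay_integral \<Phi> t v" if "v \<le> 1" "0 \<le> v" for t v
  proof -
    have "\<rho> (v * (1 - x)) = 1" if "x \<in> {0..1}" for x
      using that \<open>v \<le> 1\<close> \<open>0 \<le> v\<close> mult_mono[of v 1 "1 - x" 1] by (intro rho_le1) auto
    then show ?thesis using that by (subst I_fun.simps) (auto simp: delay_integral_def[OF c] P intro!: integral_cong)
  qed
  have "I_fun u m k t v = delay_integral \<Phi> t v" if "0 \<le> v" "v \<le> real N + 1" for N t v
    using that
  proof (induction N arbitrary: t v)
    case 0
    then show ?case using base by auto
  next
    case (Suc N)
    show ?case
    proof (cases "v \<le> 1")
      case False
      have "integral {1..v} (\<lambda>x. I_fun u m k ((1 - 1 / x) * t) (x - 1) * (1 - 1 / x) ^ k / x)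
          = integral {1..v} (\<lambda>x. delay_integral \<Phi> ((1 - 1 / x) * t) (x - 1) * (1 - 1 / x) ^ k / x)"
        using Suc.prems by (intro integral_cong) (subst Suc.IH, auto)
      then show ?thesis using False delay_integral_recursion[OF c, of v t] base[of 1 t]
        by (subst I_fun.simps) simp
    qed (use base Suc.prems in auto)
  qed
  moreover obtain N :: nat where "v \<le> real N" using real_arch_simple by blast
  ultimately have "I_fun u m k t v = delay_integral \<Phi> t v" using v by (meson add_increasing2 less_imp_le zero_le_one)
  then show ?thesis by (simp only: delay_integral_def[OF c])
qed

text \<open>Asymptotic equivalence needs a nonzero limit. The integrand is a nonnegative continuous
  function, by \<open>rho_pos\<close>, and is positive at one point.\<close>

lemma I_fun_pos:
  fixes u :: real and m :: nat
  assumes m: "m > k" and u: "u > 0"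
  shows "I_fun u m k 1 u > 0"
proof -
  define \<Phi> where "\<Phi> = (\<lambda>x. (dde_aux (- int k) (int m) (u * x) * (fact m / fact (m - k) * x ^ (m - k)))\<^sup>2)"
  define f where "f = (\<lambda>x. (1 - x) ^ (k - 1) / fact (k - 1) * \<rho> (u * (1 - x)) * \<Phi> (x * 1))"
  have eqF: "dde_aux (- int k) (int m) = dde_aux (- int k) (int (m - k) + int k)" using m by (simp add: of_nat_diff)
  have c: "continuous_on UNIV \<Phi>" unfolding \<Phi>_def eqF
    by (intro continuous_intros continuous_on_compose2[OF delay_aux_cont[of UNIV "int k" "m - k"]]) auto
  have fc: "continuous_on {0..1} f" unfolding f_def by (rule delay_integral_integrand_cont[OF c])
  have delay_nonneg: "f x \<ge> 0" if "x \<in> {0..1}" for x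
    using that rho_pos[of "u * (1 - x)"] unfolding f_def \<Phi>_def by (intro mult_nonneg_nonneg divide_nonneg_nonneg) auto
  \<comment> \<open>Small enough for u x0 <= 1, where the delay function equals 1, and away from
    both endpoints, where the powers of x and 1 - x may vanish.\<close>
  define x0 where "x0 = min (1/2) (1 / u)"
  have x0: "0 < x0" "x0 \<le> 1/2" "u * x0 \<le> 1" using u by (auto simp: x0_def min_def field_simps)
  have "dde_aux (- int k) (int m) (u * x0) = 1" using x0 by (simp add: dde_aux.simps)
  then have "f x0 > 0"
    using x0 rho_pos unfolding f_def \<Phi>_def by (intro mult_pos_pos divide_pos_pos) auto
  moreover have "integral {0..1} f = 0 \<longleftrightarrow> (\<forall>x\<in>{0..1}. f x = 0)"
    using integral_eq_0_iff[of 0 1 f] fc delay_nonneg by auto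
  moreover have "integral {0..1} f \<ge> 0" using delay_nonneg by (intro Henstock_Kurzweil_Integration.integral_nonneg integrable_continuous_interval fc) auto
  ultimately have "integral {0..1} f > 0" using x0 by (cases "integral {0..1} f = 0") (auto simp: less_le)
  then show ?thesis using I_fun_eq[OF m u, of u 1] unfolding f_def \<Phi>_def by simp
qed

end

section \<open>Limits of Euler products and the third theorem of Mertens\<close>

text \<open>The power p^(-a/L).\<close>

definition prime_twist :: "real \<Rightarrow> complex \<Rightarrow> nat \<Rightarrow> complex" where
  "prime_twist L a p = exp (- a * of_real (ln (real p) / L))"

lemma norm_prime_twist_le: "Re a \<ge> 0 \<Longrightarrow> L > 0 \<Longrightarrow> prime p \<Longrightarrow> norm (prime_twist L a p) \<le> 1"
  using real_prime_ge_2[of p] by (auto simp: prime_twist_def norm_exp_eq_Re intro!: mult_nonneg_nonneg divide_nonneg_nonneg)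

lemma prime_twist_tendsto: "((\<lambda>L. prime_twist L a p) \<longlongrightarrow> 1) at_top"
proof -
  have "((\<lambda>L. ln (real p) / L) \<longlongrightarrow> 0) at_top" by real_asymp
  then have "((\<lambda>L. prime_twist L a p) \<longlongrightarrow> exp (- a * of_real 0)) at_top"
    unfolding prime_twist_def by (intro tendsto_intros)
  then show ?thesis by simp
qed

text \<open>The summand is ln p / (p L) times the kernel of \<open>Ein\<close> at ln p / L, so weak
  convergence on [0,1] applies.\<close>

lemma sum_tendsto_Ein:
  "((\<lambda>L. \<Sum>p\<in>primes_below (exp L). (1 - prime_twist L a p) / of_nat p) \<longlongrightarrow> Ein a) at_top"
proof -
  have "((\<lambda>L. \<Sum>p\<in>primes_below (exp (1 * L)). of_real (ln (real p) / (real p * L)) * ein_ker a (ln (real p) / L))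
           \<longlongrightarrow> integral {0..1} (ein_ker a)) at_top"
    by (intro prime_weak_convergence continuous_ein_ker) simp
  moreover have "eventually (\<lambda>L. (\<Sum>p\<in>primes_below (exp (1 * L)). of_real (ln (real p) / (real p * L)) * ein_ker a (ln (real p) / L))
      = (\<Sum>p\<in>primes_below (exp L). (1 - prime_twist L a p) / of_nat p)) at_top"
    using eventually_gt_at_top[of 0]
  proof eventually_elim
    case (elim L)
    have "of_real (ln (real p) / (real p * L)) * ein_ker a (ln (real p) / L) = (1 - prime_twist L a p) / of_nat p"
      if "p \<in> primes_below (exp L)" for p
    proof -
      have p: "real p \<ge> 2" using that real_prime_ge_2 primes_belowD by blast
      then have l: "ln (real p) > 0" by simp
      have "of_real (ln (real p) / (real p * L)) * ((1 - q) / of_real (ln (real p) / L)) = (1 - q) / of_nat p" for q :: complex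
        using p l elim by (simp add: field_simps)
      then show ?thesis using p l elim by (simp add: ein_ker_def prime_twist_def)
    qed
    then show ?case by simp
  qed
  ultimately show ?thesis unfolding Ein_def by (rule Lim_transform_eventually)
qed

text \<open>Encodes q = 1 + \<alpha> + O(x^2) with \<alpha> = O(x), uniformly over an index set.
  With pairs of X and p as indices and x = 1/p the bounds are uniform in both, and under products
  the first order terms add.\<close>

definition first_order :: "'i set \<Rightarrow> ('i \<Rightarrow> real) \<Rightarrow> ('i \<Rightarrow> complex) \<Rightarrow> ('i \<Rightarrow> complex) \<Rightarrow> bool" where
  "first_order S x q \<alpha> \<longleftrightarrow> (\<exists>A C. A \<ge> 0 \<and> C \<ge> 0 \<and> (\<forall>i\<in>S. norm (\<alpha> i) \<le> A * x i \<and> norm (q i - 1 - \<alpha> i) \<le> C * (x i)\<^sup>2))"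

lemma first_order_mult:
  assumes x: "\<And>i. i \<in> S \<Longrightarrow> 0 \<le> x i \<and> x i \<le> 1"
    and "first_order S x q1 \<alpha>1" "first_order S x q2 \<alpha>2"
  shows "first_order S x (\<lambda>i. q1 i * q2 i) (\<lambda>i. \<alpha>1 i + \<alpha>2 i)"
proof -
  obtain A1 C1 A2 C2 where AC: "A1 \<ge> 0" "C1 \<ge> 0" "A2 \<ge> 0" "C2 \<ge> 0"
    and 1: "\<And>i. i \<in> S \<Longrightarrow> norm (\<alpha>1 i) \<le> A1 * x i" "\<And>i. i \<in> S \<Longrightarrow> norm (q1 i - 1 - \<alpha>1 i) \<le> C1 * (x i)\<^sup>2"
    and 2: "\<And>i. i \<in> S \<Longrightarrow> norm (\<alpha>2 i) \<le> A2 * x i" "\<And>i. i \<in> S \<Longrightarrow> norm (q2 i - 1 - \<alpha>2 i) \<le> C2 * (x i)\<^sup>2"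
    using assms(2,3) unfolding first_order_def by blast
  have "norm (\<alpha>1 i + \<alpha>2 i) \<le> (A1 + A2) * x i \<and>
      norm (q1 i * q2 i - 1 - (\<alpha>1 i + \<alpha>2 i)) \<le> (A1 * A2 + C1 * (1 + A2 + C2) + (1 + A1) * C2) * (x i)\<^sup>2" if i: "i \<in> S" for i
  proof
    show "norm (\<alpha>1 i + \<alpha>2 i) \<le> (A1 + A2) * x i"
      using norm_triangle_ineq[of "\<alpha>1 i" "\<alpha>2 i"] 1(1)[OF i] 2(1)[OF i] by (simp add: algebra_simps)
    define r1 where "r1 = q1 i - 1 - \<alpha>1 i"
    define r2 where "r2 = q2 i - 1 - \<alpha>2 i"
    have x2: "(x i)\<^sup>2 \<le> 1" "A2 * x i \<le> A2" "A1 * x i \<le> A1" "C2 * (x i)\<^sup>2 \<le> C2"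
      using x[OF i] AC by (auto simp: power_le_one mult_left_le)
    have "q1 i * q2 i - 1 - (\<alpha>1 i + \<alpha>2 i) = \<alpha>1 i * \<alpha>2 i + r1 * (1 + \<alpha>2 i + r2) + (1 + \<alpha>1 i) * r2"
      by (simp add: r1_def r2_def algebra_simps)
    also have "norm \<dots> \<le> norm (\<alpha>1 i) * norm (\<alpha>2 i) + norm r1 * (1 + norm (\<alpha>2 i) + norm r2) + (1 + norm (\<alpha>1 i)) * norm r2"
    proof (intro norm_triangle_le add_mono)
      show "norm (\<alpha>1 i * \<alpha>2 i) \<le> norm (\<alpha>1 i) * norm (\<alpha>2 i)" by (simp add: norm_mult)
      have "norm (1 + \<alpha>2 i + r2) \<le> 1 + norm (\<alpha>2 i) + norm r2" by (metis norm_one norm_triangle_le norm_triangle_ineq add_mono order_refl)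
      then show "norm (r1 * (1 + \<alpha>2 i + r2)) \<le> norm r1 * (1 + norm (\<alpha>2 i) + norm r2)"
        unfolding norm_mult by (intro mult_left_mono) auto
      have "norm (1 + \<alpha>1 i) \<le> 1 + norm (\<alpha>1 i)" using norm_triangle_ineq[of 1 "\<alpha>1 i"] by simp
      then show "norm ((1 + \<alpha>1 i) * r2) \<le> (1 + norm (\<alpha>1 i)) * norm r2" unfolding norm_mult by (intro mult_right_mono) auto
    qed
    also have "\<dots> \<le> (A1 * x i) * (A2 * x i) + (C1 * (x i)\<^sup>2) * (1 + A2 + C2) + (1 + A1) * (C2 * (x i)\<^sup>2)"
      using AC x[OF i] x2 1[OF i] 2[OF i] unfolding r1_def[symmetric] r2_def[symmetric]
      by (intro add_mono mult_mono) auto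
    also have "\<dots> = (A1 * A2 + C1 * (1 + A2 + C2) + (1 + A1) * C2) * (x i)\<^sup>2"
      by (simp add: algebra_simps power2_eq_square)
    finally show "norm (q1 i * q2 i - 1 - (\<alpha>1 i + \<alpha>2 i)) \<le> (A1 * A2 + C1 * (1 + A2 + C2) + (1 + A1) * C2) * (x i)\<^sup>2" .
  qed
  moreover have "A1 + A2 \<ge> 0" "A1 * A2 + C1 * (1 + A2 + C2) + (1 + A1) * C2 \<ge> 0" using AC by auto
  ultimately show ?thesis unfolding first_order_def by blast
qed

lemma first_order_power:
  assumes x: "\<And>i. i \<in> S \<Longrightarrow> 0 \<le> x i \<and> x i \<le> 1" and "first_order S x q \<alpha>"
  shows "first_order S x (\<lambda>i. q i ^ k) (\<lambda>i. of_nat k * \<alpha> i)"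
proof (induction k)
  case 0
  show ?case unfolding first_order_def by (rule exI[of _ 0], rule exI[of _ 0]) simp
next
  case (Suc k)
  from first_order_mult[OF x assms(2) Suc] show ?case by (simp add: algebra_simps)
qed

lemma first_order_exp:
  assumes x: "\<And>i. i \<in> S \<Longrightarrow> 0 \<le> x i \<and> x i \<le> 1" and A: "A \<ge> 0" "\<And>i. i \<in> S \<Longrightarrow> norm (\<alpha> i) \<le> A * x i"
  shows "first_order S x (\<lambda>i. exp (\<alpha> i)) \<alpha>"
  unfolding first_order_def
proof (intro exI conjI ballI)
  fix i assume i: "i \<in> S"
  have "norm (exp (\<alpha> i) - 1 - \<alpha> i) \<le> exp (norm (\<alpha> i)) * norm (\<alpha> i) ^ 2"
    using Taylor_exp_field[of "\<alpha> i" 1] by (simp add: numeral_2_eq_2 algebra_simps)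
  also have "\<dots> \<le> exp A * (A * x i) ^ 2"
    using A(2)[OF i] mult_left_le[of "x i" A] x[OF i] A(1) by (intro mult_mono power_mono) auto
  finally show "norm (exp (\<alpha> i) - 1 - \<alpha> i) \<le> exp A * A ^ 2 * (x i)\<^sup>2" by (simp add: power_mult_distrib mult_ac)
qed (use A in auto)

text \<open>The three factors have the first order terms -k X/p, k/p and -k (1 - X)/p, which cancel
  and leave O(1/p^2). The bound 3 on |X| fits X = p^(-a/L) + p^(-b/L) - p^(-(a+b)/L), a combination
  of three numbers of modulus at most 1.\<close>

lemma euler_factor_near:
  fixes g :: "nat \<Rightarrow> real"
  assumes g: "\<And>p. prime p \<Longrightarrow> \<bar>g p - real k / real p\<bar> \<le> C0 / (real p)\<^sup>2"
  obtains C where "C \<ge> 0" "\<And>(X::complex) p. prime p \<Longrightarrow> norm X \<le> 3 \<Longrightarrow>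
    norm ((1 - of_real (g p) * X) * inverse (1 - 1 / of_nat p) ^ k * exp (- of_nat k * (1 - X) / of_nat p) - 1) \<le> C / (real p)\<^sup>2"
proof -
  define S where "S = {(X :: complex, p :: nat). prime p \<and> norm X \<le> 3}"
  define x where "x = (\<lambda>(X :: complex, p :: nat). 1 / real p)"
  have x: "0 \<le> x i \<and> x i \<le> 1" if iS: "i \<in> S" for i
  proof -
    obtain X p where i: "i = (X, p)" "prime p" using iS by (auto simp: S_def)
    show ?thesis using real_prime_ge_2[OF i(2)] by (simp add: i x_def)
  qed
  have C0: "C0 \<ge> 0" using order_trans[OF abs_ge_zero g[of 2]] by (simp add: zero_le_divide_iff)
  have n1: "first_order S x (\<lambda>(X, p). 1 - of_real (g p) * X) (\<lambda>(X, p). - of_nat k * X / of_nat p)"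
    unfolding first_order_def
  proof (rule exI[of _ "real k * 3"], rule exI[of _ "C0 * 3"], intro conjI ballI, goal_cases)
    case (3 i)
    then obtain X p where i: "i = (X, p)" "prime p" "norm X \<le> 3" by (auto simp: S_def)
    then have "real k * norm X / real p \<le> real k * 3 / real p" by (intro divide_right_mono mult_left_mono) auto
    then show ?case using i by (simp add: x_def norm_mult norm_divide)
  next
    case (4 i)
    then obtain X p where i: "i = (X, p)" "prime p" "norm X \<le> 3" by (auto simp: S_def)
    have "1 - of_real (g p) * X - 1 - (- of_nat k * X / of_nat p) = - (of_real (g p - real k / real p) * X)"
      by (simp add: algebra_simps)
    also have "norm \<dots> = \<bar>g p - real k / real p\<bar> * norm X" by (simp only: norm_minus_cancel norm_mult norm_of_real)
    also have "\<dots> \<le> (C0 / (real p)\<^sup>2) * 3" using g[of p] i C0 by (intro mult_mono) auto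
    finally show ?case using i by (simp add: x_def power_divide)
  qed (use C0 in auto)
  have n2': "first_order S x (\<lambda>(X, p). inverse (1 - 1 / of_nat p)) (\<lambda>(X, p). 1 / of_nat p)"
    unfolding first_order_def
  proof (rule exI[of _ "1::real"], rule exI[of _ "2::real"], intro conjI ballI, goal_cases)
    case (3 i)
    then obtain X p where i: "i = (X, p)" "prime p" "norm X \<le> 3" by (auto simp: S_def)
    then show ?case by (simp add: x_def norm_divide)
  next
    case (4 i)
    then obtain X p where i: "i = (X, p)" "prime p" "norm X \<le> 3" by (auto simp: S_def)
    have p: "real p \<ge> 2" using real_prime_ge_2 i by blast
    have "inverse (1 - 1 / of_nat p) - 1 - 1 / of_nat p = complex_of_real (inverse (1 - 1 / real p) - 1 - 1 / real p)" by simp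
    also have "inverse (1 - 1 / real p) - 1 - 1 / real p = 1 / (real p * (real p - 1))"
      using p by (simp add: field_simps)
    also have "norm (complex_of_real (1 / (real p * (real p - 1)))) = 1 / (real p * (real p - 1))"
      using p by (simp only: norm_of_real) simp
    also have "\<dots> \<le> 1 / (real p * (real p / 2))"
      using p by (intro divide_left_mono mult_left_mono mult_pos_pos) auto
    finally show ?case using i by (simp add: x_def power2_eq_square)
  qed auto
  note n2 = first_order_power[OF x n2', of k]
  have n3: "first_order S x (\<lambda>i. exp ((\<lambda>(X, p). - of_nat k * (1 - X) / of_nat p) i)) (\<lambda>(X, p). - of_nat k * (1 - X) / of_nat p)"
  proof (rule first_order_exp[OF x])
    fix i assume "i \<in> S"
    then obtain X p where i: "i = (X, p)" "prime p" "norm X \<le> 3" by (auto simp: S_def)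
    have "norm (1 - X) \<le> 4" using norm_triangle_ineq4[of 1 X] i by simp
    then have "real k * norm (1 - X) \<le> real k * 4" by (intro mult_left_mono) auto
    then show "norm ((\<lambda>(X, p). - of_nat k * (1 - X) / of_nat p) i) \<le> (4 * real k) * x i"
      using i by (simp add: x_def norm_mult norm_divide divide_right_mono)
  qed auto
  from first_order_mult[OF x first_order_mult[OF x n1 n2] n3]
  obtain A C where C: "C \<ge> 0" and *: "\<And>i. i \<in> S \<Longrightarrow> norm
     ((case i of (X, p) \<Rightarrow> 1 - of_real (g p) * X) * (case i of (X, p) \<Rightarrow> inverse (1 - 1 / of_nat p)) ^ k *
       exp (case i of (X, p) \<Rightarrow> - of_nat k * (1 - X) / of_nat p) - 1 -
      ((case i of (X, p) \<Rightarrow> - of_nat k * X / of_nat p) + of_nat k * (case i of (X, p) \<Rightarrow> 1 / of_nat p) +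
       (case i of (X, p) \<Rightarrow> - of_nat k * (1 - X) / of_nat p))) \<le> C * (x i)\<^sup>2"
    unfolding first_order_def by blast
  show ?thesis
  proof (rule that[OF C])
    fix X :: complex and p :: nat assume p: "prime p" "norm X \<le> 3"
    have z: "- of_nat k * X / of_nat p + of_nat k * (1 / of_nat p) + - of_nat k * (1 - X) / of_nat p = 0"
      by (simp add: algebra_simps diff_divide_distrib)
    show "norm ((1 - of_real (g p) * X) * inverse (1 - 1 / of_nat p) ^ k * exp (- of_nat k * (1 - X) / of_nat p) - 1) \<le> C / (real p)\<^sup>2"
      using *[of "(X, p)"] p unfolding prod.case z by (simp add: S_def x_def power_divide)
  qed
qed

lemma tail_inverse_squares_le:
  assumes "N \<ge> 1" "finite A" "\<And>p. p \<in> A \<Longrightarrow> p > N"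
  shows "(\<Sum>p\<in>A. 1 / (real p)\<^sup>2) \<le> 1 / real N"
proof -
  obtain n where n: "\<And>p. p \<in> A \<Longrightarrow> p \<le> N + n"
    using assms(2) by (metis finite_nat_set_iff_bounded_le le_add2 order_trans)
  have "(\<Sum>p\<in>A. 1 / (real p)\<^sup>2) \<le> (\<Sum>p\<in>{N<..N+n}. 1 / (real p)\<^sup>2)"
    using n assms by (intro sum_mono2) force+
  also have "\<dots> \<le> 1 / real N - 1 / real (N + n)"
  proof (induction n)
    case (Suc n)
    have e: "{N<..N + Suc n} = insert (N + Suc n) {N<..N+n}" by auto
    have "1 / (real (N + Suc n))\<^sup>2 \<le> 1 / real (N + n) - 1 / real (N + Suc n)"
    proof -
      have M: "real (N + n) > 0" using assms(1) by simp
      have "1 / (real (N + Suc n))\<^sup>2 \<le> 1 / (real (N + n) * real (N + Suc n))"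
        unfolding power2_eq_square using M by (intro divide_left_mono mult_right_mono mult_pos_pos) auto
      also have "\<dots> = 1 / real (N + n) - 1 / real (N + Suc n)"
        using M by (simp add: field_simps)
      finally show ?thesis .
    qed
    moreover have "(\<Sum>p\<in>{N<..N + Suc n}. 1 / (real p)\<^sup>2) = 1 / (real (N + Suc n))\<^sup>2 + (\<Sum>p\<in>{N<..N+n}. 1 / (real p)\<^sup>2)"
      unfolding e by (subst sum.insert) auto
    ultimately show ?case using Suc by linarith
  qed simp
  also have "\<dots> \<le> 1 / real N" by simp
  finally show ?thesis .
qed

text \<open>Tannery's theorem for products: the primes up to N converge factor by factor, and those
  beyond N change the product by at most exp(C) (exp(C/N) - 1), uniformly in L.\<close>

lemma prod_tannery:
  fixes f :: "real \<Rightarrow> nat \<Rightarrow> complex"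
  assumes C: "C \<ge> 0" and bd: "\<And>L p. L > 0 \<Longrightarrow> prime p \<Longrightarrow> norm (f L p - 1) \<le> C / (real p)\<^sup>2"
    and lim: "\<And>p. prime p \<Longrightarrow> ((\<lambda>L. f L p) \<longlongrightarrow> h p) at_top"
    and H: "(\<lambda>N. \<Prod>p\<in>primes_below (real N). h p) \<longlonglongrightarrow> H"
  shows "((\<lambda>L. \<Prod>p\<in>primes_below (exp L). f L p) \<longlongrightarrow> H) at_top"
proof (rule tendstoI)
  fix e :: real assume e: "e > 0"
  have "(\<lambda>N. exp C * (exp (C / real N) - 1)) \<longlonglongrightarrow> exp C * (exp 0 - 1)"
    by (intro tendsto_intros lim_const_over_n)
  then have "eventually (\<lambda>N. exp C * (exp (C / real N) - 1) < e / 3) sequentially"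
    by (rule order_tendstoD) (use e in simp)
  moreover have "eventually (\<lambda>N. dist (\<Prod>p\<in>primes_below (real N). h p) H < e / 3) sequentially"
    using H e by (intro tendstoD) auto
  then have "eventually (\<lambda>N. dist (\<Prod>p\<in>primes_below (real (Suc N)). h p) H < e / 3) sequentially"
    by (subst eventually_sequentially_Suc)
  ultimately have "eventually (\<lambda>N. exp C * (exp (C / real N) - 1) < e / 3 \<and> dist (\<Prod>p\<in>primes_below (real (Suc N)). h p) H < e / 3 \<and> N \<ge> 1) sequentially"
    using eventually_ge_at_top[of 1] by eventually_elim auto
  then obtain N where N: "exp C * (exp (C / real N) - 1) < e / 3" "dist (\<Prod>p\<in>primes_below (real (Suc N)). h p) H < e / 3" "N \<ge> 1"
    by (auto dest!: eventually_happens)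
  define A where "A = primes_below (real (Suc N))"
  have "((\<lambda>L. \<Prod>p\<in>A. f L p) \<longlongrightarrow> (\<Prod>p\<in>A. h p)) at_top"
    by (intro tendsto_prod lim) (auto simp: A_def dest: primes_belowD)
  then have "eventually (\<lambda>L. dist (\<Prod>p\<in>A. f L p) (\<Prod>p\<in>A. h p) < e / 3) at_top" using e by (intro tendstoD) auto
  then show "eventually (\<lambda>L. dist (\<Prod>p\<in>primes_below (exp L). f L p) H < e) at_top"
    using eventually_ge_at_top[of "max 1 (real (Suc N))"]
  proof eventually_elim
    case (elim L)
    have L: "L > 0" using elim by simp
    have "real (Suc N) \<le> exp L" using elim exp_ge_add_one_self[of L] by linarith
    then have sub: "A \<subseteq> primes_below (exp L)" unfolding A_def by (rule primes_below_mono)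
    define B where "B = primes_below (exp L) - A"
    have Bp: "p > N" "prime p" if "p \<in> B" for p using that by (auto simp: B_def A_def primes_below_def)
    have fB: "finite B" by (simp add: B_def)
    have split: "(\<Prod>p\<in>primes_below (exp L). f L p) = (\<Prod>p\<in>A. f L p) * (\<Prod>p\<in>B. f L p)"
      unfolding B_def using sub by (subst prod.subset_diff[OF sub]) (auto simp: mult.commute)
    have "norm (\<Prod>p\<in>A. f L p) \<le> (\<Prod>p\<in>A. exp (C / (real p)\<^sup>2))"
      unfolding prod_norm[symmetric]
    proof (intro prod_mono conjI norm_ge_zero)
      fix p assume "p \<in> A"
      then have "norm (f L p - 1) \<le> C / (real p)\<^sup>2" using L by (intro bd) (auto simp: A_def dest: primes_belowD)
      then have "norm (f L p) \<le> 1 + C / (real p)\<^sup>2" using norm_triangle_ineq[of 1 "f L p - 1"] by simp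
      also have "\<dots> \<le> exp (C / (real p)\<^sup>2)" by (rule exp_ge_add_one_self)
      finally show "norm (f L p) \<le> exp (C / (real p)\<^sup>2)" .
    qed
    also have "\<dots> = exp (C * (\<Sum>p\<in>A. 1 / (real p)\<^sup>2))" by (simp add: exp_sum[symmetric] sum_distrib_left A_def)
    also have "\<dots> \<le> exp (C * 1)"
      using C by (simp del: mult_1_right, intro mult_left_mono sum_inverse_squares_le) (auto simp: A_def dest: primes_belowD prime_ge_2_nat)
    finally have nA: "norm (\<Prod>p\<in>A. f L p) \<le> exp C" by simp
    have "norm ((\<Prod>p\<in>B. 1 + (f L p - 1)) - 1) \<le> (\<Prod>p\<in>B. 1 + norm (f L p - 1)) - 1"
      by (rule norm_prod_minus1_le_prod_minus1)
    also have "(\<Prod>p\<in>B. 1 + norm (f L p - 1)) \<le> (\<Prod>p\<in>B. exp (C / (real p)\<^sup>2))"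
    proof (intro prod_mono conjI)
      fix p assume "p \<in> B"
      then have "norm (f L p - 1) \<le> C / (real p)\<^sup>2" using L Bp by (intro bd) auto
      then have "1 + norm (f L p - 1) \<le> 1 + C / (real p)\<^sup>2" by simp
      also have "\<dots> \<le> exp (C / (real p)\<^sup>2)" by (rule exp_ge_add_one_self)
      finally show "1 + norm (f L p - 1) \<le> exp (C / (real p)\<^sup>2)" .
    qed auto
    also have "\<dots> = exp (C * (\<Sum>p\<in>B. 1 / (real p)\<^sup>2))" using fB by (simp add: exp_sum[symmetric] sum_distrib_left)
    also have "\<dots> \<le> exp (C * (1 / real N))"
      using C N(3) fB Bp unfolding exp_le_cancel_iff by (intro mult_left_mono tail_inverse_squares_le) auto
    finally have nB: "norm ((\<Prod>p\<in>B. f L p) - 1) \<le> exp (C / real N) - 1" by simp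
    have "(\<Prod>p\<in>primes_below (exp L). f L p) - (\<Prod>p\<in>A. f L p) = (\<Prod>p\<in>A. f L p) * ((\<Prod>p\<in>B. f L p) - 1)"
      by (simp add: split algebra_simps)
    also have "norm \<dots> \<le> exp C * (exp (C / real N) - 1)"
      unfolding norm_mult by (intro mult_mono nA nB) auto
    also have "\<dots> < e / 3" by (rule N(1))
    finally have "dist (\<Prod>p\<in>primes_below (exp L). f L p) (\<Prod>p\<in>A. f L p) < e / 3" by (simp add: dist_norm)
    then show ?case using elim(1) N(2) unfolding A_def[symmetric]
      using dist_triangle[of "\<Prod>p\<in>primes_below (exp L). f L p" H "\<Prod>p\<in>A. f L p"]
        dist_triangle[of "\<Prod>p\<in>A. f L p" H "\<Prod>p\<in>A. h p"] by linarith
  qed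
qed


text \<open>The compensating factor exp(-k (1 - X)/p) brings each quotient within O(1/p^2) of 1, as
  \<open>prod_tannery\<close> requires; what was taken out multiplies to the exponential of k times
  the sum with limit E. The Mertens product remains as denominator because the case k = 1, g(p) =
  1/p is itself a step towards Mertens' third theorem.\<close>

lemma euler_product_ratio_tendsto:
  fixes g :: "nat \<Rightarrow> real" and X :: "real \<Rightarrow> nat \<Rightarrow> complex"
  assumes g: "\<And>p. prime p \<Longrightarrow> \<bar>g p - real k / real p\<bar> \<le> C0 / (real p)\<^sup>2"
    and X: "\<And>L p. L > 0 \<Longrightarrow> prime p \<Longrightarrow> norm (X L p) \<le> 3" "\<And>p. ((\<lambda>L. X L p) \<longlongrightarrow> 1) at_top"
    and H: "(\<lambda>N. \<Prod>p\<in>primes_below (real N). (1 - g p) * inverse (1 - 1 / real p) ^ k) \<longlonglongrightarrow> H"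
    and E: "((\<lambda>L. \<Sum>p\<in>primes_below (exp L). (1 - X L p) / of_nat p) \<longlongrightarrow> E) at_top"
  shows "((\<lambda>L. (\<Prod>p\<in>primes_below (exp L). 1 - of_real (g p) * X L p) / of_real (\<Prod>p\<in>primes_below (exp L). 1 - 1 / real p) ^ k)
     \<longlongrightarrow> of_real H * exp (of_nat k * E)) at_top"
proof -
  obtain C where C: "C \<ge> 0" "\<And>(X::complex) p. prime p \<Longrightarrow> norm X \<le> 3 \<Longrightarrow>
    norm ((1 - of_real (g p) * X) * inverse (1 - 1 / of_nat p) ^ k * exp (- of_nat k * (1 - X) / of_nat p) - 1) \<le> C / (real p)\<^sup>2"
    using euler_factor_near[OF g] by blast
  define f where "f = (\<lambda>L p. (1 - of_real (g p) * X L p) * inverse (1 - 1 / of_nat p) ^ k * exp (- of_nat k * (1 - X L p) / of_nat p))"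
  have "((\<lambda>L. \<Prod>p\<in>primes_below (exp L). f L p) \<longlongrightarrow> of_real H) at_top"
  proof (rule prod_tannery[OF C(1)])
    show "norm (f L p - 1) \<le> C / (real p)\<^sup>2" if "L > 0" "prime p" for L p
      unfolding f_def by (rule C(2)[OF that(2) X(1)[OF that]])
    show "((\<lambda>L. f L p) \<longlongrightarrow> of_real ((1 - g p) * inverse (1 - 1 / real p) ^ k)) at_top" if p: "prime p" for p
    proof -
      have "((\<lambda>L. f L p) \<longlongrightarrow> (1 - of_real (g p) * 1) * inverse (1 - 1 / of_nat p) ^ k * exp (- of_nat k * (1 - 1) / of_nat p)) at_top"
        unfolding f_def using prime_gt_0_nat[OF p] by (intro tendsto_intros X(2)) auto
      then show ?thesis by simp
    qed
    have "(\<lambda>N. complex_of_real (\<Prod>p\<in>primes_below (real N). (1 - g p) * inverse (1 - 1 / real p) ^ k)) \<longlonglongrightarrow> of_real H"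
      by (intro tendsto_of_real H)
    then show "(\<lambda>N. \<Prod>p\<in>primes_below (real N). complex_of_real ((1 - g p) * inverse (1 - 1 / real p) ^ k)) \<longlonglongrightarrow> of_real H"
      by (simp only: of_real_prod)
  qed
  then have "((\<lambda>L. (\<Prod>p\<in>primes_below (exp L). f L p) * exp (of_nat k * (\<Sum>p\<in>primes_below (exp L). (1 - X L p) / of_nat p))) \<longlongrightarrow> of_real H * exp (of_nat k * E)) at_top"
    by (intro tendsto_intros E)
  moreover have "(\<Prod>p\<in>primes_below (exp L). f L p) * exp (of_nat k * (\<Sum>p\<in>primes_below (exp L). (1 - X L p) / of_nat p)) =
      (\<Prod>p\<in>primes_below (exp L). 1 - of_real (g p) * X L p) / of_real (\<Prod>p\<in>primes_below (exp L). 1 - 1 / real p) ^ k" for L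
  proof -
    have "(\<Prod>p\<in>primes_below (exp L). f L p) * exp (of_nat k * (\<Sum>p\<in>primes_below (exp L). (1 - X L p) / of_nat p))
        = (\<Prod>p\<in>primes_below (exp L). f L p * exp (of_nat k * ((1 - X L p) / of_nat p)))"
      by (simp add: exp_sum sum_distrib_left prod.distrib)
    also have "\<dots> = (\<Prod>p\<in>primes_below (exp L). (1 - of_real (g p) * X L p) / (of_real (1 - 1 / real p)) ^ k)"
    proof (intro prod.cong refl)
      fix p
      have "exp (- of_nat k * (1 - X L p) / of_nat p) * exp (of_nat k * ((1 - X L p) / of_nat p)) = 1"
        unfolding exp_add[symmetric] by simp
      then show "f L p * exp (of_nat k * ((1 - X L p) / of_nat p)) = (1 - of_real (g p) * X L p) / (of_real (1 - 1 / real p)) ^ k"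
        unfolding f_def by (simp add: mult.assoc divide_inverse power_inverse)
    qed
    also have "\<dots> = (\<Prod>p\<in>primes_below (exp L). 1 - of_real (g p) * X L p) / of_real (\<Prod>p\<in>primes_below (exp L). 1 - 1 / real p) ^ k"
      by (simp add: prod_dividef prod_power_distrib of_real_prod)
    finally show ?thesis .
  qed
  ultimately show ?thesis by simp
qed

section \<open>Mertens' third theorem\<close>

definition mertens_product :: "real \<Rightarrow> real" where "mertens_product L = (\<Prod>p\<in>primes_below (exp L). 1 - 1 / real p)"

lemma mertens_product_pos: "mertens_product L > 0"
  unfolding mertens_product_def by (intro prod_pos) (auto dest!: primes_belowD(1) real_prime_ge_2)

text \<open>At 1 + T/L the Euler factors 1 - p^(-s) of the primes from exp L on multiply to
  something between exp(-C exp(-T)) and 1, by the tail bound with L/T in place of L, whose cutoff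
  exp(T L/T) is exp L. The image of \<open>of_real\<close> records that the value is real.\<close>

lemma zeta_series_euler_cutoff:
  obtains C where "C \<ge> 0" "\<And>L T. T \<ge> 1 \<Longrightarrow> L \<ge> T \<Longrightarrow>
    zeta_series (of_real (1 + T / L)) * (\<Prod>p\<in>primes_below (exp L). 1 - npow p (of_real (1 + T / L))) \<in> of_real ` {1..exp (C * exp (- T))}"
proof -
  obtain C where C: "C \<ge> 0" "\<And>L T S. L \<ge> 1 \<Longrightarrow> T \<ge> 1 \<Longrightarrow> finite S \<Longrightarrow>
     (\<And>p. p \<in> S \<Longrightarrow> prime p \<and> real p \<ge> exp (T * L)) \<Longrightarrow>
     (\<Sum>p\<in>S. exp (- ln (real p) / L) / real p) \<le> C * exp (- T)"
    using prime_tail_bound by blast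
  have "zeta_series (of_real (1 + T / L)) * (\<Prod>p\<in>primes_below (exp L). 1 - npow p (of_real (1 + T / L))) \<in> of_real ` {1..exp (2 * C * exp (- T))}"
    if T: "T \<ge> 1" and L: "L \<ge> T" for L T
  proof -
    define s where "s = 1 + T / L"
    have s1: "s > 1" using T L by (simp add: s_def)
    define q where "q = (\<lambda>p::nat. real p powr (- s))"
    have npq: "npow p (of_real s) = of_real (q p)" if "prime p" for p
      using prime_gt_0_nat[OF that] by (simp add: npow_def q_def powr_def exp_of_real flip: of_real_mult of_real_minus)
    have q2: "0 < q p" "q p \<le> 1/2" "q p = exp (- ln (real p) / (L / T)) / real p" if p: "prime p" for p
    proof -
      have p2: "real p \<ge> 2" using real_prime_ge_2[OF p] .
      show "0 < q p" using p2 by (simp add: q_def)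
      have "q p \<le> real p powr (- 1)" unfolding q_def using p2 s1 by (intro powr_mono) auto
      also have "\<dots> \<le> 1/2" using p2 by (simp add: powr_minus_divide field_simps)
      finally show "q p \<le> 1/2" .
      have "q p = exp (- ln (real p) / (L / T)) * exp (- ln (real p))"
        unfolding q_def powr_def exp_add[symmetric] using p2 by (simp add: s_def algebra_simps)
      then show "q p = exp (- ln (real p) / (L / T)) / real p" using p2 by (simp add: exp_minus divide_inverse)
    qed
    define R where "R = (\<lambda>N. \<Prod>p\<in>primes_below (real N) - primes_below (exp L). 1 - q p)"
    define P where "P = (\<Prod>p\<in>primes_below (exp L). 1 - q p)"
    have Ppos: "P > 0" unfolding P_def 
    proof (intro prod_pos)
      fix p assume "p \<in> primes_below (exp L)"
      then show "0 < 1 - q p" using q2(2)[of p] by (simp add: primes_below_def)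
    qed
    have Rb: "R N \<le> 1" "exp (- (2 * C * exp (- T))) \<le> R N" for N
    proof -
      have pr: "prime p" "real p \<ge> exp L" if "p \<in> primes_below (real N) - primes_below (exp L)" for p
        using that by (auto simp: primes_below_def)
      show "R N \<le> 1" unfolding R_def
      proof (intro prod_le_1)
        fix p assume "p \<in> primes_below (real N) - primes_below (exp L)"
        then show "0 \<le> 1 - q p \<and> 1 - q p \<le> 1" using q2(1,2)[of p] pr(1)[of p] by linarith
      qed
      have "(\<Sum>p\<in>primes_below (real N) - primes_below (exp L). q p) \<le> C * exp (- T)"
      proof -
        have "(\<Sum>p\<in>primes_below (real N) - primes_below (exp L). q p)
            = (\<Sum>p\<in>primes_below (real N) - primes_below (exp L). exp (- ln (real p) / (L / T)) / real p)"
          by (intro sum.cong refl q2(3) pr(1))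
        also have "\<dots> \<le> C * exp (- T)"
          using T L by (intro C(2)) (auto simp: primes_below_def)
        finally show ?thesis .
      qed
      then have "exp (- (2 * C * exp (- T))) \<le> exp (\<Sum>p\<in>primes_below (real N) - primes_below (exp L). - (2 * q p))"
        by (simp add: sum_negf sum_distrib_left[symmetric])
      also have "\<dots> = (\<Prod>p\<in>primes_below (real N) - primes_below (exp L). exp (- (2 * q p)))" by (simp add: exp_sum)
      also have "\<dots> \<le> R N" unfolding R_def
      proof (intro prod_mono conjI)
        fix p assume "p \<in> primes_below (real N) - primes_below (exp L)"
        then have q: "0 < q p" "q p \<le> 1/2" using q2 pr by auto
        have "1 + 2 * q p \<le> exp (2 * q p)" by (rule exp_ge_add_one_self)
        then have "exp (- (2 * q p)) \<le> 1 / (1 + 2 * q p)" using q by (simp add: exp_minus field_simps)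
        also have "\<dots> \<le> 1 - q p"
        proof -
          have "2 * q p * q p \<le> 1 * q p" using q by (intro mult_right_mono) auto
          then have "1 \<le> (1 - q p) * (1 + 2 * q p)" by (simp add: algebra_simps)
          then show ?thesis using q by (simp add: divide_le_eq)
        qed
        finally show "exp (- (2 * q p)) \<le> 1 - q p" .
      qed auto
      finally show "exp (- (2 * C * exp (- T))) \<le> R N" .
    qed
    have "(\<lambda>N. Re (zeta_series (of_real s) * (\<Prod>p\<in>primes_below (real N). 1 - npow p (of_real s)))) \<longlonglongrightarrow> Re 1"
      using s1 by (intro tendsto_Re euler_product_tendsto) auto
    moreover have "zeta_series (of_real s) = of_real (Re (zeta_series (of_real s)))"
    proof -
      have "(\<lambda>n. npow (Suc n) (of_real s)) sums zeta_series (of_real s)" using s1 by (intro zeta_series_sums) auto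
      from sums_Im[OF this] have "Im (zeta_series (of_real s)) = 0"
        by (simp add: npow_def Im_exp sums_iff)
      then show ?thesis by (simp add: complex_eq_iff)
    qed
    then obtain z where z: "zeta_series (of_real s) = of_real z" by blast
    have prodq: "(\<Prod>p\<in>primes_below y. 1 - npow p (of_real s)) = of_real (\<Prod>p\<in>primes_below y. 1 - q p)" for y
      unfolding of_real_prod by (intro prod.cong refl) (simp add: npq primes_belowD)
    ultimately have lim: "(\<lambda>N. z * (\<Prod>p\<in>primes_below (real N). 1 - q p)) \<longlonglongrightarrow> 1"
      unfolding z prodq by (simp only: of_real_mult[symmetric] Re_complex_of_real one_complex.sel)
    have "eventually (\<lambda>N. z * (\<Prod>p\<in>primes_below (real N). 1 - q p) = z * P * R N) sequentially"
    proof -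
      have "eventually (\<lambda>N. real N \<ge> exp L) sequentially"
        using filterlim_real_sequentially[unfolded filterlim_at_top] by blast
      then show ?thesis
      proof eventually_elim
        case (elim N)
        have sub: "primes_below (exp L) \<subseteq> primes_below (real N)" using elim by (rule primes_below_mono)
        show ?case unfolding P_def R_def by (subst prod.subset_diff[OF sub]) (auto simp: mult_ac)
      qed
    qed
    with lim have lim2: "(\<lambda>N. z * P * R N) \<longlonglongrightarrow> 1" by (rule Lim_transform_eventually)
    have zpos: "z * P > 0"
    proof (rule ccontr)
      assume n: "\<not> z * P > 0"
      have "R N \<ge> 0" for N using Rb(2)[of N] exp_gt_zero order.strict_implies_order order_trans by blast
      then have "z * P * R N \<le> 0" for N using n mult_nonpos_nonneg[of "z * P" "R N"] by auto
      then have "(1::real) \<le> 0" using lim2 by (intro LIMSEQ_le_const2[OF lim2]) auto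
      then show False by simp
    qed
    have "1 \<le> z * P"
    proof (rule LIMSEQ_le_const2[OF lim2])
      have "z * P * R N \<le> z * P" for N using zpos Rb(1)[of N] by (simp add: mult_left_le)
      then show "\<exists>N. \<forall>n\<ge>N. z * P * R n \<le> z * P" by blast
    qed
    moreover have "z * P * exp (- (2 * C * exp (- T))) \<le> 1"
    proof (rule LIMSEQ_le_const[OF lim2])
      have "z * P * exp (- (2 * C * exp (- T))) \<le> z * P * R N" for N using zpos Rb(2)[of N] by (intro mult_left_mono) auto
      then show "\<exists>N. \<forall>n\<ge>N. z * P * exp (- (2 * C * exp (- T))) \<le> z * P * R n" by blast
    qed
    then have "z * P \<le> exp (2 * C * exp (- T))" by (simp add: exp_minus field_simps)
    moreover have eq: "zeta_series (of_real s) * (\<Prod>p\<in>primes_below (exp L). 1 - npow p (of_real s)) = of_real (z * P)"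
      by (simp add: z prodq P_def)
    ultimately have "z * P \<in> {1..exp (2 * C * exp (- T))}" by simp
    with eq show ?thesis unfolding s_def by (rule image_eqI)
  qed
  then show ?thesis using C(1) by (intro that[of "2 * C"]) auto
qed

lemma of_real_imageD: "w \<in> of_real ` {x..y} \<Longrightarrow> of_real (Re w) = w \<and> x \<le> Re w \<and> Re w \<le> y"
  by auto

text \<open>Two successive limits. For fixed T and growing L the quotient of Y by L times the
  Mertens product tends to 1/\<mu>(T), where Y lies between 1 and exp(C exp(-T)). Then T grows: this
  range shrinks to 1 and \<mu>(T) tends to the desired constant.\<close>

theorem mertens_third: "((\<lambda>L. L * mertens_product L) \<longlongrightarrow> exp (- ein_const)) at_top"
proof -
  obtain C where C: "C \<ge> 0" "\<And>L T. T \<ge> 1 \<Longrightarrow> L \<ge> T \<Longrightarrow>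
    zeta_series (of_real (1 + T / L)) * (\<Prod>p\<in>primes_below (exp L). 1 - npow p (of_real (1 + T / L))) \<in> of_real ` {1..exp (C * exp (- T))}"
    using zeta_series_euler_cutoff by blast
  define \<mu> where "\<mu> = (\<lambda>T. T * exp (- ein_real T))"
  have mulim: "(\<mu> \<longlongrightarrow> exp (- ein_const)) at_top"
  proof -
    have "((\<lambda>T. exp (- (ein_real T - ln T))) \<longlongrightarrow> exp (- ein_const)) at_top" by (intro tendsto_intros ein_const)
    then show ?thesis
    proof (rule Lim_transform_eventually)
      show "eventually (\<lambda>T. exp (- (ein_real T - ln T)) = \<mu> T) at_top"
        using eventually_gt_at_top[of 0] by eventually_elim (simp add: \<mu>_def exp_diff exp_minus divide_inverse)
    qed
  qed
  text \<open>For fixed \<open>T\<close> the quantity \<open>L * mertens_product L\<close> is compared with the Euler product of zeta at \<open>1 + T / L\<close>.\<close>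
  have ratio: "((\<lambda>L. Y L / (L * mertens_product L)) \<longlongrightarrow> 1 / \<mu> T) at_top"
    if T: "T \<ge> 1" and Y: "\<And>L. L \<ge> T \<Longrightarrow> of_real (Y L) = zeta_series (of_real (1 + T / L)) * (\<Prod>p\<in>primes_below (exp L). 1 - npow p (of_real (1 + T / L)))" for T Y
  proof -
    define X where "X = (\<lambda>L p. prime_twist L (of_real T) p)"
    have "((\<lambda>L. (\<Prod>p\<in>primes_below (exp L). 1 - of_real (1 / real p) * X L p) / of_real (\<Prod>p\<in>primes_below (exp L). 1 - 1 / real p) ^ 1)
       \<longlongrightarrow> of_real 1 * exp (of_nat 1 * Ein (of_real T))) at_top"
    proof (rule euler_product_ratio_tendsto[where ?C0.0 = 0])
      show "norm (X L p) \<le> 3" if "L > 0" "prime p" for L p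
        using norm_prime_twist_le[of "of_real T" L p] that T by (simp add: X_def)
      have "(\<Prod>p\<in>primes_below (real N). (1 - 1 / real p) * inverse (1 - 1 / real p) ^ 1) = 1" for N
        by (intro prod.neutral ballI) (auto dest!: primes_belowD(1) real_prime_ge_2)
      then show "(\<lambda>N. \<Prod>p\<in>primes_below (real N). (1 - 1 / real p) * inverse (1 - 1 / real p) ^ 1) \<longlonglongrightarrow> 1"
        by (simp only: tendsto_const)
    qed (auto simp: X_def prime_twist_tendsto intro!: sum_tendsto_Ein)
    then have l1: "((\<lambda>L. (\<Prod>p\<in>primes_below (exp L). 1 - of_real (1 / real p) * X L p) / of_real (mertens_product L)) \<longlongrightarrow> of_real (exp (ein_real T))) at_top"
      unfolding mertens_product_def Ein_of_real by (simp add: exp_of_real)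
    have l2: "((\<lambda>L. zeta_series (of_real (1 + T / L)) / of_real L) \<longlongrightarrow> of_real (1 / T)) at_top"
    proof (rule Lim_transform[OF tendsto_const], rule Lim_null_comparison)
      show "eventually (\<lambda>L. norm (zeta_series (of_real (1 + T / L)) / of_real L - of_real (1 / T)) \<le> 2 * (1 + T / L) / L) at_top"
        using eventually_gt_at_top[of 0]
      proof eventually_elim
        case (elim L)
        have "norm (zeta_series (of_real (1 + T / L)) - 1 / (of_real (1 + T / L) - 1)) \<le> 2 * norm (complex_of_real (1 + T / L))"
          using T elim by (intro zeta_series_near_pole) auto
        also have "norm (complex_of_real (1 + T / L)) = 1 + T / L" using T elim by (simp only: norm_of_real) simp
        also have "1 / (complex_of_real (1 + T / L) - 1) = of_real (L / T)" by simp
        finally have "norm (zeta_series (of_real (1 + T / L)) - of_real (L / T)) / L \<le> 2 * (1 + T / L) / L"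
          using elim by (intro divide_right_mono) auto
        moreover have "zeta_series (of_real (1 + T / L)) / of_real L - of_real (1 / T) = (zeta_series (of_real (1 + T / L)) - of_real (L / T)) / of_real L"
          using elim T by (simp add: diff_divide_distrib)
        ultimately show ?case using elim by (simp only: norm_divide norm_of_real)
      qed
      show "((\<lambda>L. 2 * (1 + T / L) / L) \<longlongrightarrow> 0) at_top" by real_asymp
    qed
    have "((\<lambda>L. complex_of_real (Y L / (L * mertens_product L))) \<longlongrightarrow> of_real (1 / T) * of_real (exp (ein_real T))) at_top"
    proof (rule Lim_transform_eventually[OF tendsto_mult[OF l2 l1]])
      show "eventually (\<lambda>L. zeta_series (of_real (1 + T / L)) / of_real L * ((\<Prod>p\<in>primes_below (exp L). 1 - of_real (1 / real p) * X L p) / of_real (mertens_product L))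
          = complex_of_real (Y L / (L * mertens_product L))) at_top"
        using eventually_ge_at_top[of T]
      proof eventually_elim
        case (elim L)
        have "of_real (1 / real p) * X L p = npow p (of_real (1 + T / L))" if "p \<in> primes_below (exp L)" for p
        proof -
          have p: "real p > 0" using that by (auto dest!: primes_belowD(1) prime_gt_0_nat)
          have "complex_of_real (1 / real p) = exp (- of_real (ln (real p)))"
            using p by (simp add: exp_of_real exp_minus inverse_eq_divide flip: of_real_minus)
          then show ?thesis unfolding X_def prime_twist_def npow_def
            by (simp only: exp_add[symmetric]) (simp add: algebra_simps)
        qed
        then have "(\<Prod>p\<in>primes_below (exp L). 1 - of_real (1 / real p) * X L p) = (\<Prod>p\<in>primes_below (exp L). 1 - npow p (of_real (1 + T / L)))"
          by (intro prod.cong) auto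
        then show ?case using Y[OF elim] by (simp add: field_simps)
      qed
    qed
    then have "((\<lambda>L. complex_of_real (Y L / (L * mertens_product L))) \<longlongrightarrow> of_real (1 / T * exp (ein_real T))) at_top" by simp
    then have "((\<lambda>L. Y L / (L * mertens_product L)) \<longlongrightarrow> 1 / T * exp (ein_real T)) at_top" by (simp only: tendsto_of_real_iff)
    then show ?thesis by (simp add: \<mu>_def exp_minus field_simps)
  qed
  show ?thesis
  proof (rule order_tendstoI)
    fix c assume c: "c < exp (- ein_const)"
    have "eventually (\<lambda>T. c < \<mu> T / 1 \<and> T \<ge> 1) at_top"
      using order_tendstoD(1)[OF mulim c] eventually_ge_at_top[of 1] by eventually_elim auto
    then obtain T where T: "c < \<mu> T" "T \<ge> 1" by (auto dest!: eventually_happens)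
    define Y where "Y = (\<lambda>L. Re (zeta_series (of_real (1 + T / L)) * (\<Prod>p\<in>primes_below (exp L). 1 - npow p (of_real (1 + T / L)))))"
    have Y: "of_real (Y L) = zeta_series (of_real (1 + T / L)) * (\<Prod>p\<in>primes_below (exp L). 1 - npow p (of_real (1 + T / L)))"
      "1 \<le> Y L" "Y L \<le> exp (C * exp (- T))" if "L \<ge> T" for L
      using of_real_imageD[OF C(2)[OF T(2) that]] unfolding Y_def by blast+
    have mu: "\<mu> T > 0" using T by (simp add: \<mu>_def)
    have "((\<lambda>L. inverse (Y L / (L * mertens_product L))) \<longlongrightarrow> inverse (1 / \<mu> T)) at_top"
      using mu by (intro tendsto_inverse ratio T Y) auto
    then have "eventually (\<lambda>L. c < inverse (Y L / (L * mertens_product L))) at_top" using T by (intro order_tendstoD(1)) auto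
    then show "eventually (\<lambda>L. c < L * mertens_product L) at_top" using eventually_ge_at_top[of T]
    proof eventually_elim
      case (elim L)
      have "inverse (Y L / (L * mertens_product L)) = L * mertens_product L / Y L" by (simp add: field_simps)
      also have "\<dots> \<le> L * mertens_product L / 1" using Y(2)[of L] elim T mertens_product_pos[of L] by (intro divide_left_mono) auto
      finally show ?case using elim by simp
    qed
  next
    fix c assume c: "exp (- ein_const) < c"
    have "((\<lambda>T. \<mu> T * exp (C * exp (- T))) \<longlongrightarrow> exp (- ein_const) * exp (C * 0)) at_top"
    proof (intro tendsto_intros mulim)
      show "((\<lambda>T::real. exp (- T)) \<longlongrightarrow> 0) at_top" by real_asymp
    qed
    then have "eventually (\<lambda>T. \<mu> T * exp (C * exp (- T)) < c) at_top" using c by (intro order_tendstoD(2)) auto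
    then have "eventually (\<lambda>T. \<mu> T * exp (C * exp (- T)) < c \<and> T \<ge> 1) at_top"
      using eventually_ge_at_top[of 1] by eventually_elim auto
    then obtain T where T: "\<mu> T * exp (C * exp (- T)) < c" "T \<ge> 1" by (auto dest!: eventually_happens)
    define Y where "Y = (\<lambda>L. Re (zeta_series (of_real (1 + T / L)) * (\<Prod>p\<in>primes_below (exp L). 1 - npow p (of_real (1 + T / L)))))"
    have Y: "of_real (Y L) = zeta_series (of_real (1 + T / L)) * (\<Prod>p\<in>primes_below (exp L). 1 - npow p (of_real (1 + T / L)))"
      "1 \<le> Y L" "Y L \<le> exp (C * exp (- T))" if "L \<ge> T" for L
      using of_real_imageD[OF C(2)[OF T(2) that]] unfolding Y_def by blast+
    have mu: "\<mu> T > 0" using T by (simp add: \<mu>_def)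
    have "((\<lambda>L. inverse (Y L / (L * mertens_product L)) * exp (C * exp (- T))) \<longlongrightarrow> inverse (1 / \<mu> T) * exp (C * exp (- T))) at_top"
      using mu by (intro tendsto_intros tendsto_inverse ratio T Y) auto
    then have "eventually (\<lambda>L. inverse (Y L / (L * mertens_product L)) * exp (C * exp (- T)) < c) at_top" using T by (intro order_tendstoD(2)) auto
    then show "eventually (\<lambda>L. L * mertens_product L < c) at_top" using eventually_ge_at_top[of T]
    proof eventually_elim
      case (elim L)
      have "L * mertens_product L = L * mertens_product L / Y L * Y L" using Y(2)[of L] elim by simp
      also have "\<dots> \<le> L * mertens_product L / Y L * exp (C * exp (- T))"
        using Y(2,3)[of L] elim T mertens_product_pos[of L] by (intro mult_left_mono divide_nonneg_nonneg mult_nonneg_nonneg) auto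
      also have "L * mertens_product L / Y L = inverse (Y L / (L * mertens_product L))" by (simp add: field_simps)
      finally show ?case using elim by simp
    qed
  qed
qed

section \<open>The quadratic form as a sum over sets of primes\<close>

lemma prod_primes_properties:
  assumes "finite A" "\<And>p. p \<in> A \<Longrightarrow> prime (p::nat)"
  shows "prime_factors (\<Prod>A) = A" "squarefree (\<Prod>A)" "\<Prod>A > 0"
proof -
  show pos: "\<Prod>A > 0" using assms by (intro prod_pos) (auto simp: prime_gt_0_nat)
  have "prime_factorization (\<Prod>A) = (\<Sum>p\<in>A. prime_factorization p)"
    using assms prime_factorization_prod[of A "\<lambda>p. p"] by (auto simp: prime_gt_0_nat)
  also have "\<dots> = (\<Sum>p\<in>A. {#p#})" using assms by (intro sum.cong) (auto simp: prime_factorization_prime)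
  also have "\<dots> = mset_set A" using assms(1) by (simp add: sum_multiset_singleton)
  finally have pf: "prime_factorization (\<Prod>A) = mset_set A" .
  then show "prime_factors (\<Prod>A) = A" using assms by simp
  show "squarefree (\<Prod>A)"
    using assms by (intro squarefree_prod_coprime) (auto intro: primes_coprime squarefree_prime)
qed

lemma squarefree_eq_prod_prime_factors:
  assumes "squarefree (d::nat)" shows "\<Prod>(prime_factors d) = d"
proof -
  have d: "d \<noteq> 0" using assms by (auto intro!: Nat.gr0I)
  have "multiplicity p d = 1" if "p \<in> prime_factors d" for p
    using that assms d by (intro antisym) (auto simp: squarefree_factorial_semiring' prime_factors_multiplicity Suc_le_eq)
  then have "(\<Prod>p\<in>prime_factors d. p ^ multiplicity p d) = \<Prod>(prime_factors d)" by simp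
  then show ?thesis using prod_prime_factors[OF d] by simp
qed

lemma lcm_prod_primes:
  assumes "finite A" "finite B" "\<And>p. p \<in> A \<union> B \<Longrightarrow> prime (p::nat)"
  shows "lcm (\<Prod>A) (\<Prod>B) = \<Prod>(A \<union> B)"
proof (rule lcmI[symmetric, of "\<Prod>A" "\<Prod>(A \<union> B)" "\<Prod>B"])
  show "\<Prod>A dvd \<Prod>(A \<union> B)" "\<Prod>B dvd \<Prod>(A \<union> B)" using assms by (auto intro!: prod_dvd_prod_subset)
  show "\<Prod>(A \<union> B) dvd n" if "\<Prod>A dvd n" "\<Prod>B dvd n" for n
  proof (cases "n = 0")
    case False
    have "A \<subseteq> prime_factors n" "B \<subseteq> prime_factors n"
      using dvd_prime_factors[OF False that(1)] dvd_prime_factors[OF False that(2)] assms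
      by (simp_all add: prod_primes_properties(1))
    then have "\<Prod>(A \<union> B) dvd (\<Prod>p\<in>prime_factors n. p)" by (intro prod_dvd_prod_subset) auto
    also have "\<dots> dvd (\<Prod>p\<in>prime_factors n. p ^ multiplicity p n)"
      by (intro prod_dvd_prod) (auto simp: prime_factors_multiplicity intro!: dvd_power)
    also have "\<dots> = n" using prod_prime_factors[OF False] by simp
    finally show ?thesis .
  qed simp
  show "normalize (\<Prod>(A \<union> B)) = \<Prod>(A \<union> B)" by simp
qed

lemma multiplicative_prod_primes:
  assumes g: "multiplicative g" and "finite A" "\<And>p. p \<in> A \<Longrightarrow> prime p"
  shows "g (\<Prod>A) = (\<Prod>p\<in>A. g p)"
  using assms(2,3)
proof (induction A rule: finite_induct)
  case empty
  then show ?case using g by (simp add: multiplicative_def)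
next
  case (insert p A)
  have cop: "coprime p (\<Prod>A)" using insert by (intro prod_coprime_right primes_coprime) auto
  have "p > 0" "\<Prod>A > 0" using insert prod_primes_properties(3)[of A] by (auto simp: prime_gt_0_nat)
  then have "g (p * \<Prod>A) = g p * g (\<Prod>A)" using g cop unfolding multiplicative_def by blast
  then show ?case using insert by simp
qed

lemma sum_Pow_insert:
  assumes "finite S" "p \<notin> S"
  shows "(\<Sum>A\<in>Pow (insert p S). f A) = (\<Sum>A\<in>Pow S. f A + f (insert p A))"
proof -
  have inj: "inj_on (insert p) (Pow S)" using assms by (intro inj_onI) (auto simp: insert_eq_iff)
  have "(\<Sum>A\<in>Pow (insert p S). f A) = (\<Sum>A\<in>Pow S. f A) + (\<Sum>A\<in>insert p ` Pow S. f A)"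
    unfolding Pow_insert using assms by (intro sum.union_disjoint) auto
  also have "(\<Sum>A\<in>insert p ` Pow S. f A) = (\<Sum>A\<in>Pow S. f (insert p A))"
    by (subst sum.reindex[OF inj]) simp
  finally show ?thesis by (simp add: sum.distrib)
qed

lemma sum_Pow_Pow_insert:
  fixes F :: "'a set \<Rightarrow> 'a set \<Rightarrow> 'b :: comm_monoid_add"
  assumes "finite S" "p \<notin> S"
  shows "(\<Sum>A\<in>Pow (insert p S). \<Sum>B\<in>Pow (insert p S). F A B) =
    (\<Sum>A\<in>Pow S. \<Sum>B\<in>Pow S. F A B + F A (insert p B) + (F (insert p A) B + F (insert p A) (insert p B)))"
  by (simp add: sum_Pow_insert[OF assms] sum.distrib add_ac)

text \<open>A prime lies in neither set, in A only, in B only or in both, and contributes 1, -c x,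
  -c y or c x y accordingly.\<close>

lemma sum_Pow_Pow_eq_prod:
  fixes c x y :: "'a \<Rightarrow> complex"
  assumes "finite S"
  shows "(\<Sum>A\<in>Pow S. \<Sum>B\<in>Pow S. (-1) ^ card A * (-1) ^ card B * (\<Prod>p\<in>A \<union> B. c p) * (\<Prod>p\<in>A. x p) * (\<Prod>p\<in>B. y p))
    = (\<Prod>p\<in>S. 1 - c p * (x p + y p - x p * y p))"
  using assms
proof (induction S rule: finite_induct)
  case (insert p S)
  let ?f = "\<lambda>A B. (-1) ^ card A * (-1) ^ card B * (\<Prod>p\<in>A \<union> B. c p) * (\<Prod>p\<in>A. x p) * (\<Prod>p\<in>B. y p)"
  have "?f A B + ?f A (insert p B) + (?f (insert p A) B + ?f (insert p A) (insert p B))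
      = (1 - c p * (x p + y p - x p * y p)) * ?f A B" if "A \<in> Pow S" "B \<in> Pow S" for A B
  proof -
    have fin: "finite A" "finite B" "p \<notin> A" "p \<notin> B" using that insert.hyps finite_subset by auto
    have u: "A \<union> insert p B = insert p (A \<union> B)" "insert p A \<union> B = insert p (A \<union> B)" "insert p A \<union> insert p B = insert p (A \<union> B)" by auto
    show ?thesis unfolding u using fin by (simp add: algebra_simps)
  qed
  then have "(\<Sum>A\<in>Pow (insert p S). \<Sum>B\<in>Pow (insert p S). ?f A B) = (\<Sum>A\<in>Pow S. \<Sum>B\<in>Pow S. (1 - c p * (x p + y p - x p * y p)) * ?f A B)"
    unfolding sum_Pow_Pow_insert[OF insert.hyps(1,2)] by (intro sum.cong refl)
  also have "\<dots> = (1 - c p * (x p + y p - x p * y p)) * (\<Sum>A\<in>Pow S. \<Sum>B\<in>Pow S. ?f A B)"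
    by (simp only: sum_distrib_left)
  finally show ?case using insert by simp
qed simp

text \<open>Squarefree d1 and d2 are replaced by their sets of prime factors. Truncating the weights
  at 0 absorbs the conditions d1 <= R and d2 <= R, so that all pairs of subsets of the primes below
  z may be summed.\<close>

lemma Q_form_eq_sum_Pow:
  fixes z :: real
  assumes R: "R > 1" and m: "m \<ge> 1" and g: "multiplicative g"
  defines "S \<equiv> primes_below z"
  shows "Q_form g m R z = (\<Sum>A\<in>Pow S. \<Sum>B\<in>Pow S. (-1) ^ card A * (-1) ^ card B * (\<Prod>p\<in>A \<union> B. g p) *
      (max 0 (1 - (\<Sum>p\<in>A. ln (real p)) / ln R)) ^ m * (max 0 (1 - (\<Sum>p\<in>B. ln (real p)) / ln R)) ^ m)"
proof -
  define T where "T = {(d1, d2). 1 \<le> d1 \<and> 1 \<le> d2 \<and> real d1 \<le> R \<and> real d2 \<le> R \<and>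
                             (\<forall>p. prime p \<and> p dvd lcm d1 d2 \<longrightarrow> real p < z)}"
  define w where "w = (\<lambda>d::nat. max 0 (1 - ln (real d) / ln R) ^ m)"
  define f where "f = (\<lambda>(d1, d2). moebius_mu d1 * w d1 * (moebius_mu d2 * w d2) * g (lcm d1 d2))"
  define T' where "T' = (\<lambda>(A, B). (\<Prod>A, \<Prod>B)) ` (Pow S \<times> Pow S)"
  have lnR: "ln R > 0" using R by simp
  have finS: "finite S" and Sp: "\<And>p. p \<in> S \<Longrightarrow> prime p" by (auto simp: S_def dest: primes_belowD)
  have sub: "finite A" "\<And>p. p \<in> A \<Longrightarrow> prime p" if "A \<in> Pow S" for A
    using that finS Sp finite_subset by auto
  have finT: "finite T"
    by (rule finite_subset[of _ "{..nat \<lfloor>R\<rfloor>} \<times> {..nat \<lfloor>R\<rfloor>}"]) (auto simp: T_def le_nat_iff le_floor_iff)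
  have finT': "finite T'" unfolding T'_def using finS by simp
  have weight: "sieve_weight m R d = moebius_mu d * w d" if "1 \<le> d" "real d \<le> R" for d
  proof -
    have "ln (R / real d) / ln R = 1 - ln (real d) / ln R"
      using that R lnR by (simp add: ln_div diff_divide_distrib)
    moreover have "ln (real d) \<le> ln R" using that by simp
    ultimately show ?thesis using lnR by (simp add: sieve_weight_def P_fun_def w_def)
  qed
  have "Q_form g m R z = (\<Sum>(d1, d2)\<in>T. sieve_weight m R d1 * sieve_weight m R d2 * g (lcm d1 d2))"
    by (simp add: Q_form_def T_def)
  also have "\<dots> = sum f T"
    by (intro sum.cong refl) (auto simp: f_def T_def weight)
  \<comment> \<open>A pair that is not a pair of products of distinct primes below z has a member
    that is not squarefree, where the Moebius function vanishes.\<close>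
  also have "\<dots> = sum f (T \<inter> T')"
  proof (rule sum.mono_neutral_right[OF finT], blast, rule ballI)
    fix d assume d: "d \<in> T - T \<inter> T'"
    obtain d1 d2 where e: "d = (d1, d2)" by fastforce
    have "\<not> (squarefree d1 \<and> squarefree d2)"
    proof
      assume sq: "squarefree d1 \<and> squarefree d2"
      have "prime_factors d1 \<subseteq> S" "prime_factors d2 \<subseteq> S"
        using d by (auto simp: e T_def S_def primes_below_def in_prime_factors_iff)
      then have "d \<in> T'" unfolding T'_def e
        using sq squarefree_eq_prod_prime_factors by (intro image_eqI[of _ _ "(prime_factors d1, prime_factors d2)"]) auto
      then show False using d by simp
    qed
    then show "f d = 0" by (auto simp: f_def e moebius_mu_def)
  qed
  \<comment> \<open>Conversely the pairs with a product above R are added. A truncated weight is 0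
    there, m >= 1 excluding the value 0^0 = 1.\<close>
  also have "\<dots> = sum f T'"
  proof (rule sum.mono_neutral_left[OF finT'], blast, rule ballI)
    fix d assume d: "d \<in> T' - T \<inter> T'"
    then obtain A B where AB: "A \<in> Pow S" "B \<in> Pow S" "d = (\<Prod>A, \<Prod>B)" by (auto simp: T'_def)
    note pA = prod_primes_properties[OF sub[OF AB(1)]] and pB = prod_primes_properties[OF sub[OF AB(2)]]
    have lcm: "lcm (\<Prod>A) (\<Prod>B) = \<Prod>(A \<union> B)" using AB sub by (intro lcm_prod_primes) auto
    have pos: "\<Prod>(A \<union> B) > 0" using AB sub by (intro prod_primes_properties(3)) auto
    have "real p < z" if "prime p" "p dvd lcm (\<Prod>A) (\<Prod>B)" for p
    proof -
      have "p \<in> prime_factors (\<Prod>(A \<union> B))"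
        using that pos unfolding lcm in_prime_factors_iff by (metis less_irrefl)
      also have "prime_factors (\<Prod>(A \<union> B)) = A \<union> B" using AB sub by (intro prod_primes_properties) auto
      finally show ?thesis using AB by (auto simp: S_def primes_below_def)
    qed
    then have "\<not> (real (\<Prod>A) \<le> R \<and> real (\<Prod>B) \<le> R)"
      using d pA(3) pB(3) by (auto simp: T_def AB(3) Suc_le_eq)
    moreover have "w d = 0" if "real d > R" for d
    proof -
      have "ln (real d) > ln R" using that R by simp
      then have "1 - ln (real d) / ln R \<le> 0" using lnR by (simp add: field_simps)
      then show ?thesis using m by (simp add: w_def max_def)
    qed
    ultimately show "f d = 0" by (auto simp: f_def AB(3) not_le)
  qed
  also have "\<dots> = (\<Sum>(A, B)\<in>Pow S \<times> Pow S. f (\<Prod>A, \<Prod>B))"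
  proof -
    have "inj_on (\<lambda>(A, B). (\<Prod>A, \<Prod>B)) (Pow S \<times> Pow S)"
    proof (rule inj_on_inverseI[where g = "\<lambda>(a, b). (prime_factors a, prime_factors b)"])
      fix P assume "P \<in> Pow S \<times> Pow S"
      then obtain A B where P: "P = (A, B)" "A \<in> Pow S" "B \<in> Pow S" by blast
      have "prime_factors (\<Prod>A) = A" "prime_factors (\<Prod>B) = B"
        by (intro prod_primes_properties(1) sub[OF P(2)] sub[OF P(3)]; assumption)+
      then show "(case (case P of (A, B) \<Rightarrow> (\<Prod>A, \<Prod>B)) of (a, b) \<Rightarrow> (prime_factors a, prime_factors b)) = P"
        by (simp only: P(1) prod.case)
    qed
    then show ?thesis unfolding T'_def by (subst sum.reindex) (auto simp: case_prod_unfold)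
  qed
  also have "\<dots> = (\<Sum>A\<in>Pow S. \<Sum>B\<in>Pow S. f (\<Prod>A, \<Prod>B))" by (simp only: sum.cartesian_product)
  also have "\<dots> = (\<Sum>A\<in>Pow S. \<Sum>B\<in>Pow S. (-1) ^ card A * (-1) ^ card B * (\<Prod>p\<in>A \<union> B. g p) *
      (max 0 (1 - (\<Sum>p\<in>A. ln (real p)) / ln R)) ^ m * (max 0 (1 - (\<Sum>p\<in>B. ln (real p)) / ln R)) ^ m)"
  proof (intro sum.cong refl)
    fix A B assume AB: "A \<in> Pow S" "B \<in> Pow S"
    have lnp: "ln (real (\<Prod>A)) = (\<Sum>p\<in>A. ln (real p))" if "A \<in> Pow S" for A
      using sub[OF that] by (subst of_nat_prod, subst ln_prod) (auto dest: prime_gt_0_nat)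
    have mu: "moebius_mu (\<Prod>A) = (-1) ^ card A" if "A \<in> Pow S" for A
      using prod_primes_properties[OF sub[OF that]] by (simp add: moebius_mu_def)
    have lcm: "lcm (\<Prod>A) (\<Prod>B) = \<Prod>(A \<union> B)" using AB sub by (intro lcm_prod_primes) auto
    have gl: "g (\<Prod>(A \<union> B)) = (\<Prod>p\<in>A \<union> B. g p)" using AB sub by (intro multiplicative_prod_primes g) auto
    show "f (\<Prod>A, \<Prod>B) = (-1) ^ card A * (-1) ^ card B * (\<Prod>p\<in>A \<union> B. g p) *
      (max 0 (1 - (\<Sum>p\<in>A. ln (real p)) / ln R)) ^ m * (max 0 (1 - (\<Sum>p\<in>B. ln (real p)) / ln R)) ^ m"
      unfolding f_def prod.case mu[OF AB(1)] mu[OF AB(2)] lcm gl w_def lnp[OF AB(1)] lnp[OF AB(2)]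
      by (simp only: mult_ac)
  qed
  finally show ?thesis .
qed

text \<open>The case X = 1 of \<open>euler_factor_near\<close>: each factor is 1 + O(1/p^2), so the
  product converges absolutely and vanishes only if one of its factors does.\<close>

lemma singular_product_properties:
  fixes g :: "nat \<Rightarrow> real"
  assumes g: "\<And>p. prime p \<Longrightarrow> \<bar>g p - real k / real p\<bar> \<le> C0 / (real p)\<^sup>2"
  shows "(\<lambda>N. \<Prod>p\<in>primes_below (real N). (1 - g p) * inverse (1 - 1 / real p) ^ k) \<longlonglongrightarrow> singular_product g k"
    and "(\<forall>p. prime p \<longrightarrow> g p \<noteq> 1) \<Longrightarrow> singular_product g k \<noteq> 0"
proof -
  define h where "h = (\<lambda>p. if prime p then (1 - g p) * (1 - 1 / real p) powi (- int k) else 1)"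
  have hp: "h p = (1 - g p) * inverse (1 - 1 / real p) ^ k" if "prime p" for p
    using that by (simp add: h_def power_int_minus power_inverse)
  obtain C where C: "C \<ge> 0" "\<And>(X::complex) p. prime p \<Longrightarrow> norm X \<le> 3 \<Longrightarrow>
    norm ((1 - of_real (g p) * X) * inverse (1 - 1 / of_nat p) ^ k * exp (- of_nat k * (1 - X) / of_nat p) - 1) \<le> C / (real p)\<^sup>2"
    using euler_factor_near[OF g] by blast
  have "norm (h p - 1) \<le> C * (1 / (real p) ^ 2)" for p
  proof (cases "prime p")
    case True
    have "norm (complex_of_real (h p - 1)) \<le> C / (real p)\<^sup>2"
      using C(2)[OF True, of 1] unfolding hp[OF True] by simp
    then show ?thesis by (simp only: norm_of_real real_norm_def) simp
  qed (use C in \<open>simp add: h_def\<close>)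
  moreover have "summable (\<lambda>p. C * (1 / (real p) ^ 2))"
    using inverse_power_summable[of 2, where ?'a = real] by (intro summable_mult) (simp add: inverse_eq_divide)
  ultimately have "summable (\<lambda>p. norm (h p - 1))"
    by (intro summable_comparison_test[of "\<lambda>p. norm (h p - 1)"]) auto
  then have conv: "convergent_prod h"
    by (intro abs_convergent_prod_imp_convergent_prod summable_imp_abs_convergent_prod)
  have sing: "singular_product g k = prodinf h" by (simp add: singular_product_def h_def)
  have eq: "(\<Prod>i<N. h i) = (\<Prod>p\<in>primes_below (real N). (1 - g p) * inverse (1 - 1 / real p) ^ k)" for N
  proof -
    have "(\<Prod>i<N. h i) = (\<Prod>p\<in>primes_below (real N). h p)"
      by (intro prod.mono_neutral_right) (auto simp: primes_below_def h_def)
    then show ?thesis by (simp add: hp primes_belowD)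
  qed
  have "(\<lambda>N. \<Prod>i<N. h i) \<longlonglongrightarrow> prodinf h"
    using convergent_prod_LIMSEQ[OF conv] by (subst LIMSEQ_lessThan_iff_atMost)
  then show "(\<lambda>N. \<Prod>p\<in>primes_below (real N). (1 - g p) * inverse (1 - 1 / real p) ^ k) \<longlonglongrightarrow> singular_product g k"
    by (simp only: eq sing)
  assume n: "\<forall>p. prime p \<longrightarrow> g p \<noteq> 1"
  have "h p \<noteq> 0" for p using n real_prime_ge_2[of p] by (auto simp: h_def)
  then show "singular_product g k \<noteq> 0" unfolding sing by (intro prodinf_nonzero conv)
qed

section \<open>Domination of the twisted Euler product\<close>

lemma prime_twist_add: "prime_twist L (a + b) p = prime_twist L a p * prime_twist L b p"
  unfolding prime_twist_def exp_add[symmetric] by (simp only: minus_add_distrib distrib_right)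

lemma prime_twist_over_p: "p > 0 \<Longrightarrow> prime_twist L a p / of_nat p = npow p (1 + a / of_real L)"
proof -
  assume p: "p > 0"
  have "1 / of_nat p = exp (- complex_of_real (ln (real p)))"
    using p by (simp add: exp_of_real exp_minus inverse_eq_divide flip: of_real_minus)
  moreover have "prime_twist L a p / of_nat p = prime_twist L a p * (1 / of_nat p)" by simp
  ultimately have "prime_twist L a p / of_nat p = prime_twist L a p * exp (- complex_of_real (ln (real p)))" by (simp only:)
  also have "\<dots> = npow p (1 + a / of_real L)"
    unfolding prime_twist_def npow_def exp_add[symmetric] by (simp add: algebra_simps)
  finally show ?thesis .
qed

lemma norm_line_ge_1: "norm (Complex 1 t) \<ge> 1"
  using abs_Re_le_cmod[of "Complex 1 t"] by simp

text \<open>The exponential of minus the cut prime sum behaves like 1/|zeta(1 + a/L)|, so the cutoff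
  at exp L combines with the lower bound for zeta.\<close>

lemma prime_exp_sum_bound:
  assumes "0 < \<eta>" "\<eta> < 1"
  obtains C L0 where "C > 0" "L0 \<ge> 1"
    "\<And>L t. L \<ge> L0 \<Longrightarrow> L * exp (- (\<Sum>p\<in>primes_below (exp L). Re (npow p (1 + Complex 1 t / of_real L)))) \<le> C * norm (Complex 1 t) powr (1 + \<eta>)"
    "\<And>L. L \<ge> L0 \<Longrightarrow> (\<Sum>p\<in>primes_below (exp L). 1 / real p) \<le> ln L + C"
proof -
  obtain C1 where C1: "C1 > 0"
    "\<And>L t. L \<ge> 1 \<Longrightarrow> exp (- (\<Sum>p\<in>primes_below (exp L). Re (npow p (1 + Complex 1 t / of_real L)))) *
        norm (zeta_series (1 + Complex 1 t / of_real L)) \<le> C1"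
    "\<And>L. L \<ge> 1 \<Longrightarrow> (\<Sum>p\<in>primes_below (exp L). 1 / real p) \<le> ln L + C1"
    using prime_sum_cutoff by metis
  obtain C2 L0 where C2: "C2 > 0" "L0 \<ge> 1"
    "\<And>L t. L \<ge> L0 \<Longrightarrow> L \<le> C2 * norm (Complex 1 t) powr (1 + \<eta>) * norm (zeta_series (1 + Complex 1 t / of_real L))"
    using zeta_series_lower[OF assms] by blast
  have "L * exp (- (\<Sum>p\<in>primes_below (exp L). Re (npow p (1 + Complex 1 t / of_real L)))) \<le> (C2 * C1) * norm (Complex 1 t) powr (1 + \<eta>)"
    if L: "L \<ge> L0" for L t
  proof -
    let ?e = "exp (- (\<Sum>p\<in>primes_below (exp L). Re (npow p (1 + Complex 1 t / of_real L))))"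
    have "L * ?e \<le> C2 * norm (Complex 1 t) powr (1 + \<eta>) * norm (zeta_series (1 + Complex 1 t / of_real L)) * ?e"
      using C2(3)[OF L, of t] by (intro mult_right_mono) auto
    also have "\<dots> = C2 * norm (Complex 1 t) powr (1 + \<eta>) * (?e * norm (zeta_series (1 + Complex 1 t / of_real L)))" by (simp only: mult_ac)
    also have "\<dots> \<le> C2 * norm (Complex 1 t) powr (1 + \<eta>) * C1"
      using C2 L by (intro mult_left_mono C1(2)) auto
    finally show ?thesis by (simp only: mult_ac)
  qed
  note A = this
  show ?thesis
  proof (rule that[of "max C1 (C2 * C1)" L0])
    show "L * exp (- (\<Sum>p\<in>primes_below (exp L). Re (npow p (1 + Complex 1 t / of_real L)))) \<le> max C1 (C2 * C1) * norm (Complex 1 t) powr (1 + \<eta>)"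
      if "L \<ge> L0" for L t
      by (rule order_trans[OF A[OF that]]) (intro mult_right_mono, auto)
    show "(\<Sum>p\<in>primes_below (exp L). 1 / real p) \<le> ln L + max C1 (C2 * C1)" if "L \<ge> L0" for L
      using C1(3)[of L] C2(2) that by auto
  qed (use C1 C2 in auto)
qed

definition twisted_product :: "(nat \<Rightarrow> real) \<Rightarrow> real \<Rightarrow> complex \<Rightarrow> complex \<Rightarrow> complex" where
  "twisted_product g L a b = (\<Prod>p\<in>primes_below (exp L). 1 - of_real (g p) * (prime_twist L a p + prime_twist L b p - prime_twist L a p * prime_twist L b p))"

context
  fixes k :: nat and g :: "nat \<Rightarrow> real" and C0 :: real
  assumes k: "k \<ge> 1"
    and g: "\<And>p. prime p \<Longrightarrow> \<bar>g p - real k / real p\<bar> \<le> C0 / (real p)\<^sup>2"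
begin

text \<open>For X = p^(-a/L) + p^(-b/L) - p^(-(a+b)/L) the difference 1 - X is the same combination
  of the three terms 1 - p^(-c/L), whence the exponent Ein a + Ein b - Ein (a + b). Mertens' third
  theorem then removes the denominator.\<close>

lemma twisted_product_tendsto:
  assumes a: "Re a \<ge> 0" "Re b \<ge> 0"
  shows "((\<lambda>L. of_real L ^ k * twisted_product g L a b) \<longlongrightarrow>
    of_real (singular_product g k * exp (- (real k * ein_const))) * exp (of_nat k * (Ein a + Ein b - Ein (a + b)))) at_top"
proof -
  define X where "X = (\<lambda>L p. prime_twist L a p + prime_twist L b p - prime_twist L a p * prime_twist L b p)"
  have "((\<lambda>L. (\<Prod>p\<in>primes_below (exp L). 1 - of_real (g p) * X L p) / of_real (\<Prod>p\<in>primes_below (exp L). 1 - 1 / real p) ^ k)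
     \<longlongrightarrow> of_real (singular_product g k) * exp (of_nat k * (Ein a + Ein b - Ein (a + b)))) at_top"
  proof (rule euler_product_ratio_tendsto[OF g])
    show "norm (X L p) \<le> 3" if "L > 0" "prime p" for L p
    proof -
      have n: "norm (prime_twist L a p) \<le> 1" "norm (prime_twist L b p) \<le> 1" using norm_prime_twist_le that a by auto
      have "norm (X L p) \<le> norm (prime_twist L a p) + norm (prime_twist L b p) + norm (prime_twist L a p) * norm (prime_twist L b p)"
        unfolding X_def norm_mult[symmetric] by norm
      also have "\<dots> \<le> 1 + 1 + 1 * 1" using n by (intro add_mono mult_mono) auto
      finally show ?thesis by simp
    qed
    have "((\<lambda>L. X L p) \<longlongrightarrow> 1 + 1 - 1 * 1) at_top" for p unfolding X_def by (intro tendsto_intros prime_twist_tendsto)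
    then show "((\<lambda>L. X L p) \<longlongrightarrow> 1) at_top" for p by simp
    show "(\<lambda>N. \<Prod>p\<in>primes_below (real N). (1 - g p) * inverse (1 - 1 / real p) ^ k) \<longlonglongrightarrow> singular_product g k"
      by (rule singular_product_properties(1)[OF g])
    have "((\<lambda>L. (\<Sum>p\<in>primes_below (exp L). (1 - prime_twist L a p) / of_nat p) + (\<Sum>p\<in>primes_below (exp L). (1 - prime_twist L b p) / of_nat p)
        - (\<Sum>p\<in>primes_below (exp L). (1 - prime_twist L (a + b) p) / of_nat p)) \<longlongrightarrow> Ein a + Ein b - Ein (a + b)) at_top"
      by (intro tendsto_intros sum_tendsto_Ein)
    moreover have "(\<Sum>p\<in>primes_below (exp L). (1 - prime_twist L a p) / of_nat p) + (\<Sum>p\<in>primes_below (exp L). (1 - prime_twist L b p) / of_nat p)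
        - (\<Sum>p\<in>primes_below (exp L). (1 - prime_twist L (a + b) p) / of_nat p) = (\<Sum>p\<in>primes_below (exp L). (1 - X L p) / of_nat p)" for L
      unfolding X_def prime_twist_add sum.distrib[symmetric] sum_subtractf[symmetric]
      by (intro sum.cong refl) (simp add: algebra_simps diff_divide_distrib add_divide_distrib)
    ultimately show "((\<lambda>L. \<Sum>p\<in>primes_below (exp L). (1 - X L p) / of_nat p) \<longlongrightarrow> Ein a + Ein b - Ein (a + b)) at_top"
      by simp
  qed
  then have l1: "((\<lambda>L. twisted_product g L a b / of_real (mertens_product L) ^ k) \<longlongrightarrow> of_real (singular_product g k) * exp (of_nat k * (Ein a + Ein b - Ein (a + b)))) at_top"
    by (simp only: twisted_product_def X_def mertens_product_def)
  have "((\<lambda>L. complex_of_real ((L * mertens_product L) ^ k)) \<longlongrightarrow> of_real (exp (- ein_const) ^ k)) at_top"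
    by (intro tendsto_of_real tendsto_power mertens_third)
  from tendsto_mult[OF this l1]
  have "((\<lambda>L. of_real ((L * mertens_product L) ^ k) * (twisted_product g L a b / of_real (mertens_product L) ^ k)) \<longlongrightarrow>
      of_real (exp (- ein_const) ^ k) * (of_real (singular_product g k) * exp (of_nat k * (Ein a + Ein b - Ein (a + b))))) at_top" .
  moreover have "of_real ((L * mertens_product L) ^ k) * (twisted_product g L a b / of_real (mertens_product L) ^ k) = of_real L ^ k * twisted_product g L a b" for L
    using mertens_product_pos[of L] by (simp add: power_mult_distrib)
  moreover have "exp (- ein_const) ^ k = exp (- (real k * ein_const))" by (simp flip: exp_of_nat_mult)
  ultimately show ?thesis by (simp add: mult_ac)
qed

text \<open>The mixed term p^(-(a+b)/L) is estimated by 1/p, at the price L^k. With the L^k of the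
  statement there is one factor L^k for each of the two exponentials of -k times a prime sum, and
  each such pair is bounded by \<open>prime_exp_sum_bound\<close>.\<close>

lemma twisted_product_bound:
  obtains D L0 where "D \<ge> 0" "L0 \<ge> 1"
    "\<And>L t t'. L \<ge> L0 \<Longrightarrow> norm (of_real L ^ k * twisted_product g L (Complex 1 t) (Complex 1 t')) \<le>
       D * (norm (Complex 1 t) powr (real k + 1/2) * norm (Complex 1 t') powr (real k + 1/2))"
proof -
  \<comment> \<open>Chosen so that k (1 + \<eta>) = k + 1/2.\<close>
  define \<eta> where "\<eta> = 1 / (2 * real k)"
  have \<eta>: "0 < \<eta>" "\<eta> < 1" using k by (auto simp: \<eta>_def)
  obtain C L0 where C: "C > 0" "L0 \<ge> 1"
    "\<And>L t. L \<ge> L0 \<Longrightarrow> L * exp (- (\<Sum>p\<in>primes_below (exp L). Re (npow p (1 + Complex 1 t / of_real L)))) \<le> C * norm (Complex 1 t) powr (1 + \<eta>)"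
    "\<And>L. L \<ge> L0 \<Longrightarrow> (\<Sum>p\<in>primes_below (exp L). 1 / real p) \<le> ln L + C"
    using prime_exp_sum_bound[OF \<eta>] by blast
  have C0: "C0 \<ge> 0" using order_trans[OF abs_ge_zero g[of 2]] by (simp add: zero_le_divide_iff)
  \<comment> \<open>The first part is the error of g(p) against k/p times |X| <= 3; the second is
    half the square of the local perturbation g(p) X, which is at most 3 (k + C0)/p.\<close>
  define K where "K = 3 * C0 + (3 * (real k + C0))\<^sup>2 / 2"
  have K: "K \<ge> 0" using C0 by (simp add: K_def)
  define D where "D = exp (real k * C + K) * (C ^ k * C ^ k)"
  have "norm (of_real L ^ k * twisted_product g L (Complex 1 t) (Complex 1 t')) \<le>
       D * (norm (Complex 1 t) powr (real k + 1/2) * norm (Complex 1 t') powr (real k + 1/2))" if L: "L \<ge> L0" for L t t'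
  proof -
    define a where "a = Complex 1 t"
    define b where "b = Complex 1 t'"
    have L1: "L \<ge> 1" using L C by simp
    define PP where "PP = (\<lambda>a. \<Sum>p\<in>primes_below (exp L). Re (npow p (1 + a / of_real L)))"
    have fac: "norm (1 - of_real (g p) * (prime_twist L a p + prime_twist L b p - prime_twist L a p * prime_twist L b p)) \<le>
        exp (- (real k * Re (npow p (1 + a / of_real L))) - real k * Re (npow p (1 + b / of_real L)) + real k * (1 / real p) + K * (1 / real p ^ 2))"
      if "p \<in> primes_below (exp L)" for p
    proof -
      have p: "prime p" "real p \<ge> 2" using that primes_belowD real_prime_ge_2 by blast+
      define X where "X = prime_twist L a p + prime_twist L b p - prime_twist L a p * prime_twist L b p"
      have n: "norm (prime_twist L a p) \<le> 1" "norm (prime_twist L b p) \<le> 1" using norm_prime_twist_le p L1 by (auto simp: a_def b_def)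
      have "norm X \<le> norm (prime_twist L a p) + norm (prime_twist L b p) + norm (prime_twist L a p) * norm (prime_twist L b p)"
        unfolding X_def norm_mult[symmetric] by norm
      also have "\<dots> \<le> 1 + 1 + 1 * 1" using n by (intro add_mono mult_mono) auto
      finally have X3: "norm X \<le> 3" by simp
      have gb: "\<bar>g p - real k / real p\<bar> \<le> C0 / (real p)\<^sup>2" by (rule g[OF p(1)])
      have "\<bar>g p\<bar> \<le> (real k + C0) / real p"
      proof -
        have "C0 / (real p)\<^sup>2 \<le> C0 / real p"
          using p C0 by (intro divide_left_mono) (auto simp: power2_eq_square)
        then show ?thesis using gb p by (simp add: add_divide_distrib) (smt (verit) divide_nonneg_nonneg of_nat_0_le_iff)
      qed
      then have "\<bar>g p\<bar> * norm X \<le> (real k + C0) / real p * 3" using X3 C0 by (intro mult_mono) auto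
      then have "norm (- (of_real (g p) * X)) \<le> 3 * (real k + C0) / real p" by (simp add: norm_mult algebra_simps)
      then have "norm (- (of_real (g p) * X)) ^ 2 \<le> (3 * (real k + C0) / real p) ^ 2" by (intro power_mono) auto
      then have sq: "norm (- (of_real (g p) * X)) ^ 2 / 2 \<le> (3 * (real k + C0))\<^sup>2 / 2 * (1 / real p ^ 2)"
        by (simp add: power_divide)
      define y where "y = (g p - real k / real p) * Re X"
      have e1: "- (g p * Re X) = - (real k / real p * Re X) - y" by (simp add: y_def algebra_simps)
      have "\<bar>y\<bar> \<le> C0 / (real p)\<^sup>2 * 3"
        unfolding y_def abs_mult using gb X3 abs_Re_le_cmod[of X] C0 by (intro mult_mono) auto
      moreover have "C0 / (real p)\<^sup>2 * 3 = 3 * C0 * (1 / real p ^ 2)" by simp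
      ultimately have re: "- (g p * Re X) \<le> - (real k / real p * Re X) + 3 * C0 * (1 / real p ^ 2)"
        unfolding e1 by linarith
      have "Re X / real p = Re (X / of_nat p)" by simp
      also have "X / of_nat p = npow p (1 + a / of_real L) + npow p (1 + b / of_real L) - prime_twist L a p * prime_twist L b p / of_nat p"
        unfolding X_def using p by (simp add: add_divide_distrib diff_divide_distrib prime_twist_over_p)
      also have "Re \<dots> \<ge> Re (npow p (1 + a / of_real L)) + Re (npow p (1 + b / of_real L)) - 1 / real p"
      proof -
        have "Re (prime_twist L a p * prime_twist L b p / of_nat p) \<le> norm (prime_twist L a p * prime_twist L b p / of_nat p)" by (rule complex_Re_le_cmod)
        also have "\<dots> \<le> (1 * 1) / real p" unfolding norm_divide norm_mult norm_of_nat
          using n by (intro divide_right_mono mult_mono) auto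
        finally show ?thesis by simp
      qed
      finally have "Re X / real p \<ge> Re (npow p (1 + a / of_real L)) + Re (npow p (1 + b / of_real L)) - 1 / real p" .
      then have "real k * (Re X / real p) \<ge> real k * (Re (npow p (1 + a / of_real L)) + Re (npow p (1 + b / of_real L)) - 1 / real p)"
        by (intro mult_left_mono) auto
      then have re2: "- (real k / real p * Re X) \<le> - (real k * Re (npow p (1 + a / of_real L))) - real k * Re (npow p (1 + b / of_real L)) + real k * (1 / real p)"
        by (simp add: algebra_simps)
      have Kx: "K * (1 / real p ^ 2) = 3 * C0 * (1 / real p ^ 2) + (3 * (real k + C0))\<^sup>2 / 2 * (1 / real p ^ 2)"
        by (simp only: K_def distrib_right)
      have "norm (1 + - (of_real (g p) * X)) \<le> exp (Re (- (of_real (g p) * X)) + norm (- (of_real (g p) * X)) ^ 2 / 2)"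
        by (rule norm_one_plus_le)
      also have "Re (- (of_real (g p) * X)) = - (g p * Re X)" by simp
      also have "exp (- (g p * Re X) + norm (- (of_real (g p) * X)) ^ 2 / 2) \<le>
          exp (- (real k * Re (npow p (1 + a / of_real L))) - real k * Re (npow p (1 + b / of_real L)) + real k * (1 / real p) + K * (1 / real p ^ 2))"
        unfolding exp_le_cancel_iff Kx using sq re re2 by linarith
      finally show ?thesis unfolding X_def by simp
    qed
    have "norm (twisted_product g L a b) \<le> (\<Prod>p\<in>primes_below (exp L). exp (- (real k * Re (npow p (1 + a / of_real L))) - real k * Re (npow p (1 + b / of_real L)) + real k * (1 / real p) + K * (1 / real p ^ 2)))"
      unfolding twisted_product_def prod_norm[symmetric] by (intro prod_mono conjI norm_ge_zero fac)
    also have "\<dots> = exp (- (real k * PP a) - real k * PP b + real k * (\<Sum>p\<in>primes_below (exp L). 1 / real p) + K * (\<Sum>p\<in>primes_below (exp L). 1 / real p ^ 2))"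
      unfolding PP_def by (simp add: exp_sum[symmetric] sum.distrib sum_subtractf sum_negf sum_distrib_left)
    also have "\<dots> \<le> exp (- (real k * PP a) - real k * PP b + real k * (ln L + C) + K * 1)"
    proof -
      have "real k * (\<Sum>p\<in>primes_below (exp L). 1 / real p) \<le> real k * (ln L + C)"
        by (intro mult_left_mono C(4) L) auto
      moreover have "K * (\<Sum>p\<in>primes_below (exp L). 1 / real p ^ 2) \<le> K * 1"
        by (intro mult_left_mono sum_inverse_squares_le K) (auto dest: primes_belowD prime_ge_2_nat)
      ultimately show ?thesis by simp
    qed
    also have "\<dots> = exp (real k * C + K) * L ^ k * exp (- PP a) ^ k * exp (- PP b) ^ k"
    proof -
      have "L ^ k = exp (real k * ln L)" using L1 by (simp add: exp_of_nat_mult)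
      then show ?thesis unfolding exp_of_nat_mult[symmetric] by (simp add: algebra_simps flip: exp_add)
    qed
    finally have EPb: "norm (twisted_product g L a b) \<le> exp (real k * C + K) * L ^ k * exp (- PP a) ^ k * exp (- PP b) ^ k" .
    have "norm (of_real L ^ k * twisted_product g L a b) = L ^ k * norm (twisted_product g L a b)" using L1 by (simp add: norm_mult norm_power)
    also have "\<dots> \<le> L ^ k * (exp (real k * C + K) * L ^ k * exp (- PP a) ^ k * exp (- PP b) ^ k)"
      using L1 by (intro mult_left_mono EPb) auto
    also have "\<dots> = exp (real k * C + K) * ((L * exp (- PP a)) ^ k * (L * exp (- PP b)) ^ k)"
      by (simp only: power_mult_distrib mult_ac)
    also have "\<dots> \<le> exp (real k * C + K) * ((C * norm a powr (1 + \<eta>)) ^ k * (C * norm b powr (1 + \<eta>)) ^ k)"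
    proof (intro mult_left_mono)
      have "L * exp (- PP a) \<le> C * norm a powr (1 + \<eta>)" "L * exp (- PP b) \<le> C * norm b powr (1 + \<eta>)"
        using C(3)[OF L] by (auto simp: PP_def a_def b_def)
      from power_mono[OF this(1), of k] power_mono[OF this(2), of k]
      show "(L * exp (- PP a)) ^ k * (L * exp (- PP b)) ^ k \<le> (C * norm a powr (1 + \<eta>)) ^ k * (C * norm b powr (1 + \<eta>)) ^ k"
        using L1 C(1) by (intro mult_mono) auto
    qed simp
    also have "\<dots> = D * ((norm a powr (1 + \<eta>)) ^ k * (norm b powr (1 + \<eta>)) ^ k)"
      by (simp only: D_def power_mult_distrib mult_ac)
    also have "(norm c powr (1 + \<eta>)) ^ k = norm c powr (real k + 1/2)" if "norm c \<ge> 1" for c :: complex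
    proof -
      have "(norm c powr (1 + \<eta>)) ^ k = norm c powr (real k * (1 + \<eta>))"
        using that by (subst powr_power) (auto simp: mult.commute)
      also have "real k * (1 + \<eta>) = real k + 1/2" using k by (simp add: \<eta>_def field_simps)
      finally show ?thesis .
    qed
    note e = this
    finally show ?thesis using e[of a] e[of b] norm_line_ge_1 by (simp add: a_def b_def)
  qed
  then show ?thesis using C K by (intro that[of D L0]) (auto simp: D_def)
qed

end

text \<open>By Mertens' third theorem exp(Ein a - \<gamma>) is the limit of L times the product of 1
  - p^(-1-a/L) over p < exp L. It inherits the bound that holds for these products uniformly in
  L.\<close>

lemma exp_Ein_bound:
  assumes k: "k \<ge> 1"
  obtains C where "C \<ge> 0" "\<And>t. norm (exp (of_nat k * Ein (Complex 1 t))) \<le> C * norm (Complex 1 t) powr (real k + 1/2)"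
proof -
  define \<eta> where "\<eta> = 1 / (2 * real k)"
  have \<eta>: "0 < \<eta>" "\<eta> < 1" using k by (auto simp: \<eta>_def)
  obtain C L0 where C: "C > 0" "L0 \<ge> 1"
    "\<And>L t. L \<ge> L0 \<Longrightarrow> L * exp (- (\<Sum>p\<in>primes_below (exp L). Re (npow p (1 + Complex 1 t / of_real L)))) \<le> C * norm (Complex 1 t) powr (1 + \<eta>)"
    "\<And>L. L \<ge> L0 \<Longrightarrow> (\<Sum>p\<in>primes_below (exp L). 1 / real p) \<le> ln L + C"
    using prime_exp_sum_bound[OF \<eta>] by blast
  define K where "K = exp ein_const * (exp 4 * C)"
  have b: "norm (exp (Ein (Complex 1 t))) \<le> K * norm (Complex 1 t) powr (1 + \<eta>)" for t
  proof -
    define a where "a = Complex 1 t"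
    have "((\<lambda>L. (\<Prod>p\<in>primes_below (exp L). 1 - of_real (1 / real p) * prime_twist L a p) / of_real (\<Prod>p\<in>primes_below (exp L). 1 - 1 / real p) ^ 1)
       \<longlongrightarrow> of_real 1 * exp (of_nat 1 * Ein a)) at_top"
    proof (rule euler_product_ratio_tendsto[where ?C0.0 = 0])
      show "norm (prime_twist L a p) \<le> 3" if "L > 0" "prime p" for L p
        using norm_prime_twist_le[of a L p] that by (simp add: a_def)
      have "(\<Prod>p\<in>primes_below (real N). (1 - 1 / real p) * inverse (1 - 1 / real p) ^ 1) = 1" for N
        by (intro prod.neutral ballI) (auto dest!: primes_belowD(1) real_prime_ge_2)
      then show "(\<lambda>N. \<Prod>p\<in>primes_below (real N). (1 - 1 / real p) * inverse (1 - 1 / real p) ^ 1) \<longlonglongrightarrow> 1"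
        by (simp only: tendsto_const)
    qed (auto simp: prime_twist_tendsto intro!: sum_tendsto_Ein)
    then have "((\<lambda>L. (\<Prod>p\<in>primes_below (exp L). 1 - of_real (1 / real p) * prime_twist L a p) / of_real (mertens_product L)) \<longlongrightarrow> exp (Ein a)) at_top"
      unfolding mertens_product_def by simp
    from tendsto_mult[OF tendsto_of_real[OF mertens_third] this]
    have "((\<lambda>L. norm (of_real (L * mertens_product L) * ((\<Prod>p\<in>primes_below (exp L). 1 - of_real (1 / real p) * prime_twist L a p) / of_real (mertens_product L))))
       \<longlongrightarrow> norm (of_real (exp (- ein_const)) * exp (Ein a))) at_top" by (rule tendsto_norm)
    moreover have "eventually (\<lambda>L. norm (of_real (L * mertens_product L) * ((\<Prod>p\<in>primes_below (exp L). 1 - of_real (1 / real p) * prime_twist L a p) / of_real (mertens_product L)))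
        \<le> exp 4 * C * norm a powr (1 + \<eta>)) at_top"
      using eventually_ge_at_top[of L0]
    proof eventually_elim
      case (elim L)
      have L1: "L \<ge> 1" using elim C by simp
      have "(\<Prod>p\<in>primes_below (exp L). 1 - of_real (1 / real p) * prime_twist L a p) = (\<Prod>p\<in>primes_below (exp L). 1 - npow p (1 + a / of_real L))"
        by (intro prod.cong refl) (auto simp: prime_twist_over_p[symmetric] dest!: primes_belowD(1) prime_gt_0_nat)
      then have "norm (of_real (L * mertens_product L) * ((\<Prod>p\<in>primes_below (exp L). 1 - of_real (1 / real p) * prime_twist L a p) / of_real (mertens_product L)))
          = L * norm (\<Prod>p\<in>primes_below (exp L). 1 - npow p (1 + a / of_real L))"
        using mertens_product_pos[of L] L1 by (simp add: norm_mult norm_divide)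
      also have "\<dots> \<le> L * (exp 4 * exp (- (\<Sum>p\<in>primes_below (exp L). Re (npow p (1 + a / of_real L)))))"
        using L1 by (intro mult_left_mono norm_euler_factor_bounds) (auto simp: a_def)
      also have "\<dots> = exp 4 * (L * exp (- (\<Sum>p\<in>primes_below (exp L). Re (npow p (1 + a / of_real L)))))" by (simp only: mult_ac)
      also have "\<dots> \<le> exp 4 * (C * norm a powr (1 + \<eta>))" unfolding a_def by (intro mult_left_mono C(3) elim) auto
      finally show ?case by (simp only: mult_ac)
    qed
    ultimately have "norm (of_real (exp (- ein_const)) * exp (Ein a)) \<le> exp 4 * C * norm a powr (1 + \<eta>)"
      by (rule tendsto_upperbound) auto
    then have "exp (- ein_const) * norm (exp (Ein a)) \<le> exp 4 * C * norm a powr (1 + \<eta>)" by (simp only: norm_mult norm_of_real) simp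
    then have "exp ein_const * (exp (- ein_const) * norm (exp (Ein a))) \<le> exp ein_const * (exp 4 * C * norm a powr (1 + \<eta>))" by (intro mult_left_mono) auto
    moreover have "exp ein_const * (exp (- ein_const) * norm (exp (Ein a))) = norm (exp (Ein a))" by (simp add: exp_minus)
    ultimately show ?thesis unfolding a_def[symmetric] K_def by (simp only: mult.assoc)
  qed
  have "norm (exp (of_nat k * Ein (Complex 1 t))) \<le> K ^ k * norm (Complex 1 t) powr (real k + 1/2)" for t
  proof -
    have "norm (exp (of_nat k * Ein (Complex 1 t))) = norm (exp (Ein (Complex 1 t))) ^ k"
      by (simp add: exp_of_nat_mult norm_power)
    also have "\<dots> \<le> (K * norm (Complex 1 t) powr (1 + \<eta>)) ^ k" by (intro power_mono b) auto
    also have "\<dots> = K ^ k * norm (Complex 1 t) powr (real k * (1 + \<eta>))"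
      unfolding power_mult_distrib using norm_line_ge_1[of t] by (subst powr_power) (auto simp: mult.commute)
    also have "real k * (1 + \<eta>) = real k + 1/2" using k by (simp add: \<eta>_def field_simps)
    finally show ?thesis .
  qed
  then show ?thesis using C by (intro that[of "K ^ k"]) (auto simp: K_def)
qed

section \<open>The quadratic form as a double Perron integral\<close>

lemma Complex_line_eq: "Complex 1 t = 1 + \<i> * of_real t"
  by (simp add: complex_eq_iff)

lemma continuous_on_line [continuous_intros]: "continuous_on A f \<Longrightarrow> continuous_on A (\<lambda>x. Complex 1 (f x))"
  unfolding Complex_line_eq by (intro continuous_intros)

lemma measurable_line [measurable]: "(\<lambda>t. Complex 1 t) \<in> borel_measurable borel"
  by (rule borel_measurable_continuous_onI) (intro continuous_intros)

lemma continuous_on_Ein: "continuous_on {s. s \<noteq> 0} Ein"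
  by (intro continuous_at_imp_continuous_on ballI DERIV_isCont[OF Ein_has_field_derivative]) simp

lemma measurable_Ein_line [measurable]: "(\<lambda>t. Ein (Complex 1 t)) \<in> borel_measurable borel"
  by (rule borel_measurable_continuous_onI)
     (auto intro!: continuous_on_compose2[OF continuous_on_Ein] continuous_intros simp: complex_eq_iff)

lemma measurable_Ein_line2 [measurable]:
  "(\<lambda>x. Ein (Complex 1 (fst x) + Complex 1 (snd x))) \<in> borel_measurable (lborel \<Otimes>\<^sub>M lborel)"
proof -
  have c: "continuous_on UNIV (\<lambda>s. Ein (Complex 2 s))"
    by (rule continuous_on_compose2[OF continuous_on_Ein])
       (auto simp: complex_eq_iff Complex_eq intro!: continuous_intros)
  have "(\<lambda>s. Ein (Complex 2 s)) \<in> borel_measurable borel" using c by (rule borel_measurable_continuous_onI)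
  then have "(\<lambda>x. Ein (Complex 2 (fst x + snd x))) \<in> borel_measurable (lborel \<Otimes>\<^sub>M lborel)" by measurable
  then show ?thesis by (simp add: complex_add)
qed

lemma line_nonzero [simp]: "Complex 1 t \<noteq> 0" by (simp add: complex_eq_iff)

lemma integrable_line_bound:
  assumes [measurable]: "f \<in> borel_measurable borel" and b: "\<And>t. norm (f t) \<le> C * norm (Complex 1 t) powr (- (3/2))"
  shows "integrable lborel (f :: real \<Rightarrow> complex)"
proof (rule Bochner_Integration.integrable_bound)
  show "integrable lborel (\<lambda>t. C * norm (Complex 1 t) powr (- (3/2)))"
    by (intro integrable_mult_right integrable_norm_powr) auto
  show "AE t in lborel. norm (f t) \<le> norm (C * norm (Complex 1 t) powr (- (3/2)))"
    by (intro AE_I2 order_trans[OF b]) (simp only: real_norm_def abs_ge_self)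
qed simp

lemma norm_line_powr_le:
  assumes "r \<ge> (3/2 :: real)" shows "norm (Complex 1 t) powr (- r) \<le> norm (Complex 1 t) powr (- (3/2))"
  using norm_line_ge_1[of t] assms by (intro powr_mono) auto

definition perron_kernel :: "nat \<Rightarrow> real \<Rightarrow> real \<Rightarrow> complex" where
  "perron_kernel m y t = exp (Complex 1 t * of_real y) / Complex 1 t ^ (m + 1)"

lemma perron_kernel_measurable [measurable]: "perron_kernel m y \<in> borel_measurable borel"
  unfolding perron_kernel_def[abs_def] by measurable

lemma norm_perron_kernel: "norm (perron_kernel m y t) = exp y * norm (Complex 1 t) powr (- real (m + 1))"
proof -
  have "norm (Complex 1 t) > 0" by simp
  then have "norm (Complex 1 t) powr (- real (m + 1)) = 1 / norm (Complex 1 t) ^ (m + 1)"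
    by (simp only: powr_minus_divide powr_realpow)
  moreover have "norm (perron_kernel m y t) = exp y / norm (Complex 1 t) ^ (m + 1)"
    unfolding perron_kernel_def norm_divide norm_power norm_exp_eq_Re by simp
  ultimately show ?thesis by simp
qed

lemma perron_kernel_integrable: "m \<ge> 1 \<Longrightarrow> integrable lborel (perron_kernel m y)"
  by (rule integrable_line_bound[of _ "exp y"], simp, simp only: norm_perron_kernel, intro mult_left_mono norm_line_powr_le) auto

text \<open>For \<kappa> = 0 the delay function is the truncated power itself and its transform is
  m!/a^(m+1), so Perron's formula is an instance of \<open>laplace_inversion\<close>.\<close>

lemma perron:
  assumes m: "m \<ge> 1"
  shows "of_real (max 0 y ^ m) = of_real (fact m / (2 * pi)) * (LINT t|lborel. perron_kernel m y t)"
proof -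
  have one: "dde_aux 0 (int m) x = 1" for x by (subst dde_aux.simps) simp
  have phi: "delay_fun 0 m x = max 0 x ^ m" for x using m by (auto simp: delay_fun_def one max_def)
  have laplace: "laplace (delay_fun 0 m) (Complex 1 t) = fact m / Complex 1 t ^ (m + 1)" for t
    by (subst laplace_dphi) auto
  have eq: "exp (Complex 1 t * of_real x) * laplace (delay_fun 0 m) (Complex 1 t) = fact m * perron_kernel m x t" for t x
    unfolding laplace perron_kernel_def by simp
  have "(LINT t|lborel. exp (Complex 1 t * of_real y) * laplace (delay_fun 0 m) (Complex 1 t)) = 2 * of_real pi * of_real (delay_fun 0 m y)"
  proof (rule laplace_inversion[OF delay_fun_poly_bounded delay_fun_continuous[OF m]])
    have "integrable lborel (\<lambda>t. fact m * perron_kernel m 0 t)" using m by (intro integrable_mult_right perron_kernel_integrable)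
    then show "integrable lborel (\<lambda>t. laplace (delay_fun 0 m) (Complex 1 t))"
      unfolding eq[symmetric] by simp
  qed
  then have "fact m * (LINT t|lborel. perron_kernel m y t) = 2 * of_real pi * of_real (max 0 y ^ m)"
    unfolding eq phi by simp
  then show ?thesis by (simp add: field_simps)
qed

text \<open>Shifting the kernel from u to u - s/L, with s the sum of ln p over a set of primes,
  multiplies it by the twists of these primes. The finite double sum over sets can thus be moved
  inside the integral, where it factors over the primes.\<close>

lemma Q_form_eq_integral:
  assumes L: "L > 0" and u: "u > 0" and m: "m \<ge> 1" and g: "multiplicative g"
  shows "of_real (Q_form g m (exp (u * L)) (exp L)) = of_real (fact m / (2 * pi * u ^ m)) ^ 2 *
    (LINT x|(lborel \<Otimes>\<^sub>M lborel). perron_kernel m u (fst x) * perron_kernel m u (snd x) *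
       (\<Prod>p\<in>primes_below (exp L). 1 - of_real (g p) * (prime_twist L (Complex 1 (fst x)) p + prime_twist L (Complex 1 (snd x)) p - prime_twist L (Complex 1 (fst x)) p * prime_twist L (Complex 1 (snd x)) p)))"
proof -
  define S where "S = primes_below (exp L)"
  define c where "c = complex_of_real (fact m / (2 * pi * u ^ m))"
  define twist where "twist = (\<lambda>A t. \<Prod>p\<in>A. prime_twist L (Complex 1 t) p)"
  define s where "s = (\<lambda>A. \<Sum>p\<in>A. ln (real p))"
  define w where "w = (\<lambda>A. max 0 (1 - s A / ln (exp (u * L))) ^ m)"
  have finS: "finite S" by (simp add: S_def)
  have pkX: "perron_kernel m (u - s A / L) t = perron_kernel m u t * twist A t" if "A \<in> Pow S" for A t
  proof -
    have fin: "finite A" using that finS finite_subset by auto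
    have "twist A t = exp (\<Sum>p\<in>A. - Complex 1 t * of_real (ln (real p) / L))"
      unfolding twist_def prime_twist_def using fin by (simp only: exp_sum)
    also have "(\<Sum>p\<in>A. - Complex 1 t * of_real (ln (real p) / L)) = - Complex 1 t * of_real (s A / L)"
      unfolding s_def by (simp only: sum_distrib_left[symmetric] of_real_sum[symmetric] sum_divide_distrib)
    finally have "twist A t = exp (- Complex 1 t * of_real (s A / L))" .
    moreover have "exp (Complex 1 t * of_real (u - s A / L)) = exp (Complex 1 t * of_real u) * exp (- Complex 1 t * of_real (s A / L))"
      unfolding exp_add[symmetric] by (simp only: of_real_diff right_diff_distrib mult_minus_left add_uminus_conv_diff)
    ultimately show ?thesis by (simp add: perron_kernel_def)
  qed
  have int: "integrable lborel (\<lambda>t. perron_kernel m u t * twist A t)" if "A \<in> Pow S" for A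
  proof -
    have "perron_kernel m (u - s A / L) = (\<lambda>t. perron_kernel m u t * twist A t)" by (rule ext) (rule pkX[OF that])
    then show ?thesis using perron_kernel_integrable[OF m, of "u - s A / L"] by simp
  qed
  have weq: "of_real (w A) = c * (LINT t|lborel. perron_kernel m u t * twist A t)" if "A \<in> Pow S" for A
  proof -
    have "1 - s A / ln (exp (u * L)) = (u - s A / L) / u" using L u by (simp add: field_simps)
    then have "max 0 (1 - s A / ln (exp (u * L))) = max 0 (u - s A / L) / u"
      using u by (simp add: max_def zero_le_divide_iff divide_le_0_iff)
    then have "of_real (w A) = of_real (1 / u ^ m) * complex_of_real (max 0 (u - s A / L) ^ m)"
      by (simp add: w_def power_divide)
    also have "complex_of_real (max 0 (u - s A / L) ^ m) = of_real (fact m / (2 * pi)) * (LINT t|lborel. perron_kernel m (u - s A / L) t)"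
      by (rule perron[OF m])
    also have "of_real (1 / u ^ m) * (of_real (fact m / (2 * pi)) * (LINT t|lborel. perron_kernel m (u - s A / L) t)) = c * (LINT t|lborel. perron_kernel m (u - s A / L) t)"
      by (simp add: c_def)
    finally show ?thesis by (simp only: pkX[OF that])
  qed
  define G where "G = (\<lambda>A B. (-1) ^ card A * (-1) ^ card B * (\<Prod>p\<in>A \<union> B. complex_of_real (g p)))"
  have R: "exp (u * L) > 1" using u L by simp
  have "of_real (Q_form g m (exp (u * L)) (exp L)) = (\<Sum>A\<in>Pow S. \<Sum>B\<in>Pow S. G A B * of_real (w A) * of_real (w B))"
    unfolding Q_form_eq_sum_Pow[OF R m g] w_def s_def S_def G_def by simp
  also have "\<dots> = (\<Sum>A\<in>Pow S. \<Sum>B\<in>Pow S. G A B * (c * (LINT t|lborel. perron_kernel m u t * twist A t)) * (c * (LINT t|lborel. perron_kernel m u t * twist B t)))"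
    by (intro sum.cong refl) (simp only: weq)
  also have "\<dots> = (\<Sum>A\<in>Pow S. \<Sum>B\<in>Pow S. c ^ 2 * (LINT x|(lborel \<Otimes>\<^sub>M lborel). G A B * (case x of (t, t') \<Rightarrow> (perron_kernel m u t * twist A t) * (perron_kernel m u t' * twist B t'))))"
  proof (intro sum.cong refl)
    fix A B assume AB: "A \<in> Pow S" "B \<in> Pow S"
    show "G A B * (c * (LINT t|lborel. perron_kernel m u t * twist A t)) * (c * (LINT t|lborel. perron_kernel m u t * twist B t)) =
      c ^ 2 * (LINT x|(lborel \<Otimes>\<^sub>M lborel). G A B * (case x of (t, t') \<Rightarrow> (perron_kernel m u t * twist A t) * (perron_kernel m u t' * twist B t')))"
      unfolding integral_mult_right_zero lborel_pair.integrable_pair_mult(2)[OF int[OF AB(1)] int[OF AB(2)]]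
      by (simp only: power2_eq_square mult_ac)
  qed
  also have "\<dots> = c ^ 2 * (\<Sum>A\<in>Pow S. \<Sum>B\<in>Pow S. (LINT x|(lborel \<Otimes>\<^sub>M lborel). G A B * (case x of (t, t') \<Rightarrow> (perron_kernel m u t * twist A t) * (perron_kernel m u t' * twist B t'))))"
    by (simp only: sum_distrib_left)
  also have "(\<Sum>A\<in>Pow S. \<Sum>B\<in>Pow S. (LINT x|(lborel \<Otimes>\<^sub>M lborel). G A B * (case x of (t, t') \<Rightarrow> (perron_kernel m u t * twist A t) * (perron_kernel m u t' * twist B t'))))
     = (LINT x|(lborel \<Otimes>\<^sub>M lborel). (\<Sum>A\<in>Pow S. \<Sum>B\<in>Pow S. G A B * (case x of (t, t') \<Rightarrow> (perron_kernel m u t * twist A t) * (perron_kernel m u t' * twist B t'))))"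
  proof -
    have i: "integrable (lborel \<Otimes>\<^sub>M lborel) (\<lambda>x. G A B * (case x of (t, t') \<Rightarrow> (perron_kernel m u t * twist A t) * (perron_kernel m u t' * twist B t')))"
      if "A \<in> Pow S" "B \<in> Pow S" for A B
      by (intro integrable_mult_right lborel_pair.integrable_pair_mult(1) int that)
    show ?thesis
      by (subst Bochner_Integration.integral_sum, intro Bochner_Integration.integrable_sum i, assumption+)
         (intro sum.cong refl Bochner_Integration.integral_sum[symmetric] i)
  qed
  also have "\<dots> = (LINT x|(lborel \<Otimes>\<^sub>M lborel). perron_kernel m u (fst x) * perron_kernel m u (snd x) *
       (\<Prod>p\<in>S. 1 - of_real (g p) * (prime_twist L (Complex 1 (fst x)) p + prime_twist L (Complex 1 (snd x)) p - prime_twist L (Complex 1 (fst x)) p * prime_twist L (Complex 1 (snd x)) p)))"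
  proof (intro Bochner_Integration.integral_cong refl)
    fix x :: "real \<times> real"
    obtain t t' where x: "x = (t, t')" by fastforce
    have "(\<Sum>A\<in>Pow S. \<Sum>B\<in>Pow S. G A B * ((perron_kernel m u t * twist A t) * (perron_kernel m u t' * twist B t')))
        = perron_kernel m u t * perron_kernel m u t' * (\<Sum>A\<in>Pow S. \<Sum>B\<in>Pow S. G A B * twist A t * twist B t')"
      unfolding sum_distrib_left by (intro sum.cong refl) (simp only: mult_ac)
    also have "(\<Sum>A\<in>Pow S. \<Sum>B\<in>Pow S. G A B * twist A t * twist B t') =
        (\<Prod>p\<in>S. 1 - of_real (g p) * (prime_twist L (Complex 1 t) p + prime_twist L (Complex 1 t') p - prime_twist L (Complex 1 t) p * prime_twist L (Complex 1 t') p))"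
      unfolding G_def twist_def by (rule sum_Pow_Pow_eq_prod[OF finS])
    finally show "(\<Sum>A\<in>Pow S. \<Sum>B\<in>Pow S. G A B * (case x of (t, t') \<Rightarrow> (perron_kernel m u t * twist A t) * (perron_kernel m u t' * twist B t'))) =
       perron_kernel m u (fst x) * perron_kernel m u (snd x) *
       (\<Prod>p\<in>S. 1 - of_real (g p) * (prime_twist L (Complex 1 (fst x)) p + prime_twist L (Complex 1 (snd x)) p - prime_twist L (Complex 1 (fst x)) p * prime_twist L (Complex 1 (snd x)) p))"
      by (simp add: x)
  qed
  finally show ?thesis by (simp only: c_def S_def)
qed


text \<open>The case \<kappa> = k, n = m - k: the powers a^k and a^(m-k+1) combine to the Perron
  denominator a^(m+1).\<close>

lemma laplace_dphi_pos:
  assumes "m > k" "Re a > 0"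
  shows "laplace (delay_fun (int k) (m - k)) a = of_real (fact (m - k) * exp (- (real k * ein_const))) * (exp (of_nat k * Ein a) / a ^ (m + 1))"
proof -
  have a0: "a \<noteq> 0" using assms by auto
  have e: "m + 1 = k + (m - k + 1)" using assms by simp
  have "(a * exp (- Ein a)) powi (- int k) = inverse (a ^ k * exp (- (of_nat k * Ein a)))"
    by (simp add: power_int_minus power_mult_distrib flip: exp_of_nat_mult)
  also have "\<dots> = exp (of_nat k * Ein a) / a ^ k" by (simp add: exp_minus field_simps)
  finally have "laplace (delay_fun (int k) (m - k)) a = fact (m - k) * exp (- of_int (int k) * of_real ein_const) * (exp (of_nat k * Ein a) / a ^ k) / a ^ (m - k + 1)"
    by (subst laplace_dphi[OF assms(2)]) simp
  also have "\<dots> = fact (m - k) * exp (- of_int (int k) * of_real ein_const) * (exp (of_nat k * Ein a) / a ^ (m + 1))"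
    unfolding e power_add by simp
  also have "exp (- of_int (int k) * of_real ein_const) = complex_of_real (exp (- (real k * ein_const)))"
  proof -
    have "- of_int (int k) * of_real ein_const = complex_of_real (- (real k * ein_const))" by simp
    then show ?thesis by (simp only: exp_of_real)
  qed
  finally show ?thesis by simp
qed

text \<open>The case \<kappa> = -k, n = k - 1: the powers of s cancel and exp(-k Ein s) alone
  becomes a transform. It is used at s = a + b.\<close>

lemma laplace_dphi_neg:
  assumes "k \<ge> 1" "Re s > 0"
  shows "exp (- (of_nat k * Ein s)) = of_real (exp (- (real k * ein_const)) / fact (k - 1)) * laplace (delay_fun (- int k) (k - 1)) s"
proof -
  have s0: "s \<noteq> 0" using assms by auto
  have e: "k - 1 + 1 = k" using assms by simp
  have "(s * exp (- Ein s)) powi (- (- int k)) = s ^ k * exp (- (of_nat k * Ein s))"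
    by (simp add: power_mult_distrib flip: exp_of_nat_mult)
  then have "laplace (delay_fun (- int k) (k - 1)) s = fact (k - 1) * exp (- of_int (- int k) * of_real ein_const) * (s ^ k * exp (- (of_nat k * Ein s))) / s ^ k"
    by (subst laplace_dphi[OF assms(2)]) (simp only: e)
  also have "\<dots> = fact (k - 1) * exp (- of_int (- int k) * of_real ein_const) * exp (- (of_nat k * Ein s))"
    using s0 by simp
  also have "exp (- of_int (- int k) * of_real ein_const) = complex_of_real (exp (real k * ein_const))"
  proof -
    have "- of_int (- int k) * of_real ein_const = complex_of_real (real k * ein_const)" by simp
    then show ?thesis by (simp only: exp_of_real)
  qed
  finally have "of_real (exp (- (real k * ein_const)) / fact (k - 1)) * laplace (delay_fun (- int k) (k - 1)) s
      = of_real (exp (- (real k * ein_const)) * exp (real k * ein_const)) * exp (- (of_nat k * Ein s))" by simp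
  also have "exp (- (real k * ein_const)) * exp (real k * ein_const) = 1" by (simp add: exp_minus)
  finally show ?thesis by simp
qed

text \<open>Substitution y = u (1 - x). The exponent 2m - k collects 1 from dy, k - 1 from the first
  function and 2 (m - k) from the square.\<close>

lemma integral_delay_fun_eq_I_fun:
  assumes k: "k \<ge> 1" and m: "m > k" and u: "u > 0"
  shows "(LINT y|lborel. delay_fun (- int k) (k - 1) y * (delay_fun (int k) (m - k) (u - y))\<^sup>2) =
    u ^ (2 * m - k) * fact (k - 1) * (fact (m - k) / fact m)\<^sup>2 * I_fun u m k 1 u"
proof -
  define \<rho> where "\<rho> = dde_aux (int k) (- 1)"
  define F where "F = dde_aux (- int k) (int m)"
  define f where "f = (\<lambda>x. (1 - x) ^ (k - 1) / fact (k - 1) * \<rho> (u * (1 - x)) * (F (u * x) * (fact m / fact (m - k) * x ^ (m - k)))\<^sup>2)"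
  have eqF: "F = dde_aux (- int k) (int (m - k) + int k)" using m by (simp add: F_def of_nat_diff)
  have G: "delay_fun (int k) (m - k) x = (if x \<le> 0 then 0 else x ^ (m - k) * F x)" for x
    unfolding delay_fun_def eqF ..
  have W: "delay_fun (- int k) (k - 1) x = (if x \<le> 0 then 0 else x ^ (k - 1) * \<rho> x)" for x
    unfolding \<rho>_def by (rule W_eq[OF k])
  have Fc: "continuous_on A F" for A unfolding eqF by (rule delay_aux_cont)
  have \<rho>c: "continuous_on A \<rho>" for A unfolding \<rho>_def by (rule rho_cont[OF k])
  have fc: "continuous_on A f" for A unfolding f_def
    by (intro continuous_intros continuous_on_compose2[OF Fc[of UNIV]] continuous_on_compose2[OF \<rho>c[of UNIV]]) auto
  have fi: "set_integrable lborel {0..1} f" by (rule borel_integrable_atLeastAtMost'[OF fc])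
  have I: "I_fun u m k 1 u = (LINT x|lborel. indicator {0..1} x *\<^sub>R f x)"
    using I_fun_eq[OF k m u, of u 1] set_borel_integral_eq_integral(2)[OF fi]
    by (simp add: f_def F_def \<rho>_def set_lebesgue_integral_def)
  define c where "c = u ^ (k - 1) * (u ^ (m - k))\<^sup>2 * fact (k - 1) * (fact (m - k) / fact m)\<^sup>2"
  have "(LINT y|lborel. delay_fun (- int k) (k - 1) y * (delay_fun (int k) (m - k) (u - y))\<^sup>2) =
      \<bar>- u\<bar> *\<^sub>R (LINT x|lborel. delay_fun (- int k) (k - 1) (u + (- u) * x) * (delay_fun (int k) (m - k) (u - (u + (- u) * x)))\<^sup>2)"
    using u by (intro lborel_integral_real_affine) auto
  also have "(LINT x|lborel. delay_fun (- int k) (k - 1) (u + (- u) * x) * (delay_fun (int k) (m - k) (u - (u + (- u) * x)))\<^sup>2) =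
      (LINT x|lborel. c * (indicator {0..1} x *\<^sub>R f x))"
  proof (rule integral_cong_AE)
    show "AE x in lborel. delay_fun (- int k) (k - 1) (u + (- u) * x) * (delay_fun (int k) (m - k) (u - (u + (- u) * x)))\<^sup>2 = c * (indicator {0..1} x *\<^sub>R f x)"
      \<comment> \<open>The endpoints are left out: at x = 1 the first function is cut off to 0, but
        for k = 1 the power (1 - x)^(k-1) is 1.\<close>
      using AE_lborel_singleton[of "1::real"] AE_lborel_singleton[of "0::real"]
    proof eventually_elim
      case (elim x)
      have e1: "u + (- u) * x = u * (1 - x)" by (simp add: algebra_simps)
      have e2: "u - (u + (- u) * x) = u * x" by simp
      consider "x < 0" | "0 < x" "x < 1" | "x > 1" using elim by linarith
      then show ?case
      proof cases
        case 1
        then have "u * x \<le> 0" using u by (simp add: mult_nonneg_nonpos)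
        then show ?thesis using 1 unfolding e2 G by simp
      next
        case 3
        then have "u * (1 - x) \<le> 0" using u by (simp add: mult_nonneg_nonpos)
        then show ?thesis using 3 unfolding e1 W by simp
      next
        case 2
        then have "u * x > 0" "u * (1 - x) > 0" using u by auto
        then have "delay_fun (- int k) (k - 1) (u + (- u) * x) * (delay_fun (int k) (m - k) (u - (u + (- u) * x)))\<^sup>2
            = (u ^ (k - 1) * (1 - x) ^ (k - 1) * \<rho> (u * (1 - x))) * (u ^ (m - k) * x ^ (m - k) * F (u * x))\<^sup>2"
          unfolding e2 unfolding e1 W G by (simp add: power_mult_distrib)
        also have "\<dots> = c * f x"
          by (simp add: c_def f_def power_mult_distrib power_divide)
        finally show ?thesis using 2 by simp
      qed
    qed
    have [measurable]: "f \<in> borel_measurable borel" by (rule borel_measurable_continuous_onI[OF fc])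
    show "(\<lambda>x. delay_fun (- int k) (k - 1) (u + - u * x) * (delay_fun (int k) (m - k) (u - (u + - u * x)))\<^sup>2) \<in> borel_measurable lborel"
      by measurable
    show "(\<lambda>x. c * (indicator {0..1} x *\<^sub>R f x)) \<in> borel_measurable lborel"
      by measurable
  qed
  also have "\<dots> = c * I_fun u m k 1 u" unfolding I by (rule integral_mult_right_zero)
  also have "\<bar>- u\<bar> *\<^sub>R (c * I_fun u m k 1 u) = u ^ (2 * m - k) * fact (k - 1) * (fact (m - k) / fact m)\<^sup>2 * I_fun u m k 1 u"
  proof -
    have "u * (u ^ (k - 1) * (u ^ (m - k))\<^sup>2) = u ^ (1 + (k - 1) + 2 * (m - k))"
      by (simp only: power_add power_mult power_one_right power2_eq_square mult_ac power_mult_distrib mult_2)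
    also have "1 + (k - 1) + 2 * (m - k) = 2 * m - k" using k m by simp
    finally show ?thesis using u by (simp add: c_def mult_ac)
  qed
  finally show ?thesis .
qed

text \<open>The factor exp(-k Ein (a + b)) couples the two variables. As a Laplace transform it is a
  superposition of the products exp(-a y) exp(-b y); after Fubini's theorem each variable is
  inverted separately and yields G(u - y), hence the square.\<close>

lemma limit_integral:
  assumes k: "k \<ge> 1" and m: "m > k" and u: "u > 0"
  shows "(LINT x|(lborel \<Otimes>\<^sub>M lborel). perron_kernel m u (fst x) * perron_kernel m u (snd x) *
      exp (of_nat k * (Ein (Complex 1 (fst x)) + Ein (Complex 1 (snd x)) - Ein (Complex 1 (fst x) + Complex 1 (snd x)))))
    = of_real (exp (real k * ein_const) * (2 * pi / fact m)\<^sup>2 * u ^ (2 * m - k) * I_fun u m k 1 u)"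
proof -
  define W where "W = delay_fun (- int k) (k - 1)"
  define G where "G = delay_fun (int k) (m - k)"
  define E where "E = (\<lambda>t. perron_kernel m u t * exp (of_nat k * Ein (Complex 1 t)))"
  define c1 where "c1 = complex_of_real (exp (- (real k * ein_const)) / fact (k - 1))"
  define c2 where "c2 = complex_of_real (fact (m - k) * exp (- (real k * ein_const)))"
  have c20: "c2 \<noteq> 0" by (simp add: c2_def)
  have [measurable]: "W \<in> borel_measurable borel" unfolding W_def by (rule delay_fun_measurable)
  have [measurable]: "E \<in> borel_measurable borel" unfolding E_def[abs_def] by measurable
  obtain C where C: "C \<ge> 0" "\<And>t. norm (exp (of_nat k * Ein (Complex 1 t))) \<le> C * norm (Complex 1 t) powr (real k + 1/2)"
    using exp_Ein_bound[OF k] by blast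
  have Eb: "norm (perron_kernel m y t * exp (of_nat k * Ein (Complex 1 t))) \<le> (exp y * C) * norm (Complex 1 t) powr (- (3/2))" for y t
  proof -
    have n1: "norm (Complex 1 t) \<ge> 1" by (rule norm_line_ge_1)
    have "norm (perron_kernel m y t * exp (of_nat k * Ein (Complex 1 t))) \<le> (exp y * norm (Complex 1 t) powr (- real (m + 1))) * (C * norm (Complex 1 t) powr (real k + 1/2))"
      unfolding norm_mult[of "perron_kernel m y t"] norm_perron_kernel using C by (intro mult_left_mono) auto
    also have "\<dots> = (exp y * C) * (norm (Complex 1 t) powr (- real (m + 1)) * norm (Complex 1 t) powr (real k + 1/2))" by (simp only: mult_ac)
    also have "\<dots> = (exp y * C) * norm (Complex 1 t) powr (- (real (m + 1) - (real k + 1/2)))" by (simp flip: powr_add)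
    also have "\<dots> \<le> (exp y * C) * norm (Complex 1 t) powr (- (3/2))"
      using m C by (intro mult_left_mono norm_line_powr_le) auto
    finally show ?thesis .
  qed
  have Ei: "integrable lborel E" using Eb[of u] unfolding E_def[symmetric] by (intro integrable_line_bound) (auto simp: E_def)
  have lapG: "laplace G (Complex 1 t) = c2 * (perron_kernel m 0 t * exp (of_nat k * Ein (Complex 1 t)))" for t
    unfolding G_def by (subst laplace_dphi_pos[OF m]) (auto simp: c2_def perron_kernel_def)
  have Gint: "integrable lborel (\<lambda>t. laplace G (Complex 1 t))"
    unfolding lapG using Eb[of 0] by (intro integrable_mult_right integrable_line_bound[of _ "exp 0 * C"]) auto
  have inner: "(LINT t|lborel. E t * exp (- Complex 1 t * of_real y)) = of_real (2 * pi * G (u - y)) / c2" for y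
  proof -
    have "(LINT t|lborel. exp (Complex 1 t * of_real (u - y)) * laplace G (Complex 1 t)) = 2 * of_real pi * of_real (G (u - y))"
      unfolding G_def using Gint m by (intro laplace_inversion delay_fun_poly_bounded delay_fun_continuous) (auto simp: G_def)
    moreover have "exp (Complex 1 t * of_real (u - y)) * laplace G (Complex 1 t) = c2 * (E t * exp (- Complex 1 t * of_real y))" for t
    proof -
      have "exp (Complex 1 t * of_real (u - y)) = exp (Complex 1 t * of_real u) * exp (- Complex 1 t * of_real y)"
        unfolding exp_add[symmetric] by (simp only: of_real_diff right_diff_distrib mult_minus_left add_uminus_conv_diff)
      then show ?thesis unfolding lapG E_def by (simp add: perron_kernel_def mult_ac)
    qed
    ultimately have "c2 * (LINT t|lborel. E t * exp (- Complex 1 t * of_real y)) = of_real (2 * pi * G (u - y))"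
      by simp
    then show ?thesis using c20 by (simp add: field_simps)
  qed
  interpret P: pair_sigma_finite "lborel \<Otimes>\<^sub>M lborel :: (real \<times> real) measure" "lborel :: real measure"
    unfolding lborel_prod ..
  define f where "f = (\<lambda>x y. (E (fst x) * exp (- Complex 1 (fst x) * of_real y)) * (E (snd x) * exp (- Complex 1 (snd x) * of_real y)) * complex_of_real (W y))"
  have pbW: "poly_bounded W" unfolding W_def by (rule delay_fun_poly_bounded)
  \<comment> \<open>Both lines have real part 1, so the two exponentials have joint modulus
    exp(-2y), and f is bounded by a product of three integrable functions of one variable
    each.\<close>
  have fint: "integrable ((lborel \<Otimes>\<^sub>M lborel) \<Otimes>\<^sub>M lborel) (case_prod f)"
  proof (rule Bochner_Integration.integrable_bound)
    have "integrable (lborel \<Otimes>\<^sub>M lborel) (\<lambda>(t, t'). E t * E t')"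
      by (intro lborel_pair.integrable_pair_mult Ei)
    moreover have "integrable lborel (\<lambda>y. exp (- 2 * of_real y) * complex_of_real (W y))"
      using laplace_integrable[OF pbW, of 2] by simp
    ultimately show "integrable ((lborel \<Otimes>\<^sub>M lborel) \<Otimes>\<^sub>M lborel) (\<lambda>(x, y). (case x of (t, t') \<Rightarrow> E t * E t') * (exp (- 2 * of_real y) * complex_of_real (W y)))"
      by (intro P.integrable_pair_mult)
    show "AE z in (lborel \<Otimes>\<^sub>M lborel) \<Otimes>\<^sub>M lborel. norm (case_prod f z) \<le> norm (case z of (x, y) \<Rightarrow> (case x of (t, t') \<Rightarrow> E t * E t') * (exp (- 2 * of_real y) * complex_of_real (W y)))"
    proof (rule AE_I2)
      fix z :: "(real \<times> real) \<times> real"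
      obtain t t' y where z: "z = ((t, t'), y)" by (metis surj_pair)
      have "norm (exp (- Complex 1 t * of_real y)) * norm (exp (- Complex 1 t' * of_real y)) = norm (exp (- 2 * complex_of_real y))"
        unfolding norm_exp_eq_Re exp_add[symmetric] by simp
      then have "norm (E t) * norm (E t') * (norm (exp (- Complex 1 t * of_real y)) * norm (exp (- Complex 1 t' * of_real y))) * \<bar>W y\<bar>
          = norm (E t) * norm (E t') * norm (exp (- 2 * complex_of_real y)) * \<bar>W y\<bar>" by simp
      then show "norm (case_prod f z) \<le> norm (case z of (x, y) \<Rightarrow> (case x of (t, t') \<Rightarrow> E t * E t') * (exp (- 2 * of_real y) * complex_of_real (W y)))"
        unfolding z f_def prod.case fst_conv snd_conv norm_mult norm_of_real by (simp only: mult_ac order_refl)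
    qed
    show "case_prod f \<in> borel_measurable ((lborel \<Otimes>\<^sub>M lborel) \<Otimes>\<^sub>M lborel)"
      unfolding f_def case_prod_unfold by measurable
  qed
  have "(LINT x|(lborel \<Otimes>\<^sub>M lborel). perron_kernel m u (fst x) * perron_kernel m u (snd x) *
      exp (of_nat k * (Ein (Complex 1 (fst x)) + Ein (Complex 1 (snd x)) - Ein (Complex 1 (fst x) + Complex 1 (snd x)))))
    = (LINT x|(lborel \<Otimes>\<^sub>M lborel). c1 * (LINT y|lborel. f x y))"
  proof (intro Bochner_Integration.integral_cong refl)
    fix x :: "real \<times> real"
    define a where "a = Complex 1 (fst x)"
    define b where "b = Complex 1 (snd x)"
    have "exp (of_nat k * (Ein a + Ein b - Ein (a + b))) = exp (of_nat k * Ein a) * exp (of_nat k * Ein b) * exp (- (of_nat k * Ein (a + b)))"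
      unfolding exp_add[symmetric] by (simp add: algebra_simps)
    also have "exp (- (of_nat k * Ein (a + b))) = c1 * laplace W (a + b)"
      unfolding c1_def W_def using k by (intro laplace_dphi_neg) (auto simp: a_def b_def)
    also have "laplace W (a + b) = (LINT y|lborel. exp (- a * of_real y) * exp (- b * of_real y) * complex_of_real (W y))"
      unfolding laplace_def exp_add[symmetric] by (simp add: algebra_simps)
    finally have "perron_kernel m u (fst x) * perron_kernel m u (snd x) * exp (of_nat k * (Ein a + Ein b - Ein (a + b))) =
        c1 * (E (fst x) * E (snd x) * (LINT y|lborel. exp (- a * of_real y) * exp (- b * of_real y) * complex_of_real (W y)))"
      unfolding E_def a_def[symmetric] b_def[symmetric] by (simp only: mult_ac)
    also have "E (fst x) * E (snd x) * (LINT y|lborel. exp (- a * of_real y) * exp (- b * of_real y) * complex_of_real (W y)) = (LINT y|lborel. f x y)"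
      unfolding integral_mult_right_zero[symmetric] f_def a_def b_def by (simp only: mult_ac)
    finally show "perron_kernel m u (fst x) * perron_kernel m u (snd x) * exp (of_nat k * (Ein (Complex 1 (fst x)) + Ein (Complex 1 (snd x)) - Ein (Complex 1 (fst x) + Complex 1 (snd x)))) = c1 * (LINT y|lborel. f x y)"
      by (simp only: a_def b_def)
  qed
  also have "\<dots> = c1 * (LINT x|(lborel \<Otimes>\<^sub>M lborel). LINT y|lborel. f x y)" by (rule integral_mult_right_zero)
  also have "(LINT x|(lborel \<Otimes>\<^sub>M lborel). LINT y|lborel. f x y) = (LINT y|lborel. LINT x|(lborel \<Otimes>\<^sub>M lborel). f x y)"
    by (rule P.Fubini_integral[OF fint, symmetric])
  also have "\<dots> = (LINT y|lborel. (2 * of_real pi / c2)\<^sup>2 * complex_of_real (W y * (G (u - y))\<^sup>2))"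
  proof (intro Bochner_Integration.integral_cong refl)
    fix y :: real
    have Ey: "integrable lborel (\<lambda>t. E t * exp (- Complex 1 t * of_real y))"
    proof (rule integrable_line_bound)
      show "norm (E t * exp (- Complex 1 t * of_real y)) \<le> (exp u * C * exp (- y)) * norm (Complex 1 t) powr (- (3/2))" for t
      proof -
        have "norm (E t * exp (- Complex 1 t * of_real y)) = norm (E t) * exp (- y)"
          unfolding norm_mult norm_exp_eq_Re by simp
        also have "\<dots> \<le> (exp u * C * norm (Complex 1 t) powr (- (3/2))) * exp (- y)"
          unfolding E_def by (intro mult_right_mono Eb) auto
        finally show ?thesis by (simp only: mult_ac)
      qed
    qed measurable
    have "(LINT x|(lborel \<Otimes>\<^sub>M lborel). f x y) = (LINT x|(lborel \<Otimes>\<^sub>M lborel). (case x of (t, t') \<Rightarrow> (E t * exp (- Complex 1 t * of_real y)) * (E t' * exp (- Complex 1 t' * of_real y))) * complex_of_real (W y))"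
      by (simp add: f_def case_prod_unfold)
    also have "\<dots> = (LINT t|lborel. E t * exp (- Complex 1 t * of_real y)) * (LINT t|lborel. E t * exp (- Complex 1 t * of_real y)) * complex_of_real (W y)"
      unfolding integral_mult_left_zero lborel_pair.integrable_pair_mult(2)[OF Ey Ey] ..
    also have "\<dots> = (2 * of_real pi / c2)\<^sup>2 * complex_of_real (W y * (G (u - y))\<^sup>2)"
      unfolding inner by (simp add: power2_eq_square)
    finally show "(LINT x|(lborel \<Otimes>\<^sub>M lborel). f x y) = (2 * of_real pi / c2)\<^sup>2 * complex_of_real (W y * (G (u - y))\<^sup>2)" .
  qed
  also have "\<dots> = (2 * of_real pi / c2)\<^sup>2 * complex_of_real (LINT y|lborel. W y * (G (u - y))\<^sup>2)"
    by (simp only: integral_mult_right_zero integral_complex_of_real)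
  also have "(LINT y|lborel. W y * (G (u - y))\<^sup>2) = u ^ (2 * m - k) * fact (k - 1) * (fact (m - k) / fact m)\<^sup>2 * I_fun u m k 1 u"
    unfolding W_def G_def by (rule integral_delay_fun_eq_I_fun[OF k m u])
  also have "c1 * ((2 * of_real pi / c2)\<^sup>2 * complex_of_real (u ^ (2 * m - k) * fact (k - 1) * (fact (m - k) / fact m)\<^sup>2 * I_fun u m k 1 u))
     = of_real (exp (- (real k * ein_const)) / fact (k - 1) * ((2 * pi / (fact (m - k) * exp (- (real k * ein_const))))\<^sup>2 * (u ^ (2 * m - k) * fact (k - 1) * (fact (m - k) / fact m)\<^sup>2 * I_fun u m k 1 u)))"
    by (simp add: c1_def c2_def)
  \<comment> \<open>The factorials of k - 1 and m - k cancel. The factor exp(-k \<gamma>) enters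
    once from \<open>c1\<close> and twice inverted from \<open>c2\<close>; the net exp(k \<gamma>)
    later cancels against \<open>twisted_product_tendsto\<close>.\<close>
  also have "exp (- (real k * ein_const)) / fact (k - 1) * ((2 * pi / (fact (m - k) * exp (- (real k * ein_const))))\<^sup>2 * (u ^ (2 * m - k) * fact (k - 1) * (fact (m - k) / fact m)\<^sup>2 * I_fun u m k 1 u))
     = exp (real k * ein_const) * (2 * pi / fact m)\<^sup>2 * u ^ (2 * m - k) * I_fun u m k 1 u"
  proof -
    have gen: "e / f * ((2 * pi / (h * e))\<^sup>2 * (U * f * (h / q)\<^sup>2 * I)) = (1 / e) * (2 * pi / q)\<^sup>2 * U * I"
      if "e \<noteq> 0" "f \<noteq> 0" "h \<noteq> 0" "q \<noteq> 0" for e f h q U I :: real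
      using that by (simp add: field_simps power2_eq_square)
    have E: "exp (real k * ein_const) = 1 / exp (- (real k * ein_const))" by (simp add: exp_minus inverse_eq_divide)
    show ?thesis unfolding E by (rule gen) simp_all
  qed
  finally show ?thesis .
qed

text \<open>Dominated convergence in the double Perron integral. In each variable the majorant is
  |a|^(k + 1/2 - (m+1)) <= |a|^(-3/2), by m >= k + 1.\<close>

theorem Q_form_limit:
  assumes k: "k \<ge> 1" and m: "m > k" and u: "u > 0" and mult: "multiplicative g"
    and g: "\<And>p. prime p \<Longrightarrow> \<bar>g p - real k / real p\<bar> \<le> C0 / (real p)\<^sup>2"
  shows "((\<lambda>L. L ^ k * Q_form g m (exp (u * L)) (exp L)) \<longlongrightarrow> I_fun u m k 1 u * singular_product g k / u ^ k) at_top"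
proof -
  define A where "A = complex_of_real (singular_product g k * exp (- (real k * ein_const)))"
  define s where "s = (\<lambda>L x. perron_kernel m u (fst x) * perron_kernel m u (snd x) * (of_real L ^ k * twisted_product g L (Complex 1 (fst x)) (Complex 1 (snd x))))"
  define h where "h = (\<lambda>x. perron_kernel m u (fst x) * perron_kernel m u (snd x) *
      (A * exp (of_nat k * (Ein (Complex 1 (fst x)) + Ein (Complex 1 (snd x)) - Ein (Complex 1 (fst x) + Complex 1 (snd x))))))"
  obtain D L0 where D: "D \<ge> 0" "L0 \<ge> 1"
    "\<And>L t t'. L \<ge> L0 \<Longrightarrow> norm (of_real L ^ k * twisted_product g L (Complex 1 t) (Complex 1 t')) \<le>
       D * (norm (Complex 1 t) powr (real k + 1/2) * norm (Complex 1 t') powr (real k + 1/2))"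
    using twisted_product_bound[OF k g] by blast
  define w where "w = (\<lambda>t. exp u * norm (Complex 1 t) powr (- (3/2)))"
  have wi: "integrable lborel w" unfolding w_def by (intro integrable_mult_right integrable_norm_powr) auto
  have "((\<lambda>L. LINT x|(lborel \<Otimes>\<^sub>M lborel). s L x) \<longlongrightarrow> (LINT x|(lborel \<Otimes>\<^sub>M lborel). h x)) at_top"
  proof (rule integral_dominated_convergence_at_top[where w = "\<lambda>x. D * (case x of (t, t') \<Rightarrow> w t * w t')"])
    show "h \<in> borel_measurable (lborel \<Otimes>\<^sub>M lborel)" unfolding h_def by measurable
    show "s L \<in> borel_measurable (lborel \<Otimes>\<^sub>M lborel)" for L
      unfolding s_def twisted_product_def prime_twist_def by measurable
    show "integrable (lborel \<Otimes>\<^sub>M lborel) (\<lambda>x. D * (case x of (t, t') \<Rightarrow> w t * w t'))"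
      by (intro integrable_mult_right lborel_pair.integrable_pair_mult wi)
    show "AE x in lborel \<Otimes>\<^sub>M lborel. ((\<lambda>L. s L x) \<longlongrightarrow> h x) at_top"
      unfolding s_def h_def A_def by (intro AE_I2 tendsto_mult tendsto_const twisted_product_tendsto[OF k g]) auto
    show "\<forall>\<^sub>F L in at_top. AE x in lborel \<Otimes>\<^sub>M lborel. norm (s L x) \<le> D * (case x of (t, t') \<Rightarrow> w t * w t')"
      using eventually_ge_at_top[of L0]
    proof eventually_elim
      case (elim L)
      show ?case
      proof (rule AE_I2)
        fix x :: "real \<times> real"
        obtain t t' where x: "x = (t, t')" by fastforce
        have e: "norm (perron_kernel m u t) * norm (Complex 1 t) powr (real k + 1/2) \<le> w t" for t
        proof -
          have "norm (perron_kernel m u t) * norm (Complex 1 t) powr (real k + 1/2) = exp u * norm (Complex 1 t) powr (- (real (m + 1) - (real k + 1/2)))"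
            unfolding norm_perron_kernel by (simp flip: powr_add)
          also have "\<dots> \<le> w t" unfolding w_def using m by (intro mult_left_mono norm_line_powr_le) auto
          finally show ?thesis .
        qed
        have "norm (s L x) = norm (perron_kernel m u t) * norm (perron_kernel m u t') * norm (of_real L ^ k * twisted_product g L (Complex 1 t) (Complex 1 t'))"
          by (simp add: s_def x norm_mult)
        also have "\<dots> \<le> norm (perron_kernel m u t) * norm (perron_kernel m u t') * (D * (norm (Complex 1 t) powr (real k + 1/2) * norm (Complex 1 t') powr (real k + 1/2)))"
          by (intro mult_left_mono D(3) elim) auto
        also have "\<dots> = D * ((norm (perron_kernel m u t) * norm (Complex 1 t) powr (real k + 1/2)) * (norm (perron_kernel m u t') * norm (Complex 1 t') powr (real k + 1/2)))"
          by (simp only: mult_ac)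
        also have "\<dots> \<le> D * (w t * w t')" by (intro mult_left_mono mult_mono e D) (auto simp: w_def)
        finally show "norm (s L x) \<le> D * (case x of (t, t') \<Rightarrow> w t * w t')" by (simp add: x)
      qed
    qed
  qed
  moreover have "(LINT x|(lborel \<Otimes>\<^sub>M lborel). h x) = A * of_real (exp (real k * ein_const) * (2 * pi / fact m)\<^sup>2 * u ^ (2 * m - k) * I_fun u m k 1 u)"
  proof -
    have "(LINT x|(lborel \<Otimes>\<^sub>M lborel). h x) = (LINT x|(lborel \<Otimes>\<^sub>M lborel). A * (perron_kernel m u (fst x) * perron_kernel m u (snd x) *
      exp (of_nat k * (Ein (Complex 1 (fst x)) + Ein (Complex 1 (snd x)) - Ein (Complex 1 (fst x) + Complex 1 (snd x))))))"
      unfolding h_def by (simp only: mult_ac)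
    then show ?thesis by (simp only: integral_mult_right_zero limit_integral[OF k m u])
  qed
  ultimately have lim: "((\<lambda>L. of_real (fact m / (2 * pi * u ^ m)) ^ 2 * (LINT x|(lborel \<Otimes>\<^sub>M lborel). s L x)) \<longlongrightarrow>
      of_real (fact m / (2 * pi * u ^ m)) ^ 2 * (A * of_real (exp (real k * ein_const) * (2 * pi / fact m)\<^sup>2 * u ^ (2 * m - k) * I_fun u m k 1 u))) at_top"
    by (intro tendsto_mult tendsto_const) simp
  have const: "of_real (fact m / (2 * pi * u ^ m)) ^ 2 * (A * of_real (exp (real k * ein_const) * (2 * pi / fact m)\<^sup>2 * u ^ (2 * m - k) * I_fun u m k 1 u))
      = complex_of_real (I_fun u m k 1 u * singular_product g k / u ^ k)"
  proof -
    have e: "exp (- (real k * ein_const)) * exp (real k * ein_const) = 1" by (simp add: exp_minus)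
    have up: "u ^ (2 * m - k) = (u ^ m)\<^sup>2 / u ^ k"
      using m u by (simp add: power_diff power_mult mult.commute)
    have gen: "(q / (2 * pi * U))\<^sup>2 * ((S * e1) * (e2 * (2 * pi / q)\<^sup>2 * (U\<^sup>2 / V) * I)) = I * S / V"
      if "e1 * e2 = 1" "q \<noteq> 0" "U \<noteq> 0" for q U S e1 e2 V I :: real
    proof -
      have "x\<^sup>2 * ((S * e1) * (e2 * y\<^sup>2 * (U\<^sup>2 / V) * I)) = (e1 * e2) * ((x * y * U)\<^sup>2 * (I * S / V))" for x y
        by (simp add: power_mult_distrib mult_ac)
      then have "(q / (2 * pi * U))\<^sup>2 * ((S * e1) * (e2 * (2 * pi / q)\<^sup>2 * (U\<^sup>2 / V) * I)) = (e1 * e2) * (((q / (2 * pi * U)) * (2 * pi / q) * U)\<^sup>2 * (I * S / V))" .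
      also have "(q / (2 * pi * U)) * (2 * pi / q) * U = 1" using that by simp
      finally show ?thesis using that by simp
    qed
    have R: "(fact m / (2 * pi * u ^ m))\<^sup>2 * ((singular_product g k * exp (- (real k * ein_const))) *
        (exp (real k * ein_const) * (2 * pi / fact m)\<^sup>2 * ((u ^ m)\<^sup>2 / u ^ k) * I_fun u m k 1 u)) = I_fun u m k 1 u * singular_product g k / u ^ k"
      by (rule gen[OF e]) (use u in auto)
    show ?thesis unfolding A_def up of_real_mult[symmetric] of_real_power[symmetric] by (simp only: R)
  qed
  have ev: "eventually (\<lambda>L. of_real (fact m / (2 * pi * u ^ m)) ^ 2 * (LINT x|(lborel \<Otimes>\<^sub>M lborel). s L x)
      = complex_of_real (L ^ k * Q_form g m (exp (u * L)) (exp L))) at_top"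
    using eventually_gt_at_top[of 0]
  proof eventually_elim
    case (elim L)
    have m1: "m \<ge> 1" using m by simp
    have "(LINT x|(lborel \<Otimes>\<^sub>M lborel). s L x) = of_real L ^ k * (LINT x|(lborel \<Otimes>\<^sub>M lborel). perron_kernel m u (fst x) * perron_kernel m u (snd x) * twisted_product g L (Complex 1 (fst x)) (Complex 1 (snd x)))"
      unfolding s_def integral_mult_right_zero[symmetric] by (simp only: mult_ac)
    then show ?case
      using Q_form_eq_integral[OF elim u m1 mult] unfolding twisted_product_def
      by (simp only: of_real_mult of_real_power mult_ac)
  qed
  have "((\<lambda>L. complex_of_real (L ^ k * Q_form g m (exp (u * L)) (exp L))) \<longlongrightarrow> complex_of_real (I_fun u m k 1 u * singular_product g k / u ^ k)) at_top"
    by (rule Lim_transform_eventually[OF lim[unfolded const] ev])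
  then show ?thesis by (simp only: tendsto_of_real_iff)
qed

text \<open>Two conclusions, because some g(p) may equal 1: then the singular product is 0, and
  asymptotic equivalence would force the quadratic form to vanish eventually, whereas the limit
  still makes sense. The limit is taken from \<open>Q_form_limit\<close> at L = ln R / u, and this
  change of scale removes the factor u^k.\<close>

theorem theorem4:
  fixes k m :: nat and g :: "nat \<Rightarrow> real" and u :: real
  assumes "k \<ge> 1" and "m > k" and "u > 0"
    and "multiplicative g"
    and "\<And>n. n > 0 \<Longrightarrow> \<not> squarefree n \<Longrightarrow> g n = 0"
    and "\<exists>C. \<forall>p. prime p \<longrightarrow> \<bar>g p - real k / real p\<bar> \<le> C / (real p)\<^sup>2"
  shows "((\<forall>p. prime p \<longrightarrow> g p \<noteq> 1) \<longrightarrow>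
            (\<lambda>R. Q_form g m R (R powr (1 / u))) \<sim>[at_top]
            (\<lambda>R. I_fun u m k 1 u / (ln R) ^ k * singular_product g k)) \<and>
         ((\<lambda>R. (ln R) ^ k * Q_form g m R (R powr (1 / u))) \<longlongrightarrow>
            I_fun u m k 1 u * singular_product g k) at_top"
proof -
  obtain C where g: "\<And>p. prime p \<Longrightarrow> \<bar>g p - real k / real p\<bar> \<le> C / (real p)\<^sup>2"
    using assms(6) by blast
  let ?I = "I_fun u m k 1 u" and ?S = "singular_product g k"
  have "filterlim (\<lambda>R. ln R / u) at_top at_top"
    using \<open>u > 0\<close> by real_asymp
  moreover have "((\<lambda>L. L ^ k * Q_form g m (exp (u * L)) (exp L)) \<longlongrightarrow> ?I * ?S / u ^ k) at_top"
    by (rule Q_form_limit[OF assms(1-4) g])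
  ultimately have "((\<lambda>R. (ln R / u) ^ k * Q_form g m (exp (u * (ln R / u))) (exp (ln R / u))) \<longlongrightarrow> ?I * ?S / u ^ k) at_top"
    by (rule filterlim_compose[rotated])
  then have "((\<lambda>R. u ^ k * ((ln R / u) ^ k * Q_form g m (exp (u * (ln R / u))) (exp (ln R / u)))) \<longlongrightarrow> u ^ k * (?I * ?S / u ^ k)) at_top"
    by (intro tendsto_mult tendsto_const)
  moreover have "eventually (\<lambda>R. u ^ k * ((ln R / u) ^ k * Q_form g m (exp (u * (ln R / u))) (exp (ln R / u))) =
      ln R ^ k * Q_form g m R (R powr (1 / u))) at_top"
    using eventually_gt_at_top[of 0]
  proof eventually_elim
    case (elim R)
    have "exp (u * (ln R / u)) = R" "exp (ln R / u) = R powr (1 / u)"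
      using elim \<open>u > 0\<close> by (simp_all add: powr_def)
    then show ?case using \<open>u > 0\<close> by (simp add: power_divide)
  qed
  ultimately have "((\<lambda>R. ln R ^ k * Q_form g m R (R powr (1 / u))) \<longlongrightarrow> u ^ k * (?I * ?S / u ^ k)) at_top"
    by (rule Lim_transform_eventually)
  then have lim: "((\<lambda>R. ln R ^ k * Q_form g m R (R powr (1 / u))) \<longlongrightarrow> ?I * ?S) at_top"
    using \<open>u > 0\<close> by simp
  moreover have "(\<lambda>R. Q_form g m R (R powr (1 / u))) \<sim>[at_top] (\<lambda>R. ?I / (ln R) ^ k * ?S)"
    if ne: "\<forall>p. prime p \<longrightarrow> g p \<noteq> 1"
  proof (rule asymp_equivI')
    have IS: "?I * ?S \<noteq> 0"
      using I_fun_pos[OF assms(1-3)] singular_product_properties(2)[OF g ne] by auto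
    have "((\<lambda>R. ln R ^ k * Q_form g m R (R powr (1 / u)) / (?I * ?S)) \<longlongrightarrow> ?I * ?S / (?I * ?S)) at_top"
      by (intro tendsto_divide lim tendsto_const IS)
    then show "((\<lambda>R. Q_form g m R (R powr (1 / u)) / (?I / ln R ^ k * ?S)) \<longlongrightarrow> 1) at_top"
      using IS by (simp add: field_simps)
  qed
  ultimately show ?thesis by blast
qed

end
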